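(* Let $\Delta$ be a simple integral polytope in $\mathbb{R}^n$, let $f$ be a symbol of order $N$ on $\mathbb{R}^n$, and choose an integer $k\ge1$ with $k \ge N+n+1$. Fix a polarizing vector for $\Delta$. Then $$\sum_{\Delta \cap \mathbb{Z}^n}{}^{'} f \;=\; \left.\sum_F \sum_{\gamma \in \Gamma_F^\flat} \mathbf{M}_{\gamma,F}^k \int_{\Delta(h)} f(x)\, dx \right|_{h=0} + R^\Delta_k(f),$$ where the outer sum runs over all faces $F$ of $\Delta$, and $\mathbf{M}_{\gamma,F}^k$ and $R_k^\Delta(f)$ are as defined in the context. Moreover, the differential operators $\mathbf{M}_{\gamma,F}^k$ are of order $\le k$ in each of the variables $h_1,\ldots,h_d$. Also, the remainder satisfies an estimate of the form $$|R^\Delta_k(f)| \le K(k,\Delta)\cdot \sup_{(j_1,\dots,j_n)} \big\|\partial_1^{j_1}\cdots\partial_n^{j_n} f\big\|_{L^1(\mathbb{R}^n)},$$ where the supremum is over all $n$-tuples of non-negative integers with $k\le j_1+\cdots+j_n\le nk$ and $K(k,\Delta)$ is a constant depending on $k$ and $\Delta$ but not on $f$.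
   Context: **Symbols.** A smooth function $f\in C^\infty(\mathbb{R}^n)$ is a symbol of order $N$ if for every $n$-tuple of non-negative integers $a=(a_1,\dots,a_n)$ there is a constant $C_a$ with $|\partial_1^{a_1}\cdots\partial_n^{a_n}f(x)|\le C_a(1+|x|)^{N-|a|}$ for all $x$, where $|a|=\sum_i a_i$. **Polytope.** A compact convex polytope $\Delta\subset\mathbb{R}^n$ is integral if its vertices lie in $\mathbb{Z}^n$, and simple if exactly $n$ edges emanate from each vertex (equivalently each vertex is the intersection of exactly $n$ facets). Write $\Delta = \bigcap_{i=1}^d \{x : \langle u_i,x\rangle+\mu_i\ge 0\}$ where $d$ is the number of facets and $u_i\in(\mathbb{Z}^n)^*$ is the inward normal to the $i$th facet, normalized to be a primitive element of the dual lattice $(\mathbb{Z}^n)^*$. For $h=(h_1,\dots,h_d)\in\mathbb{R}^d$ near $0$ put $\Delta(h)=\bigcap_{i=1}^d\{x: \langle u_i,x\rangle+\mu_i+h_i\ge 0\}$. Faces are non-empty, and $\Delta$ itself counts as a face. For a face $F$ let $I_F\subset\{1,\dots,d\}$ be the set of (indices of) facets containing $F$; for a vertex $v$ write $I_v$. For a vertex $v$, let $\alpha_{i,v}\in\mathbb{R}^n$, $i\in I_v$, be the basis of $\mathbb{R}^n$ dual to the basis $u_i$, $i\in I_v$, of $(\mathbb{R}^n)^*$. **Weighted sum.** $\sum'_{\Delta\cap\mathbb{Z}^n}f=\sum_{x\in\Delta\cap\mathbb{Z}^n}\mathbf{1}^w_\Delta(x)f(x)$, where $\mathbf{1}^w_\Delta(x)=2^{-c}$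 if $x$ lies in the relative interior of a face of $\Delta$ of codimension $c$. **Finite groups.** For a face $F$ let $N_F=\operatorname{span}\{u_i: i\in I_F\}\subseteq(\mathbb{R}^n)^*$ and $\Gamma_F=(N_F\cap(\mathbb{Z}^n)^* )/\sum_{i\in I_F}\mathbb{Z}u_i$, a finite abelian group. If $F\subseteq E$ are faces, the natural map $\Gamma_E\to\Gamma_F$ is injective, and we regard $\Gamma_E\subseteq\Gamma_F$. Put $\Gamma_F^\flat=\Gamma_F\setminus\bigcup_{E\supsetneq F}\Gamma_E$, the union over faces $E$ strictly containing $F$. **Roots of unity.** For a vertex $v$, $\gamma\in\Gamma_v$, $j\in I_v$, put $\lambda_{\gamma,j,v}=e^{2\pi i\langle\gamma,\alpha_{j,v}\rangle}$ (well defined, a root of unity). For $\gamma\in\Gamma_F$ and $j\in I_F$ put $\lambda_{\gamma,j,F}=\lambda_{\gamma,j,v}$ for any vertex $v\in F$ (independent of $v$); for $j\in\{1,\dots,d\}\setminus I_F$ put $\lambda_{\gamma,j,F}=1$. **Functions $Q_{m,\lambda}$ and polynomials $\mathbf{M}^{k,\lambda}$.** Let $\lambda\ne1$ be a root of unity of order $N_\lambda$. Set $Q_{0,\lambda}(x)=-\sum_{n\in\mathbb{Z}}\lambda^n\delta(x-n)$ and, for $m\ge1$, define the $N_\lambda$-periodic $Q_{m,\lambda}$ by $\frac{d}{dx}Q_{m,\lambda}=Q_{m-1,\lambda}$ (as distributions) and $\int_0^{N_\lambda}Q_{m,\lambda}(x)\,dx=0$. ($Q_{1,\lambda}$ is the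 bounded function equal to $\frac{\lambda}{1-\lambda}\lambda^{n}$ on $(n,n+1)$; $Q_{m,\lambda}$ is continuous for $m\ge2$.) For $k\ge1$, $$\mathbf{M}^{k,\lambda}(S)=\Big(\tfrac12+\tfrac{\lambda}{1-\lambda}\Big)S+Q_{2,\lambda}(0)S^2+\cdots+Q_{k,\lambda}(0)S^k .$$ For $\lambda=1$: $Q_{k,1}(x)=B_k(\{x\})/k!$ where $B_k$ is the $k$th Bernoulli polynomial and $\{x\}=x-\lfloor x\rfloor$, and $\mathbf{M}^{k,1}(S)$ is the truncation at degree $2\lfloor k/2\rfloor$ of the power series $\mathbf{L}(S)=\frac{S/2}{\tanh(S/2)}=1+\sum_{l\ge1}\frac{b_{2l}}{(2l)!}S^{2l}$. **Operators.** For a face $F$ and $\gamma\in\Gamma_F$, $\mathbf{M}^k_{\gamma,F}=\prod_{j=1}^d\mathbf{M}^{k,\lambda_{\gamma,j,F}}\big(\frac{\partial}{\partial h_j}\big)$. **Polarization.** A polarizing vector is $\xi\in(\mathbb{R}^n)^*$ with $\langle\xi,\alpha_{j,v}\rangle\ne0$ for all vertices $v$ and $j\in I_v$. If $\langle\xi,\alpha_{j,v}\rangle<0$ put $\alpha^\sharp_{j,v}=\alpha_{j,v}$, $u^\sharp_{j,v}=u_j$, $\lambda^\sharp_{\gamma,j,v}=\lambda_{\gamma,j,v}$; if $\langle\xi,\alpha_{j,v}\rangle>0$ put $\alpha^\sharp_{j,v}=-\alpha_{j,v}$, $u^\sharp_{j,v}=-u_j$, $\lambda^\sharp_{\gamma,j,v}=\lambda_{\gamma,j,v}^{-1}$.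 Let $\#v$ be the number of $j\in I_v$ with $\alpha^\sharp_{j,v}=-\alpha_{j,v}$, and $\mathbf{C}_v^\sharp=v+\sum_{j\in I_v}\mathbb{R}_{\ge0}\alpha^\sharp_{j,v}$. **Remainder.** With $D_\alpha$ the directional derivative along $\alpha$, $$R_k^\Delta(f)=\sum_v(-1)^{\#v}\sum_{\gamma\in\Gamma_v}\sum_{I\subsetneq I_v}(-1)^{(k-1)(n-|I|)}\int_{\mathbf{C}_v^\sharp}\prod_{j\in I}\mathbf{M}^{k,\lambda^\sharp_{\gamma,j,v}}(-D_{\alpha^\sharp_{j,v}})\prod_{j\in I_v\setminus I}Q_{k,\lambda^\sharp_{\gamma,j,v}}(\langle u^\sharp_{j,v},x-v\rangle)\prod_{j\in I_v\setminus I}(D_{\alpha^\sharp_{j,v}})^kf(x)\,dx,$$ the outer sum being over the vertices $v$ of $\Delta$. *)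

theory Defs
  imports
    "HOL-Analysis.Analysis"
    "HOL-Library.Poly_Mapping"
    "HOL-Computational_Algebra.Polynomial"
    "HOL-Computational_Algebra.Formal_Power_Series"
begin

(* Conventions.  The dual space of R^n is identified with R^n by the standard inner product, and
   the dual lattice with Z^n.  Coordinates and facets are indexed by finite linearly ordered types,
   playing the role of {1..n} and {1..d}.  Functions are complex-valued. *)

definition dir_deriv ::
  "'a::real_normed_vector \<Rightarrow> ('a \<Rightarrow> 'b::real_normed_vector) \<Rightarrow> 'a \<Rightarrow> 'b" where
  "dir_deriv w g x = vector_derivative (\<lambda>t. g (x + t *\<^sub>R w)) (at 0)"

(* D_{w 1}^{a 1} ... D_{w m}^{a m} g, the factors being ordered as the index type *)
definition multi_deriv ::
  "('i::{finite,linorder} \<Rightarrow> 'a::real_normed_vector) \<Rightarrow> ('i \<Rightarrow> nat) \<Rightarrow>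
    ('a \<Rightarrow> 'b::real_normed_vector) \<Rightarrow> 'a \<Rightarrow> 'b" where
  "multi_deriv w a g = foldr (\<lambda>j. dir_deriv (w j) ^^ a j) (sorted_list_of_set UNIV) g"

definition std_dir :: "'i::finite \<Rightarrow> real^'i" where
  "std_dir i = axis i 1"

(* C^\<infinity>: every iterated partial derivative exists and is differentiable, hence continuous *)
definition smooth :: "(real^'n \<Rightarrow> 'b::real_normed_vector) \<Rightarrow> bool" where
  "smooth f \<longleftrightarrow> (\<forall>js. foldr (\<lambda>i. dir_deriv (std_dir i)) js f differentiable_on UNIV)"

definition symbol_of_order ::
  "real \<Rightarrow> (real^'n::{finite,linorder} \<Rightarrow> 'b::real_normed_vector) \<Rightarrow> bool" where
  "symbol_of_order N f \<longleftrightarrow> smooth f \<and>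
     (\<forall>a. \<exists>C. \<forall>x. norm (multi_deriv std_dir a f x)
                    \<le> C * (1 + norm x) powr (N - real (\<Sum>i\<in>UNIV. a i)))"

(* A constant-coefficient differential operator is a polynomial in commuting variables indexed by 'i,
   where a monomial is its exponent function; diff_op w T substitutes the directional derivative
   D_{w j} for the variable j and applies the result to g. *)
type_synonym 'i op_poly = "('i \<Rightarrow>\<^sub>0 nat) \<Rightarrow>\<^sub>0 complex"

definition diff_op ::
  "('i::{finite,linorder} \<Rightarrow> 'a::real_normed_vector) \<Rightarrow> 'i op_poly \<Rightarrow> ('a \<Rightarrow> complex) \<Rightarrow> 'a \<Rightarrow> complex"
  where
  "diff_op w T g x =
     (\<Sum>a\<in>Poly_Mapping.keys T.
        Poly_Mapping.lookup T a * multi_deriv w (Poly_Mapping.lookup a) g x)"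

(* the univariate polynomial p in the variable j *)
definition in_var :: "'i \<Rightarrow> complex poly \<Rightarrow> 'i op_poly" where
  "in_var j p = (\<Sum>i\<le>degree p. Poly_Mapping.single (Poly_Mapping.single j i) (coeff p i))"

definition root_order :: "complex \<Rightarrow> nat" where
  "root_order z = (LEAST m. 0 < m \<and> z ^ m = 1)"

(* For a root of unity z \<noteq> 1 and m \<ge> 1.  The value at m = 1 is the periodic mean-zero function whose
   distributional derivative is - (SUM n. z^n delta_n).  For m + 2 the second conjunct states that
   g is continuous with distributional derivative Q_root z (m + 1).  Q_{0,z} is not a function and
   is not used. *)
fun Q_root :: "complex \<Rightarrow> nat \<Rightarrow> real \<Rightarrow> complex" where
  "Q_root z 0 = undefined"
| "Q_root z (Suc 0) = (\<lambda>x. z / (1 - z) * z powi \<lfloor>x\<rfloor>)"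
| "Q_root z (Suc (Suc m)) =
     (THE g. (\<forall>x. g (x + real (root_order z)) = g x) \<and>
             (\<forall>a b. a \<le> b \<longrightarrow> (Q_root z (Suc m) has_integral (g b - g a)) {a..b}) \<and>
             (g has_integral 0) {0..real (root_order z)})"

(* t e^{xt} / (e^t - 1) = SUM m. B_m(x) t^m / m! *)
definition bernoulli_poly :: "nat \<Rightarrow> real \<Rightarrow> real" where
  "bernoulli_poly m x = fact m * fps_nth (fps_X * fps_exp x / (fps_exp 1 - 1)) m"

definition Q_fun :: "nat \<Rightarrow> complex \<Rightarrow> real \<Rightarrow> complex" where
  "Q_fun m z x =
     (if z = 1 then of_real (bernoulli_poly m (frac x) / fact m) else Q_root z m x)"

(* (S/2) / tanh (S/2) *)
definition L_series :: "real fps" where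
  "L_series = (fps_const (1/2) * fps_X) /
     ((fps_exp (1/2) - fps_exp (-(1/2))) / (fps_exp (1/2) + fps_exp (-(1/2))))"

definition M_poly :: "nat \<Rightarrow> complex \<Rightarrow> complex poly" where
  "M_poly k z =
     (if z = 1 then (\<Sum>i\<le>2 * (k div 2). monom (of_real (fps_nth L_series i)) i)
      else monom (1/2 + z / (1 - z)) 1 + (\<Sum>i=2..k. monom (Q_fun i z 0) i))"

definition int_lattice :: "(real^'n) set" where
  "int_lattice = {x. \<forall>i. x $ i \<in> \<int>}"

definition primitive_vec :: "real^'n \<Rightarrow> bool" where
  "primitive_vec w \<longleftrightarrow> w \<in> int_lattice \<and> w \<noteq> 0 \<and>
     (\<forall>(m::int) y. y \<in> int_lattice \<and> w = of_int m *\<^sub>R y \<longrightarrow> \<bar>m\<bar> = 1)"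

definition vertices :: "(real^'n) set \<Rightarrow> (real^'n) set" where
  "vertices P = {v. v extreme_point_of P}"

definition faces :: "(real^'n) set \<Rightarrow> (real^'n) set set" where
  "faces P = {F. F face_of P \<and> F \<noteq> {}}"

definition integral_polytope :: "(real^'n) set \<Rightarrow> bool" where
  "integral_polytope P \<longleftrightarrow> polytope P \<and> vertices P \<subseteq> int_lattice"

definition simple_polytope :: "(real^'n) set \<Rightarrow> bool" where
  "simple_polytope P \<longleftrightarrow> polytope P \<and> aff_dim P = int CARD('n) \<and>
     (\<forall>v\<in>vertices P. card {e. e edge_of P \<and> v \<in> e} = CARD('n))"

definition shifted_polytope ::
  "('d \<Rightarrow> real^'n) \<Rightarrow> ('d \<Rightarrow> real) \<Rightarrow> real^'d \<Rightarrow> (real^'n) set" where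
  "shifted_polytope u \<mu> h = (\<Inter>i. {x. u i \<bullet> x + \<mu> i + h $ i \<ge> 0})"

(* 'd enumerates the facets bijectively, and u i is the primitive inward normal of the i-th facet *)
definition facet_presentation ::
  "(real^'n) set \<Rightarrow> ('d::finite \<Rightarrow> real^'n) \<Rightarrow> ('d \<Rightarrow> real) \<Rightarrow> bool" where
  "facet_presentation P u \<mu> \<longleftrightarrow>
     P = (\<Inter>i. {x. u i \<bullet> x + \<mu> i \<ge> 0}) \<and>
     (\<forall>i. primitive_vec (u i)) \<and>
     bij_betw (\<lambda>i. P \<inter> {x. u i \<bullet> x + \<mu> i = 0}) UNIV {G. G facet_of P}"

(* I_F *)
definition facet_idx :: "('d \<Rightarrow> real^'n) \<Rightarrow> ('d \<Rightarrow> real) \<Rightarrow> (real^'n) set \<Rightarrow> 'd set" where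
  "facet_idx u \<mu> F = {i. \<forall>x\<in>F. u i \<bullet> x + \<mu> i = 0}"

(* alpha_{j,v} for I = I_v: the j-th vector of the basis dual to (u i) for i in I *)
definition dual_vec :: "('d \<Rightarrow> real^'n) \<Rightarrow> 'd set \<Rightarrow> 'd \<Rightarrow> real^'n" where
  "dual_vec u I j = (THE a. \<forall>i\<in>I. u i \<bullet> a = (if i = j then 1 else 0))"

definition face_weight :: "(real^'n) set \<Rightarrow> real^'n \<Rightarrow> real" where
  "face_weight P x =
     (1/2) ^ nat (int CARD('n) - aff_dim (THE F. F \<in> faces P \<and> x \<in> rel_interior F))"

definition weighted_sum :: "(real^'n) set \<Rightarrow> (real^'n \<Rightarrow> complex) \<Rightarrow> complex" where
  "weighted_sum P f = (\<Sum>x\<in>P \<inter> int_lattice. of_real (face_weight P x) * f x)"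

definition normal_lattice :: "('d \<Rightarrow> real^'n) \<Rightarrow> 'd set \<Rightarrow> (real^'n) set" where
  "normal_lattice u I = span (u ` I) \<inter> int_lattice"

definition facet_lattice :: "('d \<Rightarrow> real^'n) \<Rightarrow> 'd set \<Rightarrow> (real^'n) set" where
  "facet_lattice u I = {\<Sum>i\<in>I. of_int (m i) *\<^sub>R u i | m :: 'd \<Rightarrow> int. True}"

definition lattice_cong :: "('d \<Rightarrow> real^'n) \<Rightarrow> 'd set \<Rightarrow> ((real^'n) \<times> (real^'n)) set" where
  "lattice_cong u I =
     {(x, y). x \<in> normal_lattice u I \<and> y \<in> normal_lattice u I \<and> x - y \<in> facet_lattice u I}"

(* Gamma_F, as a set of cosets, for I = I_F *)
definition Gamma_grp :: "('d \<Rightarrow> real^'n) \<Rightarrow> 'd set \<Rightarrow> (real^'n) set set" where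
  "Gamma_grp u I = normal_lattice u I // lattice_cong u I"

(* the natural map from Gamma_E to Gamma_F for F \<subseteq> E and I = I_F: the coset g + L_E goes to g + L_F *)
definition Gamma_map :: "('d \<Rightarrow> real^'n) \<Rightarrow> 'd set \<Rightarrow> (real^'n) set \<Rightarrow> (real^'n) set" where
  "Gamma_map u I \<gamma> = lattice_cong u I `` \<gamma>"

definition Gamma_face ::
  "('d \<Rightarrow> real^'n) \<Rightarrow> ('d \<Rightarrow> real) \<Rightarrow> (real^'n) set \<Rightarrow> (real^'n) set set" where
  "Gamma_face u \<mu> F = Gamma_grp u (facet_idx u \<mu> F)"

definition Gamma_flat ::
  "(real^'n) set \<Rightarrow> ('d \<Rightarrow> real^'n) \<Rightarrow> ('d \<Rightarrow> real) \<Rightarrow> (real^'n) set \<Rightarrow> (real^'n) set set" where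
  "Gamma_flat P u \<mu> F =
     Gamma_face u \<mu> F -
     (\<Union>E\<in>{E \<in> faces P. F \<subset> E}. Gamma_map u (facet_idx u \<mu> F) ` Gamma_face u \<mu> E)"

(* lambda_{gamma,j,v} for I = I_v; the image of the coset \<gamma> is a singleton *)
definition lam_vertex :: "('d \<Rightarrow> real^'n) \<Rightarrow> 'd set \<Rightarrow> (real^'n) set \<Rightarrow> 'd \<Rightarrow> complex" where
  "lam_vertex u I \<gamma> j = the_elem ((\<lambda>g. cis (2 * pi * (g \<bullet> dual_vec u I j))) ` \<gamma>)"

(* lambda_{gamma,j,F} for \<gamma> in Gamma_F; it does not depend on the chosen vertex v of F *)
definition lam_face ::
  "(real^'n) set \<Rightarrow> ('d \<Rightarrow> real^'n) \<Rightarrow> ('d \<Rightarrow> real) \<Rightarrow> (real^'n) set \<Rightarrow> (real^'n) set \<Rightarrow> 'd \<Rightarrow> complex"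
  where
  "lam_face P u \<mu> F \<gamma> j =
     (if j \<in> facet_idx u \<mu> F
      then let I = facet_idx u \<mu> {SOME v. v \<in> vertices P \<and> v \<in> F}
           in lam_vertex u I (Gamma_map u I \<gamma>) j
      else 1)"

(* the operator M^k_{gamma,F}, the variable j standing for the partial derivative in h_j *)
definition M_op ::
  "nat \<Rightarrow> (real^'n) set \<Rightarrow> ('d::finite \<Rightarrow> real^'n) \<Rightarrow> ('d \<Rightarrow> real) \<Rightarrow> (real^'n) set \<Rightarrow> (real^'n) set \<Rightarrow>
    'd op_poly" where
  "M_op k P u \<mu> F \<gamma> = (\<Prod>j\<in>UNIV. in_var j (M_poly k (lam_face P u \<mu> F \<gamma> j)))"

definition polarizing ::
  "(real^'n) set \<Rightarrow> ('d \<Rightarrow> real^'n) \<Rightarrow> ('d \<Rightarrow> real) \<Rightarrow> real^'n \<Rightarrow> bool" where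
  "polarizing P u \<mu> \<xi> \<longleftrightarrow>
     (\<forall>v\<in>vertices P. \<forall>j\<in>facet_idx u \<mu> {v}. \<xi> \<bullet> dual_vec u (facet_idx u \<mu> {v}) j \<noteq> 0)"

(* Below I = I_v. *)

definition flipped :: "('d \<Rightarrow> real^'n) \<Rightarrow> 'd set \<Rightarrow> real^'n \<Rightarrow> 'd \<Rightarrow> bool" where
  "flipped u I \<xi> j \<longleftrightarrow> \<xi> \<bullet> dual_vec u I j > 0"

definition alpha_sharp :: "('d \<Rightarrow> real^'n) \<Rightarrow> 'd set \<Rightarrow> real^'n \<Rightarrow> 'd \<Rightarrow> real^'n" where
  "alpha_sharp u I \<xi> j = (if flipped u I \<xi> j then - dual_vec u I j else dual_vec u I j)"

definition u_sharp :: "('d \<Rightarrow> real^'n) \<Rightarrow> 'd set \<Rightarrow> real^'n \<Rightarrow> 'd \<Rightarrow> real^'n" where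
  "u_sharp u I \<xi> j = (if flipped u I \<xi> j then - u j else u j)"

definition lam_sharp ::
  "('d \<Rightarrow> real^'n) \<Rightarrow> 'd set \<Rightarrow> real^'n \<Rightarrow> (real^'n) set \<Rightarrow> 'd \<Rightarrow> complex" where
  "lam_sharp u I \<xi> \<gamma> j =
     (if flipped u I \<xi> j then inverse (lam_vertex u I \<gamma> j) else lam_vertex u I \<gamma> j)"

definition num_flips :: "('d \<Rightarrow> real^'n) \<Rightarrow> 'd set \<Rightarrow> real^'n \<Rightarrow> nat" where
  "num_flips u I \<xi> = card {j \<in> I. flipped u I \<xi> j}"

definition cone_sharp :: "('d \<Rightarrow> real^'n) \<Rightarrow> 'd set \<Rightarrow> real^'n \<Rightarrow> real^'n \<Rightarrow> (real^'n) set" where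
  "cone_sharp u I \<xi> v = {v + (\<Sum>j\<in>I. t j *\<^sub>R alpha_sharp u I \<xi> j) | t. \<forall>j\<in>I. 0 \<le> t j}"

(* The integrand for the subset J of I = I_v; pcompose with [:0, -1:] turns p(S) into p(-S), so that
   the variable j becomes -D_{alpha_sharp j}. *)
definition remainder_integrand ::
  "nat \<Rightarrow> ('d::{finite,linorder} \<Rightarrow> real^'n) \<Rightarrow> 'd set \<Rightarrow> real^'n \<Rightarrow> real^'n \<Rightarrow> (real^'n) set \<Rightarrow> 'd set \<Rightarrow>
    (real^'n \<Rightarrow> complex) \<Rightarrow> real^'n \<Rightarrow> complex" where
  "remainder_integrand k u I \<xi> v \<gamma> J f =
     diff_op (alpha_sharp u I \<xi>)
       (\<Prod>j\<in>J. in_var j (pcompose (M_poly k (lam_sharp u I \<xi> \<gamma> j)) [:0, -1:]))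
       (\<lambda>x. (\<Prod>j\<in>I - J. Q_fun k (lam_sharp u I \<xi> \<gamma> j) (u_sharp u I \<xi> j \<bullet> (x - v))) *
             diff_op (alpha_sharp u I \<xi>) (\<Prod>j\<in>I - J. in_var j (monom 1 k)) f x)"

definition remainder ::
  "nat \<Rightarrow> (real^'n) set \<Rightarrow> ('d::{finite,linorder} \<Rightarrow> real^'n) \<Rightarrow> ('d \<Rightarrow> real) \<Rightarrow> real^'n \<Rightarrow>
    (real^'n \<Rightarrow> complex) \<Rightarrow> complex" where
  "remainder k P u \<mu> \<xi> f =
     (\<Sum>v\<in>vertices P. let I = facet_idx u \<mu> {v} in
        (-1) ^ num_flips u I \<xi> *
        (\<Sum>\<gamma>\<in>Gamma_grp u I. \<Sum>J\<in>{J. J \<subset> I}.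
           (-1) ^ ((k - 1) * (CARD('n) - card J)) *
           (LINT x:cone_sharp u I \<xi> v|lborel. remainder_integrand k u I \<xi> v \<gamma> J f x)))"

end

theory Submission
  imports Defs
begin

text \<open>
Why the formula holds.  Near a vertex \<open>v\<close> the polytope is a simplicial cone, and in the edge
coordinates at \<open>v\<close> this cone is an orthant.  A sum over the integer points of an orthant is iterated
from one-dimensional sums, but the edge vectors generate a lattice that in general is not \<open>\<int>\<^sup>n\<close>.  The finite
group \<open>\<Gamma>\<^sub>v\<close> measures the difference: the average over \<open>\<Gamma>\<^sub>v\<close> of its characters is the indicator of the
integer points among the integer combinations of the edge vectors (\<open>character_sum\<close>).  Hence sums
twisted by roots of unity are needed already in dimension one.

In dimension one, repeated integration by parts against the periodic functions \<open>Q_{m,z}\<close> gives the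
twisted formula on a half-line (\<open>euler_maclaurin_ray\<close>); that its boundary terms assemble to the
polynomial \<open>\<^bold>M\<close> follows from one generating function for all \<open>Q_{m,z}\<close>.  Applying it in one
direction after another gives a formula on an orthant with a term for every subset \<open>J\<close> of the
directions (\<open>euler_maclaurin_orthant\<close>): the directions in \<open>J\<close> carry \<open>\<^bold>M\<close>, the others carry \<open>Q_k\<close> and a
\<open>k\<close>-th derivative.  Averaging over \<open>\<Gamma>\<^sub>v\<close> and changing variables gives a formula on the cone at \<open>v\<close>
(\<open>euler_maclaurin_vertex\<close>).  The volume factor of the change of variables is \<open>|\<Gamma>\<^sub>v|\<close> and cancels the
averaging factor (\<open>dual_cell_volume\<close>).

The cones are glued by a weighted polar decomposition.  If a half-space is given the weight 1 inside,
1/2 on the boundary and 0 outside, the weight function of a simple polytope is the signed sum over its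
vertices of the weight functions of the polarized cones (\<open>weighted_polar_decomposition\<close>).  After
expansion into faces each face appears once, at the vertex of the face where the polarizing vector is
minimal, so the sum is the same for all polarizing vectors and may be computed for one adapted to the
given point.  The decomposition also holds for \<open>\<Delta>(h)\<close> with \<open>h\<close> near 0, whose vertices
are affine functions of \<open>h\<close>.  Therefore \<open>\<integral>\<^bsub>\<Delta>(h)\<^esub> f\<close> is a signed sum of integrals of \<open>f\<close> over translated
cones, and a derivative in \<open>h\<^sub>j\<close> becomes minus a derivative of \<open>f\<close> along the edge \<open>\<alpha>\<^sub>j\<close>.  This turns
the terms \<open>J = I\<^sub>v\<close> of the cone formulas into operators applied to \<open>\<integral>\<^bsub>\<Delta>(h)\<^esub> f\<close>; regrouping \<open>\<Gamma>\<^sub>v\<close> by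
the faces on which its elements live (\<open>Gamma_flat_bij\<close>) gives the sum over faces in the theorem.  The
terms with \<open>J \<noteq> I\<^sub>v\<close> are the remainder.

All of this is first done for smooth functions of compact support.  A symbol \<open>f\<close> is multiplied by the
dilated cutoffs \<open>\<eta>(x/(m+1))\<close>, which are symbols of order 0 uniformly in \<open>m\<close>.  The left-hand side and
the main term do not change for large \<open>m\<close>.  Every monomial of the remainder has order at least \<open>k\<close>, so
by \<open>k \<ge> N + n + 1\<close> the integrands are dominated by a multiple of \<open>(1+|x|)^{-n-1}\<close>, and the remainder
converges.  The estimate uses the same fact: the monomials have orders between \<open>k\<close> and \<open>nk\<close>, the
functions \<open>Q_k\<close> are bounded, and only finitely many configurations of flipped edges occur.
\<close>

section \<open>Directional derivatives of smooth functions\<close>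

lemma has_derivative_dir_deriv:
  assumes "(f has_derivative D) (at x)"
  shows "dir_deriv w f x = D w"
proof -
  have "((\<lambda>t. f (x + t *\<^sub>R w)) has_derivative (\<lambda>t. D (t *\<^sub>R w))) (at (0::real))"
    by (rule has_derivative_compose[where f="\<lambda>t. x + t *\<^sub>R w" and g=f and x=0, unfolded o_def])
       (auto intro!: derivative_eq_intros assms simp: assms)
  moreover have "D (t *\<^sub>R w) = t *\<^sub>R D w" for t
    using assms by (simp add: has_derivative_def bounded_linear.linear linear_scale)
  ultimately have "((\<lambda>t. f (x + t *\<^sub>R w)) has_vector_derivative D w) (at 0)"
    by (simp add: has_vector_derivative_def)
  then show ?thesis unfolding dir_deriv_def by (rule vector_derivative_at)
qed

lemma dir_deriv_has_vector_derivative: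
  assumes "f differentiable (at (x + t *\<^sub>R w))"
  shows "((\<lambda>s. f (x + s *\<^sub>R w)) has_vector_derivative dir_deriv w f (x + t *\<^sub>R w)) (at t within S)"
proof -
  obtain D where D: "(f has_derivative D) (at (x + t *\<^sub>R w))"
    using assms by (auto simp: differentiable_def)
  have "((\<lambda>s. f (x + s *\<^sub>R w)) has_derivative (\<lambda>s. D (s *\<^sub>R w))) (at t within S)"
    by (rule has_derivative_compose[where f="\<lambda>s. x + s *\<^sub>R w" and g=f and x=t, unfolded o_def])
       (auto intro!: derivative_eq_intros D simp: D)
  moreover have "D (s *\<^sub>R w) = s *\<^sub>R D w" for s
    using D by (simp add: has_derivative_def bounded_linear.linear linear_scale)
  ultimately show ?thesis
    by (simp add: has_vector_derivative_def has_derivative_dir_deriv[OF D])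
qed

lemma dir_deriv_add_fun:
  assumes "f differentiable (at x)" "g differentiable (at x)"
  shows "dir_deriv w (\<lambda>x. f x + g x) x = dir_deriv w f x + dir_deriv w g x"
  using assms by (auto simp: differentiable_def has_derivative_dir_deriv
      has_derivative_dir_deriv[OF has_derivative_add])

lemma dir_deriv_mult_fun:
  fixes f g :: "'a::real_normed_vector \<Rightarrow> 'b::real_normed_algebra"
  assumes "f differentiable (at x)" "g differentiable (at x)"
  shows "dir_deriv w (\<lambda>x. f x * g x) x = dir_deriv w f x * g x + f x * dir_deriv w g x"
  using assms by (auto simp: differentiable_def has_derivative_dir_deriv
      has_derivative_dir_deriv[OF has_derivative_mult])

lemma dir_deriv_const [simp]: "dir_deriv w (\<lambda>x. c) = (\<lambda>x. 0)"
  by (rule ext, rule has_derivative_dir_deriv[where D="\<lambda>x. 0"]) simp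

lemma dir_deriv_zero_dir [simp]: "dir_deriv 0 f = (\<lambda>x. 0)"
  by (rule ext) (simp add: dir_deriv_def)

lemma dir_deriv_cmult_fun:
  fixes f :: "'a::real_normed_vector \<Rightarrow> 'b::real_normed_algebra"
  assumes "f differentiable (at x)"
  shows "dir_deriv w (\<lambda>x. c * f x) x = c * dir_deriv w f x"
  using dir_deriv_mult_fun[of "\<lambda>_. c" x f w] assms by simp

lemma dir_deriv_expand:
  fixes f :: "real^'n::finite \<Rightarrow> 'b::real_normed_vector"
  assumes "f differentiable (at x)"
  shows "dir_deriv w f x = (\<Sum>i\<in>UNIV. w $ i *\<^sub>R dir_deriv (std_dir i) f x)"
proof -
  obtain D where D: "(f has_derivative D) (at x)"
    using assms by (auto simp: differentiable_def)
  then have lin: "linear D" by (simp add: has_derivative_def bounded_linear.linear)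
  have "D w = D (\<Sum>i\<in>UNIV. w $ i *\<^sub>R axis i 1)"
    by (subst basis_expansion[symmetric]) (simp add: scalar_mult_eq_scaleR)
  also have "\<dots> = (\<Sum>i\<in>UNIV. w $ i *\<^sub>R D (axis i 1))"
    using lin by (simp add: linear_sum linear_scale)
  finally show ?thesis by (simp add: has_derivative_dir_deriv[OF D] std_dir_def)
qed

text \<open>A set of differentiable functions that is closed under partial derivatives consists of
  smooth functions; all closure properties of smoothness below are instances of this.\<close>

lemma smooth_coinduct:
  assumes "f \<in> X"
    and "\<And>g. g \<in> X \<Longrightarrow> g differentiable_on UNIV"
    and "\<And>g i. g \<in> X \<Longrightarrow> dir_deriv (std_dir i) g \<in> X"
  shows "smooth f"
proof -
  have "foldr (\<lambda>i. dir_deriv (std_dir i)) js f \<in> X" for js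
    by (induction js) (use assms in auto)
  then show ?thesis unfolding smooth_def using assms(2) by blast
qed

lemma smooth_differentiable: "smooth f \<Longrightarrow> f differentiable (at x)"
  using smooth_def[of f] by (metis UNIV_I differentiable_on_def foldr.simps(1) id_apply)

lemma smooth_differentiable_on: "smooth f \<Longrightarrow> f differentiable_on S"
  by (simp add: differentiable_at_imp_differentiable_on smooth_differentiable)

lemma smooth_continuous_on: "smooth f \<Longrightarrow> continuous_on S f"
  by (intro differentiable_imp_continuous_on smooth_differentiable_on)

lemma smooth_borel_measurable [measurable_dest]:
  fixes f :: "real^'n \<Rightarrow> complex"
  shows "smooth f \<Longrightarrow> f \<in> borel_measurable borel"
  by (intro borel_measurable_continuous_onI smooth_continuous_on)

lemma smooth_partial: "smooth f \<Longrightarrow> smooth (dir_deriv (std_dir i) f)"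
  unfolding smooth_def
proof
  fix js assume "\<forall>js. foldr (\<lambda>i. dir_deriv (std_dir i)) js f differentiable_on UNIV"
  then have "foldr (\<lambda>i. dir_deriv (std_dir i)) (js @ [i]) f differentiable_on UNIV" by blast
  then show "foldr (\<lambda>i. dir_deriv (std_dir i)) js (dir_deriv (std_dir i) f) differentiable_on UNIV"
    by simp
qed

text \<open>Products alone are not closed under partial derivatives; by the product rule, finite sums of products are.\<close>

lemma smooth_sum_list_mult:
  fixes L :: "((real^'n \<Rightarrow> 'b::real_normed_algebra) \<times> (real^'n \<Rightarrow> 'b)) list"
  assumes "\<forall>(f, g) \<in> set L. smooth f \<and> smooth g"
  shows "smooth (\<lambda>x. \<Sum>(f, g)\<leftarrow>L. f x * g x)"
proof (rule smooth_coinduct)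
  let ?X = "{\<lambda>x. \<Sum>(f, g)\<leftarrow>L. f x * g x | L :: ((real^'n \<Rightarrow> 'b) \<times> (real^'n \<Rightarrow> 'b)) list.
               \<forall>(f, g) \<in> set L. smooth f \<and> smooth g}"
  show "(\<lambda>x. \<Sum>(f, g)\<leftarrow>L. f x * g x) \<in> ?X" using assms by blast
  have diff: "(\<lambda>x. \<Sum>(f, g)\<leftarrow>L. f x * g x) differentiable (at x)"
    if "\<forall>(f, g) \<in> set L. smooth f \<and> smooth g"
    for x and L :: "((real^'n \<Rightarrow> 'b) \<times> (real^'n \<Rightarrow> 'b)) list"
    using that
  proof (induction L)
    case (Cons a L)
    obtain f g where "a = (f, g)" by (cases a)
    with Cons have "smooth f" "smooth g" "(\<lambda>x. \<Sum>(f, g)\<leftarrow>L. f x * g x) differentiable (at x)" by auto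
    then have "(\<lambda>x. f x * g x + (\<Sum>(f, g)\<leftarrow>L. f x * g x)) differentiable (at x)"
      by (intro differentiable_add differentiable_mult) (auto intro: smooth_differentiable)
    then show ?case by (simp add: \<open>a = (f, g)\<close>)
  qed auto
  show "h differentiable_on UNIV" if "h \<in> ?X" for h
    using that diff by (auto simp: differentiable_on_def)
  show "dir_deriv (std_dir i) h \<in> ?X" if "h \<in> ?X" for h i
  proof -
    obtain L :: "((real^'n \<Rightarrow> 'b) \<times> (real^'n \<Rightarrow> 'b)) list"
      where L: "h = (\<lambda>x. \<Sum>(f, g)\<leftarrow>L. f x * g x)" "\<forall>(f, g) \<in> set L. smooth f \<and> smooth g"
      using \<open>h \<in> ?X\<close> by blast
    let ?D = "dir_deriv (std_dir i)"
    have "\<exists>L'. ?D (\<lambda>x. \<Sum>(f, g)\<leftarrow>L. f x * g x) = (\<lambda>x. \<Sum>(f, g)\<leftarrow>L'. f x * g x)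
            \<and> (\<forall>(f, g) \<in> set L'. smooth f \<and> smooth g)"
      using L(2)
    proof (induction L)
      case Nil
      show ?case by (rule exI[of _ "[]"]) simp
    next
      case (Cons a L)
      then obtain L' where L': "?D (\<lambda>x. \<Sum>(f, g)\<leftarrow>L. f x * g x) = (\<lambda>x. \<Sum>(f, g)\<leftarrow>L'. f x * g x)"
        "\<forall>(f, g) \<in> set L'. smooth f \<and> smooth g" by auto
      obtain f g where a: "a = (f, g)" by (cases a)
      with Cons.prems have sm: "smooth f" "smooth g" by auto
      have "?D (\<lambda>x. \<Sum>(f, g)\<leftarrow>a # L. f x * g x) x = (\<Sum>(f, g)\<leftarrow>(?D f, g) # (f, ?D g) # L'. f x * g x)"
        for x
      proof -
        have "?D (\<lambda>x. f x * g x + (\<Sum>(f, g)\<leftarrow>L. f x * g x)) x =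
                ?D (\<lambda>x. f x * g x) x + ?D (\<lambda>x. \<Sum>(f, g)\<leftarrow>L. f x * g x) x"
          by (intro dir_deriv_add_fun derivative_intros diff)
             (use sm Cons.prems in \<open>auto intro: smooth_differentiable\<close>)
        then show ?thesis using sm
          by (simp add: a L' dir_deriv_mult_fun smooth_differentiable)
      qed
      then have "?D (\<lambda>x. \<Sum>(f, g)\<leftarrow>a # L. f x * g x) =
          (\<lambda>x. \<Sum>(f, g)\<leftarrow>(?D f, g) # (f, ?D g) # L'. f x * g x)"
        by blast
      moreover have "\<forall>(f, g) \<in> set ((?D f, g) # (f, ?D g) # L'). smooth f \<and> smooth g"
        using sm L' by (auto simp: smooth_partial)
      ultimately show ?case by blast
    qed
    then show ?thesis using L(1) by blast
  qed
qed

lemma smooth_mult: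
  fixes f g :: "real^'n \<Rightarrow> 'b::real_normed_algebra"
  shows "smooth f \<Longrightarrow> smooth g \<Longrightarrow> smooth (\<lambda>x. f x * g x)"
  using smooth_sum_list_mult[of "[(f, g)]"] by simp

lemma smooth_const: "smooth (\<lambda>x. c)"
  by (rule smooth_coinduct[of _ "{\<lambda>x. c, \<lambda>x. 0}"]) auto

lemma smooth_cmult:
  fixes f :: "real^'n \<Rightarrow> 'b::real_normed_algebra"
  shows "smooth f \<Longrightarrow> smooth (\<lambda>x. c * f x)"
  by (intro smooth_mult smooth_const)

lemma smooth_add:
  fixes f g :: "real^'n \<Rightarrow> 'b::real_normed_algebra_1"
  shows "smooth f \<Longrightarrow> smooth g \<Longrightarrow> smooth (\<lambda>x. f x + g x)"
  using smooth_sum_list_mult[of "[(\<lambda>_. 1, f), (\<lambda>_. 1, g)]"] by (simp add: smooth_const)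

lemma smooth_sum:
  fixes f :: "'a \<Rightarrow> real^'n \<Rightarrow> 'b::real_normed_algebra_1"
  shows "(\<And>i. i \<in> S \<Longrightarrow> smooth (f i)) \<Longrightarrow> smooth (\<lambda>x. \<Sum>i\<in>S. f i x)"
  by (induction S rule: infinite_finite_induct) (auto simp: smooth_const smooth_add)

lemma dir_deriv_expand_complex:
  fixes f :: "real^'n::finite \<Rightarrow> complex"
  assumes "smooth f"
  shows "dir_deriv w f = (\<lambda>x. \<Sum>i\<in>UNIV. of_real (w $ i) * dir_deriv (std_dir i) f x)"
  by (rule ext, subst dir_deriv_expand[OF smooth_differentiable[OF assms]])
     (simp add: scaleR_conv_of_real)

lemma smooth_dir_deriv:
  fixes f :: "real^'n \<Rightarrow> complex"
  assumes "smooth f"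
  shows "smooth (dir_deriv w f)"
  by (subst dir_deriv_expand_complex[OF assms]) (intro smooth_sum smooth_cmult smooth_partial assms)

lemma smooth_dir_deriv_pow:
  fixes f :: "real^'n \<Rightarrow> complex"
  shows "smooth f \<Longrightarrow> smooth ((dir_deriv w ^^ m) f)"
  by (induction m) (auto intro: smooth_dir_deriv)

text \<open>Second directional derivatives commute: by two applications of the mean value theorem, both
  are limits of the same second difference quotient.\<close>

lemma second_difference_mean_value:
  fixes f :: "real^'n \<Rightarrow> complex"
  assumes f: "smooth f" and h: "h > 0"
  shows "\<exists>s t. 0 < s \<and> s < h \<and> 0 < t \<and> t < h \<and>
     ((f (x + h *\<^sub>R a + h *\<^sub>R b) - f (x + h *\<^sub>R a)) - (f (x + h *\<^sub>R b) - f x)) \<bullet> c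
        = h\<^sup>2 * (dir_deriv b (dir_deriv a f) (x + s *\<^sub>R a + t *\<^sub>R b) \<bullet> c)"
proof -
  define F where "F s = (f (x + h *\<^sub>R b + s *\<^sub>R a) - f (x + s *\<^sub>R a)) \<bullet> c" for s
  define F' where "F' s = (dir_deriv a f (x + h *\<^sub>R b + s *\<^sub>R a) - dir_deriv a f (x + s *\<^sub>R a)) \<bullet> c" for s
  have F: "(F has_real_derivative F' s) (at s)" for s
    unfolding F_def F'_def has_real_derivative_iff_has_vector_derivative
    by (intro bounded_linear.has_vector_derivative[OF bounded_linear_inner_left] has_vector_derivative_diff
        dir_deriv_has_vector_derivative smooth_differentiable f)
  obtain s where s: "0 < s" "s < h" "F h - F 0 = (h - 0) * F' s"
    using MVT2[of 0 h F F'] h F by blast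
  define G where "G t = dir_deriv a f (x + s *\<^sub>R a + t *\<^sub>R b) \<bullet> c" for t
  define G' where "G' t = dir_deriv b (dir_deriv a f) (x + s *\<^sub>R a + t *\<^sub>R b) \<bullet> c" for t
  have G: "(G has_real_derivative G' s) (at s)" for s
    unfolding G_def G'_def has_real_derivative_iff_has_vector_derivative
    by (intro bounded_linear.has_vector_derivative[OF bounded_linear_inner_left]
        dir_deriv_has_vector_derivative smooth_differentiable smooth_dir_deriv f)
  obtain t where t: "0 < t" "t < h" "G h - G 0 = (h - 0) * G' t"
    using MVT2[of 0 h G G'] h G by blast
  have "F' s = G h - G 0"
    by (simp add: F'_def G_def inner_diff_left add_ac)
  with s t have "F h - F 0 = h\<^sup>2 * G' t" by (simp add: power2_eq_square)
  then show ?thesis using s(1,2) t(1,2)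
    by (rule_tac exI[of _ s], rule_tac exI[of _ t]) (simp add: F_def G'_def add_ac inner_diff_left)
qed

lemma dir_deriv_commute:
  fixes f :: "real^'n \<Rightarrow> complex"
  assumes f: "smooth f"
  shows "dir_deriv a (dir_deriv b f) = dir_deriv b (dir_deriv a f)"
proof
  fix x
  let ?A = "dir_deriv a (dir_deriv b f)" and ?B = "dir_deriv b (dir_deriv a f)"
  have cont: "isCont ?A x" "isCont ?B x"
    using f by (auto intro!: differentiable_imp_continuous_within smooth_differentiable smooth_dir_deriv)
  have eq: "?A x \<bullet> c = ?B x \<bullet> c" for c
  proof (rule ccontr)
    assume ne: "?A x \<bullet> c \<noteq> ?B x \<bullet> c"
    define e where "e = \<bar>?A x \<bullet> c - ?B x \<bullet> c\<bar> / 2"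
    have e: "e > 0" using ne by (simp add: e_def)
    have "isCont (\<lambda>y. ?A y \<bullet> c) x" "isCont (\<lambda>y. ?B y \<bullet> c) x"
      using cont by (auto intro!: continuous_intros)
    then obtain d1 d2 where d: "d1 > 0" "d2 > 0"
      "\<And>y. dist y x < d1 \<Longrightarrow> dist (?A y \<bullet> c) (?A x \<bullet> c) < e"
      "\<And>y. dist y x < d2 \<Longrightarrow> dist (?B y \<bullet> c) (?B x \<bullet> c) < e"
      using e unfolding continuous_at_eps_delta by metis
    define h where "h = min d1 d2 / (norm a + norm b + 1)"
    have pos: "norm a + norm b + 1 > 0" by (smt (verit) norm_ge_zero)
    have h: "h > 0" using d pos by (simp add: h_def)
    have near: "dist (x + s *\<^sub>R a + t *\<^sub>R b) x < min d1 d2" if "0 < s" "s < h" "0 < t" "t < h" for s t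
    proof -
      have "dist (x + s *\<^sub>R a + t *\<^sub>R b) x \<le> s * norm a + t * norm b"
        using that norm_triangle_ineq[of "s *\<^sub>R a" "t *\<^sub>R b"] by (simp add: dist_norm add_ac)
      also have "\<dots> \<le> h * (norm a + norm b)"
        using that by (auto simp: distrib_left intro!: add_mono mult_right_mono)
      also have "\<dots> < h * (norm a + norm b + 1)" using h by (simp add: algebra_simps)
      also have "\<dots> = min d1 d2" using pos by (simp add: h_def)
      finally show ?thesis .
    qed
    obtain s t where st: "0 < s" "s < h" "0 < t" "t < h"
     "((f (x + h *\<^sub>R a + h *\<^sub>R b) - f (x + h *\<^sub>R a)) - (f (x + h *\<^sub>R b) - f x)) \<bullet> c
        = h\<^sup>2 * (?B (x + s *\<^sub>R a + t *\<^sub>R b) \<bullet> c)"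
      using second_difference_mean_value[OF f h] by blast
    obtain s' t' where st': "0 < s'" "s' < h" "0 < t'" "t' < h"
     "((f (x + h *\<^sub>R b + h *\<^sub>R a) - f (x + h *\<^sub>R b)) - (f (x + h *\<^sub>R a) - f x)) \<bullet> c
        = h\<^sup>2 * (?A (x + s' *\<^sub>R b + t' *\<^sub>R a) \<bullet> c)"
      using second_difference_mean_value[OF f h] by blast
    have "(f (x + h *\<^sub>R b + h *\<^sub>R a) - f (x + h *\<^sub>R b)) - (f (x + h *\<^sub>R a) - f x)
        = (f (x + h *\<^sub>R a + h *\<^sub>R b) - f (x + h *\<^sub>R a)) - (f (x + h *\<^sub>R b) - f x)"
      by (simp add: algebra_simps)
    with st(5) st'(5) h have same: "?A (x + s' *\<^sub>R b + t' *\<^sub>R a) \<bullet> c = ?B (x + s *\<^sub>R a + t *\<^sub>R b) \<bullet> c"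
      by simp
    have "dist (?A (x + t' *\<^sub>R a + s' *\<^sub>R b) \<bullet> c) (?A x \<bullet> c) < e"
      using d(3) near[OF st'(3,4,1,2)] by simp
    moreover have "dist (?B (x + s *\<^sub>R a + t *\<^sub>R b) \<bullet> c) (?B x \<bullet> c) < e"
      using d(4) near[OF st(1-4)] by simp
    moreover have "x + t' *\<^sub>R a + s' *\<^sub>R b = x + s' *\<^sub>R b + t' *\<^sub>R a" by simp
    ultimately have "\<bar>?A x \<bullet> c - ?B x \<bullet> c\<bar> < 2 * e"
      using same by (simp add: dist_real_def)
    then show False by (simp add: e_def)
  qed
  show "?A x = ?B x" using eq vector_eq_rdot[of "?A x" "?B x"] by blast
qed

section \<open>Constant-coefficient differential operators\<close>

text \<open>Applied to smooth functions, \<^const>\<open>diff_op\<close> is a ring homomorphism from polynomials to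
  operators.\<close>

lemma smooth_foldr_deriv:
  fixes f :: "real^'n \<Rightarrow> complex"
  shows "smooth f \<Longrightarrow> smooth (foldr (\<lambda>j. dir_deriv (w j) ^^ a j) l f)"
  by (induction l) (auto intro: smooth_dir_deriv_pow)

lemma smooth_multi_deriv:
  fixes f :: "real^'n \<Rightarrow> complex"
  shows "smooth f \<Longrightarrow> smooth (multi_deriv w a f)"
  unfolding multi_deriv_def by (rule smooth_foldr_deriv)

lemma dir_deriv_commute_pow:
  fixes f :: "real^'n \<Rightarrow> complex"
  assumes "smooth f"
  shows "dir_deriv a ((dir_deriv b ^^ m) f) = (dir_deriv b ^^ m) (dir_deriv a f)"
  by (induction m) (simp_all add: dir_deriv_commute[of _ a b] smooth_dir_deriv_pow assms)

lemma dir_deriv_pow_commute_foldr: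
  fixes f :: "real^'n \<Rightarrow> complex"
  assumes "smooth f"
  shows "(dir_deriv b ^^ m) (foldr (\<lambda>j. dir_deriv (w j) ^^ a j) l f) =
         foldr (\<lambda>j. dir_deriv (w j) ^^ a j) l ((dir_deriv b ^^ m) f)"
proof -
  have pow: "(dir_deriv b ^^ m) ((dir_deriv c ^^ k) g) = (dir_deriv c ^^ k) ((dir_deriv b ^^ m) g)"
    if "smooth g" for g :: "real^'n \<Rightarrow> complex" and c k
    by (induction m) (simp_all add: dir_deriv_commute_pow that smooth_dir_deriv_pow)
  show ?thesis by (induction l) (simp_all add: pow smooth_foldr_deriv assms)
qed

lemma multi_deriv_add:
  fixes f :: "real^'n \<Rightarrow> complex"
  assumes "smooth f"
  shows "multi_deriv w (\<lambda>j. a j + b j) f = multi_deriv w a (multi_deriv w b f)"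
proof -
  have "foldr (\<lambda>j. dir_deriv (w j) ^^ (a j + b j)) l f =
        foldr (\<lambda>j. dir_deriv (w j) ^^ a j) l (foldr (\<lambda>j. dir_deriv (w j) ^^ b j) l f)" for l
    by (induction l) (simp_all add: funpow_add dir_deriv_pow_commute_foldr assms smooth_foldr_deriv)
  then show ?thesis by (simp add: multi_deriv_def)
qed

lemma multi_deriv_single:
  "multi_deriv w (\<lambda>i. if i = j then m else 0) f = (dir_deriv (w j) ^^ m) f"
proof -
  have "foldr (\<lambda>i. dir_deriv (w i) ^^ (if i = j then m else 0)) l f =
      (if j \<in> set l then (dir_deriv (w j) ^^ m) f else f)" if "distinct l" for l
    using that by (induction l) auto
  then show ?thesis by (simp add: multi_deriv_def)
qed

lemma multi_deriv_0 [simp]: "multi_deriv w (\<lambda>_. 0) f = f"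
proof -
  have "foldr (\<lambda>i. dir_deriv (w i) ^^ 0) l f = f" for l by (induction l) auto
  then show ?thesis by (simp add: multi_deriv_def)
qed

lemma multi_deriv_fun_sum:
  fixes f :: "'a \<Rightarrow> real^'n \<Rightarrow> complex"
  assumes "\<And>i. i \<in> S \<Longrightarrow> smooth (f i)"
  shows "multi_deriv w a (\<lambda>x. \<Sum>i\<in>S. c i * f i x) = (\<lambda>x. \<Sum>i\<in>S. c i * multi_deriv w a (f i) x)"
proof -
  have one: "dir_deriv v (\<lambda>x. \<Sum>i\<in>S. c i * g i x) = (\<lambda>x. \<Sum>i\<in>S. c i * dir_deriv v (g i) x)"
    if "\<And>i. i \<in> S \<Longrightarrow> smooth (g i)" for g :: "'a \<Rightarrow> real^'n \<Rightarrow> complex" and v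
    using that
  proof (induction S rule: infinite_finite_induct)
    case (insert i S)
    have "dir_deriv v (\<lambda>x. c i * g i x + (\<Sum>i\<in>S. c i * g i x)) x =
          dir_deriv v (\<lambda>x. c i * g i x) x + dir_deriv v (\<lambda>x. \<Sum>i\<in>S. c i * g i x) x" for x
      using insert by (intro dir_deriv_add_fun smooth_differentiable smooth_cmult smooth_sum) auto
    then show ?case using insert
      by (auto simp: dir_deriv_cmult_fun smooth_differentiable)
  qed auto
  have pow: "(dir_deriv v ^^ m) (\<lambda>x. \<Sum>i\<in>S. c i * g i x) = (\<lambda>x. \<Sum>i\<in>S. c i * (dir_deriv v ^^ m) (g i) x)"
    if "\<And>i. i \<in> S \<Longrightarrow> smooth (g i)" for g :: "'a \<Rightarrow> real^'n \<Rightarrow> complex" and v m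
    by (induction m) (simp_all add: one smooth_dir_deriv_pow that)
  have "foldr (\<lambda>j. dir_deriv (w j) ^^ a j) l (\<lambda>x. \<Sum>i\<in>S. c i * f i x) =
        (\<lambda>x. \<Sum>i\<in>S. c i * foldr (\<lambda>j. dir_deriv (w j) ^^ a j) l (f i) x)" for l
    by (induction l) (simp_all add: pow smooth_foldr_deriv assms)
  then show ?thesis by (simp add: multi_deriv_def)
qed

lemma diff_op_superset:
  assumes "finite S" "Poly_Mapping.keys T \<subseteq> S"
  shows "diff_op w T g x =
     (\<Sum>a\<in>S. Poly_Mapping.lookup T a * multi_deriv w (Poly_Mapping.lookup a) g x)"
  unfolding diff_op_def using assms
  by (intro sum.mono_neutral_left) (auto simp: in_keys_iff)

lemma diff_op_zero [simp]: "diff_op w 0 g x = 0"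
  by (simp add: diff_op_def)

lemma diff_op_add: "diff_op w (S + T) g x = diff_op w S g x + diff_op w T g x"
proof -
  let ?K = "Poly_Mapping.keys S \<union> Poly_Mapping.keys T"
  have "finite ?K" "Poly_Mapping.keys (S + T) \<subseteq> ?K" using Poly_Mapping.keys_add[of S T] by auto
  then show ?thesis
    by (simp add: diff_op_superset[of ?K] lookup_add sum.distrib distrib_right)
qed

lemma diff_op_sum: "diff_op w (\<Sum>i\<in>S. T i) g x = (\<Sum>i\<in>S. diff_op w (T i) g x)"
  by (induction S rule: infinite_finite_induct) (auto simp: diff_op_add)

lemma diff_op_single:
  "diff_op w (Poly_Mapping.single a c) g x = c * multi_deriv w (Poly_Mapping.lookup a) g x"
  by (auto simp: diff_op_def)

lemma diff_op_one [simp]: "diff_op w 1 g x = g x"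
proof -
  have "Poly_Mapping.lookup (0 :: 'a \<Rightarrow>\<^sub>0 nat) = (\<lambda>_. 0)" by auto
  then show ?thesis using diff_op_single[of w 0 1 g x] by (simp add: single_one)
qed

lemma smooth_diff_op:
  fixes f :: "real^'n \<Rightarrow> complex"
  shows "smooth f \<Longrightarrow> smooth (diff_op w T f)"
  unfolding diff_op_def by (intro smooth_sum smooth_cmult smooth_multi_deriv)

lemma diff_op_fun_sum:
  fixes f :: "'a \<Rightarrow> real^'n \<Rightarrow> complex"
  assumes "\<And>i. i \<in> S \<Longrightarrow> smooth (f i)"
  shows "diff_op w T (\<lambda>x. \<Sum>i\<in>S. c i * f i x) x = (\<Sum>i\<in>S. c i * diff_op w T (f i) x)"
proof -
  have "diff_op w T (\<lambda>x. \<Sum>i\<in>S. c i * f i x) x = (\<Sum>a\<in>Poly_Mapping.keys T. \<Sum>i\<in>S.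
           Poly_Mapping.lookup T a * (c i * multi_deriv w (Poly_Mapping.lookup a) (f i) x))"
    unfolding diff_op_def by (subst multi_deriv_fun_sum[OF assms]) (auto simp: sum_distrib_left)
  also have "\<dots> = (\<Sum>i\<in>S. \<Sum>a\<in>Poly_Mapping.keys T.
           Poly_Mapping.lookup T a * (c i * multi_deriv w (Poly_Mapping.lookup a) (f i) x))"
    by (rule sum.swap)
  finally show ?thesis unfolding diff_op_def by (simp add: sum_distrib_left mult_ac)
qed

lemma poly_mapping_expand:
  "T = (\<Sum>a\<in>Poly_Mapping.keys T. Poly_Mapping.single a (Poly_Mapping.lookup T a))"
proof (rule poly_mapping_eqI)
  fix b
  show "Poly_Mapping.lookup T b =
    Poly_Mapping.lookup (\<Sum>a\<in>Poly_Mapping.keys T. Poly_Mapping.single a (Poly_Mapping.lookup T a)) b"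
    by (simp add: lookup_sum lookup_single when_def sum.delta in_keys_iff)
qed

lemma diff_op_mult:
  fixes f :: "real^'n \<Rightarrow> complex"
  assumes f: "smooth f"
  shows "diff_op w (S * T) f x = diff_op w S (diff_op w T f) x"
proof -
  let ?KS = "Poly_Mapping.keys S" and ?KT = "Poly_Mapping.keys T"
  let ?m = "\<lambda>a. multi_deriv w (Poly_Mapping.lookup a)"
  have lk: "Poly_Mapping.lookup (a + b) = (\<lambda>j. Poly_Mapping.lookup a j + Poly_Mapping.lookup b j)"
    for a b :: "'b \<Rightarrow>\<^sub>0 nat" by (auto simp: lookup_add)
  have "S * T = (\<Sum>a\<in>?KS. \<Sum>b\<in>?KT. Poly_Mapping.single (a + b)
                    (Poly_Mapping.lookup S a * Poly_Mapping.lookup T b))"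
    by (subst poly_mapping_expand[of S], subst poly_mapping_expand[of T])
       (simp add: sum_product mult_single)
  then have "diff_op w (S * T) f x = (\<Sum>a\<in>?KS. \<Sum>b\<in>?KT. Poly_Mapping.lookup S a *
               (Poly_Mapping.lookup T b * ?m a (?m b f) x))"
    by (simp add: diff_op_sum diff_op_single lk multi_deriv_add[OF f] mult_ac)
  also have "\<dots> = (\<Sum>a\<in>?KS. Poly_Mapping.lookup S a *
       ?m a (\<lambda>x. \<Sum>b\<in>?KT. Poly_Mapping.lookup T b * ?m b f x) x)"
    by (subst multi_deriv_fun_sum) (auto simp: sum_distrib_left smooth_multi_deriv f)
  also have "(\<lambda>x. \<Sum>b\<in>?KT. Poly_Mapping.lookup T b * ?m b f x) = diff_op w T f"
    by (rule ext) (simp add: diff_op_def)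
  also have "(\<Sum>a\<in>?KS. Poly_Mapping.lookup S a * ?m a (diff_op w T f) x) = diff_op w S (diff_op w T f) x"
    by (simp only: diff_op_def[of w S])
  finally show ?thesis .
qed

lemma diff_op_in_var:
  "diff_op w (in_var j p) g x = (\<Sum>i\<le>degree p. coeff p i * (dir_deriv (w j) ^^ i) g x)"
proof -
  have "Poly_Mapping.lookup (Poly_Mapping.single j m) = (\<lambda>i. if i = j then m else 0)" for m :: nat
    by (auto simp: lookup_single when_def)
  then show ?thesis by (simp add: in_var_def diff_op_sum diff_op_single multi_deriv_single)
qed

text \<open>A directional derivative at a point of an open set depends only on the values on that set, and the derivatives agree there again.\<close>

lemma diff_op_local:
  assumes "open U" "\<And>x. x \<in> U \<Longrightarrow> f x = g x" "x \<in> U"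
  shows "diff_op w T f x = diff_op w T g x"
proof -
  have one: "dir_deriv v F y = dir_deriv v G y"
    if eq: "\<And>x. x \<in> U \<Longrightarrow> F x = G x" and y: "y \<in> U" for v y and F G :: "'a \<Rightarrow> complex"
  proof -
    have "((\<lambda>t. y + t *\<^sub>R v) \<longlongrightarrow> y + 0 *\<^sub>R v) (nhds (0::real))"
      by (intro tendsto_intros filterlim_ident)
    then have "\<forall>\<^sub>F t in nhds (0::real). y + t *\<^sub>R v \<in> U"
      using topological_tendstoD[OF _ assms(1), of "\<lambda>t. y + t *\<^sub>R v" y] y by simp
    then have ev: "\<forall>\<^sub>F t in nhds (0::real). F (y + t *\<^sub>R v) = G (y + t *\<^sub>R v)"
      by eventually_elim (rule eq)
    show ?thesis unfolding dir_deriv_def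
      by (rule vector_derivative_cong_eq) (use ev y eq in auto)
  qed
  have pow: "(dir_deriv v ^^ m) F y = (dir_deriv v ^^ m) G y"
    if eq: "\<And>x. x \<in> U \<Longrightarrow> F x = G x" and y: "y \<in> U" for v y m and F G :: "'a \<Rightarrow> complex"
    using y
  proof (induction m arbitrary: y)
    case (Suc m)
    show ?case unfolding funpow.simps o_def by (rule one) (use Suc in auto)
  qed (simp add: eq)
  have "foldr (\<lambda>j. dir_deriv (w j) ^^ a j) l f y = foldr (\<lambda>j. dir_deriv (w j) ^^ a j) l g y"
    if "y \<in> U" for a l y
    using that
  proof (induction l arbitrary: y)
    case (Cons j l)
    show ?case unfolding foldr.simps o_def by (rule pow) (use Cons in auto)
  qed (simp add: assms(2))
  then show ?thesis using assms(3) by (simp add: diff_op_def multi_deriv_def)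
qed

section \<open>The periodic functions and the polynomials of the one-dimensional formula\<close>

text \<open>All \<open>Q_{m,z}\<close> come from one generating function: on \<open>[n, n+1)\<close>, \<open>Q_{m,z}(x)\<close> is \<open>z^n\<close> times
  the coefficient of \<open>S^m\<close> in \<open>W(S) e^{(x-n) S}\<close>, where \<open>W(S) (e^S - z) = z S\<close>.
  At \<open>z = 1\<close> numerator and denominator of \<open>W\<close> both vanish at 0, which is why this case is defined apart.\<close>

definition twist_series :: "complex \<Rightarrow> complex fps" where
  "twist_series z =
     (if z = 1 then Abs_fps (\<lambda>i. of_real (fps_nth (fps_X / (fps_exp 1 - 1)) i))
      else fps_X * fps_const z * inverse (fps_exp 1 - fps_const z))"

definition twist_poly :: "complex \<Rightarrow> nat \<Rightarrow> real \<Rightarrow> complex" where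
  "twist_poly z m x = fps_nth (twist_series z * fps_exp (of_real x)) m"

definition twist_fun :: "complex \<Rightarrow> nat \<Rightarrow> real \<Rightarrow> complex" where
  "twist_fun z m x = z powi \<lfloor>x\<rfloor> * twist_poly z m (frac x)"

lemma fps_exp_1_minus_1: "(fps_exp (1::real) - 1) \<noteq> 0" "subdegree (fps_exp (1::real) - 1) = 1"
proof -
  have 1: "fps_nth (fps_exp (1::real) - 1) 1 \<noteq> 0" by simp
  then show "(fps_exp (1::real) - 1) \<noteq> 0" by (metis fps_zero_nth)
  show "subdegree (fps_exp (1::real) - 1) = 1" by (rule subdegreeI[OF 1]) auto
qed

lemma bernoulli_series: "fps_X / (fps_exp (1::real) - 1) * (fps_exp 1 - 1) = fps_X"
  using fps_exp_1_minus_1 by (intro fps_times_divide_eq) auto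

lemma twist_series_eq: "twist_series z * (fps_exp 1 - fps_const z) = fps_const z * fps_X"
proof (cases "z = 1")
  case True
  let ?E = "fps_X / (fps_exp (1::real) - 1)"
  have "fps_nth (twist_series z * (fps_exp 1 - fps_const z)) n = of_real (fps_nth (?E * (fps_exp 1 - 1)) n)" for n
    by (auto simp: True twist_series_def fps_mult_nth intro!: sum.cong)
  then show ?thesis unfolding bernoulli_series
    by (intro fps_ext) (simp add: True fps_X_def)
next
  case False
  then have "fps_nth (fps_exp 1 - fps_const z) 0 \<noteq> 0" by simp
  then have "inverse (fps_exp 1 - fps_const z) * (fps_exp 1 - fps_const z) = 1"
    by (rule inverse_mult_eq_1)
  then show ?thesis using False by (simp add: twist_series_def mult.assoc)
qed

lemma twist_series_nth_0: "fps_nth (twist_series z) 0 = (if z = 1 then 1 else 0)"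
proof (cases "z = 1")
  case True
  have "fps_nth (twist_series z * (fps_exp 1 - fps_const z)) 1 = fps_nth (fps_const z * fps_X) 1"
    by (simp only: twist_series_eq)
  then show ?thesis using True by (simp add: fps_mult_nth)
next
  case False
  then show ?thesis by (simp add: twist_series_def)
qed

lemma twist_series_nth_1: "fps_nth (twist_series z) 1 = (if z = 1 then - 1/2 else z / (1 - z))"
proof (cases "z = 1")
  case True
  have "fps_nth (twist_series z * (fps_exp 1 - fps_const z)) 2 = fps_nth (fps_const z * fps_X) 2"
    by (simp only: twist_series_eq)
  then have "1 / 2 + fps_nth (twist_series z) 1 = 0" using True
    by (simp add: fps_mult_nth numeral_2_eq_2 twist_series_nth_0)
  then show ?thesis using True by (simp add: add_eq_0_iff)
next
  case False
  have "fps_nth (twist_series z * (fps_exp 1 - fps_const z)) 1 = fps_nth (fps_const z * fps_X) 1"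
    by (simp only: twist_series_eq)
  then show ?thesis using False by (simp add: fps_mult_nth twist_series_nth_0 field_simps)
qed

lemma twist_poly_expand:
  "twist_poly z m x = (\<Sum>i\<le>m. fps_nth (twist_series z) i * (of_real x ^ (m - i) / fact (m - i)))"
  by (simp add: twist_poly_def fps_mult_nth atLeast0AtMost)

lemma twist_poly_0: "twist_poly z m 0 = fps_nth (twist_series z) m"
  by (simp add: twist_poly_def)

text \<open>By \<open>W(S) e^S = z W(S) + z S\<close>, the pieces on neighbouring unit intervals fit together, except for a jump at \<open>m = 1\<close>.\<close>

lemma twist_poly_1: "twist_poly z m 1 = z * twist_poly z m 0 + (if m = 1 then z else 0)"
proof -
  have "twist_poly z m 1 - z * twist_poly z m 0 = fps_nth (twist_series z * (fps_exp 1 - fps_const z)) m"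
    by (simp add: twist_poly_def right_diff_distrib fps_mult_right_const_nth mult.commute[of z])
  then have "twist_poly z m 1 - z * twist_poly z m 0 = (if m = 1 then z else 0)"
    by (simp add: twist_series_eq)
  then show ?thesis by (metis add.commute diff_add_cancel)
qed

lemma twist_poly_has_vector_derivative:
  "(twist_poly z (Suc m) has_vector_derivative twist_poly z m x) (at x within S)"
proof -
  have mono: "((\<lambda>x. of_real x ^ Suc n / fact (Suc n) :: complex) has_vector_derivative (of_real x ^ n / fact n))
      (at x within S)" for n
  proof -
    have nz: "(1 + of_nat n :: complex) \<noteq> 0" by (metis of_nat_Suc of_nat_0_eq_iff nat.distinct(2))
    have "((\<lambda>x. x ^ Suc n / fact (Suc n) :: complex) has_field_derivative
        (of_nat (Suc n) * of_real x ^ n / fact (Suc n))) (at (of_real x))"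
      by (intro DERIV_cdivide) (rule derivative_eq_intros refl | simp)+
    moreover have "of_nat (Suc n) * of_real x ^ n / fact (Suc n) = (of_real x ^ n / fact n :: complex)"
      using nz by (simp add: fact_Suc del: of_nat_Suc)
    ultimately have "((\<lambda>x. x ^ Suc n / fact (Suc n) :: complex) has_field_derivative (of_real x ^ n / fact n))
        (at (of_real x))" by simp
    then show ?thesis
      using has_vector_derivative_real_field by blast
  qed
  have "((\<lambda>x. (\<Sum>i\<le>m. fps_nth (twist_series z) i * (of_real x ^ Suc (m - i) / fact (Suc (m - i)))) +
           fps_nth (twist_series z) (Suc m)) has_vector_derivative
        (\<Sum>i\<le>m. fps_nth (twist_series z) i * (of_real x ^ (m - i) / fact (m - i))) + 0) (at x within S)"
    by (intro has_vector_derivative_add has_vector_derivative_sum has_vector_derivative_const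
          has_vector_derivative_mult_right mono)
  moreover have "twist_poly z (Suc m) = (\<lambda>x. (\<Sum>i\<le>m. fps_nth (twist_series z) i *
      (of_real x ^ Suc (m - i) / fact (Suc (m - i)))) + fps_nth (twist_series z) (Suc m))"
    unfolding twist_poly_expand[abs_def] by (auto simp: fun_eq_iff Suc_diff_le)
  ultimately show ?thesis by (simp add: twist_poly_expand)
qed

lemma twist_poly_shift_derivative:
  "((\<lambda>x. twist_poly z (Suc m) (x - c)) has_vector_derivative twist_poly z m (x - c)) (at x within S)"
proof -
  have "((\<lambda>x. x - c) has_vector_derivative 1) (at x within S)"
    by (auto intro!: derivative_eq_intros)
  from vector_diff_chain_within[OF this twist_poly_has_vector_derivative[of z m "x - c"]]
  show ?thesis by (simp add: o_def)
qed

lemma continuous_on_twist_poly: "continuous_on S (twist_poly z m)"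
  unfolding twist_poly_expand[abs_def] by (intro continuous_intros) auto

lemma twist_fun_on_piece:
  assumes "z \<noteq> 0" "m \<noteq> 1" "of_int n \<le> x" "x \<le> of_int n + 1"
  shows "twist_fun z m x = z powi n * twist_poly z m (x - of_int n)"
proof (cases "x < of_int n + 1")
  case True
  then have "\<lfloor>x\<rfloor> = n" using assms by linarith
  then show ?thesis by (simp add: twist_fun_def frac_def)
next
  case False
  then have x: "x = of_int (n + 1)" using assms by simp
  then show ?thesis using assms twist_poly_1[of z m]
    by (simp add: twist_fun_def power_int_add)
qed

lemma twist_fun_on_piece_interior:
  assumes "of_int n \<le> x" "x < of_int n + 1"
  shows "twist_fun z m x = z powi n * twist_poly z m (x - of_int n)"
proof -
  have "\<lfloor>x\<rfloor> = n" using assms by linarith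
  then show ?thesis by (simp add: twist_fun_def frac_def)
qed

text \<open>The periodic functions are given piecewise between consecutive integers; this reduces integrating them to
  one piece.\<close>

lemma has_integral_from_unit_pieces:
  fixes q G :: "real \<Rightarrow> 'b::banach"
  assumes piece: "\<And>n a b. of_int n \<le> a \<Longrightarrow> a \<le> b \<Longrightarrow> b \<le> of_int n + 1 \<Longrightarrow>
            (q has_integral (G b - G a)) {a..b}"
    and "a \<le> b"
  shows "(q has_integral (G b - G a)) {a..b}"
proof -
  have "\<forall>b. a \<le> b \<longrightarrow> \<lfloor>b\<rfloor> = \<lfloor>a\<rfloor> + int m \<longrightarrow> (q has_integral (G b - G a)) {a..b}" for m
  proof (induction m)
    case 0
    show ?case
    proof (intro allI impI)
      fix b assume "a \<le> b" "\<lfloor>b\<rfloor> = \<lfloor>a\<rfloor> + int 0"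
      then show "(q has_integral (G b - G a)) {a..b}"
        by (intro piece[of "\<lfloor>a\<rfloor>"]) linarith+
    qed
  next
    case (Suc m)
    show ?case
    proof (intro allI impI)
      fix b assume b: "a \<le> b" "\<lfloor>b\<rfloor> = \<lfloor>a\<rfloor> + int (Suc m)"
      define c where "c = max a (of_int (\<lfloor>b\<rfloor> - 1))"
      have c: "a \<le> c" "c \<le> of_int \<lfloor>b\<rfloor>" "\<lfloor>c\<rfloor> = \<lfloor>a\<rfloor> + int m" "of_int (\<lfloor>b\<rfloor> - 1) \<le> c"
        using b by (auto simp: c_def max_def) linarith+
      have "(q has_integral (G c - G a)) {a..c}" using Suc c by blast
      moreover have "(q has_integral (G (of_int \<lfloor>b\<rfloor>) - G c)) {c..of_int \<lfloor>b\<rfloor>}"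
        using c by (intro piece[of "\<lfloor>b\<rfloor> - 1"]) auto
      ultimately have "(q has_integral (G c - G a + (G (of_int \<lfloor>b\<rfloor>) - G c))) {a..of_int \<lfloor>b\<rfloor>}"
        using c by (intro has_integral_combine[of a c]) auto
      moreover have "(q has_integral (G b - G (of_int \<lfloor>b\<rfloor>))) {of_int \<lfloor>b\<rfloor>..b}"
        by (intro piece[of "\<lfloor>b\<rfloor>"]) linarith+
      ultimately have "(q has_integral (G c - G a + (G (of_int \<lfloor>b\<rfloor>) - G c) + (G b - G (of_int \<lfloor>b\<rfloor>)))) {a..b}"
        using c by - (rule has_integral_combine[of a "of_int \<lfloor>b\<rfloor>" b], linarith, linarith, assumption+)
      then show "(q has_integral (G b - G a)) {a..b}" by simp
    qed
  qed
  moreover have "\<lfloor>b\<rfloor> = \<lfloor>a\<rfloor> + int (nat (\<lfloor>b\<rfloor> - \<lfloor>a\<rfloor>))"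
    using \<open>a \<le> b\<close> by (simp add: floor_mono)
  ultimately show ?thesis using \<open>a \<le> b\<close> by blast
qed

lemma twist_fun_has_integral:
  assumes z: "z \<noteq> 0" and m: "m \<ge> 1" and ab: "a \<le> b"
  shows "(twist_fun z m has_integral (twist_fun z (Suc m) b - twist_fun z (Suc m) a)) {a..b}"
proof (rule has_integral_from_unit_pieces[OF _ ab])
  fix n :: int and a b :: real assume ab: "of_int n \<le> a" "a \<le> b" "b \<le> of_int n + 1"
  have "((\<lambda>x. twist_poly z (Suc m) (x - of_int n)) has_vector_derivative twist_poly z m (x - of_int n))
           (at x within {a..b})" for x
    by (rule twist_poly_shift_derivative)
  then have "((\<lambda>x. z powi n * twist_poly z (Suc m) (x - of_int n)) has_vector_derivative
        z powi n * twist_poly z m (x - of_int n)) (at x within {a..b})" for x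
    by (intro has_vector_derivative_mult_right)
  then have "((\<lambda>x. z powi n * twist_poly z m (x - of_int n)) has_integral
     (z powi n * twist_poly z (Suc m) (b - of_int n) - z powi n * twist_poly z (Suc m) (a - of_int n))) {a..b}"
    using ab by (intro fundamental_theorem_of_calculus) auto
  then have "(twist_fun z m has_integral
     (z powi n * twist_poly z (Suc m) (b - of_int n) - z powi n * twist_poly z (Suc m) (a - of_int n))) {a..b}"
    by (rule has_integral_spike_finite[of "{of_int n + 1}", rotated 2])
       (use ab in \<open>auto simp: twist_fun_on_piece_interior\<close>)
  then show "(twist_fun z m has_integral (twist_fun z (Suc m) b - twist_fun z (Suc m) a)) {a..b}"
    using ab z m by (simp add: twist_fun_on_piece[where n=n])
qed

lemma norm_root_of_unity:
  assumes "(z::complex) ^ N = 1" "N > 0"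
  shows "norm z = 1"
  using power_eq_1_iff[OF assms(1)] assms(2) by simp

lemma root_order_props:
  assumes "(z::complex) ^ N = 1" "N > 0"
  shows "root_order z > 0" "z ^ root_order z = 1"
  using LeastI[of "\<lambda>m. 0 < m \<and> z ^ m = 1" N] assms by (auto simp: root_order_def)

text \<open>Two antiderivatives differ by a constant, and the constant is fixed by the mean, so the defining conditions of
  \<open>Q_{m+1,z}\<close> have at most one solution.  The explicit function solves them: its mean over a period is an
  increment over a period of the next function in the sequence, which is periodic.\<close>

lemma Q_root_eq_twist_fun:
  assumes z: "z ^ N = 1" "N > 0" and "z \<noteq> 1"
  shows "Q_root z (Suc m) = twist_fun z (Suc m)"
proof (induction m)
  case 0
  have "twist_poly z (Suc 0) x = z / (1 - z)" for x
    using twist_series_nth_0[of z] twist_series_nth_1[of z] \<open>z \<noteq> 1\<close>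
    by (simp add: twist_poly_expand atMost_Suc)
  then show ?case by (auto simp: twist_fun_def)
next
  case (Suc m)
  note R = root_order_props[OF z]
  let ?R = "real (root_order z)"
  have z0: "z \<noteq> 0" using z by (auto simp: power_0_left)
  have per: "twist_fun z i (x + ?R) = twist_fun z i x" for i x
  proof -
    have "\<lfloor>x + ?R\<rfloor> = \<lfloor>x\<rfloor> + int (root_order z)" by linarith
    moreover have "frac (x + ?R) = frac x" by (simp add: frac_def)
    ultimately show ?thesis using R z0 by (simp add: twist_fun_def power_int_add)
  qed
  have mean: "(twist_fun z (Suc (Suc m)) has_integral 0) {0..?R}"
    using twist_fun_has_integral[OF z0, of "Suc (Suc m)" 0 ?R] per[of _ 0] by simp
  show ?case unfolding Q_root.simps Suc
  proof (rule the_equality, intro conjI allI impI)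
    show "twist_fun z (Suc (Suc m)) (x + ?R) = twist_fun z (Suc (Suc m)) x" for x by (rule per)
    show "(twist_fun z (Suc (Suc m)) has_integral 0) {0..?R}" by (rule mean)
    show "(twist_fun z (Suc m) has_integral twist_fun z (Suc (Suc m)) b - twist_fun z (Suc (Suc m)) a) {a..b}"
      if "a \<le> b" for a b using twist_fun_has_integral[OF z0 _ that, of "Suc m"] by simp
  next
    fix g assume g: "(\<forall>x. g (x + ?R) = g x) \<and>
       (\<forall>a b. a \<le> b \<longrightarrow> (twist_fun z (Suc m) has_integral g b - g a) {a..b}) \<and> (g has_integral 0) {0..?R}"
    let ?c = "g 0 - twist_fun z (Suc (Suc m)) 0"
    have diff: "g x = twist_fun z (Suc (Suc m)) x + ?c" for x
    proof -
      have "g (max x 0) - g (min x 0) = twist_fun z (Suc (Suc m)) (max x 0) - twist_fun z (Suc (Suc m)) (min x 0)"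
        using g twist_fun_has_integral[OF z0, of "Suc m" "min x 0" "max x 0"]
        by (intro has_integral_unique[of "twist_fun z (Suc m)" _ "{min x 0..max x 0}"]) auto
      then show ?thesis by (auto simp: max_def min_def algebra_simps split: if_splits)
    qed
    have "((\<lambda>x. twist_fun z (Suc (Suc m)) x + ?c) has_integral (0 + ?R *\<^sub>R ?c)) {0..?R}"
      using has_integral_const_real[of ?c 0 ?R] by (intro has_integral_add mean) auto
    moreover have "((\<lambda>x. twist_fun z (Suc (Suc m)) x + ?c) has_integral 0) {0..?R}"
      using g diff by (metis (no_types, lifting) ext)
    ultimately have "0 + ?R *\<^sub>R ?c = 0" by (rule has_integral_unique)
    then have c0: "?c = 0" using R(1) by simp
    show "g = twist_fun z (Suc (Suc m))"
    proof
      show "g x = twist_fun z (Suc (Suc m)) x" for x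
        using diff[of x] unfolding c0 by simp
    qed
  qed
qed

lemma twist_series_of_real:
  "twist_poly 1 m x = of_real (bernoulli_poly m x / fact m)"
proof -
  have "fps_X * fps_exp x / (fps_exp 1 - 1) = fps_X / (fps_exp 1 - 1) * fps_exp x"
    using fps_exp_1_minus_1 by (metis dvd_div_mult dvdI bernoulli_series mult.commute)
  then show ?thesis
    by (simp add: bernoulli_poly_def twist_poly_def twist_series_def fps_mult_nth)
qed

lemma Q_fun_eq_twist_fun:
  assumes "z ^ N = 1" "N > 0" "m \<ge> 1"
  shows "Q_fun m z = twist_fun z m"
proof (cases "z = 1")
  case True
  then show ?thesis by (auto simp: Q_fun_def twist_fun_def twist_series_of_real)
next
  case False
  then show ?thesis using Q_root_eq_twist_fun[OF assms(1,2) False, of "m - 1"] assms(3)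
    by (auto simp: Q_fun_def fun_eq_iff)
qed

lemma borel_measurable_twist_fun [measurable]: "twist_fun z m \<in> borel_measurable borel"
proof -
  have "(\<lambda>x::real. z powi \<lfloor>x\<rfloor>) \<in> borel_measurable borel"
    by (rule measurable_compose[OF measurable_real_floor]) simp
  moreover have "(\<lambda>x::real. twist_poly z m (frac x)) \<in> borel_measurable borel"
    unfolding frac_def
    by (rule measurable_compose[OF _ borel_measurable_continuous_onI[OF continuous_on_twist_poly]]) measurable
  ultimately show ?thesis unfolding twist_fun_def[abs_def] by measurable
qed

lemma twist_fun_bounded:
  assumes "norm z = 1"
  shows "\<exists>B. \<forall>x. norm (twist_fun z m x) \<le> B"
proof -
  have "compact (twist_poly z m ` {0..1})"
    by (intro compact_continuous_image continuous_on_twist_poly) auto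
  then obtain B where B: "\<forall>y\<in>twist_poly z m ` {0..1}. norm y \<le> B"
    using compact_imp_bounded bounded_iff by metis
  have "norm (twist_fun z m x) \<le> B" for x
  proof -
    have "frac x \<in> {0..1}" using frac_lt_1[of x] by auto
    then show ?thesis using B assms by (auto simp: twist_fun_def norm_mult norm_power_int)
  qed
  then show ?thesis by blast
qed

text \<open>The coefficients of \<open>\<^bold>M\<close> are those of \<open>W(S) + S/2\<close>, truncated.\<close>

definition todd_series :: "complex \<Rightarrow> complex fps" where
  "todd_series z = twist_series z + fps_const (1/2) * fps_X"

lemma todd_series_eq:
  "todd_series z * (fps_exp 1 - fps_const z) = fps_const (1/2) * fps_X * (fps_exp 1 + fps_const z)"
proof -
  have "todd_series z * (fps_exp 1 - fps_const z) =
     fps_const z * fps_X + fps_const (1/2) * fps_X * (fps_exp 1 - fps_const z)"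
    by (simp add: todd_series_def distrib_right twist_series_eq)
  also have "\<dots> = fps_const (1/2) * fps_X * (fps_exp 1 + fps_const z)"
  proof -
    have half: "fps_const (1/2) + fps_const (1/2) = (1 :: complex fps)"
      by (simp only: fps_const_add) simp
    have "c * X * (E + Z) = (c + c) * Z * X + c * X * (E - Z)" for c X E Z :: "complex fps"
      by (simp add: algebra_simps)
    from this[of "fps_const (1/2)", unfolded half] show ?thesis by simp
  qed
  finally show ?thesis .
qed

lemma fps_neg_nth_0: "fps_nth (- fps_X :: complex fps) 0 = 0"
  by simp

text \<open>Substituting \<open>-S\<close> in the functional equation and multiplying by \<open>- e^S / z\<close> gives the functional equation for
  \<open>1/z\<close>, which has only one solution.\<close>

lemma todd_series_inverse:
  assumes "z \<noteq> 0"
  shows "fps_nth (todd_series (inverse z)) i = (-1) ^ i * fps_nth (todd_series z) i"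
proof -
  define V where "V = todd_series z oo - fps_X"
  have c: "fps_const (inverse z) * fps_const z = 1" using assms by (simp flip: fps_const_mult)
  have e: "fps_exp (- 1) * fps_exp (1::complex) = 1" by (simp flip: fps_exp_add_mult)
  have "V * (fps_exp (-1) - fps_const z) = - (fps_const (1/2) * fps_X) * (fps_exp (-1) + fps_const z)"
  proof -
    have X: "fps_exp 1 oo - fps_X = fps_exp (-1 :: complex)"
      using fps_exp_compose_linear[of "1::complex" "-1"] by (simp flip: fps_const_neg)
    have "(todd_series z * (fps_exp 1 - fps_const z)) oo - fps_X = V * (fps_exp (-1) - fps_const z)"
      by (simp only: V_def fps_compose_mult_distrib[OF fps_neg_nth_0] fps_compose_sub_distrib X fps_const_compose)
    moreover have "(fps_const (1/2) * fps_X * (fps_exp 1 + fps_const z)) oo - fps_X =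
        fps_const (1/2) * (- fps_X) * (fps_exp (-1) + fps_const z)"
      by (simp only: V_def fps_compose_mult_distrib[OF fps_neg_nth_0] fps_compose_add_distrib X fps_const_compose)
         (simp only: fps_X_fps_compose_startby0[OF fps_neg_nth_0])
    ultimately show ?thesis unfolding todd_series_eq by simp
  qed
  then have "V * (fps_exp (-1) - fps_const z) * (- fps_exp 1 * fps_const (inverse z)) =
     - (fps_const (1/2) * fps_X) * (fps_exp (-1) + fps_const z) * (- fps_exp 1 * fps_const (inverse z))"
    by simp
  then have "V * (fps_exp 1 * (fps_const (inverse z) * fps_const z) - fps_exp (-1) * fps_exp 1 * fps_const (inverse z)) =
     fps_const (1/2) * fps_X * (fps_exp 1 * (fps_const (inverse z) * fps_const z) + fps_exp (-1) * fps_exp 1 * fps_const (inverse z))"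
    by (simp add: algebra_simps)
  then have "V * (fps_exp 1 - fps_const (inverse z)) = fps_const (1/2) * fps_X * (fps_exp 1 + fps_const (inverse z))"
    by (simp only: c e) simp
  then have eq: "V * (fps_exp 1 - fps_const (inverse z)) = todd_series (inverse z) * (fps_exp 1 - fps_const (inverse z))"
    by (simp only: todd_series_eq)
  have "fps_nth (fps_exp 1 - fps_const (inverse z)) 1 \<noteq> 0" by simp
  then have "fps_exp 1 - fps_const (inverse z) \<noteq> 0" by (metis fps_zero_nth)
  with eq have "V = todd_series (inverse z)" by simp
  moreover have "fps_nth V i = (-1) ^ i * fps_nth (todd_series z) i"
    by (simp add: V_def fps_compose_uminus')
  ultimately show ?thesis by simp
qed

text \<open>Multiplying numerator and denominator of \<open>(S/2) / tanh (S/2)\<close> by \<open>e^{S/2}\<close> gives \<open>(S/2) (e^S + 1) / (e^S - 1)\<close>.\<close>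

lemma L_series_eq: "fps_nth (todd_series 1) i = of_real (fps_nth L_series i)"
proof -
  define A where "A = fps_exp (1/2::real) - fps_exp (-(1/2))"
  define B where "B = fps_exp (1/2::real) + fps_exp (-(1/2))"
  have B0: "fps_nth B 0 \<noteq> 0" by (simp add: B_def)
  have AB: "A / B * B = A" using B0 by (intro fps_times_divide_eq) (auto simp: subdegree_eq_0)
  have A1: "fps_nth A 1 \<noteq> 0" "fps_nth A 0 = 0" by (simp_all add: A_def)
  have "subdegree A = 1" by (rule subdegreeI) (use A1 in auto)
  moreover have "subdegree (A / B * B) = subdegree (A / B) + subdegree B"
  proof (intro subdegree_mult)
    show "A / B \<noteq> 0"
    proof
      assume "A / B = 0"
      then have "A = 0" using AB by simp
      then show False using A1 by simp
    qed
    show "B \<noteq> 0" using B0 by auto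
  qed
  ultimately have sd: "subdegree (A / B) = 1" using AB B0 subdegree_eq_0[OF B0] by simp
  then have AB0: "A / B \<noteq> 0" by auto
  have "L_series * (A / B) = fps_const (1/2) * fps_X"
    unfolding L_series_def A_def[symmetric] B_def[symmetric]
    by (intro fps_times_divide_eq) (use sd AB0 in auto)
  then have "L_series * (A / B * B) = fps_const (1/2) * fps_X * B" by (metis mult.assoc)
  then have "L_series * A * fps_exp (1/2) = fps_const (1/2) * fps_X * B * fps_exp (1/2)" by (simp add: AB)
  moreover have "A * fps_exp (1/2) = fps_exp 1 - 1" "B * fps_exp (1/2) = fps_exp 1 + 1"
    by (simp_all add: A_def B_def left_diff_distrib distrib_right flip: fps_exp_add_mult)
  ultimately have L: "L_series * (fps_exp 1 - 1) = fps_const (1/2) * fps_X * (fps_exp 1 + 1)"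
    by (simp add: mult.assoc)
  define C where "C = Abs_fps (\<lambda>i. complex_of_real (fps_nth L_series i))"
  have "fps_nth (C * (fps_exp 1 - 1)) n = of_real (fps_nth (L_series * (fps_exp 1 - 1)) n)" for n
    by (auto simp: C_def fps_mult_nth intro!: sum.cong)
  then have "fps_nth (C * (fps_exp 1 - 1)) n = fps_nth (fps_const (1/2) * fps_X * (fps_exp 1 + 1)) n" for n
    unfolding L by (simp add: mult.assoc fps_mult_left_const_nth)
  then have "C * (fps_exp 1 - fps_const 1) = todd_series 1 * (fps_exp 1 - fps_const 1)"
    unfolding todd_series_eq by (intro fps_ext) simp
  moreover have "fps_nth (fps_exp 1 - fps_const (1::complex)) 1 \<noteq> 0" by simp
  then have "fps_exp 1 - fps_const (1::complex) \<noteq> 0" by (metis fps_zero_nth)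
  ultimately have "C = todd_series 1" by simp
  then show ?thesis by (metis C_def fps_nth_Abs_fps)
qed

text \<open>For \<open>z = 1\<close> the odd coefficients vanish, so truncating at \<open>2\<lfloor>k/2\<rfloor>\<close> and at \<open>k\<close> is the same.\<close>

lemma coeff_M_poly:
  assumes z: "z ^ N = 1" "N > 0" and k: "k \<ge> 1"
  shows "coeff (M_poly k z) i = (if i \<le> k then fps_nth (todd_series z) i else 0)"
proof (cases "z = 1")
  case True
  have "coeff (M_poly k z) i = (if i \<le> 2 * (k div 2) then fps_nth (todd_series z) i else 0)"
    by (simp add: M_poly_def True coeff_sum L_series_eq)
  moreover have "fps_nth (todd_series z) i = 0" if "odd i"
  proof -
    have "fps_nth (todd_series 1) i = - fps_nth (todd_series 1) i"
      using todd_series_inverse[of 1 i] that by simp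
    then show ?thesis using True by (simp add: eq_neg_iff_add_eq_0)
  qed
  moreover have "i \<le> k \<and> \<not> i \<le> 2 * (k div 2) \<Longrightarrow> odd i"
    by (metis dvd_div_mult_self dvd_mult_div_cancel even_two_times_div_two le_antisym nat_le_linear not_less_eq_eq odd_two_times_div_two_succ Suc_eq_plus1)
  moreover have "2 * (k div 2) \<le> k" by simp
  ultimately show ?thesis by auto
next
  case False
  have z0: "z \<noteq> 0" using z by (auto simp: power_0_left)
  have "Q_fun i z 0 = fps_nth (todd_series z) i" if "i \<ge> 2" for i
    using that Q_fun_eq_twist_fun[OF z, of i]
    by (simp add: twist_fun_def twist_poly_0 todd_series_def fps_X_nth)
  then have "coeff (\<Sum>i=2..k. monom (Q_fun i z 0) i) i = (if 2 \<le> i \<and> i \<le> k then fps_nth (todd_series z) i else 0)"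
    by (simp add: coeff_sum)
  moreover have "fps_nth (todd_series z) 0 = 0" "fps_nth (todd_series z) 1 = 1/2 + z / (1 - z)"
    using False twist_series_nth_0[of z] twist_series_nth_1[of z] by (simp_all add: todd_series_def)
  moreover have "i = 0 \<or> i = 1 \<or> i \<ge> 2" by linarith
  ultimately show ?thesis using False k by (auto simp: M_poly_def)
qed

lemma degree_M_poly: "k \<ge> 1 \<Longrightarrow> degree (M_poly k z) \<le> k"
  by (rule degree_le) (auto simp: M_poly_def coeff_sum)

lemma coeff_M_poly_0: "z \<noteq> 1 \<Longrightarrow> coeff (M_poly k z) 0 = 0"
  by (simp add: M_poly_def coeff_sum)

text \<open>Reversing the direction of an edge is harmless because \<open>\<^bold>M\<^sup>k\<^sup>,\<^sup>z(-S) = \<^bold>M\<^sup>k\<^sup>,\<^sup>1\<^sup>/\<^sup>z(S)\<close>.\<close>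

lemma coeff_pcompose_uminus: "coeff (pcompose p [:0, -1:]) i = (-1) ^ i * coeff (p :: 'a::comm_ring_1 poly) i"
proof (induction p arbitrary: i)
  case (pCons a p)
  then show ?case by (cases i) (simp_all add: pcompose_pCons)
qed simp

lemma M_poly_inverse:
  assumes "z ^ N = 1" "N > 0" "k \<ge> 1"
  shows "M_poly k (inverse z) = pcompose (M_poly k z) [:0, -1:]"
proof (rule poly_eqI)
  have "z \<noteq> 0" "inverse z ^ N = 1" using assms by (auto simp: power_0_left power_inverse)
  then show "coeff (M_poly k (inverse z)) i = coeff (pcompose (M_poly k z) [:0, -1:]) i" for i
    using assms by (simp add: coeff_M_poly[of _ N] coeff_pcompose_uminus todd_series_inverse)
qed

section \<open>The twisted Euler--Maclaurin formula on a half-line\<close>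

definition ray_weight :: "nat \<Rightarrow> complex" where
  "ray_weight m = (if m = 0 then 1/2 else 1)"

lemma twist_piece_by_parts:
  fixes \<phi> \<phi>' :: "real \<Rightarrow> complex"
  assumes d: "\<And>t. (\<phi> has_vector_derivative \<phi>' t) (at t)" and c: "continuous_on UNIV \<phi>'"
  shows "((\<lambda>t. twist_fun z m t * \<phi> t) has_integral
     z ^ n * (twist_poly z (Suc m) 1 * \<phi> (real (Suc n)) - twist_poly z (Suc m) 0 * \<phi> (real n))
       - integral {real n..real (Suc n)} (\<lambda>t. twist_fun z (Suc m) t * \<phi>' t)) {real n..real (Suc n)}"
    and "(\<lambda>t. twist_fun z (Suc m) t * \<phi>' t) integrable_on {real n..real (Suc n)}"
proof -
  let ?I = "{real n..real (Suc n)}"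
  let ?p = "\<lambda>m t. z ^ n * twist_poly z m (t - real n)"
  have eq: "twist_fun z m t = ?p m t" if "t \<in> ?I - {real (Suc n)}" for t m
    using that twist_fun_on_piece_interior[of "int n" t z m] by simp
  have contphi: "continuous_on S \<phi>" for S
    using d by (meson continuous_at_imp_continuous_on has_vector_derivative_continuous)
  have dp: "(?p (Suc m) has_vector_derivative ?p m t) (at t within S)" for m t S
    by (intro has_vector_derivative_mult_right twist_poly_shift_derivative)
  have contp: "continuous_on S (?p m)" for m S
    by (intro continuous_intros continuous_on_compose2[OF continuous_on_twist_poly[of UNIV]]) auto
  have int: "(\<lambda>t. ?p (Suc m) t * \<phi>' t) integrable_on ?I"
    by (intro integrable_continuous_real continuous_intros contp continuous_on_subset[OF c]) auto
  have eqi: "integral ?I (\<lambda>t. twist_fun z (Suc m) t * \<phi>' t) = integral ?I (\<lambda>t. ?p (Suc m) t * \<phi>' t)"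
    by (rule integral_spike[of "{real (Suc n)}"]) (auto simp: eq)
  show "(\<lambda>t. twist_fun z (Suc m) t * \<phi>' t) integrable_on ?I"
    by (rule integrable_spike[OF int, of "{real (Suc n)}"]) (auto simp: eq)
  have "((\<lambda>t. ?p m t * \<phi> t) has_integral
      (?p (Suc m) (real (Suc n)) * \<phi> (real (Suc n)) - ?p (Suc m) (real n) * \<phi> (real n)
       - integral ?I (\<lambda>t. ?p (Suc m) t * \<phi>' t))) ?I"
  proof (rule integration_by_parts[OF bounded_bilinear_mult, of _ _ "?p (Suc m)" \<phi>])
    show "((\<lambda>t. ?p (Suc m) t * \<phi>' t) has_integral
       ?p (Suc m) (real (Suc n)) * \<phi> (real (Suc n)) - ?p (Suc m) (real n) * \<phi> (real n) -
       (?p (Suc m) (real (Suc n)) * \<phi> (real (Suc n)) - ?p (Suc m) (real n) * \<phi> (real n)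
       - integral ?I (\<lambda>t. ?p (Suc m) t * \<phi>' t))) ?I"
      using int by (simp add: integrable_integral)
  qed (use contp contphi d dp in auto)
  then have "((\<lambda>t. twist_fun z m t * \<phi> t) has_integral
      (?p (Suc m) (real (Suc n)) * \<phi> (real (Suc n)) - ?p (Suc m) (real n) * \<phi> (real n)
       - integral ?I (\<lambda>t. ?p (Suc m) t * \<phi>' t))) ?I"
    by (rule has_integral_spike_finite[of "{real (Suc n)}", rotated 2]) (auto simp: eq)
  then show "((\<lambda>t. twist_fun z m t * \<phi> t) has_integral
     z ^ n * (twist_poly z (Suc m) 1 * \<phi> (real (Suc n)) - twist_poly z (Suc m) 0 * \<phi> (real n))
       - integral ?I (\<lambda>t. twist_fun z (Suc m) t * \<phi>' t)) ?I"
    unfolding eqi by (simp add: algebra_simps)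
qed

text \<open>Summed over the unit intervals the boundary terms telescope.  Only for \<open>m = 0\<close> does the jump of the first
  periodic function leave a contribution at every integer.\<close>

lemma twist_by_parts:
  fixes \<phi> \<phi>' :: "real \<Rightarrow> complex"
  assumes d: "\<And>t. (\<phi> has_vector_derivative \<phi>' t) (at t)" and c: "continuous_on UNIV \<phi>'"
  shows "(\<lambda>t. twist_fun z (Suc m) t * \<phi>' t) integrable_on {0..real T} \<and>
     ((\<lambda>t. twist_fun z m t * \<phi> t) has_integral
     fps_nth (twist_series z) (Suc m) * (z ^ T * \<phi> (real T) - \<phi> 0)
       + (if m = 0 then \<Sum>n<T. z ^ Suc n * \<phi> (real (Suc n)) else 0)
       - integral {0..real T} (\<lambda>t. twist_fun z (Suc m) t * \<phi>' t)) {0..real T}"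
proof (induction T)
  case 0
  have "(\<lambda>t. twist_fun z (Suc m) t * \<phi>' t) integrable_on {0}"
    using has_integral_refl(2) by (rule has_integral_integrable)
  then show ?case by (simp add: has_integral_refl)
next
  case (Suc T)
  note P = twist_piece_by_parts[OF d c, of z m T]
  let ?f = "\<lambda>t. twist_fun z (Suc m) t * \<phi>' t"
  have i: "?f integrable_on {0..real (Suc T)}"
    by (rule Henstock_Kurzweil_Integration.integrable_combine[of 0 "real T"]) (use Suc P(2) in auto)
  have "integral {0..real (Suc T)} ?f = integral {0..real T} ?f + integral {real T..real (Suc T)} ?f"
    using i by (intro Henstock_Kurzweil_Integration.integral_combine[symmetric]) auto
  moreover have "((\<lambda>t. twist_fun z m t * \<phi> t) has_integral
     (fps_nth (twist_series z) (Suc m) * (z ^ T * \<phi> (real T) - \<phi> 0)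
       + (if m = 0 then \<Sum>n<T. z ^ Suc n * \<phi> (real (Suc n)) else 0)
       - integral {0..real T} ?f) +
     (z ^ T * (twist_poly z (Suc m) 1 * \<phi> (real (Suc T)) - twist_poly z (Suc m) 0 * \<phi> (real T))
       - integral {real T..real (Suc T)} ?f)) {0..real (Suc T)}"
    using Suc P(1) by (intro has_integral_combine[of 0 "real T"]) auto
  ultimately show ?case using i
    by (simp add: twist_poly_1 twist_poly_0 algebra_simps split del: if_split cong: if_cong)
       (auto simp: algebra_simps)
qed

text \<open>The boundary terms of repeated integration by parts against \<open>Q\<close> are rewritten as integrals, using
  \<open>\<phi>(0) = -\<integral>\<phi>'\<close>; this turns them into the value of the operator \<open>\<^bold>M(-d/dt)\<close>.\<close>

theorem euler_maclaurin_ray: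
  fixes \<phi> :: "nat \<Rightarrow> real \<Rightarrow> complex"
  assumes d: "\<And>i t. (\<phi> i has_vector_derivative \<phi> (Suc i) t) (at t)"
    and van: "\<And>i t. t \<ge> real T \<Longrightarrow> \<phi> i t = 0"
    and z: "z ^ N = 1" "N > 0" and k: "k \<ge> 1"
  shows "(\<Sum>m\<le>T. ray_weight m * z ^ m * \<phi> 0 (real m)) =
     (\<Sum>i\<le>k. coeff (M_poly k z) i * (-1) ^ i * integral {0..real T} (\<phi> i))
      + (-1) ^ (k - 1) * integral {0..real T} (\<lambda>t. Q_fun k z t * \<phi> k t)"
proof -
  define W where "W = fps_nth (twist_series z)"
  define A where "A m = integral {0..real T} (\<lambda>t. twist_fun z m t * \<phi> m t)" for m
  define I where "I m = integral {0..real T} (\<phi> m)" for m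
  have cont: "continuous_on UNIV (\<phi> i)" for i
    using d by (meson continuous_at_imp_continuous_on has_vector_derivative_continuous)
  have I: "\<phi> i 0 = - I (Suc i)" for i
  proof -
    have "(\<phi> (Suc i) has_integral (\<phi> i (real T) - \<phi> i 0)) {0..real T}"
      using d by (intro fundamental_theorem_of_calculus) (auto intro: has_vector_derivative_at_within)
    then show ?thesis by (simp add: I_def van integral_unique)
  qed
  have rec: "A m = W (Suc m) * I (Suc m) + (if m = 0 then \<Sum>n<T. z ^ Suc n * \<phi> 0 (real (Suc n)) else 0) - A (Suc m)" for m
  proof -
    have "((\<lambda>t. twist_fun z m t * \<phi> m t) has_integral
     W (Suc m) * (z ^ T * \<phi> m (real T) - \<phi> m 0)
       + (if m = 0 then \<Sum>n<T. z ^ Suc n * \<phi> m (real (Suc n)) else 0) - A (Suc m)) {0..real T}"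
      unfolding A_def W_def by (rule conjunct2[OF twist_by_parts[OF d cont]])
    then have "A m = W (Suc m) * (z ^ T * \<phi> m (real T) - \<phi> m 0)
       + (if m = 0 then \<Sum>n<T. z ^ Suc n * \<phi> m (real (Suc n)) else 0) - A (Suc m)"
      unfolding A_def[of m] by (rule integral_unique)
    then show ?thesis by (simp add: van I)
  qed
  have A0: "A 0 = W 0 * I 0"
  proof (cases "z = 1")
    case True
    then show ?thesis by (simp add: A_def I_def W_def twist_fun_def twist_poly_expand)
  next
    case False
    then show ?thesis by (simp add: A_def W_def twist_fun_def twist_poly_expand twist_series_nth_0)
  qed
  have S: "(\<Sum>m\<le>T. ray_weight m * z ^ m * \<phi> 0 (real m)) = 1/2 * \<phi> 0 0 + (\<Sum>n<T. z ^ Suc n * \<phi> 0 (real (Suc n)))"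
    by (simp add: ray_weight_def sum.atMost_shift)
  have main: "(\<Sum>m\<le>T. ray_weight m * z ^ m * \<phi> 0 (real m)) =
     (\<Sum>i\<le>Suc k. fps_nth (todd_series z) i * (-1) ^ i * I i) + (-1) ^ k * A (Suc k)" for k
  proof (induction k)
    case 0
    show ?case unfolding S using rec[of 0] A0 I[of 0]
      by (simp add: todd_series_def W_def algebra_simps)
  next
    case (Suc k)
    have "fps_nth (todd_series z) (Suc (Suc k)) = W (Suc (Suc k))"
      by (simp add: todd_series_def W_def)
    then show ?case using Suc rec[of "Suc k"] by (simp add: algebra_simps)
  qed
  obtain k' where k': "k = Suc k'" using k by (cases k) auto
  have "(\<Sum>i\<le>k. coeff (M_poly k z) i * (-1) ^ i * I i) = (\<Sum>i\<le>k. fps_nth (todd_series z) i * (-1) ^ i * I i)"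
    by (intro sum.cong) (auto simp: coeff_M_poly[OF z k])
  then show ?thesis using main[of k'] unfolding k'
    by (simp add: A_def I_def Q_fun_eq_twist_fun[OF z])
qed

section \<open>Vertices and faces of a simple polytope\<close>

locale simple_presentation =
  fixes P :: "(real^'n::finite) set" and u :: "'d::finite \<Rightarrow> real^'n" and \<mu> :: "'d \<Rightarrow> real"
  assumes simple: "simple_polytope P" and presentation: "facet_presentation P u \<mu>"
begin

definition slack :: "'d \<Rightarrow> real^'n \<Rightarrow> real" where
  "slack i x = u i \<bullet> x + \<mu> i"

abbreviation tight :: "real^'n \<Rightarrow> 'd set" where
  "tight x \<equiv> facet_idx u \<mu> {x}"

lemma tight_iff: "i \<in> tight x \<longleftrightarrow> slack i x = 0"
  by (simp add: facet_idx_def slack_def)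

lemma slack_add: "slack i (x + y) = slack i x + u i \<bullet> y"
  by (simp add: slack_def inner_add_right)

lemma slack_diff: "slack i y - slack i x = u i \<bullet> (y - x)"
  by (simp add: slack_def inner_diff_right)

lemma mem_P_iff: "x \<in> P \<longleftrightarrow> (\<forall>i. slack i x \<ge> 0)"
proof -
  have "P = (\<Inter>i. {x. u i \<bullet> x + \<mu> i \<ge> 0})"
    using presentation unfolding facet_presentation_def by (rule conjunct1)
  then show ?thesis unfolding slack_def by (metis (mono_tags, lifting) INT_iff UNIV_I mem_Collect_eq)
qed

lemma u_nonzero: "u i \<noteq> 0" and u_int: "u i \<in> int_lattice"
  using presentation by (auto simp: facet_presentation_def primitive_vec_def)

lemma facets_bij: "bij_betw (\<lambda>i. P \<inter> {x. slack i x = 0}) UNIV {G. G facet_of P}"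
  using presentation unfolding facet_presentation_def slack_def by blast

lemma polytope_P: "polytope P" and aff_dim_P: "aff_dim P = int CARD('n)"
  using simple by (auto simp: simple_polytope_def)

lemma compact_P: "compact P" and convex_P: "convex P" and bounded_P: "bounded P"
  and polyhedron_P: "polyhedron P"
  using polytope_P by (auto intro: polytope_imp_compact polytope_imp_convex polytope_imp_bounded
      polytope_imp_polyhedron)

lemma finite_vertices: "finite (vertices P)"
  unfolding vertices_def by (rule finite_polyhedron_extreme_points[OF polyhedron_P])

lemma vertex_in_P: "v \<in> vertices P \<Longrightarrow> v \<in> P"
  by (simp add: vertices_def extreme_point_of_def)

lemma affine_hull_P: "affine hull P = UNIV"
  using aff_dim_P by (simp add: aff_dim_eq_full[symmetric])

lemma interior_P_nonempty: "interior P \<noteq> {}"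
  using rel_interior_interior[OF affine_hull_P] rel_interior_eq_empty[OF convex_P] affine_hull_P
  by auto

text \<open>Inequalities that are strict at \<open>x\<close> remain strict for a while, so only the tight ones restrict the directions
  in which one can move inside \<open>P\<close>.\<close>

lemma small_move:
  assumes "x \<in> P" "\<And>i. i \<in> tight x \<Longrightarrow> u i \<bullet> w \<ge> 0"
  shows "\<exists>e>0. \<forall>t. 0 \<le> t \<and> t \<le> e \<longrightarrow> x + t *\<^sub>R w \<in> P \<and> (\<forall>i. i \<notin> tight x \<longrightarrow> slack i (x + t *\<^sub>R w) > 0)"
proof -
  have "\<forall>i\<in>-tight x. \<forall>\<^sub>F t in at_right (0::real). slack i (x + t *\<^sub>R w) > 0"
  proof
    fix i assume "i \<in> - tight x"
    then have "slack i x > 0" using assms(1) by (auto simp: mem_P_iff tight_iff less_le)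
    moreover have "((\<lambda>t. slack i (x + t *\<^sub>R w)) \<longlongrightarrow> slack i (x + 0 *\<^sub>R w)) (at_right 0)"
      unfolding slack_def by (intro tendsto_intros)
    ultimately show "\<forall>\<^sub>F t in at_right (0::real). slack i (x + t *\<^sub>R w) > 0"
      by (intro order_tendstoD(1)) auto
  qed
  then have "\<forall>\<^sub>F t in at_right (0::real). \<forall>i\<in>-tight x. slack i (x + t *\<^sub>R w) > 0"
    by (intro eventually_ball_finite) auto
  then obtain b where b: "b > 0" "\<And>t. 0 < t \<Longrightarrow> t < b \<Longrightarrow> \<forall>i\<in>-tight x. slack i (x + t *\<^sub>R w) > 0"
    unfolding eventually_at_right[OF zero_less_one] by blast
  have pos: "slack i (x + t *\<^sub>R w) > 0" if "0 \<le> t" "t \<le> b / 2" "i \<notin> tight x" for t i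
    using b(2)[of t] b(1) that assms(1) by (cases "t = 0") (auto simp: mem_P_iff tight_iff less_le)
  moreover have "slack i (x + t *\<^sub>R w) \<ge> 0" if "0 \<le> t" "i \<in> tight x" for t i
    using assms(2)[OF that(2)] that by (simp add: slack_add tight_iff)
  ultimately have "\<forall>t. 0 \<le> t \<and> t \<le> b / 2 \<longrightarrow> x + t *\<^sub>R w \<in> P \<and> (\<forall>i. i \<notin> tight x \<longrightarrow> slack i (x + t *\<^sub>R w) > 0)"
    unfolding mem_P_iff by (metis less_imp_le)
  then show ?thesis using b(1) by (intro exI[of _ "b / 2"]) auto
qed

text \<open>Otherwise \<open>v\<close> would be the midpoint of a segment in direction \<open>w\<close> inside \<open>P\<close>.\<close>

lemma vertex_normals_span:
  assumes v: "v \<in> vertices P" and w: "\<And>i. i \<in> tight v \<Longrightarrow> u i \<bullet> w = 0"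
  shows "w = 0"
proof (rule ccontr)
  assume "w \<noteq> 0"
  have vP: "v \<in> P" by (rule vertex_in_P[OF v])
  obtain e1 where e1: "e1 > 0" "\<And>t. 0 \<le> t \<Longrightarrow> t \<le> e1 \<Longrightarrow> v + t *\<^sub>R w \<in> P"
    using small_move[OF vP, of w] w by auto
  obtain e2 where e2: "e2 > 0" "\<And>t. 0 \<le> t \<Longrightarrow> t \<le> e2 \<Longrightarrow> v + t *\<^sub>R (- w) \<in> P"
    using small_move[OF vP, of "- w"] w by auto
  define e where "e = min e1 e2"
  have e: "e > 0" "v + e *\<^sub>R w \<in> P" "v - e *\<^sub>R w \<in> P"
    using e1 e2(1) e2(2)[of e] by (auto simp: e_def)
  have "v \<in> open_segment (v + e *\<^sub>R w) (v - e *\<^sub>R w)"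
  proof -
    have "(v + e *\<^sub>R w) - (v - e *\<^sub>R w) = (e + e) *\<^sub>R w"
      unfolding scaleR_add_left by (simp only: add_diff_add add.commute[of v] diff_conv_add_uminus minus_add_distrib minus_minus add.assoc) simp
    moreover have "(e + e) *\<^sub>R w \<noteq> 0" using e(1) \<open>w \<noteq> 0\<close> by simp
    ultimately have "v + e *\<^sub>R w \<noteq> v - e *\<^sub>R w" by (metis diff_self)
    moreover have "v = (1 - 1/2) *\<^sub>R (v + e *\<^sub>R w) + (1/2) *\<^sub>R (v - e *\<^sub>R w)"
      by (simp add: scaleR_add_right scaleR_diff_right flip: scaleR_add_left)
    ultimately show ?thesis unfolding in_segment(2)
      by (intro conjI exI[of _ "1/2"]) auto
  qed
  then show False using v e by (auto simp: vertices_def extreme_point_of_def)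
qed

definition tangent_cone :: "real^'n \<Rightarrow> (real^'n) set" where
  "tangent_cone v = {x. \<forall>i\<in>tight v. u i \<bullet> x \<ge> 0}"

text \<open>Cut the tangent cone at a vertex by \<open>\<Sum>u\<^sub>i = 1\<close>.  The extreme points of this compact
  section inject into the edges at the vertex, so there are at most \<open>n\<close> of them.\<close>

definition cross_section :: "real^'n \<Rightarrow> (real^'n) set" where
  "cross_section v = {x \<in> tangent_cone v. (\<Sum>i\<in>tight v. u i) \<bullet> x = 1}"

lemma tangent_cone_functional:
  assumes v: "v \<in> vertices P" and x: "x \<in> tangent_cone v"
  shows "(\<Sum>i\<in>tight v. u i) \<bullet> x \<ge> 0" "(\<Sum>i\<in>tight v. u i) \<bullet> x = 0 \<longleftrightarrow> x = 0"
proof -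
  have eq: "(\<Sum>i\<in>tight v. u i) \<bullet> x = (\<Sum>i\<in>tight v. u i \<bullet> x)" by (simp add: inner_sum_left)
  show "(\<Sum>i\<in>tight v. u i) \<bullet> x \<ge> 0"
    unfolding eq by (rule sum_nonneg) (use x in \<open>auto simp: tangent_cone_def\<close>)
  show "(\<Sum>i\<in>tight v. u i) \<bullet> x = 0 \<longleftrightarrow> x = 0"
  proof
    assume "(\<Sum>i\<in>tight v. u i) \<bullet> x = 0"
    then have "\<forall>i\<in>tight v. u i \<bullet> x = 0"
      unfolding eq using x by (subst (asm) sum_nonneg_eq_0_iff) (auto simp: tangent_cone_def)
    then show "x = 0" using vertex_normals_span[OF v] by blast
  qed simp
qed

lemma P_minus_vertex_tangent: "v \<in> P \<Longrightarrow> x \<in> P \<Longrightarrow> x - v \<in> tangent_cone v"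
  using slack_diff[of _ x v] by (auto simp: tangent_cone_def mem_P_iff tight_iff) (metis diff_zero)

text \<open>The functional \<open>\<Sum>u\<^sub>i\<close> is positive on the unit vectors of the cone, hence bounded away from 0 there by
  compactness; this bounds the norm on the section.\<close>

lemma compact_cross_section:
  assumes v: "v \<in> vertices P"
  shows "compact (cross_section v)"
proof -
  let ?c = "\<Sum>i\<in>tight v. u i"
  have closedT: "closed (tangent_cone v)"
  proof -
    have "tangent_cone v = (\<Inter>i\<in>tight v. {x. u i \<bullet> x \<ge> 0})" by (auto simp: tangent_cone_def)
    then show ?thesis by (auto intro!: closed_INT closed_halfspace_ge)
  qed
  let ?K = "tangent_cone v \<inter> sphere 0 1"
  have K: "compact ?K" using closedT by (intro closed_Int_compact) auto
  have bound: "\<exists>B. \<forall>x\<in>cross_section v. norm x \<le> B"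
  proof (cases "?K = {}")
    case True
    have "cross_section v \<subseteq> {0}"
    proof
      fix x assume x: "x \<in> cross_section v"
      show "x \<in> {0}"
      proof (rule ccontr)
        assume "x \<notin> {0}"
        then have "(1 / norm x) *\<^sub>R x \<in> ?K" using x
          by (auto simp: cross_section_def tangent_cone_def)
        then show False using True by blast
      qed
    qed
    then show ?thesis by (intro exI[of _ 0]) auto
  next
    case False
    have "continuous_on ?K (\<lambda>x. ?c \<bullet> x)" by (intro continuous_intros)
    then obtain x0 where x0: "x0 \<in> ?K" "\<And>x. x \<in> ?K \<Longrightarrow> ?c \<bullet> x0 \<le> ?c \<bullet> x"
      using continuous_attains_inf[OF K False] by blast
    have pos: "?c \<bullet> x0 > 0"
      using tangent_cone_functional[OF v, of x0] x0(1) by (auto simp: less_le)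
    have "norm x \<le> 1 / (?c \<bullet> x0)" if x: "x \<in> cross_section v" for x
    proof -
      have "x \<noteq> 0" using x by (auto simp: cross_section_def)
      then have "(1 / norm x) *\<^sub>R x \<in> ?K" using x by (auto simp: cross_section_def tangent_cone_def)
      from x0(2)[OF this] have "?c \<bullet> x0 \<le> 1 / norm x" using x by (simp add: cross_section_def)
      then show ?thesis using pos \<open>x \<noteq> 0\<close> by (simp add: field_simps)
    qed
    then show ?thesis by blast
  qed
  have "closed (cross_section v)"
  proof -
    have "cross_section v = tangent_cone v \<inter> {x. ?c \<bullet> x = 1}" by (auto simp: cross_section_def)
    then show ?thesis using closedT by (auto intro: closed_hyperplane)
  qed
  then show ?thesis using bound by (simp add: compact_eq_bounded_closed bounded_iff)
qed

lemma convex_cross_section: "convex (cross_section v)"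
proof -
  have "cross_section v = (\<Inter>i\<in>tight v. {x. u i \<bullet> x \<ge> 0}) \<inter> {x. (\<Sum>i\<in>tight v. u i) \<bullet> x = 1}"
    by (auto simp: cross_section_def tangent_cone_def)
  then show ?thesis by (auto intro!: convex_INT convex_halfspace_ge convex_hyperplane convex_Int)
qed

lemma tangent_cone_scale: "x \<in> tangent_cone v \<Longrightarrow> t \<ge> 0 \<Longrightarrow> t *\<^sub>R x \<in> tangent_cone v"
  by (auto simp: tangent_cone_def)

text \<open>If a point of the ray lies inside a segment of \<open>P\<close>, the directions from \<open>v\<close> to the two endpoints, scaled into
  the cross section, average to \<open>s\<close>.  Since \<open>s\<close> is extreme, both equal \<open>s\<close>.\<close>

lemma extreme_ray_edge:
  assumes v: "v \<in> vertices P" and s: "s extreme_point_of cross_section v"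
  shows "{x \<in> P. \<exists>t\<ge>0. x = v + t *\<^sub>R s} edge_of P"
proof -
  let ?E = "{x \<in> P. \<exists>t\<ge>0. x = v + t *\<^sub>R s}"
  let ?c = "\<Sum>i\<in>tight v. u i"
  have vP: "v \<in> P" by (rule vertex_in_P[OF v])
  have sS: "s \<in> cross_section v" using s by (simp add: extreme_point_of_def)
  then have sT: "s \<in> tangent_cone v" and cs: "?c \<bullet> s = 1" by (auto simp: cross_section_def)
  have s0: "s \<noteq> 0" using cs by auto
  have ends: "a \<in> ?E \<and> b \<in> ?E" if ab: "a \<in> P" "b \<in> P" and x: "x \<in> ?E" "x \<in> open_segment a b" for a b x
  proof -
    obtain t where t: "t \<ge> 0" "x = v + t *\<^sub>R s" using x by blast
    obtain l where l: "0 < l" "l < 1" "x = (1 - l) *\<^sub>R a + l *\<^sub>R b"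
      using x(2) by (auto simp: in_segment)
    define a' b' where "a' = a - v" and "b' = b - v"
    have a'T: "a' \<in> tangent_cone v" and b'T: "b' \<in> tangent_cone v"
      using P_minus_vertex_tangent[OF vP] ab by (auto simp: a'_def b'_def)
    have ts: "t *\<^sub>R s = (1 - l) *\<^sub>R a' + l *\<^sub>R b'"
      using t(2) l(3) by (simp add: a'_def b'_def algebra_simps)
    let ?ca = "?c \<bullet> a'" and ?cb = "?c \<bullet> b'"
    note A = tangent_cone_functional[OF v a'T] and B = tangent_cone_functional[OF v b'T]
    have tc: "t = (1 - l) * ?ca + l * ?cb"
      using arg_cong[OF ts, of "\<lambda>y. ?c \<bullet> y"] cs by (simp add: inner_add_right)
    have "a' = ?ca *\<^sub>R s \<and> b' = ?cb *\<^sub>R s"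
    proof (cases "?ca = 0 \<or> ?cb = 0")
      case True
      then show ?thesis
      proof
        assume ca: "?ca = 0"
        then have a0: "a' = 0" using A by blast
        then have "l *\<^sub>R b' = l *\<^sub>R (?cb *\<^sub>R s)" using ts tc ca by simp
        then have "b' = ?cb *\<^sub>R s" using scaleR_left_imp_eq[of l b'] l(1) by simp
        then show ?thesis using a0 by simp
      next
        assume cb: "?cb = 0"
        then have b0: "b' = 0" using B by blast
        then have "(1 - l) *\<^sub>R a' = (1 - l) *\<^sub>R (?ca *\<^sub>R s)" using ts tc cb by simp
        then have "a' = ?ca *\<^sub>R s" using scaleR_left_imp_eq[of "1 - l" a'] l(2) by simp
        then show ?thesis using b0 by simp
      qed
    next
      case False
      then have pos: "?ca > 0" "?cb > 0" using A B by (auto simp: less_le)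
      define p q where "p = (1 / ?ca) *\<^sub>R a'" and "q = (1 / ?cb) *\<^sub>R b'"
      have pq: "p \<in> cross_section v" "q \<in> cross_section v"
        using a'T b'T pos by (auto simp: p_def q_def cross_section_def intro!: tangent_cone_scale)
      have a'p: "a' = ?ca *\<^sub>R p" "b' = ?cb *\<^sub>R q" using pos by (auto simp: p_def q_def)
      have tpos: "t > 0" unfolding tc using pos l by (intro add_pos_pos mult_pos_pos) auto
      define r where "r = l * ?cb / t"
      have "1 - r = (1 - l) * ?ca / t" using tpos tc by (simp add: r_def field_simps)
      moreover have "s = (1 / t) *\<^sub>R ((1 - l) *\<^sub>R a' + l *\<^sub>R b')" using tpos by (simp flip: ts)
      moreover have "(1 / t) *\<^sub>R ((1 - l) *\<^sub>R a' + l *\<^sub>R b') =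
          ((1 - l) * ?ca / t) *\<^sub>R p + (l * ?cb / t) *\<^sub>R q"
        using pos by (simp add: p_def q_def scaleR_add_right)
      ultimately have sr: "s = (1 - r) *\<^sub>R p + r *\<^sub>R q"
        by (simp only: r_def)
      have r: "0 < r" "r < 1"
      proof -
        show "0 < r" using tpos l pos by (simp add: r_def)
        have "1 - r > 0" unfolding \<open>1 - r = (1 - l) * ?ca / t\<close> using tpos l pos by simp
        then show "r < 1" by simp
      qed
      have "p = q"
      proof (rule ccontr)
        assume "p \<noteq> q"
        then have "s \<in> open_segment p q" using sr r by (auto simp: in_segment)
        then show False using s pq by (auto simp: extreme_point_of_def)
      qed
      then have "s = p" using sr by (simp flip: scaleR_add_left)
      then show ?thesis using a'p \<open>p = q\<close> by simp
    qed
    then have "a = v + ?ca *\<^sub>R s" "b = v + ?cb *\<^sub>R s"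
      unfolding a'_def b'_def by (metis add.commute diff_add_cancel)+
    then show ?thesis using A B ab by blast
  qed
  have conv: "convex ?E"
  proof -
    have "convex {x. \<exists>t\<ge>0. x = v + t *\<^sub>R s}"
    proof (rule convexI)
      fix x y and p q :: real
      assume "x \<in> {x. \<exists>t\<ge>0. x = v + t *\<^sub>R s}" "y \<in> {x. \<exists>t\<ge>0. x = v + t *\<^sub>R s}" and pq: "0 \<le> p" "0 \<le> q" "p + q = 1"
      then obtain t t' where "t \<ge> 0" "t' \<ge> 0" "x = v + t *\<^sub>R s" "y = v + t' *\<^sub>R s" by blast
      then have "p *\<^sub>R x + q *\<^sub>R y = (p + q) *\<^sub>R v + (p * t + q * t') *\<^sub>R s" "p * t + q * t' \<ge> 0"
        using pq(1,2) by (auto simp: algebra_simps)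
      then show "p *\<^sub>R x + q *\<^sub>R y \<in> {x. \<exists>t\<ge>0. x = v + t *\<^sub>R s}" using pq(3) by auto
    qed
    then have "convex (P \<inter> {x. \<exists>t\<ge>0. x = v + t *\<^sub>R s})" using convex_P by (rule convex_Int[rotated])
    moreover have "?E = P \<inter> {x. \<exists>t\<ge>0. x = v + t *\<^sub>R s}" by blast
    ultimately show ?thesis by simp
  qed
  have face: "?E face_of P"
    unfolding face_of_def using conv ends by blast
  have "u i \<bullet> s \<ge> 0" if "i \<in> tight v" for i using sT that by (simp add: tangent_cone_def)
  then obtain e where e: "e > 0" "v + e *\<^sub>R s \<in> P" using small_move[OF vP, of s]
    by (metis less_imp_le order_refl)
  have "v = v + 0 *\<^sub>R s" by simp
  then have "v \<in> ?E" using vP by (metis (mono_tags, lifting) mem_Collect_eq order_refl)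
  moreover have "v + e *\<^sub>R s \<in> ?E" using e less_imp_le[OF e(1)] by blast
  ultimately have "{v, v + e *\<^sub>R s} \<subseteq> ?E" by simp
  then have "aff_dim {v, v + e *\<^sub>R s} \<le> aff_dim ?E" by (rule aff_dim_subset)
  then have lower: "1 \<le> aff_dim ?E" using e s0 by simp
  have "?E \<subseteq> affine hull {v, v + s}"
  proof
    fix x assume "x \<in> ?E"
    then obtain t where "x = v + t *\<^sub>R s" by blast
    then have "x = (1 - t) *\<^sub>R v + t *\<^sub>R (v + s)" by (simp add: algebra_simps)
    then show "x \<in> affine hull {v, v + s}" unfolding affine_hull_2
      by (metis (mono_tags, lifting) diff_add_cancel mem_Collect_eq)
  qed
  then have "aff_dim ?E \<le> aff_dim (affine hull {v, v + s})" by (rule aff_dim_subset)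
  then have "aff_dim ?E \<le> aff_dim {v, v + s}" by (simp only: aff_dim_affine_hull)
  then have "aff_dim ?E \<le> 1" using s0 by simp
  then show ?thesis using face lower by (simp add: edge_of_def)
qed

lemma card_extreme_rays:
  assumes v: "v \<in> vertices P"
  shows "finite {s. s extreme_point_of cross_section v}"
    "card {s. s extreme_point_of cross_section v} \<le> CARD('n)"
proof -
  let ?X = "{s. s extreme_point_of cross_section v}" and ?Y = "{e. e edge_of P \<and> v \<in> e}"
  let ?E = "\<lambda>s. {x \<in> P. \<exists>t\<ge>0. x = v + t *\<^sub>R s}"
  have vP: "v \<in> P" by (rule vertex_in_P[OF v])
  have card: "card ?Y = CARD('n)" using simple v by (auto simp: simple_polytope_def)
  then have finY: "finite ?Y" by (metis card.infinite zero_less_card_finite less_irrefl)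
  have sub: "?E ` ?X \<subseteq> ?Y" using extreme_ray_edge[OF v] vP by (auto intro: exI[of _ 0])
  have inj: "inj_on ?E ?X"
  proof (rule inj_onI)
    fix s s' assume s: "s \<in> ?X" "s' \<in> ?X" and eq: "?E s = ?E s'"
    have S: "s \<in> tangent_cone v" "(\<Sum>i\<in>tight v. u i) \<bullet> s = 1" "(\<Sum>i\<in>tight v. u i) \<bullet> s' = 1"
      using s by (auto simp: extreme_point_of_def cross_section_def)
    have "u i \<bullet> s \<ge> 0" if "i \<in> tight v" for i using S that by (simp add: tangent_cone_def)
    then obtain e where e: "e > 0" "v + e *\<^sub>R s \<in> P" using small_move[OF vP, of s]
      by (metis less_imp_le order_refl)
    then have "v + e *\<^sub>R s \<in> ?E s" using less_imp_le by blast
    then obtain t where "v + e *\<^sub>R s = v + t *\<^sub>R s'" using eq by auto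
    then have es: "e *\<^sub>R s = t *\<^sub>R s'" by simp
    have "e * ((\<Sum>i\<in>tight v. u i) \<bullet> s) = t * ((\<Sum>i\<in>tight v. u i) \<bullet> s')"
      by (simp only: es flip: inner_scaleR_right)
    then have "e = t" using S by simp
    then show "s = s'" using es e by simp
  qed
  show "finite ?X" using finite_imageD[OF finite_subset[OF sub finY] inj] .
  show "card ?X \<le> CARD('n)" using card_inj_on_le[OF inj sub finY] card by simp
qed

text \<open>The edge condition of simplicity is converted into the facet condition.  The set \<open>R\<close> of extreme rays spans the
  space and has at most \<open>n\<close> elements, so it is a basis.  A facet through \<open>v\<close> has dimension \<open>n - 1\<close>, hence its
  normal vanishes on all elements of \<open>R\<close> except one, and distinct facets have distinct exceptional rays.
  Rescaled, these rays form the dual basis.\<close>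

lemma vertex_dual_basis_exists:
  assumes v: "v \<in> vertices P"
  shows "card (tight v) = CARD('n) \<and> (\<forall>j\<in>tight v. \<exists>a. \<forall>i\<in>tight v. u i \<bullet> a = (if i = j then 1 else 0))"
proof -
  let ?I = "tight v" and ?c = "\<Sum>i\<in>tight v. u i"
  define R where "R = {s. s extreme_point_of cross_section v}"
  have vP: "v \<in> P" by (rule vertex_in_P[OF v])
  have finR: "finite R" and cardR: "card R \<le> CARD('n)" using card_extreme_rays[OF v] by (auto simp: R_def)
  have hull: "cross_section v = convex hull R"
    unfolding R_def by (rule Krein_Milman_Minkowski[OF compact_cross_section[OF v] convex_cross_section])
  have RT: "r \<in> tangent_cone v" "?c \<bullet> r = 1" if "r \<in> R" for r
    using that by (auto simp: R_def extreme_point_of_def cross_section_def)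
  (* By Minkowski the section is the hull of its extreme points; scaling extends this to the cone. *)
  have comb: "\<exists>a. (\<forall>r\<in>R. a r \<ge> 0) \<and> x = (\<Sum>r\<in>R. a r *\<^sub>R r)" if x: "x \<in> tangent_cone v" for x
  proof (cases "x = 0")
    case True
    then show ?thesis by (intro exI[of _ "\<lambda>_. 0"]) auto
  next
    case False
    then have pos: "?c \<bullet> x > 0" using tangent_cone_functional[OF v x] by (auto simp: less_le)
    then have "(1 / (?c \<bullet> x)) *\<^sub>R x \<in> cross_section v"
      using x by (auto simp: cross_section_def intro!: tangent_cone_scale)
    then obtain a where a: "\<forall>r\<in>R. a r \<ge> 0" "(\<Sum>r\<in>R. a r *\<^sub>R r) = (1 / (?c \<bullet> x)) *\<^sub>R x"
      unfolding hull convex_hull_finite[OF finR] by auto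
    have "x = (?c \<bullet> x) *\<^sub>R ((1 / (?c \<bullet> x)) *\<^sub>R x)" using pos by simp
    also have "\<dots> = (\<Sum>r\<in>R. ((?c \<bullet> x) * a r) *\<^sub>R r)" by (simp flip: a(2) add: scaleR_sum_right)
    finally show ?thesis using a(1) pos by (intro exI[of _ "\<lambda>r. (?c \<bullet> x) * a r"]) auto
  qed
  have spanT: "tangent_cone v \<subseteq> span R"
  proof
    fix x assume "x \<in> tangent_cone v"
    then obtain a where "x = (\<Sum>r\<in>R. a r *\<^sub>R r)" using comb by blast
    then show "x \<in> span R" by (simp add: span_sum span_scale span_base)
  qed
  have span: "span R = UNIV"
  proof -
    obtain x0 e where x0: "e > 0" "ball x0 e \<subseteq> P" using interior_P_nonempty by (auto simp: mem_interior)
    have "y \<in> span R" for y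
    proof (cases "y = 0")
      case False
      define t where "t = e / (2 * norm y)"
      have t: "t > 0" using x0 False by (simp add: t_def)
      have "dist x0 (x0 + t *\<^sub>R y) < e" using x0(1) False by (simp add: dist_norm t_def)
      then have "x0 + t *\<^sub>R y \<in> P" "x0 \<in> P" using x0 by (auto simp: subset_iff)
      then have "(x0 + t *\<^sub>R y - v) - (x0 - v) \<in> span R"
        using P_minus_vertex_tangent[OF vP] spanT by (blast intro: span_diff)
      then have "t *\<^sub>R y \<in> span R" by simp
      then have "(1 / t) *\<^sub>R (t *\<^sub>R y) \<in> span R" by (rule span_scale)
      moreover have "(1 / t) *\<^sub>R (t *\<^sub>R y) = y" using t by simp
      ultimately show ?thesis by simp
    qed (simp add: span_zero)
    then show ?thesis by auto
  qed
  have dimU: "dim (UNIV :: (real^'n) set) = CARD('n)" by (simp add: dim_UNIV)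
  have ind: "independent R"
    by (rule card_le_dim_spanning[of _ UNIV]) (use span finR cardR dimU in auto)
  have zero: "x = 0" if "\<And>r. r \<in> R \<Longrightarrow> w \<bullet> r = 0" "w \<noteq> 0" for w x :: "real^'n"
  proof -
    have "w \<bullet> y = 0" for y
    proof -
      have "y \<in> span R" using span by simp
      then show ?thesis
        by (induction rule: span_induct_alt) (use that in \<open>auto simp: inner_add_right\<close>)
    qed
    then have "w \<bullet> w = 0" by blast
    then show ?thesis using that(2) by simp
  qed
  (* The normal of a facet cannot vanish on the whole basis R, and it cannot be positive on two
     members of R, for then the facet would have dimension at most n - 2. *)
  have Rpos: "\<exists>r\<in>R. u i \<bullet> r > 0" if i: "i \<in> ?I" for i
  proof (rule ccontr)
    assume no: "\<not> (\<exists>r\<in>R. u i \<bullet> r > 0)"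
    have "u i \<bullet> r = 0" if "r \<in> R" for r
      using RT(1)[OF that] i no that by (auto simp: tangent_cone_def less_le)
    then have "(axis undefined 1 :: real^'n) = 0" using zero[of "u i"] u_nonzero[of i] by blast
    then show False by (simp add: axis_eq_0_iff)
  qed
  have Runiq: "r = r'" if i: "i \<in> ?I" and r: "r \<in> R" "r' \<in> R" "u i \<bullet> r > 0" "u i \<bullet> r' > 0" for i r r'
  proof (rule ccontr)
    assume ne: "r \<noteq> r'"
    let ?G = "P \<inter> {x. slack i x = 0}" and ?Z = "{r \<in> R. u i \<bullet> r = 0}"
    have "?G facet_of P" using facets_bij by (auto simp: bij_betw_def)
    then have dimG: "aff_dim ?G = int CARD('n) - 1" using aff_dim_P by (simp add: facet_of_def)
    have vG: "v \<in> ?G" using i vP by (simp add: tight_iff)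
    have "(+) (- v) ` ?G \<subseteq> span ?Z"
    proof
      fix y assume "y \<in> (+) (- v) ` ?G"
      then obtain x where x: "x \<in> P" "slack i x = 0" "y = x - v" by auto
      then obtain a where a: "\<forall>r\<in>R. a r \<ge> 0" "y = (\<Sum>r\<in>R. a r *\<^sub>R r)"
        using comb P_minus_vertex_tangent[OF vP] by blast
      have "u i \<bullet> y = 0" using slack_diff[of i x v] x i by (simp add: tight_iff)
      then have "(\<Sum>r\<in>R. a r * (u i \<bullet> r)) = 0" by (simp add: a(2) inner_sum_right)
      then have "\<forall>r\<in>R. a r * (u i \<bullet> r) = 0"
        using a(1) RT(1) i by (subst (asm) sum_nonneg_eq_0_iff[OF finR]) (auto simp: tangent_cone_def)
      then have "y = (\<Sum>r\<in>?Z. a r *\<^sub>R r)" unfolding a(2)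
        using finR by (intro sum.mono_neutral_right) auto
      moreover have "(\<Sum>r\<in>?Z. a r *\<^sub>R r) \<in> span ?Z"
        by (intro span_sum span_scale span_base)
      ultimately show "y \<in> span ?Z" by metis
    qed
    then have "dim ((+) (- v) ` ?G) \<le> card ?Z"
      using finR by (intro order_trans[OF dim_subset dim_le_card[OF order_refl]])
        (auto intro: order_trans[OF dim_subset])
    moreover have "aff_dim ?G = int (dim ((+) (- v) ` ?G))"
      by (rule aff_dim_eq_dim) (use vG hull_subset in fast)
    moreover have "card ?Z \<le> card (R - {r, r'})" using r finR by (intro card_mono) auto
    moreover have "card (R - {r, r'}) = card R - 2" "card R \<ge> 2"
      using r ne finR card_mono[of R "{r, r'}"] by (auto simp: card_Diff_subset)
    ultimately show False using dimG cardR by linarith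
  qed
  define rr where "rr i = (SOME r. r \<in> R \<and> u i \<bullet> r > 0)" for i
  have rr: "rr i \<in> R" "u i \<bullet> rr i > 0" if "i \<in> ?I" for i
    using someI_ex[of "\<lambda>r. r \<in> R \<and> u i \<bullet> r > 0"] Rpos[OF that] by (auto simp: rr_def)
  have rr0: "u i \<bullet> r = 0" if "i \<in> ?I" "r \<in> R" "r \<noteq> rr i" for i r
    using Runiq[OF that(1,2) rr(1)[OF that(1)] _ rr(2)[OF that(1)]] RT(1)[OF that(2)] that
    by (auto simp: tangent_cone_def less_le)
  (* Normals with the same exceptional ray are proportional and cut out the same facet. *)
  have inj: "inj_on rr ?I"
  proof (rule inj_onI)
    fix i j assume ij: "i \<in> ?I" "j \<in> ?I" "rr i = rr j"
    define s where "s = (u i \<bullet> rr i) / (u j \<bullet> rr i)"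
    have spos: "s > 0" using rr(2)[OF ij(1)] rr(2)[OF ij(2)] ij(3) by (simp add: s_def)
    have diff: "u i = s *\<^sub>R u j"
    proof (rule ccontr)
      assume "u i \<noteq> s *\<^sub>R u j"
      then have "u i - s *\<^sub>R u j \<noteq> 0" by simp
      moreover have "(u i - s *\<^sub>R u j) \<bullet> r = 0" if "r \<in> R" for r
      proof (cases "r = rr i")
        case True
        then show ?thesis using rr(2)[OF ij(2)] ij(3) by (simp add: inner_diff_left s_def)
      next
        case False
        then show ?thesis using rr0[OF ij(1) that] rr0[OF ij(2) that] ij(3) by (simp add: inner_diff_left)
      qed
      ultimately have "(axis undefined 1 :: real^'n) = 0" using zero by blast
      then show False by (simp add: axis_eq_0_iff)
    qed
    have "slack i x = 0 \<longleftrightarrow> slack j x = 0" for x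
      using slack_diff[of i x v] slack_diff[of j x v] ij spos by (simp add: tight_iff diff)
    then have "P \<inter> {x. slack i x = 0} = P \<inter> {x. slack j x = 0}" by blast
    then show "i = j" using facets_bij by (auto simp: bij_betw_def inj_on_def)
  qed
  have surj: "rr ` ?I = R"
  proof (intro equalityI subsetI)
    fix r assume r: "r \<in> R"
    show "r \<in> rr ` ?I"
    proof (rule ccontr)
      assume "r \<notin> rr ` ?I"
      then have "u i \<bullet> r = 0" if "i \<in> ?I" for i using rr0 that r by blast
      then have "r = 0" by (rule vertex_normals_span[OF v])
      then show False using RT(2)[OF r] by simp
    qed
  qed (use rr in auto)
  have "card R = CARD('n)"
    using ind span dimU dim_eq_card_independent[OF ind] by (metis dim_span)
  then have "card ?I = CARD('n)" using card_image[OF inj] surj by simp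
  moreover have "\<exists>a. \<forall>i\<in>?I. u i \<bullet> a = (if i = j then 1 else 0)" if j: "j \<in> ?I" for j
  proof (intro exI ballI)
    fix i assume i: "i \<in> ?I"
    show "u i \<bullet> ((1 / (u j \<bullet> rr j)) *\<^sub>R rr j) = (if i = j then 1 else 0)"
      using rr[OF j] rr0[OF i rr(1)[OF j]] inj i j by (auto simp: inj_on_def)
  qed
  ultimately show ?thesis by blast
qed

abbreviation edge_dir :: "real^'n \<Rightarrow> 'd \<Rightarrow> real^'n" where
  "edge_dir v \<equiv> dual_vec u (tight v)"

lemma card_tight_vertex: "v \<in> vertices P \<Longrightarrow> card (tight v) = CARD('n)"
  using vertex_dual_basis_exists by blast

lemma edge_dir_dual:
  assumes v: "v \<in> vertices P" and i: "i \<in> tight v"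
  shows "u i \<bullet> edge_dir v j = (if i = j then 1 else 0)"
proof -
  have "\<exists>!a. \<forall>i\<in>tight v. u i \<bullet> a = (if i = j then 1 else 0)"
  proof (rule ex_ex1I)
    show "\<exists>a. \<forall>i\<in>tight v. u i \<bullet> a = (if i = j then 1 else 0)"
    proof (cases "j \<in> tight v")
      case True then show ?thesis using vertex_dual_basis_exists[OF v] by blast
    next
      case False then show ?thesis by (intro exI[of _ 0]) auto
    qed
    fix a b assume "\<forall>i\<in>tight v. u i \<bullet> a = (if i = j then 1 else 0)" "\<forall>i\<in>tight v. u i \<bullet> b = (if i = j then 1 else 0)"
    then have "a - b = 0" by (intro vertex_normals_span[OF v]) (simp add: inner_diff_right)
    then show "a = b" by simp
  qed
  from theI'[OF this] show ?thesis using i unfolding dual_vec_def by blast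
qed

lemma edge_dir_outside: "v \<in> vertices P \<Longrightarrow> j \<notin> tight v \<Longrightarrow> edge_dir v j = 0"
  by (rule vertex_normals_span) (auto simp: edge_dir_dual)

lemma edge_dir_expand:
  assumes "v \<in> vertices P"
  shows "x = (\<Sum>j\<in>tight v. (u j \<bullet> x) *\<^sub>R edge_dir v j)"
proof -
  have "x - (\<Sum>j\<in>tight v. (u j \<bullet> x) *\<^sub>R edge_dir v j) = 0"
    by (rule vertex_normals_span[OF assms])
       (simp add: inner_diff_right inner_sum_right edge_dir_dual[OF assms] if_distrib sum.delta cong: if_cong)
  then show ?thesis by simp
qed

text \<open>At a simple vertex all sets of facets behave like sets of coordinate hyperplanes: faces through the vertex
  correspond to arbitrary subsets of the facets through it.\<close>

definition face_on :: "'d set \<Rightarrow> (real^'n) set" where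
  "face_on A = {x \<in> P. \<forall>i\<in>A. slack i x = 0}"

lemma face_on_face: "face_on A face_of P"
proof -
  have eq: "(\<Sum>i\<in>A. u i) \<bullet> x + (\<Sum>i\<in>A. \<mu> i) = (\<Sum>i\<in>A. slack i x)" for x
    by (simp add: slack_def inner_sum_left sum.distrib)
  have "face_on A = P \<inter> {x. (\<Sum>i\<in>A. u i) \<bullet> x = - (\<Sum>i\<in>A. \<mu> i)}"
  proof -
    have "(\<forall>i\<in>A. slack i x = 0) \<longleftrightarrow> (\<Sum>i\<in>A. slack i x) = 0" if "x \<in> P" for x
      using that by (subst sum_nonneg_eq_0_iff) (auto simp: mem_P_iff)
    then show ?thesis unfolding face_on_def by (auto simp: eq[symmetric] eq_neg_iff_add_eq_0)
  qed
  moreover have "(\<Sum>i\<in>A. u i) \<bullet> x \<ge> - (\<Sum>i\<in>A. \<mu> i)" if "x \<in> P" for x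
    using that eq[of x] sum_nonneg[of A "\<lambda>i. slack i x"] by (auto simp: mem_P_iff)
  ultimately show ?thesis by (simp add: face_of_Int_supporting_hyperplane_ge[OF convex_P])
qed

text \<open>Move from \<open>v\<close> a little along all edges that leave the facets outside \<open>A\<close>.\<close>

lemma tight_set_realized:
  assumes v: "v \<in> vertices P" and A: "A \<subseteq> tight v"
  shows "\<exists>x\<in>P. tight x = A"
proof -
  define w where "w = (\<Sum>j\<in>tight v - A. edge_dir v j)"
  have uw: "u i \<bullet> w = (if i \<in> A then 0 else 1)" if "i \<in> tight v" for i
    using that A by (auto simp: w_def inner_sum_right edge_dir_dual[OF v] sum.delta')
  then have "u i \<bullet> w \<ge> 0" if "i \<in> tight v" for i using that by simp
  then obtain e where e: "e > 0" "\<forall>t. 0 \<le> t \<and> t \<le> e \<longrightarrow> v + t *\<^sub>R w \<in> P \<and> (\<forall>i. i \<notin> tight v \<longrightarrow> slack i (v + t *\<^sub>R w) > 0)"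
    using small_move[OF vertex_in_P[OF v], of w] by blast
  have "slack i (v + e *\<^sub>R w) = 0 \<longleftrightarrow> i \<in> A" for i
  proof (cases "i \<in> tight v")
    case True
    then show ?thesis using uw[OF True] e(1) by (simp add: slack_add tight_iff)
  next
    case False
    then show ?thesis using e A by (metis less_imp_le less_irrefl order_refl subsetD)
  qed
  then show ?thesis using e by (intro bexI[of _ "v + e *\<^sub>R w"]) (auto simp: tight_iff)
qed

lemma facet_idx_iff: "i \<in> facet_idx u \<mu> F \<longleftrightarrow> (\<forall>x\<in>F. slack i x = 0)"
  by (simp add: facet_idx_def slack_def)

lemma facet_idx_face_on:
  assumes "v \<in> vertices P" "A \<subseteq> tight v"
  shows "facet_idx u \<mu> (face_on A) = A"
  using tight_set_realized[OF assms] by (auto simp: facet_idx_iff face_on_def tight_iff set_eq_iff)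

lemma face_on_in_faces:
  assumes "v \<in> vertices P" "A \<subseteq> tight v"
  shows "face_on A \<in> faces P"
proof -
  have "v \<in> face_on A" using assms vertex_in_P[OF assms(1)] by (auto simp: face_on_def tight_iff)
  then show ?thesis using face_on_face by (auto simp: faces_def)
qed

lemma face_eq_face_on:
  assumes F: "F \<in> faces P"
  shows "F = face_on (facet_idx u \<mu> F)"
proof (cases "F = P")
  case True
  then show ?thesis by (auto simp: face_on_def facet_idx_iff)
next
  case False
  have face: "F face_of P" "F \<noteq> {}" using F by (auto simp: faces_def)
  have Feq: "F = \<Inter>{G. G facet_of P \<and> F \<subseteq> G}"
    by (rule face_of_polyhedron[OF polyhedron_P face False])
  show ?thesis
  proof
    show "F \<subseteq> face_on (facet_idx u \<mu> F)"
      using face_of_imp_subset[OF face(1)] by (auto simp: face_on_def facet_idx_iff)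
    show "face_on (facet_idx u \<mu> F) \<subseteq> F"
    proof
      fix x assume x: "x \<in> face_on (facet_idx u \<mu> F)"
      have "x \<in> G" if G: "G facet_of P" "F \<subseteq> G" for G
      proof -
        obtain i where i: "G = P \<inter> {x. slack i x = 0}"
          using facets_bij G(1) by (auto simp: bij_betw_def)
        then have "i \<in> facet_idx u \<mu> F" using G(2) by (auto simp: facet_idx_iff)
        then show ?thesis using x i by (auto simp: face_on_def)
      qed
      then show "x \<in> F" by (subst Feq) blast
    qed
  qed
qed

lemma face_has_vertex:
  assumes F: "F \<in> faces P"
  shows "\<exists>v. v \<in> vertices P \<and> v \<in> F"
proof -
  have face: "F face_of P" "F \<noteq> {}" using F by (auto simp: faces_def)
  have "compact F" "convex F"
    using face_of_imp_compact[OF convex_P compact_P face(1)] face_of_imp_convex[OF face(1)] by auto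
  then obtain v where "v extreme_point_of F" using extreme_point_exists_convex face(2) by blast
  then show ?thesis using extreme_point_of_face[OF face(1)] by (auto simp: vertices_def)
qed

lemma facet_idx_subset_vertex: "v \<in> F \<Longrightarrow> facet_idx u \<mu> F \<subseteq> tight v"
  by (auto simp: facet_idx_iff tight_iff)

lemma finite_faces: "finite (faces P)"
  using finite_polyhedron_faces[OF polyhedron_P] by (rule finite_subset[rotated]) (auto simp: faces_def)

lemma face_on_strict:
  assumes F: "F \<in> faces P" and E: "E \<in> faces P" and sub: "F \<subset> E"
  shows "facet_idx u \<mu> E \<subset> facet_idx u \<mu> F"
proof -
  have "facet_idx u \<mu> E \<subseteq> facet_idx u \<mu> F" using sub unfolding facet_idx_iff subset_iff psubset_eq by blast
  moreover have "facet_idx u \<mu> E \<noteq> facet_idx u \<mu> F"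
    using face_eq_face_on[OF F] face_eq_face_on[OF E] sub by auto
  ultimately show ?thesis by blast
qed

text \<open>The face is spanned at \<open>v\<close> by the edges that leave the facets outside \<open>A\<close>.  Hence the weight of a point
  depends only on the number of facets through it.\<close>

lemma aff_dim_face_on:
  assumes v: "v \<in> vertices P" and A: "A \<subseteq> tight v"
  shows "aff_dim (face_on A) = int CARD('n) - int (card A)"
proof -
  let ?B = "edge_dir v ` (tight v - A)"
  have inj: "inj_on (edge_dir v) (tight v)"
    by (rule inj_onI) (metis edge_dir_dual[OF v] zero_neq_one)
  have ind: "independent (edge_dir v ` tight v)"
  proof (rule card_le_dim_spanning[of _ UNIV])
    have "x \<in> span (edge_dir v ` tight v)" for x
      by (subst edge_dir_expand[OF v, of x]) (intro span_sum span_scale span_base imageI)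
    then show "UNIV \<subseteq> span (edge_dir v ` tight v)" by blast
    show "card (edge_dir v ` tight v) \<le> dim (UNIV :: (real^'n) set)"
      using card_tight_vertex[OF v] card_image_le[of "tight v" "edge_dir v"] by (simp add: dim_UNIV)
  qed auto
  have indB: "independent ?B" by (rule independent_mono[OF ind]) auto
  have cardB: "card ?B = CARD('n) - card A"
    using card_image[OF inj_on_subset[OF inj, of "tight v - A"]] card_Diff_subset[of A "tight v"] A
      card_tight_vertex[OF v] finite_subset[OF A] by auto
  have vF: "v \<in> face_on A" using v A by (auto simp: face_on_def vertex_in_P tight_iff)
  have "aff_dim (face_on A) = int (dim ((+) (- v) ` face_on A))"
    by (rule aff_dim_eq_dim) (use vF hull_subset in fast)
  also have "dim ((+) (- v) ` face_on A) = card ?B"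
  proof (rule antisym)
    have "(+) (- v) ` face_on A \<subseteq> span ?B"
    proof
      fix y assume "y \<in> (+) (- v) ` face_on A"
      then obtain x where x: "x \<in> face_on A" "y = x - v" by auto
      have "u i \<bullet> y = 0" if "i \<in> A" for i
        using slack_diff[of i x v] x that A by (auto simp: face_on_def tight_iff)
      then have "y = (\<Sum>j\<in>tight v - A. (u j \<bullet> y) *\<^sub>R edge_dir v j)"
        by (subst edge_dir_expand[OF v, of y]) (intro sum.mono_neutral_right, auto)
      then show "y \<in> span ?B" by (metis (no_types, lifting) imageI span_base span_scale span_sum)
    qed
    then show "dim ((+) (- v) ` face_on A) \<le> card ?B"
      using dim_subset[of "(+) (- v) ` face_on A" "span ?B"] dim_eq_card_independent[OF indB] by simp
    have "?B \<subseteq> span ((+) (- v) ` face_on A)"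
    proof
      fix b assume "b \<in> ?B"
      then obtain j where j: "j \<in> tight v" "j \<notin> A" "b = edge_dir v j" by auto
      obtain e where e: "e > 0" "v + e *\<^sub>R b \<in> P"
        using small_move[OF vertex_in_P[OF v], of b] j edge_dir_dual[OF v]
        by (metis less_imp_le order_refl zero_le_one)
      have "slack i (v + e *\<^sub>R b) = 0" if "i \<in> A" for i
        using that A j edge_dir_dual[OF v, of i j] by (auto simp: slack_add tight_iff)
      then have "e *\<^sub>R b \<in> (+) (- v) ` face_on A"
        using e by (intro image_eqI[of _ _ "v + e *\<^sub>R b"]) (auto simp: face_on_def)
      then have "(1 / e) *\<^sub>R (e *\<^sub>R b) \<in> span ((+) (- v) ` face_on A)" by (intro span_scale span_base)
      then show "b \<in> span ((+) (- v) ` face_on A)" using e by simp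
    qed
    then show "card ?B \<le> dim ((+) (- v) ` face_on A)"
      using dim_subset[of ?B "span ((+) (- v) ` face_on A)"] dim_eq_card_independent[OF indB] by simp
  qed
  moreover have "card A \<le> CARD('n)" using card_mono[OF _ A] card_tight_vertex[OF v] by simp
  ultimately show ?thesis using cardB by simp
qed

lemma face_weight_eq:
  assumes x: "x \<in> P"
  shows "face_weight P x = (1/2) ^ card (tight x)"
proof -
  let ?F = "face_on (tight x)"
  have xF: "x \<in> ?F" using x by (auto simp: face_on_def tight_iff)
  then have F: "?F \<in> faces P" using face_on_face by (auto simp: faces_def)
  obtain v where v: "v \<in> vertices P" "v \<in> ?F" using face_has_vertex[OF F] by blast
  have A: "tight x \<subseteq> tight v" using v(2) by (auto simp: face_on_def tight_iff)
  have "\<forall>i\<in>-tight x. \<forall>\<^sub>F y in nhds x. slack i y > 0"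
  proof
    fix i assume "i \<in> - tight x"
    then have "slack i x > 0" using x by (auto simp: mem_P_iff tight_iff less_le)
    moreover have "(slack i \<longlongrightarrow> slack i x) (nhds x)"
      unfolding slack_def by (intro tendsto_intros filterlim_ident)
    ultimately show "\<forall>\<^sub>F y in nhds x. slack i y > 0" by (intro order_tendstoD(1)) auto
  qed
  then have "\<forall>\<^sub>F y in nhds x. \<forall>i\<in>-tight x. slack i y > 0" by (intro eventually_ball_finite) auto
  then obtain e where e: "e > 0" "\<And>y. dist y x < e \<Longrightarrow> \<forall>i\<in>-tight x. slack i y > 0"
    unfolding eventually_nhds_metric by blast
  have hullF: "affine hull ?F \<subseteq> {y. \<forall>i\<in>tight x. slack i y = 0}"
  proof (rule hull_minimal)
    show "?F \<subseteq> {y. \<forall>i\<in>tight x. slack i y = 0}" by (auto simp: face_on_def)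
    have "{y. \<forall>i\<in>tight x. slack i y = 0} = (\<Inter>i\<in>tight x. {y. u i \<bullet> y = - \<mu> i})"
      by (auto simp: slack_def eq_neg_iff_add_eq_0)
    then show "affine {y. \<forall>i\<in>tight x. slack i y = 0}" by (auto intro: affine_Inter affine_hyperplane)
  qed
  have "ball x e \<inter> affine hull ?F \<subseteq> ?F"
  proof
    fix y assume y: "y \<in> ball x e \<inter> affine hull ?F"
    then have "\<forall>i\<in>tight x. slack i y = 0" using hullF by blast
    moreover have "\<forall>i\<in>-tight x. slack i y > 0" using e(2) y by (auto simp: dist_commute)
    ultimately have "slack i y \<ge> 0" for i by (cases "i \<in> tight x") (auto intro: less_imp_le)
    with \<open>\<forall>i\<in>tight x. slack i y = 0\<close> show "y \<in> ?F" by (simp add: face_on_def mem_P_iff)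
  qed
  then have xrel: "x \<in> rel_interior ?F" using xF e(1) by (auto simp: mem_rel_interior_ball)
  have "(THE F. F \<in> faces P \<and> x \<in> rel_interior F) = ?F"
  proof (rule the_equality)
    show "?F \<in> faces P \<and> x \<in> rel_interior ?F" using F xrel by simp
    fix G assume "G \<in> faces P \<and> x \<in> rel_interior G"
    then show "G = ?F" using face_of_eq[of G P ?F] F xrel by (auto simp: faces_def)
  qed
  moreover have "card (tight x) \<le> CARD('n)" using card_mono[OF _ A] card_tight_vertex[OF v(1)] by simp
  ultimately show ?thesis unfolding face_weight_def by (simp add: aff_dim_face_on[OF v(1) A])
qed

end

section \<open>The weighted polar decomposition\<close>

text \<open>The value at 0 is chosen so that the product over all facets is \<open>2\<^sup>-\<^sup>c\<close> on a face of codimension \<open>c\<close>.\<close>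

definition half_step :: "real \<Rightarrow> real" where
  "half_step s = (if s > 0 then 1 else if s = 0 then 1/2 else 0)"

lemma eventually_affine_pos: "a > 0 \<Longrightarrow> \<forall>\<^sub>F e in at_right (0::real). a + e * b > 0"
proof -
  assume a: "a > 0"
  have "((\<lambda>e. a + e * b) \<longlongrightarrow> a + 0 * b) (at_right 0)" by (intro tendsto_intros)
  then show ?thesis using a by (intro order_tendstoD(1)) auto
qed

lemma eventually_affine_neg: "a < 0 \<Longrightarrow> \<forall>\<^sub>F e in at_right (0::real). a + e * b < 0"
  using eventually_affine_pos[of "- a" "- b"] by (auto elim!: eventually_mono)

lemma eventually_affine_pos_imp: "\<forall>\<^sub>F e in at_right (0::real). a > 0 \<longrightarrow> a + e * b > 0"
  by (cases "a > 0") (rule eventually_mono[OF eventually_affine_pos[where b=b]], simp_all)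

lemma eventually_affine_neg_imp: "\<forall>\<^sub>F e in at_right (0::real). a < 0 \<longrightarrow> a + e * b < 0"
  by (cases "a < 0") (rule eventually_mono[OF eventually_affine_neg[where b=b]], simp_all)

lemma eventually_affine_nonzero:
  assumes "b \<noteq> 0"
  shows "\<forall>\<^sub>F e in at_right (0::real). a + e * b \<noteq> 0"
proof (cases "a = 0")
  case True
  then show ?thesis using assms by (auto simp: eventually_at_filter)
next
  case False
  then consider "a > 0" | "a < 0" by linarith
  then show ?thesis
  proof cases
    case 1
    then show ?thesis by (rule eventually_mono[OF eventually_affine_pos[where b=b]]) simp
  next
    case 2
    then show ?thesis by (rule eventually_mono[OF eventually_affine_neg[where b=b]]) simp
  qed
qed

context simple_presentation
begin

lemma vertices_nonempty: "vertices P \<noteq> {}"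
proof -
  have "P \<noteq> {}" using interior_P_nonempty interior_subset[of P] by blast
  then show ?thesis using face_has_vertex[of P] convex_P by (auto simp: faces_def face_of_refl)
qed

definition flips :: "real^'n \<Rightarrow> real^'n \<Rightarrow> 'd set" where
  "flips \<xi> v = {j \<in> tight v. \<xi> \<bullet> edge_dir v j > 0}"

lemma flipped_iff: "flipped u (tight v) \<xi> j \<longleftrightarrow> \<xi> \<bullet> edge_dir v j > 0"
  by (simp add: flipped_def)

lemma num_flips_eq: "num_flips u (tight v) \<xi> = card (flips \<xi> v)"
  by (simp add: num_flips_def flips_def flipped_def)

lemma polarizing_iff:
  "polarizing P u \<mu> \<xi> \<longleftrightarrow> (\<forall>v\<in>vertices P. \<forall>j\<in>tight v. \<xi> \<bullet> edge_dir v j \<noteq> 0)"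
  by (simp add: polarizing_def)

text \<open>The vertex of a face with all edges of the face flipped is the vertex where \<open>\<xi>\<close> is
  minimal on the face.\<close>

lemma unique_flipped_vertex:
  assumes pol: "polarizing P u \<mu> \<xi>" and v0: "v0 \<in> vertices P" "A \<subseteq> tight v0"
  shows "\<exists>!v. v \<in> vertices P \<and> A \<subseteq> tight v \<and> tight v - A \<subseteq> flips \<xi> v"
proof (rule ex_ex1I)
  let ?F = "face_on A"
  have F: "?F \<in> faces P" by (rule face_on_in_faces[OF v0])
  have face: "?F face_of P" "?F \<noteq> {}" using F by (auto simp: faces_def)
  have comp: "compact ?F" and conv: "convex ?F"
    using face_of_imp_compact[OF convex_P compact_P face(1)] face_of_imp_convex[OF face(1)] by auto
  have "continuous_on ?F (\<lambda>x. \<xi> \<bullet> x)" by (intro continuous_intros)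
  then obtain x0 where x0: "x0 \<in> ?F" "\<And>x. x \<in> ?F \<Longrightarrow> \<xi> \<bullet> x0 \<le> \<xi> \<bullet> x"
    using continuous_attains_inf[OF comp face(2)] by blast
  let ?M = "?F \<inter> {x. \<xi> \<bullet> x = \<xi> \<bullet> x0}"
  have M: "?M face_of ?F" by (rule face_of_Int_supporting_hyperplane_ge[OF conv]) (rule x0(2))
  have MP: "?M face_of P" by (rule face_of_trans[OF M face(1)])
  then have "?M \<in> faces P" using x0(1) by (auto simp: faces_def)
  then obtain v where v: "v \<in> vertices P" "v \<in> ?M" using face_has_vertex by blast
  have Av: "A \<subseteq> tight v" using v by (auto simp: face_on_def tight_iff)
  have "j \<in> flips \<xi> v" if j: "j \<in> tight v" "j \<notin> A" for j
  proof -
    have ud: "u i \<bullet> edge_dir v j \<ge> 0" if "i \<in> tight v" for i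
      using edge_dir_dual[OF v(1) that, of j] by simp
    obtain e where e: "e > 0" "\<forall>t. 0 \<le> t \<and> t \<le> e \<longrightarrow> v + t *\<^sub>R edge_dir v j \<in> P \<and>
        (\<forall>i. i \<notin> tight v \<longrightarrow> slack i (v + t *\<^sub>R edge_dir v j) > 0)"
      using small_move[OF vertex_in_P[OF v(1)] ud] by blast
    have "slack i (v + e *\<^sub>R edge_dir v j) = 0" if "i \<in> A" for i
      using that Av j edge_dir_dual[OF v(1), of i j] by (auto simp: slack_add tight_iff)
    then have "v + e *\<^sub>R edge_dir v j \<in> ?F" using e by (auto simp: face_on_def)
    then have "\<xi> \<bullet> x0 \<le> \<xi> \<bullet> (v + e *\<^sub>R edge_dir v j)" by (rule x0(2))
    moreover have "\<xi> \<bullet> v = \<xi> \<bullet> x0" using v(2) by auto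
    ultimately have "0 \<le> e * (\<xi> \<bullet> edge_dir v j)" by (simp add: inner_add_right)
    then have "\<xi> \<bullet> edge_dir v j \<ge> 0" using e(1) by (simp add: zero_le_mult_iff)
    moreover have "\<xi> \<bullet> edge_dir v j \<noteq> 0" using pol v(1) j(1) by (auto simp: polarizing_iff)
    ultimately show ?thesis using j(1) by (simp add: flips_def)
  qed
  then show "\<exists>v. v \<in> vertices P \<and> A \<subseteq> tight v \<and> tight v - A \<subseteq> flips \<xi> v" using v(1) Av by blast
next
  fix v w
  assume v: "v \<in> vertices P \<and> A \<subseteq> tight v \<and> tight v - A \<subseteq> flips \<xi> v"
    and w: "w \<in> vertices P \<and> A \<subseteq> tight w \<and> tight w - A \<subseteq> flips \<xi> w"
  have key: "\<xi> \<bullet> v \<le> \<xi> \<bullet> w \<and> (\<xi> \<bullet> v = \<xi> \<bullet> w \<longrightarrow> v = w)"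
    if v: "v \<in> vertices P" "tight v - A \<subseteq> flips \<xi> v" and w: "w \<in> vertices P" "A \<subseteq> tight w" for v w
  proof -
    have nonneg: "(u j \<bullet> (w - v)) * (\<xi> \<bullet> edge_dir v j) \<ge> 0 \<and>
       ((u j \<bullet> (w - v)) * (\<xi> \<bullet> edge_dir v j) = 0 \<longrightarrow> u j \<bullet> (w - v) = 0)" if j: "j \<in> tight v" for j
    proof (cases "j \<in> A")
      case True
      then have "u j \<bullet> (w - v) = 0" using w j slack_diff[of j w v] by (auto simp: tight_iff)
      then show ?thesis by simp
    next
      case False
      then have "\<xi> \<bullet> edge_dir v j > 0" using j v by (auto simp: flips_def)
      moreover have "u j \<bullet> (w - v) \<ge> 0"
        using slack_diff[of j w v] j vertex_in_P[OF w(1)] by (auto simp: tight_iff mem_P_iff) (metis diff_zero)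
      ultimately show ?thesis by auto
    qed
    have "w - v = (\<Sum>j\<in>tight v. (u j \<bullet> (w - v)) *\<^sub>R edge_dir v j)" by (rule edge_dir_expand[OF v(1)])
    then have eq: "\<xi> \<bullet> w - \<xi> \<bullet> v = (\<Sum>j\<in>tight v. (u j \<bullet> (w - v)) * (\<xi> \<bullet> edge_dir v j))"
      by (metis (mono_tags, lifting) inner_diff_right inner_scaleR_right inner_sum_right sum.cong)
    have "\<xi> \<bullet> w - \<xi> \<bullet> v \<ge> 0" unfolding eq by (rule sum_nonneg) (use nonneg in blast)
    moreover have "v = w" if "\<xi> \<bullet> v = \<xi> \<bullet> w"
    proof -
      have "(\<Sum>j\<in>tight v. (u j \<bullet> (w - v)) * (\<xi> \<bullet> edge_dir v j)) = 0" using eq that by simp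
      then have "\<forall>j\<in>tight v. (u j \<bullet> (w - v)) * (\<xi> \<bullet> edge_dir v j) = 0"
        using nonneg by (subst (asm) sum_nonneg_eq_0_iff) auto
      then have "w - v = 0" using nonneg by (intro vertex_normals_span[OF v(1)]) blast
      then show ?thesis by simp
    qed
    ultimately show ?thesis by simp
  qed
  show "v = w" using key[of v w] key[of w v] v w by force
qed

text \<open>Expanding the flipped factors \<open>w\<^sub>j - 1\<close>, every face contributes once, at the vertex just
  described; hence the signed sum over the vertices does not depend on \<open>\<xi>\<close>.\<close>

lemma polar_sum_expand:
  assumes pol: "polarizing P u \<mu> \<xi>"
  shows "(\<Sum>v\<in>vertices P. (-1) ^ card (flips \<xi> v) * (\<Prod>j\<in>tight v. if j \<in> flips \<xi> v then 1 - w j else w j)) =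
     (\<Sum>A\<in>{A. \<exists>v\<in>vertices P. A \<subseteq> tight v}. (-1) ^ (CARD('n) - card A) * (\<Prod>j\<in>A. w j :: real))"
proof -
  let ?K = "{A. \<exists>v\<in>vertices P. A \<subseteq> tight v}"
  let ?g = "\<lambda>A. (-1) ^ (CARD('n) - card A) * (\<Prod>j\<in>A. w j)"
  have vert: "(-1) ^ card (flips \<xi> v) * (\<Prod>j\<in>tight v. if j \<in> flips \<xi> v then 1 - w j else w j) =
      (\<Sum>A\<in>?K. if A \<subseteq> tight v \<and> tight v - A \<subseteq> flips \<xi> v then ?g A else 0)" if v: "v \<in> vertices P" for v
  proof -
    let ?f = "\<lambda>j. if j \<in> flips \<xi> v then -1 else (0::real)"
    have sub: "flips \<xi> v \<subseteq> tight v" by (auto simp: flips_def)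
    have "(-1) ^ card (flips \<xi> v) * (\<Prod>j\<in>tight v. if j \<in> flips \<xi> v then 1 - w j else w j) =
        (\<Prod>j\<in>tight v. if j \<in> flips \<xi> v then -1 else 1) * (\<Prod>j\<in>tight v. if j \<in> flips \<xi> v then 1 - w j else w j)"
      using sub by (simp add: prod.If_cases Int_absorb1)
    also have "\<dots> = (\<Prod>j\<in>tight v. w j + ?f j)"
      unfolding prod.distrib[symmetric] by (rule prod.cong) auto
    also have "\<dots> = (\<Sum>A\<in>Pow (tight v). (\<Prod>j\<in>A. w j) * (\<Prod>j\<in>tight v - A. ?f j))"
      by (rule prod_add) simp
    also have "\<dots> = (\<Sum>A\<in>Pow (tight v). if A \<subseteq> tight v \<and> tight v - A \<subseteq> flips \<xi> v then ?g A else 0)"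
    proof (rule sum.cong)
      fix A assume "A \<in> Pow (tight v)"
      then have A: "A \<subseteq> tight v" by simp
      show "(\<Prod>j\<in>A. w j) * (\<Prod>j\<in>tight v - A. ?f j) = (if A \<subseteq> tight v \<and> tight v - A \<subseteq> flips \<xi> v then ?g A else 0)"
      proof (cases "tight v - A \<subseteq> flips \<xi> v")
        case True
        then have "(\<Prod>j\<in>tight v - A. ?f j) = (\<Prod>j\<in>tight v - A. -1)" by (intro prod.cong) auto
        also have "\<dots> = (-1) ^ (CARD('n) - card A)"
          using A card_tight_vertex[OF v] by (simp add: card_Diff_subset finite_subset[OF A])
        finally show ?thesis using True A by simp
      next
        case False
        then have "\<exists>j\<in>tight v - A. ?f j = 0" by auto
        then have "(\<Prod>j\<in>tight v - A. ?f j) = 0" by (intro prod_zero) auto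
        then show ?thesis using False by simp
      qed
    qed simp
    also have "\<dots> = (\<Sum>A\<in>?K. if A \<subseteq> tight v \<and> tight v - A \<subseteq> flips \<xi> v then ?g A else 0)"
      using v by (intro sum.mono_neutral_left) auto
    finally show ?thesis .
  qed
  have "(\<Sum>v\<in>vertices P. (-1) ^ card (flips \<xi> v) * (\<Prod>j\<in>tight v. if j \<in> flips \<xi> v then 1 - w j else w j)) =
      (\<Sum>v\<in>vertices P. \<Sum>A\<in>?K. if A \<subseteq> tight v \<and> tight v - A \<subseteq> flips \<xi> v then ?g A else 0)"
    by (intro sum.cong vert) auto
  also have "\<dots> = (\<Sum>A\<in>?K. \<Sum>v\<in>vertices P. if A \<subseteq> tight v \<and> tight v - A \<subseteq> flips \<xi> v then ?g A else 0)"
    by (rule sum.swap)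
  also have "\<dots> = (\<Sum>A\<in>?K. ?g A)"
  proof (rule sum.cong)
    fix A assume "A \<in> ?K"
    then obtain v0 where v0: "v0 \<in> vertices P" "A \<subseteq> tight v0" by blast
    obtain v where v: "v \<in> vertices P" "A \<subseteq> tight v \<and> tight v - A \<subseteq> flips \<xi> v"
      "\<And>w. w \<in> vertices P \<Longrightarrow> A \<subseteq> tight w \<and> tight w - A \<subseteq> flips \<xi> w \<Longrightarrow> w = v"
    proof (rule ex1E[OF unique_flipped_vertex[OF pol v0]])
      fix v assume "v \<in> vertices P \<and> A \<subseteq> tight v \<and> tight v - A \<subseteq> flips \<xi> v"
        "\<forall>w. w \<in> vertices P \<and> A \<subseteq> tight w \<and> tight w - A \<subseteq> flips \<xi> w \<longrightarrow> w = v"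
      then show thesis by - (rule that[of v]; blast)
    qed
    have "(\<Sum>w\<in>vertices P. if A \<subseteq> tight w \<and> tight w - A \<subseteq> flips \<xi> w then ?g A else 0) =
          (\<Sum>w\<in>vertices P. if w = v then ?g A else 0)"
    proof (rule sum.cong)
      fix w assume w: "w \<in> vertices P"
      have "A \<subseteq> tight w \<and> tight w - A \<subseteq> flips \<xi> w \<longleftrightarrow> w = v"
        using v(2) v(3)[OF w] by blast
      then show "(if A \<subseteq> tight w \<and> tight w - A \<subseteq> flips \<xi> w then ?g A else 0) = (if w = v then ?g A else 0)"
        by simp
    qed simp
    then show "(\<Sum>w\<in>vertices P. if A \<subseteq> tight w \<and> tight w - A \<subseteq> flips \<xi> w then ?g A else 0) = ?g A"
      using v(1) finite_vertices by (simp add: sum.delta)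
  qed simp
  finally show ?thesis .
qed

text \<open>As \<open>h\<close> varies, the facets through a vertex \<open>v\<close> keep meeting in one point, which is an affine function of \<open>h\<close>.
  A shift is stable if these points stay strictly inside the other facets, so that they are the vertices
  of \<open>\<Delta>(h)\<close>.\<close>

definition slack_shift :: "real^'d \<Rightarrow> 'd \<Rightarrow> real^'n \<Rightarrow> real" where
  "slack_shift h i x = slack i x + h $ i"

definition vertex_shift :: "real^'n \<Rightarrow> real^'d \<Rightarrow> real^'n" where
  "vertex_shift v h = v - (\<Sum>j\<in>UNIV. (h $ j) *\<^sub>R edge_dir v j)"

definition stable_shift :: "real^'d \<Rightarrow> bool" where
  "stable_shift h \<longleftrightarrow> (\<forall>v\<in>vertices P. \<forall>i\<in>-tight v. slack_shift h i (vertex_shift v h) > 0)"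

lemma mem_shifted_polytope: "x \<in> shifted_polytope u \<mu> h \<longleftrightarrow> (\<forall>i. slack_shift h i x \<ge> 0)"
  by (simp add: shifted_polytope_def slack_shift_def slack_def)

lemma slack_shift_vertex:
  assumes v: "v \<in> vertices P" and i: "i \<in> tight v"
  shows "slack_shift h i (vertex_shift v h) = 0"
proof -
  have "u i \<bullet> (\<Sum>j\<in>UNIV. (h $ j) *\<^sub>R edge_dir v j) = h $ i"
    by (simp add: inner_sum_right edge_dir_dual[OF v i] if_distrib[of "\<lambda>x. _ * x"] sum.delta cong: if_cong)
  then show ?thesis using i slack_diff[of i "vertex_shift v h" v]
    by (simp add: slack_shift_def vertex_shift_def tight_iff)
qed

lemma slack_shift_diff: "slack_shift h i y - slack_shift h i x = u i \<bullet> (y - x)"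
  using slack_diff[of i y x] by (simp add: slack_shift_def)

lemma eventually_stable_shift: "\<exists>U. open U \<and> 0 \<in> U \<and> (\<forall>h\<in>U. stable_shift h)"
proof -
  have "\<forall>v\<in>vertices P. \<forall>\<^sub>F h in nhds 0. \<forall>i\<in>-tight v. slack_shift h i (vertex_shift v h) > 0"
  proof
    fix v assume v: "v \<in> vertices P"
    have "\<forall>i\<in>-tight v. \<forall>\<^sub>F h in nhds 0. slack_shift h i (vertex_shift v h) > 0"
    proof
      fix i assume "i \<in> - tight v"
      then have pos: "slack i v > 0" using vertex_in_P[OF v] by (auto simp: mem_P_iff tight_iff less_le)
      have "((\<lambda>h. slack_shift h i (vertex_shift v h)) \<longlongrightarrow> slack_shift 0 i (vertex_shift v 0)) (nhds 0)"
        unfolding slack_shift_def vertex_shift_def slack_def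
        by (intro tendsto_intros filterlim_ident)
      moreover have "slack_shift 0 i (vertex_shift v 0) > 0"
        using pos by (simp add: slack_shift_def vertex_shift_def)
      ultimately show "\<forall>\<^sub>F h in nhds 0. slack_shift h i (vertex_shift v h) > 0"
        by (rule order_tendstoD(1))
    qed
    then show "\<forall>\<^sub>F h in nhds 0. \<forall>i\<in>-tight v. slack_shift h i (vertex_shift v h) > 0"
      by (intro eventually_ball_finite) auto
  qed
  then have "\<forall>\<^sub>F h in nhds 0. stable_shift h"
    unfolding stable_shift_def by (intro eventually_ball_finite finite_vertices)
  then show ?thesis unfolding eventually_nhds by blast
qed

text \<open>By the expansion into faces the right-hand side may be computed with another polarizing vector \<open>\<zeta>\<close>, chosen
  for the point \<open>x\<close>.  If \<open>x\<close> violates an inequality, take \<open>\<zeta>\<close> near the outward normal of that facet: then \<open>\<zeta>\<close>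
  is larger at \<open>x\<close> than at all vertices, while it is at most its value at the apex on every polarized cone, so
  no cone contains \<open>x\<close>.  If \<open>x \<in> \<Delta>(h)\<close>, take \<open>\<zeta>\<close> near the sum of the outward normals of the facets through \<open>x\<close>:
  then only the vertex where \<open>\<zeta>\<close> is maximal contributes, and nothing is flipped there.\<close>

theorem weighted_polar_decomposition:
  assumes pol: "polarizing P u \<mu> \<xi>" and h: "stable_shift h"
  shows "(\<Prod>i\<in>UNIV. half_step (slack_shift h i x)) =
     (\<Sum>v\<in>vertices P. (-1) ^ card (flips \<xi> v) *
        (\<Prod>j\<in>tight v. if j \<in> flips \<xi> v then 1 - half_step (slack_shift h j x) else half_step (slack_shift h j x)))"
    (is "_ = ?S \<xi>")
proof -
  define s where "s j = slack_shift h j x" for j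
  define T where "T = (if \<exists>i. s i < 0 then {SOME i. s i < 0} else {i. s i = 0})"
  (* The multiple of \<xi> only serves to make the direction polarizing. *)
  define \<eta> where "\<eta> e = - (\<Sum>i\<in>T. u i) + e *\<^sub>R \<xi>" for e :: real
  have inner: "\<eta> e \<bullet> y = - (\<Sum>i\<in>T. u i \<bullet> y) + e * (\<xi> \<bullet> y)" for e y
    by (simp add: \<eta>_def inner_add_left inner_diff_left inner_sum_left)
  have ev1: "\<forall>\<^sub>F e in at_right 0. \<forall>v\<in>vertices P. \<forall>j\<in>tight v. \<eta> e \<bullet> edge_dir v j \<noteq> 0"
    unfolding inner using pol
    by (intro eventually_ball_finite finite_vertices ballI eventually_affine_nonzero) (auto simp: polarizing_iff)
  have ev2: "\<forall>\<^sub>F e in at_right 0. \<forall>v\<in>vertices P. \<forall>j\<in>tight v. - (\<Sum>i\<in>T. u i \<bullet> edge_dir v j) < 0 \<longrightarrow> \<eta> e \<bullet> edge_dir v j < 0"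
    unfolding inner
  proof (intro eventually_ball_finite finite_vertices ballI)
    fix v j
    show "\<forall>\<^sub>F e in at_right 0. - (\<Sum>i\<in>T. u i \<bullet> edge_dir v j) < 0 \<longrightarrow>
       - (\<Sum>i\<in>T. u i \<bullet> edge_dir v j) + e * (\<xi> \<bullet> edge_dir v j) < 0"
      by (rule eventually_affine_neg_imp)
  qed auto
  have ev3: "\<forall>\<^sub>F e in at_right 0. \<forall>v\<in>vertices P. - (\<Sum>i\<in>T. u i \<bullet> (x - vertex_shift v h)) > 0 \<longrightarrow> \<eta> e \<bullet> (x - vertex_shift v h) > 0"
    unfolding inner
  proof (intro eventually_ball_finite finite_vertices ballI)
    fix v
    show "\<forall>\<^sub>F e in at_right 0. - (\<Sum>i\<in>T. u i \<bullet> (x - vertex_shift v h)) > 0 \<longrightarrow>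
       - (\<Sum>i\<in>T. u i \<bullet> (x - vertex_shift v h)) + e * (\<xi> \<bullet> (x - vertex_shift v h)) > 0"
      by (rule eventually_affine_pos_imp)
  qed
  have "\<forall>\<^sub>F e in at_right (0::real). e > 0" by (simp add: eventually_at_filter)
  with ev1 ev2 ev3 have "\<forall>\<^sub>F e in at_right 0.
       (\<forall>v\<in>vertices P. \<forall>j\<in>tight v. \<eta> e \<bullet> edge_dir v j \<noteq> 0) \<and>
       (\<forall>v\<in>vertices P. \<forall>j\<in>tight v. - (\<Sum>i\<in>T. u i \<bullet> edge_dir v j) < 0 \<longrightarrow> \<eta> e \<bullet> edge_dir v j < 0) \<and>
       (\<forall>v\<in>vertices P. - (\<Sum>i\<in>T. u i \<bullet> (x - vertex_shift v h)) > 0 \<longrightarrow> \<eta> e \<bullet> (x - vertex_shift v h) > 0)"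
    by eventually_elim auto
  then obtain e where "(\<forall>v\<in>vertices P. \<forall>j\<in>tight v. \<eta> e \<bullet> edge_dir v j \<noteq> 0) \<and>
       (\<forall>v\<in>vertices P. \<forall>j\<in>tight v. - (\<Sum>i\<in>T. u i \<bullet> edge_dir v j) < 0 \<longrightarrow> \<eta> e \<bullet> edge_dir v j < 0) \<and>
       (\<forall>v\<in>vertices P. - (\<Sum>i\<in>T. u i \<bullet> (x - vertex_shift v h)) > 0 \<longrightarrow> \<eta> e \<bullet> (x - vertex_shift v h) > 0)"
    using eventually_happens'[OF trivial_limit_at_right_real] by blast
  define \<zeta> where "\<zeta> = \<eta> e"
  have \<zeta>: "\<And>v j. v \<in> vertices P \<Longrightarrow> j \<in> tight v \<Longrightarrow> \<zeta> \<bullet> edge_dir v j \<noteq> 0"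
      "\<And>v j. v \<in> vertices P \<Longrightarrow> j \<in> tight v \<Longrightarrow> (\<Sum>i\<in>T. u i \<bullet> edge_dir v j) > 0 \<Longrightarrow> \<zeta> \<bullet> edge_dir v j < 0"
      "\<And>v. v \<in> vertices P \<Longrightarrow> (\<Sum>i\<in>T. u i \<bullet> (x - vertex_shift v h)) < 0 \<Longrightarrow> \<zeta> \<bullet> (x - vertex_shift v h) > 0"
    using \<open>_ \<and> _ \<and> _\<close> unfolding \<zeta>_def by auto
  have pol\<zeta>: "polarizing P u \<mu> \<zeta>" using \<zeta>(1) by (auto simp: polarizing_iff)
  have indep: "?S \<xi> = ?S \<zeta>" by (simp only: polar_sum_expand[OF pol] polar_sum_expand[OF pol\<zeta>])
  let ?w = "\<lambda>j. half_step (s j)"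
  let ?t = "\<lambda>v. \<Prod>j\<in>tight v. if j \<in> flips \<zeta> v then 1 - ?w j else ?w j"
  have us: "u i \<bullet> (x - vertex_shift v h) = s i - slack_shift h i (vertex_shift v h)" for i v
    by (simp add: s_def slack_shift_diff)
  have expand: "\<zeta> \<bullet> (x - vertex_shift v h) = (\<Sum>j\<in>tight v. s j * (\<zeta> \<bullet> edge_dir v j))" if v: "v \<in> vertices P" for v
  proof -
    have "x - vertex_shift v h = (\<Sum>j\<in>tight v. (u j \<bullet> (x - vertex_shift v h)) *\<^sub>R edge_dir v j)"
      by (rule edge_dir_expand[OF v])
    also have "\<dots> = (\<Sum>j\<in>tight v. s j *\<^sub>R edge_dir v j)"
      by (intro sum.cong) (auto simp: us slack_shift_vertex[OF v])
    finally show ?thesis by (simp add: inner_sum_right)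
  qed
  have zero: "?t v = 0" if v: "v \<in> vertices P" and sep: "(\<Sum>i\<in>T. u i \<bullet> (x - vertex_shift v h)) < 0" for v
  proof (rule ccontr)
    assume "?t v \<noteq> 0"
    then have nz: "(if j \<in> flips \<zeta> v then 1 - ?w j else ?w j) \<noteq> 0" if "j \<in> tight v" for j
      using that prod_zero[of "tight v" "\<lambda>j. if j \<in> flips \<zeta> v then 1 - ?w j else ?w j"] by auto
    have "s j * (\<zeta> \<bullet> edge_dir v j) \<le> 0" if j: "j \<in> tight v" for j
    proof (cases "j \<in> flips \<zeta> v")
      case True
      then have "s j \<le> 0" "\<zeta> \<bullet> edge_dir v j > 0" using nz[OF j] by (auto simp: half_step_def flips_def split: if_splits)
      then show ?thesis by (simp add: mult_nonpos_nonneg)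
    next
      case False
      then have "s j \<ge> 0" "\<zeta> \<bullet> edge_dir v j \<le> 0" using nz[OF j] j by (auto simp: half_step_def flips_def split: if_splits)
      then show ?thesis by (simp add: mult_nonneg_nonpos)
    qed
    then have "\<zeta> \<bullet> (x - vertex_shift v h) \<le> 0" unfolding expand[OF v] by (rule sum_nonpos)
    then show False using \<zeta>(3)[OF v sep] by simp
  qed
  have hv: "slack_shift h i (vertex_shift v h) \<ge> 0" if "v \<in> vertices P" for i v
    using h that slack_shift_vertex[OF that, of i h] unfolding stable_shift_def
    by (cases "i \<in> tight v") (auto intro: less_imp_le)
  have "(\<Prod>i\<in>UNIV. ?w i) = ?S \<zeta>"
  proof (cases "\<exists>i. s i < 0")
    case True
    define i where "i = (SOME i. s i < 0)"
    have i: "s i < 0" "T = {i}" using someI_ex[OF True] True by (auto simp: i_def T_def)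
    have "?t v = 0" if "v \<in> vertices P" for v
      by (rule zero[OF that]) (use i hv[OF that, of i] in \<open>simp add: us\<close>)
    then have "?S \<zeta> = 0" unfolding s_def[symmetric]
      by (intro sum.neutral ballI) (simp only: mult_zero_right)
    moreover have "(\<Prod>i\<in>UNIV. ?w i) = 0" using i by (intro prod_zero bexI[of _ i]) (auto simp: half_step_def)
    ultimately show ?thesis by simp
  next
    case False
    then have s0: "s i \<ge> 0" for i by (meson not_less)
    have T: "T = {i. s i = 0}" using False by (simp add: T_def)
    have out: "?t v = 0" if v: "v \<in> vertices P" and nT: "\<not> T \<subseteq> tight v \<or> flips \<zeta> v \<noteq> {}" for v
    proof (cases "T \<subseteq> tight v")
      case False
      then obtain i where i: "i \<in> T" "i \<notin> tight v" by blast
      then have "slack_shift h i (vertex_shift v h) > 0" using h v by (auto simp: stable_shift_def)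
      then have "(\<Sum>i\<in>T. slack_shift h i (vertex_shift v h)) > 0"
        using hv[OF v] i by (intro sum_pos2) auto
      then have "(\<Sum>i\<in>T. u i \<bullet> (x - vertex_shift v h)) < 0" unfolding us T by (simp add: sum_subtractf sum_negf)
      then show ?thesis by (rule zero[OF v])
    next
      case True
      then obtain j where j: "j \<in> flips \<zeta> v" using nT by blast
      then have jt: "j \<in> tight v" by (auto simp: flips_def)
      have "j \<notin> T"
      proof
        assume "j \<in> T"
        have "(\<Sum>i\<in>T. u i \<bullet> edge_dir v j) = (\<Sum>i\<in>T. if i = j then 1 else 0)"
          using True by (intro sum.cong) (auto simp: edge_dir_dual[OF v])
        then have "(\<Sum>i\<in>T. u i \<bullet> edge_dir v j) > 0" using \<open>j \<in> T\<close> by simp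
        then show False using \<zeta>(2)[OF v jt] j by (simp add: flips_def)
      qed
      then have "?w j = 1" using s0[of j] T by (auto simp: half_step_def)
      then show ?thesis using j jt by (intro prod_zero bexI[of _ j]) auto
    qed
    (* The vertex where \<zeta> is maximal is the one with all edges flipped for -\<zeta>. *)
    have polm: "polarizing P u \<mu> (- \<zeta>)" using \<zeta>(1) by (auto simp: polarizing_iff)
    obtain v0 where v0: "v0 \<in> vertices P" using vertices_nonempty by blast
    obtain v where v: "v \<in> vertices P" "tight v \<subseteq> flips (- \<zeta>) v"
      using ex1_implies_ex[OF unique_flipped_vertex[OF polm v0, of "{}"]] by auto
    have vuniq: "w = v" if "w \<in> vertices P" "flips \<zeta> w = {}" for w
    proof -
      have "tight w \<subseteq> flips (- \<zeta>) w" using that \<zeta>(1)[OF that(1)] by (force simp: flips_def)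
      then show ?thesis using unique_flipped_vertex[OF polm v(1), of "{}"] v that by auto
    qed
    have neg: "\<zeta> \<bullet> edge_dir v j < 0" if "j \<in> tight v" for j using v(2) that by (auto simp: flips_def)
    then have nofl: "flips \<zeta> v = {}" by (force simp: flips_def)
    have Tv: "T \<subseteq> tight v"
    proof (rule ccontr)
      assume "\<not> T \<subseteq> tight v"
      then obtain i where i: "i \<in> T" "i \<notin> tight v" by blast
      then have "slack_shift h i (vertex_shift v h) > 0" using h v by (auto simp: stable_shift_def)
      then have "(\<Sum>i\<in>T. slack_shift h i (vertex_shift v h)) > 0"
        using hv[OF v(1)] i by (intro sum_pos2) auto
      then have "(\<Sum>i\<in>T. u i \<bullet> (x - vertex_shift v h)) < 0" unfolding us T by (simp add: sum_subtractf sum_negf)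
      then have "\<zeta> \<bullet> (x - vertex_shift v h) > 0" by (rule \<zeta>(3)[OF v(1)])
      moreover have "\<zeta> \<bullet> (x - vertex_shift v h) \<le> 0" unfolding expand[OF v(1)]
        using s0 neg by (intro sum_nonpos mult_nonneg_nonpos) (auto intro: less_imp_le)
      ultimately show False by simp
    qed
    have "?S \<zeta> = (\<Sum>w\<in>vertices P. if w = v then ?t v else 0)"
      unfolding s_def[symmetric]
    proof (rule sum.cong)
      fix w assume w: "w \<in> vertices P"
      show "(-1) ^ card (flips \<zeta> w) * ?t w = (if w = v then ?t v else 0)"
      proof (cases "w = v")
        case True
        then show ?thesis using nofl by simp
      next
        case False
        then have "?t w = 0" using vuniq[OF w] by (intro out[OF w]) blast
        then show ?thesis using False by simp
      qed
    qed simp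
    also have "\<dots> = ?t v" using v(1) finite_vertices by (simp add: sum.delta)
    also have "\<dots> = (\<Prod>j\<in>tight v. ?w j)" using nofl by simp
    also have "\<dots> = (\<Prod>j\<in>T. ?w j)"
      using Tv s0 by (intro prod.mono_neutral_right) (auto simp: T half_step_def less_le)
    also have "\<dots> = (\<Prod>i\<in>UNIV. ?w i)"
      using s0 by (intro prod.mono_neutral_left) (auto simp: T half_step_def less_le)
    finally show ?thesis by simp
  qed
  then show ?thesis unfolding indep by (simp add: s_def)
qed

lemma half_step_slack_prod:
  "(\<Prod>i\<in>UNIV. half_step (slack i x)) = (if x \<in> P then face_weight P x else 0)"
proof (cases "x \<in> P")
  case True
  then have s0: "slack i x \<ge> 0" for i by (simp add: mem_P_iff)
  have "(\<Prod>i\<in>UNIV. half_step (slack i x)) = (\<Prod>i\<in>tight x. half_step (slack i x))"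
    using s0 by (intro prod.mono_neutral_right) (auto simp: tight_iff half_step_def less_le)
  also have "\<dots> = (\<Prod>i\<in>tight x. 1/2)" by (intro prod.cong) (auto simp: tight_iff half_step_def)
  finally show ?thesis using True by (simp add: face_weight_eq power_one_over)
next
  case False
  then obtain i where "slack i x < 0" by (auto simp: mem_P_iff not_le)
  then have "half_step (slack i x) = 0" by (simp add: half_step_def)
  then have "(\<Prod>i\<in>UNIV. half_step (slack i x)) = 0" by (intro prod_zero) auto
  then show ?thesis using False by simp
qed

lemma vertex_shift_0: "vertex_shift v 0 = v"
  by (simp add: vertex_shift_def)

lemma stable_shift_0: "stable_shift 0"
  using eventually_stable_shift by blast

end

section \<open>The finite groups of a simple polytope\<close>

lemma int_lattice_add: "x \<in> int_lattice \<Longrightarrow> y \<in> int_lattice \<Longrightarrow> x + y \<in> int_lattice"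
  and int_lattice_diff: "x \<in> int_lattice \<Longrightarrow> y \<in> int_lattice \<Longrightarrow> x - y \<in> int_lattice"
  and int_lattice_zero: "0 \<in> int_lattice"
  and int_lattice_axis: "axis i 1 \<in> int_lattice"
  by (auto simp: int_lattice_def axis_def)

lemma int_lattice_scale: "c \<in> \<int> \<Longrightarrow> x \<in> int_lattice \<Longrightarrow> c *\<^sub>R x \<in> int_lattice"
  by (auto simp: int_lattice_def)

lemma int_lattice_sum: "(\<And>i. i \<in> S \<Longrightarrow> f i \<in> int_lattice) \<Longrightarrow> (\<Sum>i\<in>S. f i) \<in> int_lattice"
  by (induction S rule: infinite_finite_induct) (auto simp: int_lattice_zero int_lattice_add)

lemma int_lattice_inner: "x \<in> int_lattice \<Longrightarrow> y \<in> int_lattice \<Longrightarrow> x \<bullet> y \<in> \<int>"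
  unfolding int_lattice_def inner_vec_def by (auto intro!: Ints_sum)

lemma finite_bounded_int_lattice:
  assumes "bounded S"
  shows "finite (S \<inter> (int_lattice :: (real^'n) set))"
proof -
  obtain B where B: "\<And>x. x \<in> S \<Longrightarrow> norm x \<le> B" using assms by (auto simp: bounded_iff)
  let ?f = "\<lambda>x::real^'n. \<lambda>i. \<lfloor>x $ i\<rfloor>"
  have "?f ` (S \<inter> int_lattice) \<subseteq> PiE UNIV (\<lambda>_. {-\<lceil>B\<rceil>..\<lceil>B\<rceil>})"
  proof safe
    fix x :: "real^'n" and i assume x: "x \<in> S"
    have "\<bar>x $ i\<bar> \<le> B" using component_le_norm_cart[of x i] B[OF x] by linarith
    then show "\<lfloor>x $ i\<rfloor> \<in> {-\<lceil>B\<rceil>..\<lceil>B\<rceil>}" by simp linarith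
  qed auto
  then have "finite (?f ` (S \<inter> int_lattice))" by (rule finite_subset) (auto intro: finite_PiE)
  moreover have "inj_on ?f (S \<inter> int_lattice)"
  proof (rule inj_onI)
    fix x y :: "real^'n" assume xy: "x \<in> S \<inter> int_lattice" "y \<in> S \<inter> int_lattice" "?f x = ?f y"
    have "x $ i = y $ i" for i
    proof -
      have "x $ i \<in> \<int>" "y $ i \<in> \<int>" using xy by (auto simp: int_lattice_def)
      moreover have "\<lfloor>x $ i\<rfloor> = \<lfloor>y $ i\<rfloor>" using xy(3) by (rule fun_cong)
      ultimately show ?thesis by (metis Ints_cases floor_of_int)
    qed
    then show "x = y" by (simp add: vec_eq_iff)
  qed
  ultimately show ?thesis by (rule finite_imageD)
qed

lemma cis_2pi_Ints: "x \<in> \<int> \<Longrightarrow> cis (2 * pi * x) = 1"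
  by (elim Ints_cases) (simp add: cis_multiple_2pi)

lemma cis_2pi_eq_1_iff: "cis (2 * pi * x) = 1 \<longleftrightarrow> x \<in> \<int>"
proof
  assume "cis (2 * pi * x) = 1"
  then have "cos (2 * pi * x) = 1" by (metis cis.simps(1) one_complex.simps(1))
  then obtain n :: int where "2 * pi * x = of_int n * 2 * pi" by (auto simp: cos_one_2pi_int)
  then have "x = of_int n" by simp
  then show "x \<in> \<int>" by simp
qed (rule cis_2pi_Ints)

context simple_presentation
begin

definition coset :: "'d set \<Rightarrow> real^'n \<Rightarrow> (real^'n) set" where
  "coset A g = lattice_cong u A `` {g}"

lemma dual_expand:
  assumes v: "v \<in> vertices P"
  shows "g = (\<Sum>j\<in>tight v. (g \<bullet> edge_dir v j) *\<^sub>R u j)"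
proof -
  let ?d = "g - (\<Sum>j\<in>tight v. (g \<bullet> edge_dir v j) *\<^sub>R u j)"
  have d: "?d \<bullet> edge_dir v i = 0" if "i \<in> tight v" for i
  proof -
    have "(\<Sum>j\<in>tight v. (g \<bullet> edge_dir v j) *\<^sub>R u j) \<bullet> edge_dir v i =
        (\<Sum>j\<in>tight v. if j = i then g \<bullet> edge_dir v j else 0)"
      unfolding inner_sum_left by (intro sum.cong) (auto simp: edge_dir_dual[OF v])
    then show ?thesis using that by (simp add: inner_diff_left)
  qed
  have "?d \<bullet> ?d = (\<Sum>j\<in>tight v. (u j \<bullet> ?d) * (?d \<bullet> edge_dir v j))"
    by (subst (2) edge_dir_expand[OF v, of ?d]) (simp only: inner_sum_right inner_scaleR_right)
  also have "\<dots> = 0" using d by simp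
  finally show ?thesis by simp
qed

text \<open>The pairings with the edge vectors are the coordinates in the basis \<open>u\<^sub>i\<close>, so both lattices can be described by
  them.\<close>

lemma normal_lattice_iff:
  assumes v: "v \<in> vertices P" and A: "A \<subseteq> tight v"
  shows "g \<in> normal_lattice u A \<longleftrightarrow> g \<in> int_lattice \<and> (\<forall>j\<in>tight v - A. g \<bullet> edge_dir v j = 0)"
proof -
  have "g \<in> span (u ` A) \<longleftrightarrow> (\<forall>j\<in>tight v - A. g \<bullet> edge_dir v j = 0)"
  proof
    assume "g \<in> span (u ` A)"
    then show "\<forall>j\<in>tight v - A. g \<bullet> edge_dir v j = 0"
    proof (induction rule: span_induct_alt)
      case (step c x y)
      then show ?case using A edge_dir_dual[OF v] by (auto simp: inner_add_left)
    qed simp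
  next
    assume "\<forall>j\<in>tight v - A. g \<bullet> edge_dir v j = 0"
    then have "g = (\<Sum>j\<in>A. (g \<bullet> edge_dir v j) *\<^sub>R u j)"
      using A by (subst dual_expand[OF v, of g]) (intro sum.mono_neutral_right, auto)
    then show "g \<in> span (u ` A)" by (metis (no_types, lifting) imageI span_base span_scale span_sum)
  qed
  then show ?thesis by (auto simp: normal_lattice_def)
qed

lemma facet_lattice_iff:
  assumes v: "v \<in> vertices P" and A: "A \<subseteq> tight v"
  shows "g \<in> facet_lattice u A \<longleftrightarrow>
     (\<forall>j\<in>A. g \<bullet> edge_dir v j \<in> \<int>) \<and> (\<forall>j\<in>tight v - A. g \<bullet> edge_dir v j = 0)"
proof
  assume "g \<in> facet_lattice u A"
  then obtain m :: "'d \<Rightarrow> int" where m: "g = (\<Sum>i\<in>A. of_int (m i) *\<^sub>R u i)" by (auto simp: facet_lattice_def)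
  have "g \<bullet> edge_dir v j = (if j \<in> A then of_int (m j) else 0)" for j
  proof -
    have "g \<bullet> edge_dir v j = (\<Sum>i\<in>A. if i = j then of_int (m i) else 0)"
      unfolding m inner_sum_left using A by (intro sum.cong) (auto simp: edge_dir_dual[OF v])
    then show ?thesis by simp
  qed
  then show "(\<forall>j\<in>A. g \<bullet> edge_dir v j \<in> \<int>) \<and> (\<forall>j\<in>tight v - A. g \<bullet> edge_dir v j = 0)" by simp
next
  assume R: "(\<forall>j\<in>A. g \<bullet> edge_dir v j \<in> \<int>) \<and> (\<forall>j\<in>tight v - A. g \<bullet> edge_dir v j = 0)"
  then have "g = (\<Sum>j\<in>A. (g \<bullet> edge_dir v j) *\<^sub>R u j)"
    using A by (subst dual_expand[OF v, of g]) (intro sum.mono_neutral_right, auto)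
  also have "\<dots> = (\<Sum>j\<in>A. of_int \<lfloor>g \<bullet> edge_dir v j\<rfloor> *\<^sub>R u j)"
    using R by (intro sum.cong) (auto elim!: Ints_cases)
  finally show "g \<in> facet_lattice u A" unfolding facet_lattice_def
    by (intro CollectI exI[of _ "\<lambda>j. \<lfloor>g \<bullet> edge_dir v j\<rfloor>"] conjI TrueI)
qed

lemma equiv_lattice_cong:
  assumes "v \<in> vertices P" "A \<subseteq> tight v"
  shows "equiv (normal_lattice u A) (lattice_cong u A)"
proof (rule equivI)
  show "lattice_cong u A \<subseteq> normal_lattice u A \<times> normal_lattice u A" by (auto simp: lattice_cong_def)
  show "refl_on (normal_lattice u A) (lattice_cong u A)"
    by (auto simp: refl_on_def lattice_cong_def facet_lattice_iff[OF assms])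
  show "sym (lattice_cong u A)"
  proof (rule symI)
    fix x y assume "(x, y) \<in> lattice_cong u A"
    moreover have "c - d \<in> \<int> \<Longrightarrow> d - c \<in> \<int>" for c d :: real using Ints_minus[of "c - d"] by simp
    ultimately show "(y, x) \<in> lattice_cong u A"
      by (auto simp: lattice_cong_def facet_lattice_iff[OF assms] inner_diff_left)
  qed
  show "trans (lattice_cong u A)"
  proof (rule transI)
    fix x y z assume "(x, y) \<in> lattice_cong u A" "(y, z) \<in> lattice_cong u A"
    moreover have "c - d \<in> \<int> \<Longrightarrow> d - e \<in> \<int> \<Longrightarrow> c - e \<in> \<int>" for c d e :: real
      using Ints_add[of "c - d" "d - e"] by simp
    ultimately show "(x, z) \<in> lattice_cong u A"
      by (force simp: lattice_cong_def facet_lattice_iff[OF assms] inner_diff_left)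
  qed
qed

lemma Gamma_grp_eq: "Gamma_grp u A = coset A ` normal_lattice u A"
  by (auto simp: Gamma_grp_def quotient_def coset_def)

lemma coset_eq_iff:
  assumes "v \<in> vertices P" "A \<subseteq> tight v" "g \<in> normal_lattice u A" "g' \<in> normal_lattice u A"
  shows "coset A g = coset A g' \<longleftrightarrow> g - g' \<in> facet_lattice u A"
  unfolding coset_def eq_equiv_class_iff[OF equiv_lattice_cong[OF assms(1,2)] assms(3,4)]
  using assms by (auto simp: lattice_cong_def)

lemma mem_coset_iff: "y \<in> coset A g \<longleftrightarrow> (g, y) \<in> lattice_cong u A"
  by (simp add: coset_def)

lemma coset_self: "v \<in> vertices P \<Longrightarrow> A \<subseteq> tight v \<Longrightarrow> g \<in> normal_lattice u A \<Longrightarrow> g \<in> coset A g"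
  unfolding coset_def by (rule equiv_class_self[OF equiv_lattice_cong])

lemma lattice_mono:
  assumes "v \<in> vertices P" "A \<subseteq> B" "B \<subseteq> tight v"
  shows "normal_lattice u A \<subseteq> normal_lattice u B" "facet_lattice u A \<subseteq> facet_lattice u B"
proof -
  have A: "A \<subseteq> tight v" using assms by blast
  show "normal_lattice u A \<subseteq> normal_lattice u B"
    unfolding subset_iff normal_lattice_iff[OF assms(1) A] normal_lattice_iff[OF assms(1,3)]
    using assms(2) by blast
  have "x \<bullet> edge_dir v j \<in> \<int>" if "\<forall>j\<in>A. x \<bullet> edge_dir v j \<in> \<int>" "\<forall>j\<in>tight v - A. x \<bullet> edge_dir v j = 0"
    "j \<in> B" for x j
    using that assms(3) by (cases "j \<in> A") auto
  then show "facet_lattice u A \<subseteq> facet_lattice u B"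
    unfolding subset_iff facet_lattice_iff[OF assms(1) A] facet_lattice_iff[OF assms(1,3)]
    using assms(2) by blast
qed

lemma Gamma_map_coset:
  assumes v: "v \<in> vertices P" and AB: "A \<subseteq> B" "B \<subseteq> tight v" and g: "g \<in> normal_lattice u A"
  shows "Gamma_map u B (coset A g) = coset B g"
proof -
  note M = lattice_mono[OF v AB]
  have A: "A \<subseteq> tight v" using AB by blast
  have "coset B y = coset B g" if "y \<in> coset A g" for y
  proof -
    have "y \<in> normal_lattice u A" "g - y \<in> facet_lattice u A" using that by (auto simp: mem_coset_iff lattice_cong_def)
    then show ?thesis using M g coset_eq_iff[OF v AB(2), of g y] by auto
  qed
  then have "(\<Union>y\<in>coset A g. coset B y) = (\<Union>y\<in>coset A g. coset B g)" by (rule SUP_cong[OF refl])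
  also have "\<dots> = coset B g" using coset_self[OF v A g] by blast
  finally have "(\<Union>y\<in>coset A g. coset B y) = coset B g" .
  moreover have "Gamma_map u B (coset A g) = (\<Union>y\<in>coset A g. coset B y)"
    by (auto simp: Gamma_map_def coset_def)
  ultimately show ?thesis by simp
qed

lemma normal_lattice_vertex: "v \<in> vertices P \<Longrightarrow> normal_lattice u (tight v) = int_lattice"
  using normal_lattice_iff[of v "tight v"] by auto

lemma lam_vertex_coset:
  assumes v: "v \<in> vertices P" and g: "g \<in> int_lattice" and j: "j \<in> tight v"
  shows "lam_vertex u (tight v) (coset (tight v) g) j = cis (2 * pi * (g \<bullet> edge_dir v j))"
proof -
  have gself: "g \<in> coset (tight v) g" using coset_self[OF v order_refl] g by (simp add: normal_lattice_vertex[OF v])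
  have const: "cis (2 * pi * (y \<bullet> edge_dir v j)) = cis (2 * pi * (g \<bullet> edge_dir v j))" if "y \<in> coset (tight v) g" for y
  proof -
    have "(g - y) \<bullet> edge_dir v j \<in> \<int>"
      using that j by (auto simp: mem_coset_iff lattice_cong_def facet_lattice_iff[OF v order_refl])
    then have "cis (2 * pi * ((g - y) \<bullet> edge_dir v j)) = 1" by (rule cis_2pi_Ints)
    moreover have "2 * pi * (g \<bullet> edge_dir v j) = 2 * pi * (y \<bullet> edge_dir v j) + 2 * pi * ((g - y) \<bullet> edge_dir v j)"
      by (simp add: inner_diff_left algebra_simps)
    ultimately show ?thesis by (simp flip: cis_mult)
  qed
  show ?thesis unfolding lam_vertex_def
  proof (rule the_elem_image_unique)
    show "coset (tight v) g \<noteq> {}" using gself by blast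
  qed (rule const)
qed

text \<open>For \<open>g\<close> in the span of the normals of the facets through \<open>F\<close>, the pairing \<open>\<langle>g, \<alpha>\<^bsub>j,v\<^esub>\<rangle>\<close> is the coefficient of
  \<open>u\<^sub>j\<close> in \<open>g\<close>; this is why the choice of the vertex does not matter.\<close>

lemma lam_face_coset:
  assumes F: "F \<in> faces P" and v: "v \<in> vertices P" and A: "facet_idx u \<mu> F \<subseteq> tight v"
    and g: "g \<in> normal_lattice u (facet_idx u \<mu> F)" and j: "j \<in> facet_idx u \<mu> F"
  shows "lam_face P u \<mu> F (coset (facet_idx u \<mu> F) g) j = cis (2 * pi * (g \<bullet> edge_dir v j))"
proof -
  let ?A = "facet_idx u \<mu> F"
  define w where "w = (SOME v. v \<in> vertices P \<and> v \<in> F)"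
  have w: "w \<in> vertices P" "w \<in> F" using someI_ex[OF face_has_vertex[OF F]] by (auto simp: w_def)
  have Aw: "?A \<subseteq> tight w" by (rule facet_idx_subset_vertex[OF w(2)])
  have gint: "g \<in> int_lattice" using g by (simp add: normal_lattice_def)
  have "g = (\<Sum>i\<in>tight v. (g \<bullet> edge_dir v i) *\<^sub>R u i)" by (rule dual_expand[OF v])
  also have "\<dots> = (\<Sum>i\<in>?A. (g \<bullet> edge_dir v i) *\<^sub>R u i)"
    using g A by (intro sum.mono_neutral_right) (auto simp: normal_lattice_iff[OF v A])
  finally have "g \<bullet> edge_dir w j = (\<Sum>i\<in>?A. (g \<bullet> edge_dir v i) *\<^sub>R u i) \<bullet> edge_dir w j" by simp
  also have "\<dots> = (\<Sum>i\<in>?A. if i = j then g \<bullet> edge_dir v i else 0)"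
    unfolding inner_sum_left using Aw by (intro sum.cong) (auto simp: edge_dir_dual[OF w(1)])
  finally have "g \<bullet> edge_dir w j = g \<bullet> edge_dir v j" using j by simp
  moreover have "lam_face P u \<mu> F (coset ?A g) j = lam_vertex u (tight w) (Gamma_map u (tight w) (coset ?A g)) j"
    using j by (simp add: lam_face_def w_def Let_def)
  ultimately show ?thesis using Gamma_map_coset[OF w(1) Aw order_refl g] lam_vertex_coset[OF w(1) gint] j Aw
    by auto
qed

text \<open>If the coefficient of one \<open>u\<^sub>j\<close> in \<open>g\<close> is an integer, it can be removed without changing the coset, and the
  rest lies in the span belonging to a larger face.\<close>

lemma coset_in_flat_iff:
  assumes F: "F \<in> faces P" and v: "v \<in> vertices P" and A: "facet_idx u \<mu> F \<subseteq> tight v"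
    and g: "g \<in> normal_lattice u (facet_idx u \<mu> F)"
  shows "coset (facet_idx u \<mu> F) g \<in> Gamma_flat P u \<mu> F \<longleftrightarrow>
     (\<forall>j\<in>facet_idx u \<mu> F. g \<bullet> edge_dir v j \<notin> \<int>)"
proof -
  let ?A = "facet_idx u \<mu> F"
  have inG: "coset ?A g \<in> Gamma_face u \<mu> F" using g by (auto simp: Gamma_face_def Gamma_grp_eq)
  have gv: "g \<bullet> edge_dir v i = 0" if "i \<in> tight v" "i \<notin> ?A" for i
    using g that by (auto simp: normal_lattice_iff[OF v A])
  show ?thesis
  proof
    assume flat: "coset ?A g \<in> Gamma_flat P u \<mu> F"
    show "\<forall>j\<in>?A. g \<bullet> edge_dir v j \<notin> \<int>"
    proof (intro ballI notI)
      fix j assume j: "j \<in> ?A" and int: "g \<bullet> edge_dir v j \<in> \<int>"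
      let ?B = "?A - {j}"
      have B: "?B \<subseteq> tight v" using A by blast
      let ?E = "face_on ?B"
      have E: "?E \<in> faces P" "facet_idx u \<mu> ?E = ?B"
        using face_on_in_faces[OF v B] facet_idx_face_on[OF v B] by auto
      have "F \<subseteq> ?E" using face_eq_face_on[OF F] by (auto simp: face_on_def)
      moreover have "F \<noteq> ?E"
      proof
        assume "F = ?E"
        then have "?A = ?B" using E(2) by simp
        then show False using j by blast
      qed
      ultimately have FE: "F \<subset> ?E" by blast
      define g' where "g' = g - (g \<bullet> edge_dir v j) *\<^sub>R u j"
      have g'dir: "g' \<bullet> edge_dir v i = (if i = j then 0 else g \<bullet> edge_dir v i)" if "i \<in> tight v" for i
        using edge_dir_dual[OF v, of j i] j A by (auto simp: g'_def inner_diff_left)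
      have g'int: "g' \<in> int_lattice" unfolding g'_def
        using g int u_int by (intro int_lattice_diff int_lattice_scale) (auto simp: normal_lattice_def)
      have g'B: "g' \<in> normal_lattice u ?B"
        using g'int g'dir gv by (auto simp: normal_lattice_iff[OF v B])
      have g'A: "g' \<in> normal_lattice u ?A" using lattice_mono(1)[OF v, of ?B ?A] g'B A by blast
      have "g - g' \<in> facet_lattice u ?A"
        using int A edge_dir_dual[OF v, of j] j by (auto simp: g'_def facet_lattice_iff[OF v A])
      then have "coset ?A g = coset ?A g'" using coset_eq_iff[OF v A g g'A] by blast
      also have "\<dots> = Gamma_map u ?A (coset ?B g')"
        by (rule Gamma_map_coset[OF v _ A g'B, symmetric]) blast
      finally have "coset ?A g \<in> Gamma_map u ?A ` Gamma_face u \<mu> ?E"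
        using g'B E(2) by (auto simp: Gamma_face_def Gamma_grp_eq)
      then show False using flat E(1) FE unfolding Gamma_flat_def by blast
    qed
  next
    assume nint: "\<forall>j\<in>?A. g \<bullet> edge_dir v j \<notin> \<int>"
    show "coset ?A g \<in> Gamma_flat P u \<mu> F"
    proof (rule ccontr)
      assume "coset ?A g \<notin> Gamma_flat P u \<mu> F"
      then obtain E \<gamma> where E: "E \<in> faces P" "F \<subset> E" "\<gamma> \<in> Gamma_face u \<mu> E" "coset ?A g = Gamma_map u ?A \<gamma>"
        using inG unfolding Gamma_flat_def by blast
      let ?B = "facet_idx u \<mu> E"
      have BA: "?B \<subset> ?A" by (rule face_on_strict[OF F E(1,2)])
      then have B: "?B \<subseteq> tight v" using A by blast
      obtain g' where g': "g' \<in> normal_lattice u ?B" "\<gamma> = coset ?B g'"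
        using E(3) by (auto simp: Gamma_face_def Gamma_grp_eq)
      have "coset ?A g = coset ?A g'" using Gamma_map_coset[OF v _ A g'(1)] BA E(4) g'(2) by auto
      moreover have "g' \<in> normal_lattice u ?A" using lattice_mono(1)[OF v _ A, of ?B] BA g'(1) by blast
      ultimately have L: "g - g' \<in> facet_lattice u ?A" using coset_eq_iff[OF v A g] by blast
      obtain j where j: "j \<in> ?A" "j \<notin> ?B" using BA by blast
      then have "g' \<bullet> edge_dir v j = 0" using g'(1) A by (auto simp: normal_lattice_iff[OF v B])
      moreover have "(g - g') \<bullet> edge_dir v j \<in> \<int>" using L j by (auto simp: facet_lattice_iff[OF v A])
      ultimately show False using nint j by (simp add: inner_diff_left)
    qed
  qed
qed

lemma flat_facets:
  assumes F: "F \<in> faces P" and v: "v \<in> vertices P" and A: "facet_idx u \<mu> F \<subseteq> tight v"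
    and g: "g \<in> normal_lattice u (facet_idx u \<mu> F)"
    and flat: "coset (facet_idx u \<mu> F) g \<in> Gamma_flat P u \<mu> F"
  shows "facet_idx u \<mu> F = {j \<in> tight v. g \<bullet> edge_dir v j \<notin> \<int>}"
proof (intro equalityI subsetI)
  fix j assume "j \<in> facet_idx u \<mu> F"
  then show "j \<in> {j \<in> tight v. g \<bullet> edge_dir v j \<notin> \<int>}"
    using coset_in_flat_iff[OF F v A g] flat A by auto
next
  fix j assume j: "j \<in> {j \<in> tight v. g \<bullet> edge_dir v j \<notin> \<int>}"
  show "j \<in> facet_idx u \<mu> F"
  proof (rule ccontr)
    assume "j \<notin> facet_idx u \<mu> F"
    then have "g \<bullet> edge_dir v j = 0" using g j by (auto simp: normal_lattice_iff[OF v A])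
    then show False using j by simp
  qed
qed

text \<open>Every coset meets the bounded half-open cell spanned by the normals.\<close>

lemma finite_Gamma_vertex:
  assumes v: "v \<in> vertices P"
  shows "finite (Gamma_grp u (tight v))"
proof -
  let ?S = "{x. \<forall>j\<in>tight v. 0 \<le> x \<bullet> edge_dir v j \<and> x \<bullet> edge_dir v j < 1}"
  have "norm x \<le> (\<Sum>j\<in>tight v. norm (u j))" if "x \<in> ?S" for x
  proof -
    have "norm x \<le> (\<Sum>j\<in>tight v. norm ((x \<bullet> edge_dir v j) *\<^sub>R u j))"
      by (subst dual_expand[OF v, of x]) (rule norm_sum)
    also have "\<dots> \<le> (\<Sum>j\<in>tight v. norm (u j))"
      using that by (intro sum_mono) (auto intro!: mult_left_le_one_le simp: less_imp_le)
    finally show ?thesis .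
  qed
  then have "bounded ?S" by (auto simp: bounded_iff)
  then have fin: "finite (?S \<inter> int_lattice)" by (rule finite_bounded_int_lattice)
  have "Gamma_grp u (tight v) \<subseteq> coset (tight v) ` (?S \<inter> int_lattice)"
  proof
    fix \<gamma> assume "\<gamma> \<in> Gamma_grp u (tight v)"
    then obtain g where g: "g \<in> int_lattice" "\<gamma> = coset (tight v) g"
      by (auto simp: Gamma_grp_eq normal_lattice_vertex[OF v])
    define l where "l = (\<Sum>j\<in>tight v. of_int \<lfloor>g \<bullet> edge_dir v j\<rfloor> *\<^sub>R u j)"
    have lL: "l \<in> facet_lattice u (tight v)"
      unfolding l_def facet_lattice_def by (rule CollectI, rule exI[of _ "\<lambda>j. \<lfloor>g \<bullet> edge_dir v j\<rfloor>"]) simp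
    have lint: "l \<in> int_lattice" unfolding l_def by (intro int_lattice_sum int_lattice_scale u_int) auto
    have "l \<bullet> edge_dir v j = of_int \<lfloor>g \<bullet> edge_dir v j\<rfloor>" if "j \<in> tight v" for j
    proof -
      have "l \<bullet> edge_dir v j = (\<Sum>i\<in>tight v. if i = j then of_int \<lfloor>g \<bullet> edge_dir v i\<rfloor> else 0)"
        unfolding l_def inner_sum_left by (intro sum.cong) (auto simp: edge_dir_dual[OF v])
      then show ?thesis using that by simp
    qed
    then have "g - l \<in> ?S" by (auto simp: inner_diff_left) linarith
    moreover have "g - l \<in> int_lattice" using g(1) lint by (rule int_lattice_diff)
    moreover have "coset (tight v) g = coset (tight v) (g - l)"
      using coset_eq_iff[OF v order_refl, of g "g - l"] g(1) lL \<open>g - l \<in> int_lattice\<close>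
      by (simp add: normal_lattice_vertex[OF v])
    ultimately show "\<gamma> \<in> coset (tight v) ` (?S \<inter> int_lattice)" using g(2) by blast
  qed
  then show ?thesis using fin finite_subset by blast
qed

text \<open>Two multiples of \<open>g\<close> lie in the same coset because there are only finitely many cosets.\<close>

lemma lam_vertex_root_of_unity:
  assumes v: "v \<in> vertices P" and \<gamma>: "\<gamma> \<in> Gamma_grp u (tight v)" and j: "j \<in> tight v"
  shows "\<exists>N>0. lam_vertex u (tight v) \<gamma> j ^ N = 1"
proof -
  obtain g where g: "g \<in> int_lattice" "\<gamma> = coset (tight v) g"
    using \<gamma> by (auto simp: Gamma_grp_eq normal_lattice_vertex[OF v])
  have mg: "real m *\<^sub>R g \<in> int_lattice" for m by (intro int_lattice_scale g) auto
  let ?f = "\<lambda>m. coset (tight v) (real m *\<^sub>R g)"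
  have "range ?f \<subseteq> Gamma_grp u (tight v)"
    using mg by (auto simp: Gamma_grp_eq normal_lattice_vertex[OF v])
  then have "\<not> inj ?f" using finite_Gamma_vertex[OF v] finite_subset infinite_UNIV_nat finite_imageD by blast
  then obtain a b where ab: "a \<noteq> b" "?f a = ?f b" unfolding inj_on_def by blast
  obtain m n where mn: "m < n" "?f m = ?f n"
  proof (cases "a < b")
    case True
    then show thesis using that ab(2) by blast
  next
    case False
    then have "b < a" using ab(1) by simp
    then show thesis using that[of b a] ab(2)[symmetric] by blast
  qed
  then have "real n *\<^sub>R g - real m *\<^sub>R g \<in> facet_lattice u (tight v)"
    using coset_eq_iff[OF v order_refl, of "real n *\<^sub>R g" "real m *\<^sub>R g"] mg by (simp add: normal_lattice_vertex[OF v])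
  then have "(real n *\<^sub>R g - real m *\<^sub>R g) \<bullet> edge_dir v j \<in> \<int>" using j by (auto simp: facet_lattice_iff[OF v order_refl])
  then have "real (n - m) * (g \<bullet> edge_dir v j) \<in> \<int>"
    using mn(1) by (simp add: inner_diff_left of_nat_diff left_diff_distrib)
  then have "cis (2 * pi * (real (n - m) * (g \<bullet> edge_dir v j))) = 1" by (rule cis_2pi_Ints)
  then have "cis (2 * pi * (g \<bullet> edge_dir v j)) ^ (n - m) = 1"
    by (simp add: Complex.DeMoivre mult_ac)
  then show ?thesis using mn(1) g lam_vertex_coset[OF v g(1) j] by (intro exI[of _ "n - m"]) auto
qed

text \<open>Orthogonality of characters detects the lattice points among the integer combinations of the
  edge vectors: if the combination \<open>x\<close> has a coordinate that is not an integer, translating the group by the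
  class of that coordinate functional multiplies the sum by a number other than 1.\<close>

lemma character_sum:
  assumes v: "v \<in> vertices P"
  shows "(\<Sum>\<gamma>\<in>Gamma_grp u (tight v). \<Prod>j\<in>tight v. lam_vertex u (tight v) \<gamma> j powi m j) =
    (if (\<Sum>j\<in>tight v. of_int (m j) *\<^sub>R edge_dir v j) \<in> int_lattice
     then of_nat (card (Gamma_grp u (tight v))) else 0)"
proof -
  let ?G = "Gamma_grp u (tight v)"
  define x where "x = (\<Sum>j\<in>tight v. of_int (m j) *\<^sub>R edge_dir v j)"
  define f where "f \<gamma> = (\<Prod>j\<in>tight v. lam_vertex u (tight v) \<gamma> j powi m j)" for \<gamma>
  have G: "?G = coset (tight v) ` int_lattice" by (simp add: Gamma_grp_eq normal_lattice_vertex[OF v])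
  have f: "f (coset (tight v) g) = cis (2 * pi * (g \<bullet> x))" if g: "g \<in> int_lattice" for g
  proof -
    have prod_cis: "(\<Prod>j\<in>S. cis (h j)) = cis (\<Sum>j\<in>S. h j)" for S :: "'d set" and h
      by (induction S rule: infinite_finite_induct) (auto simp: cis_mult)
    have "f (coset (tight v) g) = (\<Prod>j\<in>tight v. cis (of_int (m j) * (2 * pi * (g \<bullet> edge_dir v j))))"
      unfolding f_def by (intro prod.cong) (auto simp: lam_vertex_coset[OF v g] cis_power_int mult_ac)
    also have "\<dots> = cis (2 * pi * (g \<bullet> x))"
      unfolding prod_cis by (simp add: x_def inner_sum_right sum_distrib_left mult_ac)
    finally show ?thesis .
  qed
  show ?thesis
  proof (cases "x \<in> int_lattice")
    case True
    have "f \<gamma> = 1" if "\<gamma> \<in> ?G" for \<gamma>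
      using that f True by (auto simp: G int_lattice_inner cis_2pi_Ints)
    then show ?thesis using True unfolding f_def x_def by simp
  next
    case False
    then obtain i where i: "x $ i \<notin> \<int>" by (auto simp: int_lattice_def)
    let ?e = "axis i 1 :: real^'n"
    let ?t = "\<lambda>\<gamma>. (\<lambda>g. g + ?e) ` \<gamma>"
    have t: "?t (coset (tight v) g) = coset (tight v) (g + ?e)" if g: "g \<in> int_lattice" for g
    proof
      show "?t (coset (tight v) g) \<subseteq> coset (tight v) (g + ?e)"
        by (auto simp: mem_coset_iff lattice_cong_def normal_lattice_vertex[OF v] int_lattice_add int_lattice_axis)
      show "coset (tight v) (g + ?e) \<subseteq> ?t (coset (tight v) g)"
      proof
        fix y assume y: "y \<in> coset (tight v) (g + ?e)"
        have eq: "g - (y - ?e) = g + ?e - y" by simp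
        have "y - ?e \<in> coset (tight v) g" using y g
          by (auto simp: mem_coset_iff lattice_cong_def normal_lattice_vertex[OF v] int_lattice_diff int_lattice_axis eq)
        then show "y \<in> ?t (coset (tight v) g)" by (intro image_eqI[of _ _ "y - ?e"]) auto
      qed
    qed
    have "bij_betw ?t ?G ?G"
    proof (rule bij_betw_imageI)
      have "inj (\<lambda>g. g + ?e)" by (simp add: inj_def)
      then show "inj_on ?t ?G" by (intro inj_onI) (simp only: inj_image_eq_iff)
      show "?t ` ?G = ?G"
      proof
        show "?t ` ?G \<subseteq> ?G" using t by (auto simp: G int_lattice_add int_lattice_axis)
        show "?G \<subseteq> ?t ` ?G"
        proof
          fix \<gamma> assume "\<gamma> \<in> ?G"
          then obtain g where g: "g \<in> int_lattice" "\<gamma> = coset (tight v) g" by (auto simp: G)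
          then have g': "g - ?e \<in> int_lattice" by (simp add: int_lattice_diff int_lattice_axis)
          have "\<gamma> = ?t (coset (tight v) (g - ?e))" using t[OF g'] g(2) by simp
          then show "\<gamma> \<in> ?t ` ?G" using g' by (auto simp: G)
        qed
      qed
    qed
    then have "(\<Sum>\<gamma>\<in>?G. f \<gamma>) = (\<Sum>\<gamma>\<in>?G. f (?t \<gamma>))"
      by (intro sum.reindex_bij_betw[symmetric])
    also have "\<dots> = (\<Sum>\<gamma>\<in>?G. cis (2 * pi * (x $ i)) * f \<gamma>)"
    proof (rule sum.cong)
      fix \<gamma> assume "\<gamma> \<in> ?G"
      then obtain g where g: "g \<in> int_lattice" "\<gamma> = coset (tight v) g" by (auto simp: G)
      have "(g + ?e) \<bullet> x = g \<bullet> x + x $ i" by (simp add: inner_add_left inner_axis')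
      then show "f (?t \<gamma>) = cis (2 * pi * (x $ i)) * f \<gamma>"
        using g by (simp add: t f int_lattice_add int_lattice_axis cis_mult algebra_simps)
    qed simp
    also have "\<dots> = cis (2 * pi * (x $ i)) * (\<Sum>\<gamma>\<in>?G. f \<gamma>)" by (simp add: sum_distrib_left)
    finally have "(1 - cis (2 * pi * (x $ i))) * (\<Sum>\<gamma>\<in>?G. f \<gamma>) = 0" by (simp add: algebra_simps)
    moreover have "1 - cis (2 * pi * (x $ i)) \<noteq> 0" using i cis_2pi_eq_1_iff by auto
    ultimately have "(\<Sum>\<gamma>\<in>?G. f \<gamma>) = 0" by simp
    then show ?thesis using False unfolding f_def x_def by simp
  qed
qed

text \<open>At a vertex \<open>v\<close>, the pairs \<open>(F, \<gamma>)\<close> with \<open>v \<in> F\<close> and \<open>\<gamma> \<in> \<Gamma>\<^sub>F\<^sup>\<flat>\<close> enumerate \<open>\<Gamma>\<^sub>v\<close>: the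
  face belonging to \<open>\<gamma> \<in> \<Gamma>\<^sub>v\<close> is cut out by the facets whose root of unity is not 1.\<close>

lemma Gamma_flat_cases:
  assumes v: "v \<in> vertices P" and A: "facet_idx u \<mu> F \<subseteq> tight v" and \<gamma>: "\<gamma> \<in> Gamma_flat P u \<mu> F"
  obtains g where "g \<in> normal_lattice u (facet_idx u \<mu> F)" "\<gamma> = coset (facet_idx u \<mu> F) g"
    "Gamma_map u (tight v) \<gamma> = coset (tight v) g"
  using \<gamma> Gamma_map_coset[OF v A order_refl] unfolding Gamma_flat_def Gamma_face_def Gamma_grp_eq by blast

lemma lam_face_eq_lam_vertex:
  assumes F: "F \<in> faces P" and v: "v \<in> vertices P" and A: "facet_idx u \<mu> F \<subseteq> tight v"
    and \<gamma>: "\<gamma> \<in> Gamma_flat P u \<mu> F" and j: "j \<in> tight v"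
  shows "lam_face P u \<mu> F \<gamma> j = lam_vertex u (tight v) (Gamma_map u (tight v) \<gamma>) j"
proof -
  obtain g where g: "g \<in> normal_lattice u (facet_idx u \<mu> F)" "\<gamma> = coset (facet_idx u \<mu> F) g"
    "Gamma_map u (tight v) \<gamma> = coset (tight v) g" using Gamma_flat_cases[OF v A \<gamma>] .
  have gint: "g \<in> int_lattice" using g(1) by (simp add: normal_lattice_def)
  have "lam_vertex u (tight v) (Gamma_map u (tight v) \<gamma>) j = cis (2 * pi * (g \<bullet> edge_dir v j))"
    using lam_vertex_coset[OF v gint j] g(3) by simp
  moreover have "lam_face P u \<mu> F \<gamma> j = cis (2 * pi * (g \<bullet> edge_dir v j))"
  proof (cases "j \<in> facet_idx u \<mu> F")
    case True
    then show ?thesis using lam_face_coset[OF F v A g(1)] g(2) by simp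
  next
    case False
    then have "g \<bullet> edge_dir v j = 0" using g(1) j by (auto simp: normal_lattice_iff[OF v A])
    then show ?thesis using False by (simp add: lam_face_def)
  qed
  ultimately show ?thesis by simp
qed

lemma lam_face_flat_ne_1:
  assumes F: "F \<in> faces P" and \<gamma>: "\<gamma> \<in> Gamma_flat P u \<mu> F" and j: "j \<in> facet_idx u \<mu> F"
  shows "lam_face P u \<mu> F \<gamma> j \<noteq> 1"
proof -
  obtain v where v: "v \<in> vertices P" "v \<in> F" using face_has_vertex[OF F] by blast
  have A: "facet_idx u \<mu> F \<subseteq> tight v" by (rule facet_idx_subset_vertex[OF v(2)])
  obtain g where g: "g \<in> normal_lattice u (facet_idx u \<mu> F)" "\<gamma> = coset (facet_idx u \<mu> F) g"
    using Gamma_flat_cases[OF v(1) A \<gamma>] .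
  then show ?thesis
    using coset_in_flat_iff[OF F v(1) A g(1)] \<gamma> j lam_face_coset[OF F v(1) A g(1) j] cis_2pi_eq_1_iff by auto
qed

lemma Gamma_flat_bij:
  assumes v: "v \<in> vertices P"
  shows "bij_betw (\<lambda>(F, \<gamma>). Gamma_map u (tight v) \<gamma>)
     (SIGMA F:{F \<in> faces P. facet_idx u \<mu> F \<subseteq> tight v}. Gamma_flat P u \<mu> F) (Gamma_grp u (tight v))"
proof (rule bij_betw_imageI)
  let ?D = "SIGMA F:{F \<in> faces P. facet_idx u \<mu> F \<subseteq> tight v}. Gamma_flat P u \<mu> F"
  let ?\<phi> = "\<lambda>(F :: (real^'n) set, \<gamma>). Gamma_map u (tight v) \<gamma>"
  show "inj_on ?\<phi> ?D"
  proof (rule inj_onI, clarify)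
    fix F F' \<gamma> \<gamma>'
    assume F: "F \<in> faces P" "facet_idx u \<mu> F \<subseteq> tight v" "\<gamma> \<in> Gamma_flat P u \<mu> F"
      and F': "F' \<in> faces P" "facet_idx u \<mu> F' \<subseteq> tight v" "\<gamma>' \<in> Gamma_flat P u \<mu> F'"
      and eq: "Gamma_map u (tight v) \<gamma> = Gamma_map u (tight v) \<gamma>'"
    obtain g where g: "g \<in> normal_lattice u (facet_idx u \<mu> F)" "\<gamma> = coset (facet_idx u \<mu> F) g"
      "Gamma_map u (tight v) \<gamma> = coset (tight v) g" using Gamma_flat_cases[OF v F(2,3)] .
    obtain g' where g': "g' \<in> normal_lattice u (facet_idx u \<mu> F')" "\<gamma>' = coset (facet_idx u \<mu> F') g'"
      "Gamma_map u (tight v) \<gamma>' = coset (tight v) g'" using Gamma_flat_cases[OF v F'(2,3)] .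
    have ints: "g \<in> int_lattice" "g' \<in> int_lattice" using g(1) g'(1) by (auto simp: normal_lattice_def)
    have L: "g - g' \<in> facet_lattice u (tight v)"
      using coset_eq_iff[OF v order_refl, of g g'] ints eq g(3) g'(3) by (simp add: normal_lattice_vertex[OF v])
    have I: "facet_idx u \<mu> F = {j \<in> tight v. g \<bullet> edge_dir v j \<notin> \<int>}"
      using flat_facets[OF F(1) v F(2) g(1)] F(3) g(2) by simp
    have I': "facet_idx u \<mu> F' = {j \<in> tight v. g' \<bullet> edge_dir v j \<notin> \<int>}"
      using flat_facets[OF F'(1) v F'(2) g'(1)] F'(3) g'(2) by simp
    have "g \<bullet> edge_dir v j \<in> \<int> \<longleftrightarrow> g' \<bullet> edge_dir v j \<in> \<int>" if "j \<in> tight v" for j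
    proof -
      have d: "g \<bullet> edge_dir v j - g' \<bullet> edge_dir v j \<in> \<int>"
        using L that by (auto simp: facet_lattice_iff[OF v order_refl] inner_diff_left)
      show ?thesis
        using Ints_add[OF d, of "g' \<bullet> edge_dir v j"] Ints_diff[OF _ d, of "g \<bullet> edge_dir v j"] by auto
    qed
    then have II: "facet_idx u \<mu> F = facet_idx u \<mu> F'" unfolding I I' by blast
    then have FF: "F = F'" using face_eq_face_on[OF F(1)] face_eq_face_on[OF F'(1)] by simp
    have g'F: "g' \<in> normal_lattice u (facet_idx u \<mu> F)" using g'(1) by (simp only: II)
    have "g - g' \<in> facet_lattice u (facet_idx u \<mu> F)"
      using L g(1) g'F F(2) by (auto simp: facet_lattice_iff[OF v F(2)] facet_lattice_iff[OF v order_refl]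
          normal_lattice_iff[OF v F(2)] inner_diff_left)
    then have "\<gamma> = \<gamma>'" using coset_eq_iff[OF v F(2) g(1), of g'] g g' II by simp
    then show "F = F' \<and> \<gamma> = \<gamma>'" using FF by simp
  qed
  show "?\<phi> ` ?D = Gamma_grp u (tight v)"
  proof
    show "?\<phi> ` ?D \<subseteq> Gamma_grp u (tight v)"
    proof clarify
      fix F \<gamma> assume F: "F \<in> faces P" "facet_idx u \<mu> F \<subseteq> tight v" "\<gamma> \<in> Gamma_flat P u \<mu> F"
      obtain g where g: "g \<in> normal_lattice u (facet_idx u \<mu> F)" "Gamma_map u (tight v) \<gamma> = coset (tight v) g"
        using Gamma_flat_cases[OF v F(2,3)] .
      then show "Gamma_map u (tight v) \<gamma> \<in> Gamma_grp u (tight v)"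
        using lattice_mono(1)[OF v F(2) order_refl] by (auto simp: Gamma_grp_eq)
    qed
    show "Gamma_grp u (tight v) \<subseteq> ?\<phi> ` ?D"
    proof
      fix \<delta> assume "\<delta> \<in> Gamma_grp u (tight v)"
      then obtain g where g: "g \<in> int_lattice" "\<delta> = coset (tight v) g"
        by (auto simp: Gamma_grp_eq normal_lattice_vertex[OF v])
      define A where "A = {j \<in> tight v. g \<bullet> edge_dir v j \<notin> \<int>}"
      have A: "A \<subseteq> tight v" by (auto simp: A_def)
      define l where "l = (\<Sum>j\<in>tight v - A. (g \<bullet> edge_dir v j) *\<^sub>R u j)"
      have ldir: "l \<bullet> edge_dir v j = (if j \<in> A then 0 else g \<bullet> edge_dir v j)" if "j \<in> tight v" for j
      proof -
        have "l \<bullet> edge_dir v j = (\<Sum>i\<in>tight v - A. if i = j then g \<bullet> edge_dir v i else 0)"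
          unfolding l_def inner_sum_left by (intro sum.cong) (auto simp: edge_dir_dual[OF v])
        then show ?thesis using that by simp
      qed
      have lint: "l \<in> int_lattice" unfolding l_def
        by (intro int_lattice_sum int_lattice_scale u_int) (auto simp: A_def)
      have gl: "g - l \<in> int_lattice" using g(1) lint by (rule int_lattice_diff)
      have N: "g - l \<in> normal_lattice u A" using gl ldir by (auto simp: normal_lattice_iff[OF v A] inner_diff_left)
      have "l \<in> facet_lattice u (tight v)"
        using ldir by (auto simp: facet_lattice_iff[OF v order_refl] A_def)
      then have co: "\<delta> = coset (tight v) (g - l)"
        using coset_eq_iff[OF v order_refl, of g "g - l"] g gl by (simp add: normal_lattice_vertex[OF v])
      let ?F = "face_on A"
      have F: "?F \<in> faces P" "facet_idx u \<mu> ?F = A"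
        using face_on_in_faces[OF v A] facet_idx_face_on[OF v A] by auto
      have "\<forall>j\<in>A. (g - l) \<bullet> edge_dir v j \<notin> \<int>" using ldir A by (auto simp: inner_diff_left A_def)
      then have flat: "coset A (g - l) \<in> Gamma_flat P u \<mu> ?F"
        using coset_in_flat_iff[OF F(1) v] F(2) A N by simp
      have "Gamma_map u (tight v) (coset A (g - l)) = \<delta>"
        using Gamma_map_coset[OF v A order_refl N] co by simp
      then show "\<delta> \<in> ?\<phi> ` ?D" using flat F A by (intro image_eqI[of _ _ "(?F, coset A (g - l))"]) auto
    qed
  qed
qed

lemma finite_Gamma_flat:
  assumes F: "F \<in> faces P"
  shows "finite (Gamma_flat P u \<mu> F)"
proof -
  obtain v where v: "v \<in> vertices P" "v \<in> F" using face_has_vertex[OF F] by blast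
  have A: "facet_idx u \<mu> F \<subseteq> tight v" by (rule facet_idx_subset_vertex[OF v(2)])
  have "finite (SIGMA F:{F \<in> faces P. facet_idx u \<mu> F \<subseteq> tight v}. Gamma_flat P u \<mu> F)"
    using Gamma_flat_bij[OF v(1)] finite_Gamma_vertex[OF v(1)] by (simp add: bij_betw_finite)
  then have "finite (Pair F -` (SIGMA F:{F \<in> faces P. facet_idx u \<mu> F \<subseteq> tight v}. Gamma_flat P u \<mu> F))"
    by (rule finite_vimageI) (auto simp: inj_on_def)
  moreover have "Gamma_flat P u \<mu> F \<subseteq> Pair F -` (SIGMA F:{F \<in> faces P. facet_idx u \<mu> F \<subseteq> tight v}. Gamma_flat P u \<mu> F)"
    using F A by auto
  ultimately show ?thesis by (rule finite_subset[rotated])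
qed

lemma sum_over_flats:
  fixes s :: "(real^'n) set \<Rightarrow> (real^'n) set \<Rightarrow> complex"
  assumes v: "v \<in> vertices P"
    and out: "\<And>F \<gamma>. F \<in> faces P \<Longrightarrow> \<gamma> \<in> Gamma_flat P u \<mu> F \<Longrightarrow> \<not> facet_idx u \<mu> F \<subseteq> tight v \<Longrightarrow> s F \<gamma> = 0"
    and inn: "\<And>F \<gamma>. F \<in> faces P \<Longrightarrow> \<gamma> \<in> Gamma_flat P u \<mu> F \<Longrightarrow> facet_idx u \<mu> F \<subseteq> tight v \<Longrightarrow>
        s F \<gamma> = t (Gamma_map u (tight v) \<gamma>)"
  shows "(\<Sum>F\<in>faces P. \<Sum>\<gamma>\<in>Gamma_flat P u \<mu> F. s F \<gamma>) = (\<Sum>\<gamma>\<in>Gamma_grp u (tight v). t \<gamma>)"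
proof -
  let ?Fv = "{F \<in> faces P. facet_idx u \<mu> F \<subseteq> tight v}"
  have "(\<Sum>F\<in>faces P. \<Sum>\<gamma>\<in>Gamma_flat P u \<mu> F. s F \<gamma>) = (\<Sum>F\<in>?Fv. \<Sum>\<gamma>\<in>Gamma_flat P u \<mu> F. s F \<gamma>)"
    using finite_faces out by (intro sum.mono_neutral_right) auto
  also have "\<dots> = (\<Sum>(F, \<gamma>)\<in>(SIGMA F:?Fv. Gamma_flat P u \<mu> F). s F \<gamma>)"
    using finite_faces finite_Gamma_flat by (intro sum.Sigma) auto
  also have "\<dots> = (\<Sum>p\<in>(SIGMA F:?Fv. Gamma_flat P u \<mu> F). t (case p of (F, \<gamma>) \<Rightarrow> Gamma_map u (tight v) \<gamma>))"
    using inn by (intro sum.cong) auto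
  also have "\<dots> = (\<Sum>\<gamma>\<in>Gamma_grp u (tight v). t \<gamma>)"
    by (rule sum.reindex_bij_betw[OF Gamma_flat_bij[OF v]])
  finally show ?thesis .
qed

end

section \<open>The Euler--Maclaurin formula on a cone\<close>

definition compact_support :: "(real^'n \<Rightarrow> complex) \<Rightarrow> bool" where
  "compact_support g \<longleftrightarrow> (\<exists>R. \<forall>x. norm x > R \<longrightarrow> g x = 0)"

lemma diff_op_vanishes:
  assumes "open U" "\<And>x. x \<in> U \<Longrightarrow> g x = 0" "x \<in> U"
  shows "diff_op w S g x = 0"
proof -
  have "diff_op w S g x = diff_op w S (\<lambda>x. 0) x"
    using assms by (intro diff_op_local[of U]) auto
  also have "\<dots> = 0"
  proof -
    have "foldr (\<lambda>j. dir_deriv (w j) ^^ a j) l (\<lambda>x. 0) = (\<lambda>x. 0 :: complex)" for a l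
    proof (induction l)
      case (Cons j l)
      have "(dir_deriv (w j) ^^ m) (\<lambda>x. 0) = (\<lambda>x. 0 :: complex)" for m by (induction m) auto
      then show ?case using Cons by simp
    qed simp
    then show ?thesis by (simp add: diff_op_def multi_deriv_def)
  qed
  finally show ?thesis .
qed

lemma compact_support_diff_op: "compact_support g \<Longrightarrow> compact_support (diff_op w S g)"
proof -
  assume "compact_support g"
  then obtain R where R: "\<And>x. norm x > R \<Longrightarrow> g x = 0" by (auto simp: compact_support_def)
  have "open {x. R < norm x}" by (intro open_Collect_less continuous_intros)
  then have "\<forall>x. norm x > R \<longrightarrow> diff_op w S g x = 0"
    using diff_op_vanishes[of "{x. R < norm x}" g] R by auto
  then show ?thesis unfolding compact_support_def by blast
qed

lemma compact_support_bounded: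
  assumes "smooth g" "compact_support g"
  shows "\<exists>B. \<forall>x. norm (g x) \<le> B"
proof -
  obtain R where R: "\<And>x. norm x > R \<Longrightarrow> g x = 0" using assms(2) by (auto simp: compact_support_def)
  have "compact (g ` cball 0 R)"
    by (intro compact_continuous_image smooth_continuous_on assms compact_cball)
  then obtain B where B: "\<And>y. y \<in> g ` cball 0 R \<Longrightarrow> norm y \<le> B" using compact_imp_bounded bounded_iff by metis
  have "norm (g x) \<le> max B 0" for x
    using R[of x] B[of "g x"] by (cases "norm x \<le> R") (auto simp: le_max_iff_disj)
  then show ?thesis by blast
qed

lemma dir_deriv_pow_eq_diff_op: "(dir_deriv (w j) ^^ i) g x = diff_op w (in_var j (monom 1 i)) g x"
proof -
  have "(\<Sum>n\<le>i. (if i = n then 1 else 0) * (dir_deriv (w j) ^^ n) g x) = (dir_deriv (w j) ^^ i) g x"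
    by (simp add: if_distrib[of "\<lambda>c. c * _"] cong: if_cong)
  then show ?thesis by (simp add: diff_op_in_var degree_monom_eq)
qed

text \<open>The one-dimensional formula is stated with gauge integrals over bounded intervals; iterating it needs Fubini and
  thus Lebesgue integrals.\<close>

lemma has_bochner_integral_half_line:
  fixes f :: "real \<Rightarrow> complex"
  assumes f: "f \<in> borel_measurable borel" and B: "\<And>t. norm (f t) \<le> B" and van: "\<And>t. t > r \<Longrightarrow> f t = 0"
    and T: "r \<le> T" "0 \<le> T"
  shows "integrable lborel (\<lambda>t. of_real (indicat_real {0..} t) * f t)"
    and "(\<integral>t. of_real (indicat_real {0..} t) * f t \<partial>lborel) = integral {0..T} f"
proof -
  have eq: "of_real (indicat_real {0..} t) * f t = indicat_real {0..T} t *\<^sub>R f t" for t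
    using van[of t] T by (auto simp: indicator_def)
  have int: "set_integrable lborel {0..T} f"
    unfolding set_integrable_def
    using f B T by (intro integrableI_bounded_set_indicator[where B=B]) auto
  then show "integrable lborel (\<lambda>t. of_real (indicat_real {0..} t) * f t)"
    by (simp add: eq set_integrable_def)
  show "(\<integral>t. of_real (indicat_real {0..} t) * f t \<partial>lborel) = integral {0..T} f"
    using set_borel_integral_eq_integral(2)[OF int] by (simp add: eq set_lebesgue_integral_def)
qed

lemma Q_fun_measurable [measurable]:
  assumes "z ^ N = 1" "N > 0" "k \<ge> 1" shows "Q_fun k z \<in> borel_measurable borel"
  using Q_fun_eq_twist_fun[OF assms] by simp

lemma Q_fun_bounded:
  assumes "z ^ N = 1" "N > 0" "k \<ge> 1" shows "\<exists>B. \<forall>x. norm (Q_fun k z x) \<le> B"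
  using Q_fun_eq_twist_fun[OF assms] twist_fun_bounded[OF norm_root_of_unity[OF assms(1,2)]] by simp

definition main_poly :: "nat \<Rightarrow> complex \<Rightarrow> complex poly" where
  "main_poly k z = pcompose (M_poly k z) [:0, -1:]"

lemma coeff_main_poly: "coeff (main_poly k z) i = (-1) ^ i * coeff (M_poly k z) i"
  unfolding main_poly_def by (rule coeff_pcompose_uminus)

lemma diff_op_in_var_bound:
  assumes "degree p \<le> k"
  shows "diff_op w (in_var j p) g x = (\<Sum>i\<le>k. coeff p i * (dir_deriv (w j) ^^ i) g x)"
  unfolding diff_op_in_var using assms
  by (intro sum.mono_neutral_left) (auto simp: coeff_eq_0)

lemma degree_main_poly:
  assumes "k \<ge> 1" shows "degree (main_poly k z) \<le> k"
  using degree_M_poly[OF assms, of z] by (intro degree_le) (auto simp: coeff_main_poly coeff_eq_0)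

text \<open>Restricted to a ray, powers of the directional derivative become ordinary derivatives.\<close>

lemma euler_maclaurin_along:
  fixes h :: "real^'n \<Rightarrow> complex"
  assumes h: "smooth h" "compact_support h" and van: "\<And>t. t > r \<Longrightarrow> h (x + t *\<^sub>R w j) = 0"
    and T: "r < real T" and z: "z ^ N = 1" "N > 0" and k: "k \<ge> 1"
  defines "f1 \<equiv> \<lambda>t. of_real (indicat_real {0..} t) * diff_op w (in_var j (main_poly k z)) h (x + t *\<^sub>R w j)"
    and "f2 \<equiv> \<lambda>t. of_real (indicat_real {0..} t) * (Q_fun k z t * diff_op w (in_var j (monom 1 k)) h (x + t *\<^sub>R w j))"
  shows "integrable lborel f1" "integrable lborel f2"
    "(\<Sum>m\<le>T. ray_weight m * z ^ m * h (x + real m *\<^sub>R w j)) =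
       integral\<^sup>L lborel f1 + (-1) ^ (k - 1) * integral\<^sup>L lborel f2"
proof -
  define \<phi> where "\<phi> i t = (dir_deriv (w j) ^^ i) h (x + t *\<^sub>R w j)" for i t
  have sm: "smooth ((dir_deriv (w j) ^^ i) h)" for i by (rule smooth_dir_deriv_pow[OF h(1)])
  have d: "(\<phi> i has_vector_derivative \<phi> (Suc i) t) (at t)" for i t
    unfolding \<phi>_def using dir_deriv_has_vector_derivative[OF smooth_differentiable[OF sm]] by simp
  have van\<phi>: "\<phi> i t = 0" if "t > r" for i t
    using that
  proof (induction i arbitrary: t)
    case 0
    then show ?case by (simp add: \<phi>_def van)
  next
    case (Suc i)
    have "(\<phi> i has_vector_derivative 0) (at t)"
      by (rule has_vector_derivative_transform_within_open[OF has_vector_derivative_const[of 0], of "{r<..}"])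
         (use Suc in auto)
    then show ?case using vector_derivative_unique_at[OF d] by blast
  qed
  have cont: "continuous_on UNIV (\<phi> i)" for i
    using d by (meson continuous_at_imp_continuous_on has_vector_derivative_continuous)
  have meas[measurable]: "\<phi> i \<in> borel_measurable borel" for i
    by (rule borel_measurable_continuous_onI[OF cont])
  have bound: "\<exists>B. \<forall>t. norm (\<phi> i t) \<le> B" for i
  proof -
    have "compact_support ((dir_deriv (w j) ^^ i) h)"
      using compact_support_diff_op[OF h(2), of w "in_var j (monom 1 i)"]
      by (simp add: dir_deriv_pow_eq_diff_op[abs_def])
    from compact_support_bounded[OF sm this] show ?thesis unfolding \<phi>_def by blast
  qed
  have f1: "f1 = (\<lambda>t. of_real (indicat_real {0..} t) * (\<Sum>i\<le>k. coeff (main_poly k z) i * \<phi> i t))"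
    unfolding f1_def \<phi>_def by (simp add: diff_op_in_var_bound[OF degree_main_poly[OF k]])
  have f2: "f2 = (\<lambda>t. of_real (indicat_real {0..} t) * (Q_fun k z t * \<phi> k t))"
    unfolding f2_def \<phi>_def by (simp add: dir_deriv_pow_eq_diff_op)
  obtain BQ where BQ: "\<And>t. norm (Q_fun k z t) \<le> BQ" using Q_fun_bounded[OF z k] by blast
  obtain Bk where Bk: "\<And>t. norm (\<phi> k t) \<le> Bk" using bound by blast
  have [measurable]: "Q_fun k z \<in> borel_measurable borel" by (rule Q_fun_measurable[OF z k])
  have T0: "r \<le> real T" "0 \<le> real T" using T by auto
  have i2: "integrable lborel (\<lambda>t. of_real (indicat_real {0..} t) * (Q_fun k z t * \<phi> k t))"
    "(\<integral>t. of_real (indicat_real {0..} t) * (Q_fun k z t * \<phi> k t) \<partial>lborel) =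
       integral {0..real T} (\<lambda>t. Q_fun k z t * \<phi> k t)"
    by (rule has_bochner_integral_half_line[OF _ _ _ T0, where B="BQ * Bk"],
        measurable, use BQ Bk van\<phi> in \<open>auto simp: norm_mult intro!: mult_mono' order_trans[OF norm_ge_zero BQ]\<close>)+
  have i1: "integrable lborel (\<lambda>t. of_real (indicat_real {0..} t) * \<phi> i t)"
    "(\<integral>t. of_real (indicat_real {0..} t) * \<phi> i t \<partial>lborel) = integral {0..real T} (\<phi> i)" for i
  proof -
    obtain B where B: "\<And>t. norm (\<phi> i t) \<le> B" using bound by blast
    show "integrable lborel (\<lambda>t. of_real (indicat_real {0..} t) * \<phi> i t)"
      "(\<integral>t. of_real (indicat_real {0..} t) * \<phi> i t \<partial>lborel) = integral {0..real T} (\<phi> i)"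
      by (rule has_bochner_integral_half_line[OF meas B van\<phi> T0]; assumption)+
  qed
  have f1': "f1 = (\<lambda>t. \<Sum>i\<le>k. coeff (main_poly k z) i * (of_real (indicat_real {0..} t) * \<phi> i t))"
    unfolding f1 by (auto simp: sum_distrib_left mult_ac)
  show "integrable lborel f1" unfolding f1' by (intro Bochner_Integration.integrable_sum integrable_mult_right i1)
  show "integrable lborel f2" unfolding f2 by (rule i2)
  have "integral\<^sup>L lborel f1 = (\<Sum>i\<le>k. coeff (main_poly k z) i * integral {0..real T} (\<phi> i))"
    unfolding f1' by (subst Bochner_Integration.integral_sum) (auto simp: i1 intro!: i1)
  moreover have "(\<Sum>m\<le>T. ray_weight m * z ^ m * \<phi> 0 (real m)) =
     (\<Sum>i\<le>k. coeff (M_poly k z) i * (-1) ^ i * integral {0..real T} (\<phi> i))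
      + (-1) ^ (k - 1) * integral {0..real T} (\<lambda>t. Q_fun k z t * \<phi> k t)"
    by (rule euler_maclaurin_ray[where \<phi>=\<phi>, OF d _ z k]) (use T van\<phi> in auto)
  moreover have "integral\<^sup>L lborel f2 = integral {0..real T} (\<lambda>t. Q_fun k z t * \<phi> k t)"
    unfolding f2 by (rule i2)
  ultimately show "(\<Sum>m\<le>T. ray_weight m * z ^ m * h (x + real m *\<^sub>R w j)) =
       integral\<^sup>L lborel f1 + (-1) ^ (k - 1) * integral\<^sup>L lborel f2"
    by (simp add: coeff_main_poly \<phi>_def mult_ac)
qed

lemma sum_PiE_insert:
  assumes "finite K" "i \<notin> K"
  shows "(\<Sum>m\<in>PiE (insert i K) (\<lambda>_. A). F m) = (\<Sum>m\<in>PiE K (\<lambda>_. A). \<Sum>n\<in>A. F (m(i := n)))"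
proof -
  have "(\<Sum>m\<in>PiE (insert i K) (\<lambda>_. A). F m) = (\<Sum>(n, m)\<in>A \<times> PiE K (\<lambda>_. A). F (m(i := n)))"
    unfolding PiE_insert_eq using inj_combinator[OF assms(2), of "\<lambda>_. A"]
    by (subst sum.reindex) (auto simp: case_prod_unfold o_def)
  also have "\<dots> = (\<Sum>n\<in>A. \<Sum>m\<in>PiE K (\<lambda>_. A). F (m(i := n)))"
    by (simp add: sum.cartesian_product)
  finally show ?thesis by (subst sum.swap) simp
qed

text \<open>In the cone formula, \<open>J\<close> is the set of directions in which the main term of the one-dimensional formula is
  taken.  In the other directions the kernel carries \<open>Q\<^sub>k\<close>, and the operator the \<open>k\<close>-th derivative.\<close>

definition orthant_kernel :: "nat \<Rightarrow> ('d \<Rightarrow> complex) \<Rightarrow> 'd set \<Rightarrow> 'd set \<Rightarrow> ('d \<Rightarrow> real) \<Rightarrow> complex" where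
  "orthant_kernel k lam K J t =
     (\<Prod>j\<in>K. of_real (indicat_real {0..} (t j)) * (if j \<in> J then 1 else Q_fun k (lam j) (t j)))"

definition orthant_op :: "nat \<Rightarrow> ('d \<Rightarrow> complex) \<Rightarrow> 'd set \<Rightarrow> 'd set \<Rightarrow> 'd op_poly" where
  "orthant_op k lam K J =
     (\<Prod>j\<in>J. in_var j (main_poly k (lam j))) * (\<Prod>j\<in>K - J. in_var j (monom 1 k))"

interpretation lborel_prod: product_sigma_finite "\<lambda>_. lborel :: real measure"
  by standard

lemma translate_PiM_measurable:
  fixes a :: "'d \<Rightarrow> 'v::euclidean_space"
  shows "(\<lambda>t. y + (\<Sum>j\<in>K. t j *\<^sub>R a j)) \<in> borel_measurable (PiM K (\<lambda>_. lborel))"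
proof -
  have "(\<lambda>t. t j *\<^sub>R a j) \<in> borel_measurable (PiM K (\<lambda>_. lborel))" if "j \<in> K" for j
    using that by measurable
  then show ?thesis by (intro borel_measurable_add borel_measurable_sum borel_measurable_const)
qed

text \<open>\<open>a\<close> spans a cone with apex \<open>v\<close>, and \<open>b\<close> is the dual family.\<close>

locale twisted_cone =
  fixes a b :: "'d::{finite,linorder} \<Rightarrow> real^'n::finite" and lam :: "'d \<Rightarrow> complex"
    and I :: "'d set" and v :: "real^'n" and k :: nat
  assumes dual: "\<And>i j. i \<in> I \<Longrightarrow> j \<in> I \<Longrightarrow> b i \<bullet> a j = (if i = j then 1 else 0)"
    and root: "\<And>j. j \<in> I \<Longrightarrow> \<exists>N>0. lam j ^ N = 1" and k: "k \<ge> 1"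
begin

lemma ray_coordinate:
  assumes "K \<subseteq> I" "i \<in> I" "b i \<bullet> (y - v) = 0"
  shows "b i \<bullet> (y + (\<Sum>j\<in>K. t j *\<^sub>R a j) - v) = (if i \<in> K then t i else 0)"
proof -
  have "b i \<bullet> (\<Sum>j\<in>K. t j *\<^sub>R a j) = (\<Sum>j\<in>K. if j = i then t j else 0)"
    unfolding inner_sum_right using assms(1,2) by (intro sum.cong) (auto simp: dual subset_iff)
  then have "b i \<bullet> (\<Sum>j\<in>K. t j *\<^sub>R a j) = (if i \<in> K then t i else 0)" by simp
  moreover have eq: "y + (\<Sum>j\<in>K. t j *\<^sub>R a j) - v = (y - v) + (\<Sum>j\<in>K. t j *\<^sub>R a j)" by simp
  ultimately show ?thesis unfolding eq inner_add_right assms(3) by simp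
qed

lemma Q_fun_lam:
  assumes "j \<in> I"
  shows "Q_fun k (lam j) \<in> borel_measurable borel" "\<exists>B. \<forall>x. norm (Q_fun k (lam j) x) \<le> B"
  using root[OF assms] Q_fun_measurable[OF _ _ k] Q_fun_bounded[OF _ _ k] by blast+

lemma kernel_measurable:
  assumes "K \<subseteq> I"
  shows "orthant_kernel k lam K J \<in> borel_measurable (PiM K (\<lambda>_. lborel))"
proof -
  have [measurable]: "Q_fun k (lam j) \<in> borel_measurable borel" if "j \<in> K" for j
    using Q_fun_lam(1) assms that by blast
  have "(\<lambda>t. of_real (indicat_real {0..} (t j)) * (if j \<in> J then 1 else Q_fun k (lam j) (t j)))
     \<in> borel_measurable (PiM K (\<lambda>_. lborel))" if j[measurable]: "j \<in> K" for j
    using that by (cases "j \<in> J"; simp; measurable)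
  then show ?thesis unfolding orthant_kernel_def[abs_def] by (intro borel_measurable_prod)
qed

lemma kernel_bounded:
  assumes "K \<subseteq> I"
  shows "\<exists>C. \<forall>J t. norm (orthant_kernel k lam K J t) \<le> C"
proof -
  have "\<forall>j\<in>I. \<exists>B. \<forall>x. norm (Q_fun k (lam j) x) \<le> B" using Q_fun_lam(2) by blast
  then obtain B where B: "\<And>j x. j \<in> I \<Longrightarrow> norm (Q_fun k (lam j) x) \<le> B j" by metis
  have "norm (orthant_kernel k lam K J t) \<le> (\<Prod>j\<in>K. max 1 (B j))" for J t
    unfolding orthant_kernel_def
  proof (rule order_trans[OF norm_prod_le prod_mono], intro conjI norm_ge_zero)
    fix j assume "j \<in> K"
    then have "norm (Q_fun k (lam j) (t j)) \<le> max 1 (B j)" using B[of j "t j"] assms by (auto simp: le_max_iff_disj)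
    then show "norm (of_real (indicat_real {0..} (t j)) * (if j \<in> J then 1 else Q_fun k (lam j) (t j))) \<le> max 1 (B j)"
      by (auto simp: norm_mult indicator_def)
  qed
  then show ?thesis by blast
qed

lemma kernel_outside: "j \<in> K \<Longrightarrow> t j < 0 \<Longrightarrow> orthant_kernel k lam K J t = 0"
  unfolding orthant_kernel_def by (rule prod_zero) (auto intro!: bexI[of _ j])

lemma orthant_integrable:
  assumes K: "K \<subseteq> I" and h: "smooth h" "compact_support h"
    and van: "\<And>x j. j \<in> K \<Longrightarrow> \<bar>b j \<bullet> (x - v)\<bar> > r \<Longrightarrow> h x = 0"
    and y: "\<And>j. j \<in> K \<Longrightarrow> b j \<bullet> (y - v) = 0"
  shows "integrable (PiM K (\<lambda>_. lborel))
     (\<lambda>t. orthant_kernel k lam K J t * h (y + (\<Sum>j\<in>K. t j *\<^sub>R a j)))"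
proof -
  obtain C where C: "\<And>t. norm (orthant_kernel k lam K J t) \<le> C" using kernel_bounded[OF K] by blast
  obtain B where B: "\<And>x. norm (h x) \<le> B" using compact_support_bounded[OF h] by blast
  have C0: "0 \<le> C" "0 \<le> B" using order_trans[OF norm_ge_zero C] order_trans[OF norm_ge_zero B] by auto
  let ?D = "\<lambda>t. C * B * (\<Prod>j\<in>K. indicat_real {0..r} (t j))"
  have "integrable (PiM K (\<lambda>_. lborel)) ?D"
    by (intro integrable_mult_right lborel_prod.product_integrable_prod)
       (auto intro!: integrable_real_indicator emeasure_bounded_finite)
  moreover have "(\<lambda>t. orthant_kernel k lam K J t * h (y + (\<Sum>j\<in>K. t j *\<^sub>R a j)))
      \<in> borel_measurable (PiM K (\<lambda>_. lborel))"
    by (intro borel_measurable_times kernel_measurable[OF K]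
        measurable_compose[OF translate_PiM_measurable smooth_borel_measurable[OF h(1)]])
  moreover have bound: "norm (orthant_kernel k lam K J t * h (y + (\<Sum>j\<in>K. t j *\<^sub>R a j))) \<le> norm (?D t)" for t
  proof (cases "\<forall>j\<in>K. 0 \<le> t j \<and> t j \<le> r")
    case True
    then have "(\<Prod>j\<in>K. indicat_real {0..r} (t j)) = 1" by (intro prod.neutral) auto
    then show ?thesis using C B C0 by (auto simp: norm_mult intro!: mult_mono)
  next
    case False
    then obtain j where j: "j \<in> K" "t j < 0 \<or> t j > r" by force
    have "h (y + (\<Sum>j\<in>K. t j *\<^sub>R a j)) = 0" if "t j > r"
      by (rule van[OF j(1)]) (use ray_coordinate[OF K _ y[OF j(1)], of t] j that K in auto)
    then have "orthant_kernel k lam K J t * h (y + (\<Sum>j\<in>K. t j *\<^sub>R a j)) = 0"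
      using j kernel_outside[OF j(1)] by auto
    then show ?thesis by (simp only: norm_zero norm_ge_zero)
  qed
  ultimately show ?thesis
    by - (rule Bochner_Integration.integrable_bound, assumption, assumption, rule AE_I2, rule bound)
qed

text \<open>Induction on the set of directions.  The direction added last is treated first, by the
  one-dimensional formula under the integral sign.\<close>

theorem euler_maclaurin_orthant:
  assumes "K \<subseteq> I" "smooth g" "compact_support g"
    and "\<And>x j. j \<in> K \<Longrightarrow> \<bar>b j \<bullet> (x - v)\<bar> > r \<Longrightarrow> g x = 0" "r < real T"
    and "\<And>j. j \<in> K \<Longrightarrow> b j \<bullet> (y - v) = 0"
  shows "(\<Sum>m\<in>PiE K (\<lambda>_. {..T}). (\<Prod>j\<in>K. ray_weight (m j) * lam j ^ m j) * g (y + (\<Sum>j\<in>K. real (m j) *\<^sub>R a j))) =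
     (\<Sum>J\<in>Pow K. ((-1) ^ (k - 1)) ^ card (K - J) *
        (\<integral>t. orthant_kernel k lam K J t * diff_op a (orthant_op k lam K J) g (y + (\<Sum>j\<in>K. t j *\<^sub>R a j))
           \<partial>PiM K (\<lambda>_. lborel)))"
proof -
  have "finite K" by simp
  then show ?thesis using assms
  proof (induction K arbitrary: g rule: finite_induct)
    case empty
    have "orthant_op k lam {} {} = 1" by (simp add: orthant_op_def)
    then show ?case by (simp add: orthant_kernel_def PiM_empty lebesgue_integral_count_space_finite)
  next
    case (insert i K)
    note prems = insert.prems
    have iI: "i \<in> I" and KI: "K \<subseteq> I" using prems(1) by auto
    obtain N where N: "lam i ^ N = 1" "N > 0" using root[OF iI] by blast
    define s where "s = ((-1) ^ (k - 1) :: complex)"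
    define c where "c n = ray_weight n * lam i ^ n" for n
    define g' where "g' x = (\<Sum>n\<le>T. c n * g (x + real n *\<^sub>R a i))" for x
    have tr: "smooth (\<lambda>x. g (x + w))" "diff_op a S (\<lambda>x. g (x + w)) x = diff_op a S g (x + w)" for w S x
    proof -
      show "smooth (\<lambda>x. g (x + w))"
      proof (rule smooth_coinduct[of _ "{\<lambda>x. f (x + w) | f. smooth f}"])
        show "(\<lambda>x. g (x + w)) \<in> {\<lambda>x. f (x + w) | f. smooth f}" using prems(2) by blast
      next
        fix F :: "real^'n \<Rightarrow> complex" assume "F \<in> {\<lambda>x. f (x + w) | f. smooth f}"
        then obtain f where f: "F = (\<lambda>x. f (x + w))" "smooth f" by blast
        have "(\<lambda>x. f (x + w)) differentiable (at x)" for x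
          using differentiable_chain_at[of "\<lambda>x. x + w" x f] smooth_differentiable[OF f(2)]
          by (auto simp: o_def intro!: derivative_intros)
        then show "F differentiable_on UNIV" unfolding f(1) by (simp add: differentiable_on_def)
        fix j
        have "dir_deriv (std_dir j) F = (\<lambda>x. dir_deriv (std_dir j) f (x + w))"
          by (auto simp: f(1) dir_deriv_def add_ac)
        then show "dir_deriv (std_dir j) F \<in> {\<lambda>x. f (x + w) | f. smooth f}"
          using smooth_partial[OF f(2)] by blast
      qed
      have one: "dir_deriv d (\<lambda>x. f (x + w)) = (\<lambda>x. dir_deriv d f (x + w))" for d and f :: "real^'n \<Rightarrow> complex"
        by (auto simp: dir_deriv_def add_ac)
      have pow: "(dir_deriv d ^^ m) (\<lambda>x. f (x + w)) = (\<lambda>x. (dir_deriv d ^^ m) f (x + w))" for d m and f :: "real^'n \<Rightarrow> complex"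
        by (induction m) (simp_all add: one)
      have "foldr (\<lambda>j. dir_deriv (a j) ^^ q j) l (\<lambda>x. g (x + w)) = (\<lambda>x. foldr (\<lambda>j. dir_deriv (a j) ^^ q j) l g (x + w))" for q l
        by (induction l) (simp_all add: pow)
      then show "diff_op a S (\<lambda>x. g (x + w)) x = diff_op a S g (x + w)"
        by (simp add: diff_op_def multi_deriv_def)
    qed
    have g'sm: "smooth g'" unfolding g'_def by (intro smooth_sum smooth_cmult tr)
    have g'op: "diff_op a S g' x = (\<Sum>n\<le>T. c n * diff_op a S g (x + real n *\<^sub>R a i))" for S x
      unfolding g'_def by (subst diff_op_fun_sum) (auto simp: tr)
    have g'cs: "compact_support g'"
    proof -
      obtain R where R: "\<And>x. norm x > R \<Longrightarrow> g x = 0" using prems(3) by (auto simp: compact_support_def)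
      have "g' x = 0" if "norm x > R + real T * norm (a i)" for x
      proof -
        have "g (x + real n *\<^sub>R a i) = 0" if n: "n \<le> T" for n
        proof (rule R)
          have "norm (real n *\<^sub>R a i) \<le> real T * norm (a i)" using n by (simp add: mult_right_mono)
          then show "R < norm (x + real n *\<^sub>R a i)"
            using \<open>norm x > R + real T * norm (a i)\<close> norm_diff_ineq[of x "real n *\<^sub>R a i"] by linarith
        qed
        then show ?thesis by (simp add: g'_def)
      qed
      then show ?thesis unfolding compact_support_def by blast
    qed
    have g'van: "g' x = 0" if j: "j \<in> K" "\<bar>b j \<bullet> (x - v)\<bar> > r" for x j
    proof -
      have "b j \<bullet> a i = 0" using j insert.hyps iI KI by (auto simp: dual subset_iff)
      then have "b j \<bullet> (x + real n *\<^sub>R a i - v) = b j \<bullet> (x - v)" for n by (simp add: inner_diff_right inner_add_right)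
      then have "g (x + real n *\<^sub>R a i) = 0" for n using prems(4)[of j "x + real n *\<^sub>R a i"] j by simp
      then show ?thesis by (simp add: g'_def)
    qed
    have upd: "(\<Sum>j\<in>K. (t(i := x)) j *\<^sub>R a j) = (\<Sum>j\<in>K. t j *\<^sub>R a j)" for t x
      using insert.hyps by (intro sum.cong) auto
    (* Summing over the last direction first leaves a sum over K of the partial sums g'. *)
    have L: "(\<Sum>m\<in>PiE (insert i K) (\<lambda>_. {..T}). (\<Prod>j\<in>insert i K. ray_weight (m j) * lam j ^ m j) *
          g (y + (\<Sum>j\<in>insert i K. real (m j) *\<^sub>R a j))) =
      (\<Sum>m\<in>PiE K (\<lambda>_. {..T}). (\<Prod>j\<in>K. ray_weight (m j) * lam j ^ m j) * g' (y + (\<Sum>j\<in>K. real (m j) *\<^sub>R a j)))"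
    proof -
      have "(\<Sum>m\<in>PiE (insert i K) (\<lambda>_. {..T}). (\<Prod>j\<in>insert i K. ray_weight (m j) * lam j ^ m j) *
          g (y + (\<Sum>j\<in>insert i K. real (m j) *\<^sub>R a j))) =
        (\<Sum>m\<in>PiE K (\<lambda>_. {..T}). \<Sum>n\<le>T. (\<Prod>j\<in>insert i K. ray_weight ((m(i := n)) j) * lam j ^ (m(i := n)) j) *
          g (y + (\<Sum>j\<in>insert i K. real ((m(i := n)) j) *\<^sub>R a j)))"
        by (rule sum_PiE_insert[OF insert.hyps])
      also have "\<dots> = (\<Sum>m\<in>PiE K (\<lambda>_. {..T}). \<Sum>n\<le>T. (\<Prod>j\<in>K. ray_weight (m j) * lam j ^ m j) *
          (c n * g (y + (\<Sum>j\<in>K. real (m j) *\<^sub>R a j) + real n *\<^sub>R a i)))"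
      proof (intro sum.cong refl)
        fix m n
        have "(\<Prod>j\<in>K. ray_weight ((m(i := n)) j) * lam j ^ (m(i := n)) j) = (\<Prod>j\<in>K. ray_weight (m j) * lam j ^ m j)"
          "(\<Sum>j\<in>K. real ((m(i := n)) j) *\<^sub>R a j) = (\<Sum>j\<in>K. real (m j) *\<^sub>R a j)"
          using insert.hyps by (auto intro!: prod.cong sum.cong)
        then show "(\<Prod>j\<in>insert i K. ray_weight ((m(i := n)) j) * lam j ^ (m(i := n)) j) *
          g (y + (\<Sum>j\<in>insert i K. real ((m(i := n)) j) *\<^sub>R a j)) =
          (\<Prod>j\<in>K. ray_weight (m j) * lam j ^ m j) * (c n * g (y + (\<Sum>j\<in>K. real (m j) *\<^sub>R a j) + real n *\<^sub>R a i))"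
          using insert.hyps by (simp add: c_def mult_ac add_ac)
      qed
      finally show ?thesis by (simp add: g'_def sum_distrib_left)
    qed
    let ?S = "PiM (insert i K) (\<lambda>_. lborel :: real measure)"
    define H where "H J t = orthant_kernel k lam (insert i K) J t *
        diff_op a (orthant_op k lam (insert i K) J) g (y + (\<Sum>j\<in>insert i K. t j *\<^sub>R a j))" for J t
    have van_op: "diff_op a S g x = 0" if "j \<in> insert i K" "\<bar>b j \<bullet> (x - v)\<bar> > r" for S x j
    proof (rule diff_op_vanishes[of "{x. r < \<bar>b j \<bullet> (x - v)\<bar>}"])
      show "open {x. r < \<bar>b j \<bullet> (x - v)\<bar>}" by (intro open_Collect_less continuous_intros)
    qed (use prems(4) that in auto)
    have intH: "integrable ?S (H J)" for J
      unfolding H_def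
      by (rule orthant_integrable[OF prems(1) smooth_diff_op[OF prems(2)] compact_support_diff_op[OF prems(3)]])
         (use van_op prems(6) in auto)
    text \<open>For a fixed set \<open>J\<close> of directions in \<open>K\<close> that carry the main term.\<close>
    have step: "(\<integral>t. orthant_kernel k lam K J t * diff_op a (orthant_op k lam K J) g' (y + (\<Sum>j\<in>K. t j *\<^sub>R a j))
           \<partial>PiM K (\<lambda>_. lborel)) = integral\<^sup>L ?S (H (insert i J)) + s * integral\<^sup>L ?S (H J)" if J: "J \<subseteq> K" for J
    proof -
      have iJ: "i \<notin> J" "finite J" using J insert.hyps by (auto intro: finite_subset)
      define h where "h = diff_op a (orthant_op k lam K J) g"
      have h: "smooth h" "compact_support h"
        unfolding h_def using smooth_diff_op[OF prems(2)] compact_support_diff_op[OF prems(3)] by auto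
      have op1: "orthant_op k lam (insert i K) (insert i J) = in_var i (main_poly k (lam i)) * orthant_op k lam K J"
      proof -
        have "insert i K - insert i J = K - J" using iJ insert.hyps by blast
        then show ?thesis unfolding orthant_op_def using iJ by (simp add: mult_ac)
      qed
      have op2: "orthant_op k lam (insert i K) J = in_var i (monom 1 k) * orthant_op k lam K J"
      proof -
        have "insert i K - J = insert i (K - J)" "i \<notin> K - J" using iJ insert.hyps by auto
        then show ?thesis unfolding orthant_op_def by (simp add: mult_ac)
      qed
      have ker: "orthant_kernel k lam (insert i K) (insert i J) (t(i := x)) = orthant_kernel k lam K J t * of_real (indicat_real {0..} x)"
        "orthant_kernel k lam (insert i K) J (t(i := x)) = orthant_kernel k lam K J t * (of_real (indicat_real {0..} x) * Q_fun k (lam i) x)" for t x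
      proof -
        have p: "(\<Prod>j\<in>K. of_real (indicat_real {0..} ((t(i := x)) j)) * (if j \<in> J' then 1 else Q_fun k (lam j) ((t(i := x)) j))) =
          orthant_kernel k lam K J t" if "J' = J \<or> J' = insert i J" for J'
          unfolding orthant_kernel_def using insert.hyps that by (intro prod.cong) auto
        show "orthant_kernel k lam (insert i K) (insert i J) (t(i := x)) = orthant_kernel k lam K J t * of_real (indicat_real {0..} x)"
          unfolding orthant_kernel_def[of _ _ "insert i K"] prod.insert[OF insert.hyps] using p[of "insert i J"] by simp
        show "orthant_kernel k lam (insert i K) J (t(i := x)) = orthant_kernel k lam K J t * (of_real (indicat_real {0..} x) * Q_fun k (lam i) x)"
          unfolding orthant_kernel_def[of _ _ "insert i K"] prod.insert[OF insert.hyps] using p[of J] iJ by simp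
      qed
      have inner: "orthant_kernel k lam K J t * diff_op a (orthant_op k lam K J) g' (y + (\<Sum>j\<in>K. t j *\<^sub>R a j)) =
          (\<integral>x. H (insert i J) (t(i := x)) + s * H J (t(i := x)) \<partial>lborel)" for t
      proof -
        let ?x = "y + (\<Sum>j\<in>K. t j *\<^sub>R a j)"
        define f1 where "f1 = (\<lambda>x. of_real (indicat_real {0..} x) * diff_op a (in_var i (main_poly k (lam i))) h (?x + x *\<^sub>R a i))"
        define f2 where "f2 = (\<lambda>x. of_real (indicat_real {0..} x) * (Q_fun k (lam i) x * diff_op a (in_var i (monom 1 k)) h (?x + x *\<^sub>R a i)))"
        have van1: "h (?x + x *\<^sub>R a i) = 0" if "x > r" for x
          unfolding h_def
        proof (rule van_op)
          have "b i \<bullet> (?x - v) = 0"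
            using ray_coordinate[OF KI iI prems(6), of t] insert.hyps by simp
          moreover have eq: "?x + x *\<^sub>R a i - v = (?x - v) + x *\<^sub>R a i" by simp
          ultimately have "b i \<bullet> (?x + x *\<^sub>R a i - v) = x"
            unfolding eq inner_add_right using dual[OF iI iI] by simp
          then show "r < \<bar>b i \<bullet> (?x + x *\<^sub>R a i - v)\<bar>" using that by linarith
        qed simp
        have f12: "integrable lborel f1" "integrable lborel f2"
          "(\<Sum>m\<le>T. ray_weight m * lam i ^ m * h (?x + real m *\<^sub>R a i)) = integral\<^sup>L lborel f1 + (-1) ^ (k - 1) * integral\<^sup>L lborel f2"
          unfolding f1_def f2_def
          by (rule euler_maclaurin_along[where x="?x" and w=a and j=i, OF h van1 prems(5) N k]; assumption)+
        have H1: "H (insert i J) (t(i := x)) = orthant_kernel k lam K J t * f1 x" for x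
          unfolding H_def f1_def h_def ker op1 diff_op_mult[OF prems(2)] sum.insert[OF insert.hyps] upd
          by (simp add: add_ac)
        have H2: "H J (t(i := x)) = orthant_kernel k lam K J t * f2 x" for x
          unfolding H_def f2_def h_def ker op2 diff_op_mult[OF prems(2)] sum.insert[OF insert.hyps] upd
          by (simp add: add_ac)
        have "diff_op a (orthant_op k lam K J) g' ?x = (\<Sum>m\<le>T. ray_weight m * lam i ^ m * h (?x + real m *\<^sub>R a i))"
          unfolding g'op h_def c_def by simp
        also have "\<dots> = integral\<^sup>L lborel f1 + s * integral\<^sup>L lborel f2" using f12(3) by (simp add: s_def)
        also have "orthant_kernel k lam K J t * \<dots> = (\<integral>x. orthant_kernel k lam K J t * f1 x + s * (orthant_kernel k lam K J t * f2 x) \<partial>lborel)"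
          using f12(1,2) by (simp add: Bochner_Integration.integral_add algebra_simps)
        finally show ?thesis unfolding H1 H2 .
      qed
      have intsum: "integrable ?S (\<lambda>t. H (insert i J) t + s * H J t)"
        by (intro Bochner_Integration.integrable_add integrable_mult_right intH)
      have "(\<integral>t. orthant_kernel k lam K J t * diff_op a (orthant_op k lam K J) g' (y + (\<Sum>j\<in>K. t j *\<^sub>R a j))
           \<partial>PiM K (\<lambda>_. lborel)) = (\<integral>t. H (insert i J) t + s * H J t \<partial>?S)"
        unfolding inner lborel_prod.product_integral_insert[OF insert.hyps intsum] ..
      also have "\<dots> = integral\<^sup>L ?S (H (insert i J)) + s * integral\<^sup>L ?S (H J)"
        using intH by (subst Bochner_Integration.integral_add) auto
      finally show ?thesis .
    qed
    have disj: "Pow K \<inter> insert i ` Pow K = {}" using insert.hyps by blast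
    have inj: "inj_on (insert i) (Pow K)"
      by (rule inj_on_inverseI[where g="\<lambda>A. A - {i}"]) (use insert.hyps in auto)
    have "(\<Sum>m\<in>PiE K (\<lambda>_. {..T}). (\<Prod>j\<in>K. ray_weight (m j) * lam j ^ m j) * g' (y + (\<Sum>j\<in>K. real (m j) *\<^sub>R a j))) =
      (\<Sum>J\<in>Pow K. s ^ card (K - J) * (integral\<^sup>L ?S (H (insert i J)) + s * integral\<^sup>L ?S (H J)))"
      unfolding s_def
      by (subst insert.IH[OF KI g'sm g'cs g'van prems(5)]) (use prems(6) step in \<open>auto simp: s_def intro!: sum.cong\<close>)
    also have "\<dots> = (\<Sum>J\<in>Pow K. s ^ card (insert i K - insert i J) * integral\<^sup>L ?S (H (insert i J))) +
        (\<Sum>J\<in>Pow K. s ^ card (insert i K - J) * integral\<^sup>L ?S (H J))"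
      unfolding sum.distrib[symmetric]
    proof (intro sum.cong refl)
      fix J assume "J \<in> Pow K"
      then have "i \<notin> J" using insert.hyps by auto
      then have "insert i K - insert i J = K - J" "insert i K - J = insert i (K - J)" "i \<notin> K - J" using insert.hyps by auto
      then show "s ^ card (K - J) * (integral\<^sup>L ?S (H (insert i J)) + s * integral\<^sup>L ?S (H J)) =
         s ^ card (insert i K - insert i J) * integral\<^sup>L ?S (H (insert i J)) + s ^ card (insert i K - J) * integral\<^sup>L ?S (H J)"
        by (simp add: algebra_simps)
    qed
    also have "\<dots> = (\<Sum>J\<in>Pow (insert i K). s ^ card (insert i K - J) * integral\<^sup>L ?S (H J))"
      unfolding Pow_insert using disj inj by (subst sum.union_disjoint) (auto simp: sum.reindex)
    finally show ?case unfolding L H_def s_def .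
  qed
qed

end

section \<open>Edge coordinates and the volume of a lattice cell\<close>

text \<open>Lebesgue measure on \<open>\<real>\<^sup>n\<close> as a product measure, for coordinates that are labelled by another index set.\<close>

lemma PiM_distr_axes:
  fixes \<tau> :: "'d \<Rightarrow> 'n::finite"
  assumes fin: "finite I" and \<tau>: "bij_betw \<tau> I UNIV"
  shows "distr (PiM I (\<lambda>_. lborel)) borel (\<lambda>t. \<Sum>j\<in>I. t j *\<^sub>R (axis (\<tau> j) 1 :: real^'n)) = lborel"
    (is "distr ?M borel ?F = _")
proof (rule lborel_eqI[symmetric])
  have F[measurable]: "?F \<in> borel_measurable ?M"
    using translate_PiM_measurable[of 0 "\<lambda>j. axis (\<tau> j) 1 :: real^'n" I] by simp
  have comp: "?F t $ \<tau> j = t j" if "j \<in> I" for t j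
  proof -
    have "?F t $ \<tau> j = (\<Sum>i\<in>I. if i = j then t i else 0)"
      unfolding sum_component using that \<tau> by (intro sum.cong) (auto simp: axis_def bij_betw_def inj_on_def)
    then show ?thesis using that fin by simp
  qed
  fix l u :: "real^'n" assume lu: "\<And>b. b \<in> Basis \<Longrightarrow> l \<bullet> b \<le> u \<bullet> b"
  have le: "l $ i \<le> u $ i" for i using lu[of "axis i 1"] by (auto simp: inner_axis axis_in_Basis_iff)
  have pre: "?F -` box l u \<inter> space ?M = PiE I (\<lambda>j. {l $ \<tau> j <..< u $ \<tau> j})"
  proof (intro equalityI subsetI)
    fix t assume t: "t \<in> ?F -` box l u \<inter> space ?M"
    then have box: "l $ i < ?F t $ i \<and> ?F t $ i < u $ i" for i by (simp only: vimage_eq Int_iff mem_box_cart)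
    show "t \<in> PiE I (\<lambda>j. {l $ \<tau> j <..< u $ \<tau> j})"
    proof (rule PiE_I)
      fix j assume j: "j \<in> I"
      show "t j \<in> {l $ \<tau> j <..< u $ \<tau> j}" using box[of "\<tau> j"] comp[OF j, of t] by simp
    next
      fix j assume "j \<notin> I"
      then show "t j = undefined" using t by (auto simp: space_PiM PiE_def extensional_def)
    qed
  next
    fix t assume t: "t \<in> PiE I (\<lambda>j. {l $ \<tau> j <..< u $ \<tau> j})"
    have "l $ i < ?F t $ i \<and> ?F t $ i < u $ i" for i
    proof -
      obtain j where "j \<in> I" "i = \<tau> j" using \<tau> by (auto simp: bij_betw_def)
      then show ?thesis using comp[of j t] t by auto
    qed
    then have "?F t \<in> box l u" unfolding mem_box_cart by blast
    then show "t \<in> ?F -` box l u \<inter> space ?M" using t by (auto simp: space_PiM PiE_def extensional_def)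
  qed
  have "emeasure (distr ?M borel ?F) (box l u) = emeasure ?M (PiE I (\<lambda>j. {l $ \<tau> j <..< u $ \<tau> j}))"
    by (subst emeasure_distr[OF F]) (auto simp: pre)
  also have "\<dots> = (\<Prod>j\<in>I. emeasure lborel {l $ \<tau> j <..< u $ \<tau> j})"
    using fin by (intro lborel_prod.emeasure_PiM) auto
  also have "\<dots> = (\<Prod>j\<in>I. ennreal (u $ \<tau> j - l $ \<tau> j))" using le by simp
  also have "\<dots> = (\<Prod>i\<in>UNIV. ennreal (u $ i - l $ i))"
    by (rule prod.reindex_bij_betw[OF \<tau>])
  also have "\<dots> = ennreal (\<Prod>i\<in>UNIV. u $ i - l $ i)" using le by (intro prod_ennreal) simp
  also have "(\<Prod>i\<in>UNIV. u $ i - l $ i) = (\<Prod>b\<in>Basis. (u - l) \<bullet> b)"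
  proof -
    have B: "(Basis :: (real^'n) set) = range (\<lambda>i. axis i 1)" by (auto simp: Basis_vec_def)
    have "inj (\<lambda>i. axis i 1 :: real^'n)" by (auto simp: inj_def axis_eq_axis)
    then have "(\<Prod>b\<in>range (\<lambda>i. axis i 1). (u - l) \<bullet> b) = (\<Prod>i\<in>UNIV. (u - l) \<bullet> axis i 1)"
      by (subst prod.reindex) auto
    then show ?thesis unfolding B by (simp add: inner_axis)
  qed
  finally show "emeasure (distr ?M borel ?F) (box l u) = ennreal (\<Prod>b\<in>Basis. (u - l) \<bullet> b)" .
qed simp

lemma emeasure_lborel_eq_measure_lebesgue:
  fixes S :: "'a::euclidean_space set"
  assumes "S \<in> lmeasurable" "S \<in> sets borel"
  shows "emeasure lborel S = ennreal (measure lebesgue S)"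
proof -
  have "emeasure lborel S = emeasure lebesgue S" using assms(2) by simp
  also have "\<dots> = ennreal (measure lebesgue S)"
    using assms(1) by (intro emeasure_eq_ennreal_measure) (auto simp: fmeasurable_def)
  finally show ?thesis .
qed

definition unit_cell :: "(real^'n) set" where
  "unit_cell = {x. \<forall>i. 0 \<le> x $ i \<and> x $ i < 1}"

lemma unit_cell_borel: "unit_cell \<in> sets borel"
proof -
  have "unit_cell = (\<Inter>i. {x. 0 \<le> x $ i} \<inter> {x::real^'n. x $ i < 1})" by (auto simp: unit_cell_def)
  also have "\<dots> \<in> sets borel"
    by (intro sets.countable_INT'' sets.Int borel_closed borel_open closed_Collect_le open_Collect_less
        continuous_intros) auto
  finally show ?thesis .
qed

lemma unit_cell_measure:
  "(unit_cell :: (real^'n) set) \<in> lmeasurable" "measure lebesgue (unit_cell :: (real^'n) set) = 1"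
proof -
  have sub: "unit_cell \<subseteq> cbox 0 (1 :: real^'n)" by (auto simp: unit_cell_def mem_box_cart less_imp_le)
  have sup: "box 0 (1 :: real^'n) \<subseteq> unit_cell" by (auto simp: unit_cell_def mem_box_cart less_imp_le)
  show L: "(unit_cell :: (real^'n) set) \<in> lmeasurable"
    by (rule fmeasurableI2[OF lmeasurable_cbox sub]) (use unit_cell_borel in auto)
  have le: "(0 :: real^'n) \<bullet> b \<le> 1 \<bullet> b" if "b \<in> Basis" for b
    using that by (auto simp: Basis_vec_def inner_axis)
  have "(\<Prod>b\<in>Basis. (1 - 0 :: real^'n) \<bullet> b) = 1"
    by (intro prod.neutral) (auto simp: Basis_vec_def inner_axis)
  then have c: "measure lebesgue (cbox 0 (1 :: real^'n)) = 1" "measure lebesgue (box 0 (1 :: real^'n)) = 1"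
    using le by (simp_all add: content_cbox measure_lborel_box)
  have "measure lebesgue (unit_cell :: (real^'n) set) \<le> 1"
    using measure_mono_fmeasurable[OF sub _ lmeasurable_cbox] L c by auto
  moreover have "1 \<le> measure lebesgue (unit_cell :: (real^'n) set)"
    using measure_mono_fmeasurable[OF sup _ L] c by auto
  ultimately show "measure lebesgue (unit_cell :: (real^'n) set) = 1" by simp
qed

locale dual_frame =
  fixes a b :: "'d \<Rightarrow> real^'n::{finite,wellorder}" and I :: "'d set"
  assumes dual: "\<And>i j. i \<in> I \<Longrightarrow> j \<in> I \<Longrightarrow> b i \<bullet> a j = (if i = j then 1 else 0)"
    and fin: "finite I" and card: "card I = CARD('n)"
    and expand: "\<And>x. x = (\<Sum>j\<in>I. (b j \<bullet> x) *\<^sub>R a j)"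
    and expand': "\<And>x. x = (\<Sum>j\<in>I. (a j \<bullet> x) *\<^sub>R b j)"
begin

text \<open>With \<open>C\<close> the coordinate map of the basis \<open>a\<close>, the density of the coordinate measure and the
  volume of the dual cell are both \<open>|det C|\<close>.\<close>

lemma coordinate_density:
  obtains c where "c > 0"
    "\<And>v. distr (PiM I (\<lambda>_. lborel)) borel (\<lambda>t. v + (\<Sum>j\<in>I. t j *\<^sub>R a j)) = density lborel (\<lambda>_. ennreal c)"
    "emeasure lborel {x. \<forall>j\<in>I. 0 \<le> a j \<bullet> x \<and> a j \<bullet> x < 1} = ennreal c"
proof -
  obtain \<tau> :: "'d \<Rightarrow> 'n" where \<tau>: "bij_betw \<tau> I UNIV"
    using finite_same_card_bij[OF fin finite_class.finite_UNIV] card by auto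
  have inj: "\<tau> i = \<tau> j \<longleftrightarrow> i = j" if "i \<in> I" "j \<in> I" for i j
    using \<tau> that by (auto simp: bij_betw_def inj_on_def)
  have surj: "\<exists>j\<in>I. i = \<tau> j" for i using \<tau> by (auto simp: bij_betw_def)
  define A where "A x = (\<Sum>j\<in>I. (x $ \<tau> j) *\<^sub>R a j)" for x :: "real^'n::_"
  define B where "B x = (\<Sum>j\<in>I. (x $ \<tau> j) *\<^sub>R b j)" for x :: "real^'n::_"
  define C where "C x = (\<Sum>j\<in>I. (b j \<bullet> x) *\<^sub>R (axis (\<tau> j) 1 :: real^'n::_))" for x :: "real^'n::_"
  have linA: "linear A" unfolding A_def
    by (intro linear_compose_sum ballI linearI) (auto simp: algebra_simps)
  have linB: "linear B" unfolding B_def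
    by (intro linear_compose_sum ballI linearI) (auto simp: algebra_simps)
  have linC: "linear C" unfolding C_def
    by (intro linear_compose_sum ballI linearI) (auto simp: inner_add_right scaleR_add_left)
  have Cc: "C x $ \<tau> j = b j \<bullet> x" if "j \<in> I" for x j
  proof -
    have "C x $ \<tau> j = (\<Sum>i\<in>I. if i = j then b i \<bullet> x else 0)"
      unfolding C_def sum_component using that inj by (intro sum.cong) (auto simp: axis_def)
    then show ?thesis using that fin by simp
  qed
  have AC: "A (C x) = x" for x
  proof -
    have "A (C x) = (\<Sum>j\<in>I. (b j \<bullet> x) *\<^sub>R a j)" unfolding A_def by (intro sum.cong) (auto simp: Cc)
    then show ?thesis using expand[of x] by simp
  qed
  have CA: "C (A x) = x" for x
  proof -
    have "C (A x) $ \<tau> j = x $ \<tau> j" if j: "j \<in> I" for j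
    proof -
      have "b j \<bullet> A x = (\<Sum>i\<in>I. if i = j then x $ \<tau> i else 0)"
        unfolding A_def inner_sum_right using j by (intro sum.cong) (auto simp: dual)
      then show ?thesis using Cc[OF j] j fin by simp
    qed
    then show ?thesis unfolding vec_eq_iff using surj by metis
  qed
  have detBC: "det (matrix B) = det (matrix C)"
  proof -
    have "matrix B = transpose (matrix C)"
    proof -
      have "B (axis (\<tau> j) 1) $ k = C (axis k 1) $ \<tau> j" if j: "j \<in> I" for j k
      proof -
        have "B (axis (\<tau> j) 1) = (\<Sum>i\<in>I. if i = j then b i else 0)"
          unfolding B_def using j inj by (intro sum.cong) (auto simp: axis_def)
        then have "B (axis (\<tau> j) 1) = b j" using j fin by simp
        then show ?thesis using Cc[OF j] by (simp add: inner_axis)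
      qed
      then show ?thesis unfolding matrix_def transpose_def vec_eq_iff using surj by (auto) metis
    qed
    then show ?thesis by simp
  qed
  define c where "c = \<bar>det (matrix C)\<bar>"
  have c: "c > 0"
  proof -
    have "matrix (C \<circ> A) = matrix C ** matrix A" by (rule matrix_compose[OF linA linC])
    moreover have "C \<circ> A = id" using CA by auto
    ultimately have "matrix C ** matrix A = mat 1" by (simp add: matrix_id_mat_1)
    then have "det (matrix C) * det (matrix A) = 1" by (metis det_I det_mul)
    then show ?thesis by (auto simp: c_def)
  qed
  have Am[measurable]: "(\<lambda>x. v + A x) \<in> borel_measurable borel" for v
    by (intro borel_measurable_continuous_onI continuous_intros linear_continuous_on linear_linear[THEN iffD2] linA)
  have dA: "distr lborel borel (\<lambda>x. v + A x) = density lborel (\<lambda>_. ennreal c)" for v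
  proof -
    let ?D = "distr lborel borel (\<lambda>x. v + A x)"
    have "lborel = density ?D (\<lambda>_. ennreal (1 / c))"
    proof (rule lborel_eqI)
      fix l u :: "real^'n::_" assume lu: "\<And>b. b \<in> Basis \<Longrightarrow> l \<bullet> b \<le> u \<bullet> b"
      let ?S = "(\<lambda>x. v + A x) -` box l u"
      have S: "?S = C ` box (l - v) (u - v)"
      proof (intro equalityI subsetI)
        fix x assume "x \<in> ?S"
        then have "A x \<in> box (l - v) (u - v)" by (auto simp: mem_box inner_diff_left inner_add_left algebra_simps)
        then show "x \<in> C ` box (l - v) (u - v)" using CA[of x] by (metis imageI)
      next
        fix x assume "x \<in> C ` box (l - v) (u - v)"
        then obtain y where "x = C y" "y \<in> box (l - v) (u - v)" by blast
        then show "x \<in> ?S" by (auto simp: AC mem_box inner_diff_left inner_add_left algebra_simps)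
      qed
      have Sb: "?S \<in> sets borel" using measurable_sets[OF Am, of "box l u"] by auto
      have SL: "?S \<in> lmeasurable" unfolding S by (rule measurable_linear_image[OF linC lmeasurable_box])
      have "measure lebesgue ?S = c * measure lebesgue (box (l - v) (u - v))"
        unfolding S c_def by (rule measure_linear_image[OF linC lmeasurable_box])
      also have "measure lebesgue (box (l - v) (u - v)) = (\<Prod>b\<in>Basis. (u - l) \<bullet> b)"
        using lu by (simp add: measure_lborel_box inner_diff_left)
      finally have m: "measure lebesgue ?S = c * (\<Prod>b\<in>Basis. (u - l) \<bullet> b)" .
      have "emeasure (density ?D (\<lambda>_. ennreal (1 / c))) (box l u) = ennreal (1 / c) * emeasure ?D (box l u)"
        by (simp add: emeasure_density_const)
      also have "emeasure ?D (box l u) = emeasure lborel ?S" by (subst emeasure_distr) auto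
      also have "\<dots> = ennreal (c * (\<Prod>b\<in>Basis. (u - l) \<bullet> b))"
        by (simp add: emeasure_lborel_eq_measure_lebesgue[OF SL Sb] m)
      also have "ennreal (1 / c) * \<dots> = ennreal (1 / c * (c * (\<Prod>b\<in>Basis. (u - l) \<bullet> b)))"
        using c by (intro ennreal_mult'[symmetric]) auto
      also have "1 / c * (c * (\<Prod>b\<in>Basis. (u - l) \<bullet> b)) = (\<Prod>b\<in>Basis. (u - l) \<bullet> b)" using c by simp
      finally show "emeasure (density ?D (\<lambda>_. ennreal (1 / c))) (box l u) = ennreal (\<Prod>b\<in>Basis. (u - l) \<bullet> b)" .
    qed simp
    then have "density lborel (\<lambda>_. ennreal c) = density (density ?D (\<lambda>_. ennreal (1 / c))) (\<lambda>_. ennreal c)" by simp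
    also have "\<dots> = density ?D (\<lambda>_. ennreal (1 / c) * ennreal c)" by (subst density_density_eq) auto
    also have "ennreal (1 / c) * ennreal c = 1" using c by (simp flip: ennreal_mult')
    finally show ?thesis by (simp add: density_1)
  qed
  show thesis
  proof (rule that[OF c])
    fix v
    let ?F = "\<lambda>t. \<Sum>j\<in>I. t j *\<^sub>R (axis (\<tau> j) 1 :: real^'n::_)"
    have F[measurable]: "?F \<in> borel_measurable (PiM I (\<lambda>_. lborel))"
      using translate_PiM_measurable[of 0 "\<lambda>j. axis (\<tau> j) 1 :: real^'n::_" I] by simp
    have "A (?F t) = (\<Sum>j\<in>I. t j *\<^sub>R a j)" for t
    proof -
      have "A (axis (\<tau> j) 1) = a j" if j: "j \<in> I" for j
      proof -
        have "A (axis (\<tau> j) 1) = (\<Sum>i\<in>I. if i = j then a i else 0)"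
          unfolding A_def using j inj by (intro sum.cong) (auto simp: axis_def)
        then show ?thesis using j fin by simp
      qed
      then show ?thesis using linA by (simp add: linear_sum linear_scale)
    qed
    then have "(\<lambda>t. v + (\<Sum>j\<in>I. t j *\<^sub>R a j)) = (\<lambda>x. v + A x) \<circ> ?F" by auto
    then have "distr (PiM I (\<lambda>_. lborel)) borel (\<lambda>t. v + (\<Sum>j\<in>I. t j *\<^sub>R a j)) =
        distr (distr (PiM I (\<lambda>_. lborel)) borel ?F) borel (\<lambda>x. v + A x)"
      by (subst distr_distr) auto
    then show "distr (PiM I (\<lambda>_. lborel)) borel (\<lambda>t. v + (\<Sum>j\<in>I. t j *\<^sub>R a j)) = density lborel (\<lambda>_. ennreal c)"
      by (simp add: PiM_distr_axes[OF fin \<tau>] dA)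
  next
    let ?D = "{x. \<forall>j\<in>I. 0 \<le> a j \<bullet> x \<and> a j \<bullet> x < 1}"
    have aB: "a j \<bullet> B x = x $ \<tau> j" if j: "j \<in> I" for j x
    proof -
      have "a j \<bullet> B x = (\<Sum>i\<in>I. if i = j then x $ \<tau> i else 0)"
        unfolding B_def inner_sum_right using j by (intro sum.cong) (auto simp: dual inner_commute[of "a j"])
      then show ?thesis using j fin by simp
    qed
    have D: "?D = B ` unit_cell"
    proof (intro equalityI subsetI)
      fix x assume x: "x \<in> ?D"
      define y where "y = (\<Sum>j\<in>I. (a j \<bullet> x) *\<^sub>R (axis (\<tau> j) 1 :: real^'n::_))"
      have y: "y $ \<tau> j = a j \<bullet> x" if "j \<in> I" for j
      proof -
        have "y $ \<tau> j = (\<Sum>i\<in>I. if i = j then a i \<bullet> x else 0)"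
          unfolding y_def sum_component using that inj by (intro sum.cong) (auto simp: axis_def)
        then show ?thesis using that fin by simp
      qed
      have "B y = (\<Sum>j\<in>I. (a j \<bullet> x) *\<^sub>R b j)" unfolding B_def by (intro sum.cong) (auto simp: y)
      then have "B y = x" using expand'[of x] by simp
      moreover have "y \<in> unit_cell" unfolding unit_cell_def
      proof (intro CollectI allI)
        fix i obtain j where "j \<in> I" "i = \<tau> j" using surj by blast
        then show "0 \<le> y $ i \<and> y $ i < 1" using x y by auto
      qed
      ultimately show "x \<in> B ` unit_cell" by blast
    qed (auto simp: aB unit_cell_def)
    have DL: "?D \<in> lmeasurable" unfolding D by (rule measurable_linear_image[OF linB unit_cell_measure(1)])
    have "measure lebesgue ?D = c"
      unfolding D measure_linear_image[OF linB unit_cell_measure(1)] unit_cell_measure(2) detBC c_def by simp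
    moreover have "?D \<in> sets borel"
    proof -
      have "?D = (\<Inter>j\<in>I. {x. 0 \<le> a j \<bullet> x} \<inter> {x. a j \<bullet> x < 1})" by auto
      moreover have "{x. 0 \<le> a j \<bullet> x} \<inter> {x. a j \<bullet> x < 1} \<in> sets borel" for j
        by (intro sets.Int borel_closed borel_open closed_Collect_le open_Collect_less continuous_intros)
      ultimately show ?thesis using fin card by (auto intro!: sets.finite_INT)
    qed
    ultimately show "emeasure lborel ?D = ennreal c"
      using emeasure_lborel_eq_measure_lebesgue[OF DL] by simp
  qed
qed

text \<open>Both cells are fundamental domains: \<open>D\<close> for the lattice \<open>L\<close> spanned by \<open>b\<close>, and \<open>[0,1)\<^sup>n\<close> for
  \<open>\<int>\<^sup>n\<close>.  Cutting \<open>D\<close> along the integer translates of the unit cube and reassembling by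
  translations in \<open>L\<close> shows that the volume of \<open>D\<close> is the index of \<open>L\<close>.\<close>

lemma dual_cell_volume:
  assumes b: "\<And>j. j \<in> I \<Longrightarrow> b j \<in> int_lattice"
    and G: "finite G" "G \<subseteq> int_lattice"
    and rep: "\<And>z. z \<in> int_lattice \<Longrightarrow> \<exists>!g. g \<in> G \<and> (\<forall>j\<in>I. a j \<bullet> (z - g) \<in> \<int>)"
  shows "emeasure lborel {x. \<forall>j\<in>I. 0 \<le> a j \<bullet> x \<and> a j \<bullet> x < 1} = of_nat (card G)"
proof -
  define D where "D = {x. \<forall>j\<in>I. 0 \<le> a j \<bullet> x \<and> a j \<bullet> x < 1}"
  define L where "L = {l \<in> int_lattice. \<forall>j\<in>I. a j \<bullet> l \<in> \<int>}"
  have Dm[measurable]: "D \<in> sets borel"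
  proof -
    have "D = (\<Inter>j\<in>I. {x. 0 \<le> a j \<bullet> x} \<inter> {x. a j \<bullet> x < 1})" by (auto simp: D_def)
    moreover have "{x. 0 \<le> a j \<bullet> x} \<inter> {x. a j \<bullet> x < 1} \<in> sets borel" for j
      by (intro sets.Int borel_closed borel_open closed_Collect_le open_Collect_less continuous_intros)
    ultimately show ?thesis using fin card by (auto intro!: sets.finite_INT)
  qed
  have Qm[measurable]: "(unit_cell :: (real^'n::_) set) \<in> sets borel" by (rule unit_cell_borel)
  have countZ: "countable (int_lattice :: (real^'n::_) set)"
  proof -
    have "int_lattice \<subseteq> range (\<lambda>f :: 'n \<Rightarrow> int. \<chi> i. (of_int (f i) :: real))"
    proof
      fix x :: "real^'n::_" assume "x \<in> int_lattice"
      then have "x = (\<chi> i. of_int \<lfloor>x $ i\<rfloor>)" by (auto simp: int_lattice_def vec_eq_iff)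
      then show "x \<in> range (\<lambda>f :: 'n \<Rightarrow> int. \<chi> i. (of_int (f i) :: real))" by (intro range_eqI[of _ _ "\<lambda>i. \<lfloor>x $ i\<rfloor>"])
    qed
    then show ?thesis by (rule countable_subset) simp
  qed
  have countL: "countable L" by (rule countable_subset[OF _ countZ]) (auto simp: L_def)
  have int_small: "m = 0" if "m \<in> \<int>" "-1 < m" "m < 1" for m :: real
    using that by (auto elim!: Ints_cases)
  have Quniq: "z = z'" if "z \<in> int_lattice" "z' \<in> int_lattice" "x - z \<in> unit_cell" "x - z' \<in> unit_cell" for x z z' :: "real^'n::_"
  proof -
    have "z $ i - z' $ i = 0" for i
    proof (rule int_small)
      show "z $ i - z' $ i \<in> \<int>" using that by (auto simp: int_lattice_def)
      have "0 \<le> x $ i - z $ i" "x $ i - z $ i < 1" "0 \<le> x $ i - z' $ i" "x $ i - z' $ i < 1"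
        using that(3,4) by (auto simp: unit_cell_def)
      then show "-1 < z $ i - z' $ i" "z $ i - z' $ i < 1" by linarith+
    qed
    then show ?thesis by (simp add: vec_eq_iff)
  qed
  have Qex: "\<exists>z\<in>int_lattice. x - z \<in> unit_cell" for x :: "real^'n::_"
    by (rule bexI[of _ "\<chi> i. of_int \<lfloor>x $ i\<rfloor>"]) (auto simp: unit_cell_def int_lattice_def, linarith)
  have Duniq: "l = l'" if "l \<in> L" "l' \<in> L" "l + x \<in> D" "l' + x \<in> D" for x l l'
  proof -
    have "a j \<bullet> (l - l') = 0" if j: "j \<in> I" for j
    proof (rule int_small)
      show "a j \<bullet> (l - l') \<in> \<int>" using that \<open>l \<in> L\<close> \<open>l' \<in> L\<close> by (auto simp: L_def inner_diff_right)
      have "0 \<le> a j \<bullet> (l + x)" "a j \<bullet> (l + x) < 1" "0 \<le> a j \<bullet> (l' + x)" "a j \<bullet> (l' + x) < 1"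
        using \<open>l + x \<in> D\<close> \<open>l' + x \<in> D\<close> j by (auto simp: D_def)
      then show "-1 < a j \<bullet> (l - l')" "a j \<bullet> (l - l') < 1" by (simp_all add: inner_diff_right inner_add_right)
    qed
    then have "l - l' = 0" using expand'[of "l - l'"] by simp
    then show ?thesis by simp
  qed
  have Dex: "\<exists>l\<in>L. l + x \<in> D" for x
  proof -
    define l where "l = (\<Sum>j\<in>I. of_int (- \<lfloor>a j \<bullet> x\<rfloor>) *\<^sub>R b j)"
    have al: "a j \<bullet> l = - of_int \<lfloor>a j \<bullet> x\<rfloor>" if j: "j \<in> I" for j
    proof -
      have "a j \<bullet> l = (\<Sum>i\<in>I. if i = j then - of_int \<lfloor>a i \<bullet> x\<rfloor> else 0)"
        unfolding l_def inner_sum_right using j by (intro sum.cong) (auto simp: dual inner_commute[of "a j"])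
      then show ?thesis using j fin by simp
    qed
    have "l \<in> int_lattice" unfolding l_def by (intro int_lattice_sum int_lattice_scale b) auto
    then have "l \<in> L" using al by (auto simp: L_def)
    moreover have "l + x \<in> D" unfolding D_def
    proof (intro CollectI ballI)
      fix j assume "j \<in> I"
      then have "a j \<bullet> (l + x) = a j \<bullet> x - of_int \<lfloor>a j \<bullet> x\<rfloor>" by (simp add: inner_add_right al)
      then show "0 \<le> a j \<bullet> (l + x) \<and> a j \<bullet> (l + x) < 1" by linarith
    qed
    ultimately show ?thesis by blast
  qed
  (* X g l is the part of the cell D in the unit cube at g + l; translating it by -l moves it to Y g l,
     in the cube at g.  The sets X g l tile D, and for fixed g the sets Y g l tile that cube. *)
  define X where "X g l = {x \<in> D. x - g - l \<in> unit_cell}" for g l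
  define Y where "Y g l = {x. l + x \<in> D \<and> x - g \<in> unit_cell}" for g l
  have X_borel: "X g l \<in> sets borel" for g l
  proof -
    have "X g l = D \<inter> (\<lambda>x. x - g - l) -` unit_cell" by (auto simp: X_def)
    moreover have "(\<lambda>x. x - g - l) -` unit_cell \<in> sets borel"
      using measurable_sets[of "\<lambda>x. x - g - l" borel borel unit_cell] by simp
    ultimately show ?thesis by simp
  qed
  have Y_eq: "Y g l = (+) l -` X g l" for g l by (auto simp: X_def Y_def algebra_simps)
  have Y_borel: "Y g l \<in> sets borel" for g l
    unfolding Y_eq using measurable_sets[of "(+) l" borel borel "X g l"] X_borel by simp
  have XY: "emeasure lborel (X g l) = emeasure lborel (Y g l)" for g l
  proof -
    have "emeasure lborel (X g l) = emeasure (distr lborel borel ((+) l)) (X g l)" by (simp add: lborel_distr_plus)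
    also have "\<dots> = emeasure lborel (Y g l)" unfolding Y_eq using X_borel by (subst emeasure_distr) auto
    finally show ?thesis .
  qed
  have cell: "emeasure lborel (\<Union>l\<in>L. X g l) = 1" if g: "g \<in> int_lattice" for g
  proof -
    have "emeasure lborel (\<Union>l\<in>L. X g l) = (\<integral>\<^sup>+l. emeasure lborel (X g l) \<partial>count_space L)"
    proof (rule emeasure_UN_countable[OF _ countL])
      show "disjoint_family_on (X g) L" unfolding disjoint_family_on_def
      proof (intro ballI impI)
        fix l l' assume l: "l \<in> L" "l' \<in> L" "l \<noteq> l'"
        have "g + l = g + l'" if "x \<in> X g l" "x \<in> X g l'" for x
          by (rule Quniq[of _ _ x]) (use that l g in \<open>auto simp: X_def L_def int_lattice_add diff_diff_add\<close>)
        then show "X g l \<inter> X g l' = {}" using l(3) by auto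
      qed
    qed (use X_borel in auto)
    also have "\<dots> = (\<integral>\<^sup>+l. emeasure lborel (Y g l) \<partial>count_space L)" by (simp add: XY)
    also have "\<dots> = emeasure lborel (\<Union>l\<in>L. Y g l)"
    proof (rule emeasure_UN_countable[OF _ countL, symmetric])
      show "disjoint_family_on (Y g) L" unfolding disjoint_family_on_def
        using Duniq by (auto simp: Y_def)
    qed (use Y_borel in auto)
    also have "(\<Union>l\<in>L. Y g l) = (+) (- g) -` unit_cell" using Dex by (auto simp: Y_def)
    also have "emeasure lborel \<dots> = emeasure (distr lborel borel ((+) (- g))) unit_cell"
      by (subst emeasure_distr) auto
    also have "\<dots> = 1"
      using emeasure_lborel_eq_measure_lebesgue[OF unit_cell_measure(1) unit_cell_borel]
      by (simp add: lborel_distr_plus unit_cell_measure(2))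
    finally show ?thesis .
  qed
  have "D = (\<Union>g\<in>G. \<Union>l\<in>L. X g l)"
  proof (intro equalityI subsetI)
    fix x assume x: "x \<in> D"
    obtain z where z: "z \<in> int_lattice" "x - z \<in> unit_cell" using Qex by blast
    obtain g where g: "g \<in> G" "\<forall>j\<in>I. a j \<bullet> (z - g) \<in> \<int>" using ex1_implies_ex[OF rep[OF z(1)]] by blast
    have "z - g \<in> L" using g z(1) G(2) by (auto simp: L_def intro: int_lattice_diff)
    moreover have "x \<in> X g (z - g)" using x z(2) by (simp add: X_def)
    ultimately show "x \<in> (\<Union>g\<in>G. \<Union>l\<in>L. X g l)" using g(1) by blast
  qed (auto simp: X_def)
  then have "emeasure lborel D = (\<Sum>g\<in>G. emeasure lborel (\<Union>l\<in>L. X g l))"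
  proof (simp only:, intro sum_emeasure[symmetric])
    show "disjoint_family_on (\<lambda>g. \<Union>l\<in>L. X g l) G" unfolding disjoint_family_on_def
    proof (intro ballI impI)
      fix g g' assume g: "g \<in> G" "g' \<in> G" "g \<noteq> g'"
      have False if x: "x \<in> X g l" "x \<in> X g' l'" "l \<in> L" "l' \<in> L" for x l l'
      proof -
        have "g + l = g' + l'"
          by (rule Quniq[of _ _ x]) (use x g G(2) in \<open>auto simp: X_def L_def int_lattice_add diff_diff_add\<close>)
        then have "g - g' = l' - l" by (simp add: algebra_simps)
        then have "\<forall>j\<in>I. a j \<bullet> (g - g') \<in> \<int>" using x by (auto simp: L_def inner_diff_right)
        moreover have "\<forall>j\<in>I. a j \<bullet> (g - g) \<in> \<int>" by simp
        moreover have "g \<in> int_lattice" using g G(2) by blast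
        ultimately show False using rep[of g] g by blast
      qed
      then show "(\<Union>l\<in>L. X g l) \<inter> (\<Union>l\<in>L. X g' l) = {}" by blast
    qed
    show "(\<lambda>g. \<Union>l\<in>L. X g l) ` G \<subseteq> sets lborel"
      using X_borel countL by (auto intro!: sets.countable_UN')
  qed (rule G(1))
  also have "\<dots> = (\<Sum>g\<in>G. 1)" using cell G(2) by (intro sum.cong) auto
  finally show ?thesis by (simp add: D_def)
qed

text \<open>The integer vectors split into \<open>|G|\<close> classes modulo the lattice of the normals, and this number is the density of
  the edge coordinates.\<close>

lemma integral_edge_coordinates:
  fixes F :: "real^'n::_ \<Rightarrow> complex"
  assumes b: "\<And>j. j \<in> I \<Longrightarrow> b j \<in> int_lattice"
    and G: "finite G" "G \<subseteq> int_lattice"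
    and rep: "\<And>z. z \<in> int_lattice \<Longrightarrow> \<exists>!g. g \<in> G \<and> (\<forall>j\<in>I. a j \<bullet> (z - g) \<in> \<int>)"
    and F: "F \<in> borel_measurable borel"
  shows "(\<integral>t. F (v + (\<Sum>j\<in>I. t j *\<^sub>R a j)) \<partial>PiM I (\<lambda>_. lborel)) = of_nat (card G) * (\<integral>x. F x \<partial>lborel)"
proof -
  obtain c where c: "c > 0"
    "\<And>v. distr (PiM I (\<lambda>_. lborel)) borel (\<lambda>t. v + (\<Sum>j\<in>I. t j *\<^sub>R a j)) = density lborel (\<lambda>_. ennreal c)"
    "emeasure lborel {x. \<forall>j\<in>I. 0 \<le> a j \<bullet> x \<and> a j \<bullet> x < 1} = ennreal c"
    by (rule coordinate_density, rule that; assumption)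
  have "ennreal c = ennreal (real (card G))"
    using c(3) dual_cell_volume[OF b G rep] by (simp add: ennreal_of_nat_eq_real_of_nat)
  then have cG: "c = real (card G)" using c(1) by simp
  note T = translate_PiM_measurable[of v a I]
  have "(\<integral>t. F (v + (\<Sum>j\<in>I. t j *\<^sub>R a j)) \<partial>PiM I (\<lambda>_. lborel)) = integral\<^sup>L (density lborel (\<lambda>_. ennreal c)) F"
    unfolding c(2)[of v, symmetric] by (rule integral_distr[OF T F, symmetric])
  also have "\<dots> = (\<integral>x. c *\<^sub>R F x \<partial>lborel)" using c(1) F by (intro integral_density) auto
  finally show "(\<integral>t. F (v + (\<Sum>j\<in>I. t j *\<^sub>R a j)) \<partial>PiM I (\<lambda>_. lborel)) = of_nat (card G) * (\<integral>x. F x \<partial>lborel)"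
    by (simp add: cG scaleR_conv_of_real)
qed

end

section \<open>Integrals over translated sets\<close>

lemma integrable_bounded_compact_support:
  fixes f :: "real^'n \<Rightarrow> complex"
  assumes f: "f \<in> borel_measurable borel" and B: "\<And>x. norm (f x) \<le> B" and R: "\<And>x. norm x > R \<Longrightarrow> f x = 0"
  shows "integrable lborel f"
proof -
  have "set_integrable lborel (cball 0 R) f"
    unfolding set_integrable_def
    using f B emeasure_bounded_finite[OF bounded_cball[of 0 R]]
    by (intro integrableI_bounded_set_indicator[where B=B]) auto
  moreover have "indicator (cball 0 R) x *\<^sub>R f x = f x" for x using R[of x] by (auto simp: indicator_def)
  ultimately show ?thesis by (simp add: set_integrable_def)
qed

lemma test_function_integrable:
  fixes f :: "real^'n \<Rightarrow> complex"
  assumes "smooth f" "compact_support f" "K \<in> sets borel"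
  shows "integrable lborel (\<lambda>z. indicator K z *\<^sub>R f (y + z))"
proof -
  obtain R where R: "\<And>x. norm x > R \<Longrightarrow> f x = 0" using assms(2) by (auto simp: compact_support_def)
  obtain B where B: "\<And>x. norm (f x) \<le> B" using compact_support_bounded[OF assms(1,2)] by blast
  show ?thesis
  proof (rule integrable_bounded_compact_support)
    have [measurable]: "f \<in> borel_measurable borel" using assms(1) by (rule smooth_borel_measurable)
    show "(\<lambda>z. indicator K z *\<^sub>R f (y + z)) \<in> borel_measurable borel" using assms(3) by measurable
    show "norm (indicator K z *\<^sub>R f (y + z)) \<le> B" for z
      using B[of "y + z"] order_trans[OF norm_ge_zero B[of z]] by (auto simp: indicator_def)
    fix z :: "real^'n" assume "norm z > R + norm y"
    then have "norm (y + z) > R" using norm_diff_ineq[of z y] by (simp add: add.commute)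
    then show "indicator K z *\<^sub>R f (y + z) = 0" using R by simp
  qed
qed

text \<open>The contribution of a cone to \<open>\<integral>\<^bsub>\<Delta>(h)\<^esub> f\<close>, as a function of the apex.  Translating \<open>f\<close> instead of the cone lets
  derivatives in the apex pass to \<open>f\<close> without any boundary term.\<close>

definition smear :: "(real^'n) set \<Rightarrow> (real^'n \<Rightarrow> complex) \<Rightarrow> real^'n \<Rightarrow> complex" where
  "smear K f y = (\<integral>z. indicator K z *\<^sub>R f (y + z) \<partial>lborel)"

lemma vector_mvt_bound:
  fixes g :: "real \<Rightarrow> complex"
  assumes "\<And>s. (g has_vector_derivative g' s) (at s)" "\<And>s. \<bar>s\<bar> \<le> \<bar>t\<bar> \<Longrightarrow> norm (g' s) \<le> B"
  shows "norm (g t - g 0) \<le> B * \<bar>t\<bar>"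
proof -
  have "norm (g t - g 0) \<le> B * norm (t - 0)"
  proof (rule differentiable_bound[where S="{- \<bar>t\<bar>..\<bar>t\<bar>}" and f=g and f'="\<lambda>s h. h *\<^sub>R g' s"])
    show "(g has_derivative (\<lambda>h. h *\<^sub>R g' s)) (at s within {- \<bar>t\<bar>..\<bar>t\<bar>})" for s
      using assms(1)[of s] by (auto simp: has_vector_derivative_def intro: has_derivative_at_withinI)
    show "onorm (\<lambda>h. h *\<^sub>R g' s) \<le> B" if "s \<in> {- \<bar>t\<bar>..\<bar>t\<bar>}" for s
    proof (rule onorm_le)
      fix h :: real
      have "norm (g' s) \<le> B" using that by (intro assms(2)) auto
      then show "norm (h *\<^sub>R g' s) \<le> B * norm h"
        using mult_left_mono[of "norm (g' s)" B "\<bar>h\<bar>"] by (simp add: mult.commute)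
    qed
  qed auto
  then show ?thesis by simp
qed

text \<open>The difference quotients converge at a rate that is uniform in \<open>z\<close>, and the integrands vanish outside a fixed ball.\<close>

lemma smear_dir_deriv:
  fixes f :: "real^'n \<Rightarrow> complex"
  assumes f: "smooth f" "compact_support f" and K: "K \<in> sets borel"
  shows "((\<lambda>t. smear K f (y + t *\<^sub>R w)) has_vector_derivative smear K (dir_deriv w f) y) (at 0)"
proof -
  let ?D = "dir_deriv w f" and ?DD = "dir_deriv w (dir_deriv w f)"
  have sm: "smooth ?D" "smooth ?DD" using f(1) by (auto intro: smooth_dir_deriv)
  have D1: "?D = diff_op w' S f" if "w' = (\<lambda>_::bool. w)" "S = in_var True (monom 1 1)" for w' S
    using dir_deriv_pow_eq_diff_op[where w=w' and j=True and i=1 and g=f] that by auto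
  have cs: "compact_support ?D" using compact_support_diff_op[OF f(2)] D1[OF refl refl] by metis
  have csDD: "compact_support ?DD"
    using compact_support_diff_op[OF cs, of "\<lambda>_::bool. w" "in_var True (monom 1 1)"]
      dir_deriv_pow_eq_diff_op[where w="\<lambda>_::bool. w" and j=True and i=1 and g="?D"]
    by (simp flip: dir_deriv_pow_eq_diff_op add: fun_eq_iff compact_support_def)
  obtain B where B: "\<And>x. norm (?DD x) \<le> B" using compact_support_bounded[OF sm(2) csDD] by blast
  have B0: "0 \<le> B" using order_trans[OF norm_ge_zero B] .
  obtain R where R: "\<And>x. norm x > R \<Longrightarrow> f x = 0" using f(2) by (auto simp: compact_support_def)
  obtain R' where R': "\<And>x. norm x > R' \<Longrightarrow> ?D x = 0" using cs by (auto simp: compact_support_def)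
  have taylor: "norm (f (x + t *\<^sub>R w) - f x - t *\<^sub>R ?D x) \<le> B * t\<^sup>2" for x t
  proof -
    define g where "g s = f (x + s *\<^sub>R w) - s *\<^sub>R ?D x" for s
    define g' where "g' s = ?D (x + s *\<^sub>R w)" for s
    have g': "(g' has_vector_derivative ?DD (x + s *\<^sub>R w)) (at s)" for s
      unfolding g'_def by (intro dir_deriv_has_vector_derivative smooth_differentiable sm)
    have g'b: "norm (g' s - g' 0) \<le> B * \<bar>s\<bar>" for s by (rule vector_mvt_bound[OF g' B])
    have "(g has_vector_derivative (g' s - g' 0)) (at s)" for s
    proof -
      have "((\<lambda>s. s *\<^sub>R ?D x) has_vector_derivative 1 *\<^sub>R ?D x) (at s)"
        by (auto intro!: derivative_eq_intros)
      then have "((\<lambda>s. f (x + s *\<^sub>R w) - s *\<^sub>R ?D x) has_vector_derivative ?D (x + s *\<^sub>R w) - 1 *\<^sub>R ?D x) (at s)"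
        by (intro has_vector_derivative_diff dir_deriv_has_vector_derivative smooth_differentiable f)
      then show ?thesis by (simp add: g_def[abs_def] g'_def)
    qed
    moreover have "norm (g' s - g' 0) \<le> B * \<bar>t\<bar>" if "\<bar>s\<bar> \<le> \<bar>t\<bar>" for s
      using g'b[of s] mult_left_mono[OF that B0] by linarith
    ultimately have "norm (g t - g 0) \<le> B * \<bar>t\<bar> * \<bar>t\<bar>" by (rule vector_mvt_bound)
    then show ?thesis by (simp add: g_def power2_eq_square algebra_simps)
  qed
  define r where "r = max R R' + norm y + norm w"
  define V where "V = measure lborel (cball (0::real^'n) r)"
  have bound: "norm (smear K f (y + t *\<^sub>R w) - smear K f y - t *\<^sub>R smear K ?D y) \<le> B * t\<^sup>2 * V" if t: "\<bar>t\<bar> \<le> 1" for t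
  proof -
    define d where "d z = indicator K z *\<^sub>R (f (y + z + t *\<^sub>R w) - f (y + z) - t *\<^sub>R ?D (y + z))" for z
    have deq: "d = (\<lambda>z. indicator K z *\<^sub>R f (y + t *\<^sub>R w + z) - indicator K z *\<^sub>R f (y + z)
          - t *\<^sub>R (indicator K z *\<^sub>R ?D (y + z)))"
      by (auto simp: d_def algebra_simps)
    have di: "integrable lborel d" unfolding deq
      by (intro Bochner_Integration.integrable_diff integrable_scaleR_right test_function_integrable f sm(1) cs K)
    have eq: "smear K f (y + t *\<^sub>R w) - smear K f y - t *\<^sub>R smear K ?D y = (\<integral>z. d z \<partial>lborel)"
    proof -
      note i1 = test_function_integrable[OF f K, of "y + t *\<^sub>R w"] and i2 = test_function_integrable[OF f K, of y]
        and i3 = test_function_integrable[OF sm(1) cs K, of y]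
      have "(\<integral>z. d z \<partial>lborel) = (\<integral>z. indicator K z *\<^sub>R f (y + t *\<^sub>R w + z) - indicator K z *\<^sub>R f (y + z)
          - t *\<^sub>R (indicator K z *\<^sub>R ?D (y + z)) \<partial>lborel)"
        by (simp only: deq)
      also have "\<dots> = smear K f (y + t *\<^sub>R w) - smear K f y - t *\<^sub>R smear K ?D y"
        unfolding smear_def
        by (simp only: Bochner_Integration.integral_diff[OF Bochner_Integration.integrable_diff[OF i1 i2] integrable_scaleR_right[OF i3]]
            Bochner_Integration.integral_diff[OF i1 i2] integral_scaleR_right)
      finally show ?thesis ..
    qed
    have db: "norm (d z) \<le> B * t\<^sup>2 * indicat_real (cball 0 r) z" for z
    proof (cases "norm z \<le> r")
      case True
      have "norm (d z) \<le> norm (f (y + z + t *\<^sub>R w) - f (y + z) - t *\<^sub>R ?D (y + z))"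
        by (auto simp: d_def indicator_def)
      also have "\<dots> \<le> B * t\<^sup>2" by (rule taylor)
      finally show ?thesis using True by simp
    next
      case False
      have "norm (t *\<^sub>R w) \<le> norm w" using t mult_right_mono[OF t norm_ge_zero[of w]] by simp
      then have "norm (y + z) > max R R'" "norm (y + z + t *\<^sub>R w) > max R R'"
      proof -
        have "norm z > max R R' + norm y + norm w" using False by (simp add: r_def)
        moreover have "norm (y + z) \<ge> norm z - norm y" using norm_diff_ineq[of z y] by (simp only: add.commute)
        moreover have "norm (y + z + t *\<^sub>R w) \<ge> norm z - norm (y + t *\<^sub>R w)"
          using norm_diff_ineq[of z "y + t *\<^sub>R w"] by (simp only: add_ac)
        moreover have "norm (y + t *\<^sub>R w) \<le> norm y + norm (t *\<^sub>R w)" by (rule norm_triangle_ineq)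
        moreover have "norm w \<ge> 0" by simp
        ultimately have "norm (y + z) > max R R' \<and> norm (y + z + t *\<^sub>R w) > max R R'"
          using \<open>norm (t *\<^sub>R w) \<le> norm w\<close> by linarith
        then show "norm (y + z) > max R R'" "norm (y + z + t *\<^sub>R w) > max R R'" by simp_all
      qed
      then have "d z = 0" using R[of "y + z + t *\<^sub>R w"] R[of "y + z"] R'[of "y + z"] by (simp add: d_def)
      then show ?thesis using False by simp
    qed
    have i: "integrable lborel (\<lambda>z. B * t\<^sup>2 * indicat_real (cball (0::real^'n) r) z)"
      using emeasure_bounded_finite[OF bounded_cball[of "0::real^'n" r]]
      by (intro integrable_mult_right integrable_real_indicator) auto
    have "norm (\<integral>z. d z \<partial>lborel) \<le> (\<integral>z. B * t\<^sup>2 * indicat_real (cball (0::real^'n) r) z \<partial>lborel)"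
      by (rule Bochner_Integration.integral_norm_bound_integral[OF di i]) (rule db)
    also have "\<dots> = B * t\<^sup>2 * V" by (simp add: V_def)
    finally show ?thesis unfolding eq .
  qed
  show ?thesis unfolding has_vector_derivative_def has_derivative_at_alt
  proof (intro conjI allI impI)
    show "bounded_linear (\<lambda>h. h *\<^sub>R smear K ?D y)" by (rule bounded_linear_scaleR_left)
    fix e :: real assume e: "e > 0"
    define d where "d = min 1 (e / (B * V + 1))"
    have BV: "0 \<le> B * V" using B0 by (simp add: V_def)
    have d: "d > 0" using e BV by (simp add: d_def)
    show "\<exists>d>0. \<forall>t. norm (t - 0) < d \<longrightarrow> norm (smear K f (y + t *\<^sub>R w) - smear K f (y + 0 *\<^sub>R w) -
       (t - 0) *\<^sub>R smear K ?D y) \<le> e * norm (t - 0)"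
    proof (intro exI conjI allI impI)
      fix t :: real assume t: "norm (t - 0) < d"
      have "norm (smear K f (y + t *\<^sub>R w) - smear K f y - t *\<^sub>R smear K ?D y) \<le> B * t\<^sup>2 * V"
        using t by (intro bound) (simp add: d_def)
      also have "\<dots> = (B * V * \<bar>t\<bar>) * \<bar>t\<bar>" by (simp add: power2_eq_square abs_mult[symmetric])
      also have "\<dots> \<le> e * \<bar>t\<bar>"
      proof (rule mult_right_mono)
        have "B * V * \<bar>t\<bar> \<le> (B * V + 1) * (e / (B * V + 1))"
          using t BV by (intro mult_mono) (auto simp: d_def)
        also have "\<dots> = e" using BV by simp
        finally show "B * V * \<bar>t\<bar> \<le> e" .
      qed simp
      finally show "norm (smear K f (y + t *\<^sub>R w) - smear K f (y + 0 *\<^sub>R w) - (t - 0) *\<^sub>R smear K ?D y) \<le> e * norm (t - 0)"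
        by simp
    qed (rule d)
  qed
qed

lemma smear_linear_combination:
  assumes "\<And>i. i \<in> S \<Longrightarrow> smooth (g i)" "\<And>i. i \<in> S \<Longrightarrow> compact_support (g i)" "K \<in> sets borel"
  shows "smear K (\<lambda>x. \<Sum>i\<in>S. c i * g i x) y = (\<Sum>i\<in>S. c i * smear K (g i) y)"
proof -
  have i: "integrable lborel (\<lambda>z. indicator K z *\<^sub>R g i (y + z))" if "i \<in> S" for i
    using that assms by (intro test_function_integrable) auto
  have "smear K (\<lambda>x. \<Sum>i\<in>S. c i * g i x) y = (\<integral>z. (\<Sum>i\<in>S. c i * (indicator K z *\<^sub>R g i (y + z))) \<partial>lborel)"
    unfolding smear_def by (intro Bochner_Integration.integral_cong) (auto simp: scaleR_sum_right)
  also have "\<dots> = (\<Sum>i\<in>S. \<integral>z. c i * (indicator K z *\<^sub>R g i (y + z)) \<partial>lborel)"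
    using i by (intro Bochner_Integration.integral_sum integrable_mult_right)
  also have "\<dots> = (\<Sum>i\<in>S. c i * smear K (g i) y)"
    by (intro sum.cong refl) (simp only: smear_def integral_mult_right_zero)
  finally show ?thesis .
qed

lemma compact_support_foldr_deriv:
  assumes "smooth f" "compact_support f"
  shows "compact_support (foldr (\<lambda>j. dir_deriv (w j) ^^ a j) l f)"
proof (induction l)
  case (Cons j l)
  have "compact_support ((dir_deriv v ^^ m) g)" if "compact_support g" for v m g
    using compact_support_diff_op[OF that, of "\<lambda>_::bool. v" "in_var True (monom 1 m)"]
    by (simp flip: dir_deriv_pow_eq_diff_op add: compact_support_def)
  then show ?case using Cons by simp
qed (use assms in simp)

text \<open>An affine dependence of the apex on \<open>h\<close> turns derivatives in \<open>h\<close> into derivatives of \<open>f\<close> in the directions in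
  which the apex moves.\<close>

lemma diff_op_smear_sum:
  fixes A :: "'v \<Rightarrow> real^'d::{finite,linorder} \<Rightarrow> real^'n"
  assumes V: "finite V" and K: "\<And>v. v \<in> V \<Longrightarrow> K v \<in> sets borel" and f: "smooth f" "compact_support f"
    and A: "\<And>v h j t. v \<in> V \<Longrightarrow> A v (h + t *\<^sub>R std_dir j) = A v h + t *\<^sub>R w v j"
  shows "diff_op std_dir S (\<lambda>h. \<Sum>v\<in>V. c v * smear (K v) f (A v h)) h =
     (\<Sum>v\<in>V. c v * smear (K v) (diff_op (w v) S f) (A v h))"
proof -
  have one: "dir_deriv (std_dir j) (\<lambda>h. \<Sum>v\<in>V. c v * smear (K v) (g v) (A v h)) =
      (\<lambda>h. \<Sum>v\<in>V. c v * smear (K v) (dir_deriv (w v j) (g v)) (A v h))"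
    if g: "\<And>v. v \<in> V \<Longrightarrow> smooth (g v)" "\<And>v. v \<in> V \<Longrightarrow> compact_support (g v)" for g j
  proof
    fix h
    have "((\<lambda>t. \<Sum>v\<in>V. c v * smear (K v) (g v) (A v h + t *\<^sub>R w v j)) has_vector_derivative
        (\<Sum>v\<in>V. c v * smear (K v) (dir_deriv (w v j) (g v)) (A v h))) (at 0)"
      using g K by (intro has_vector_derivative_sum has_vector_derivative_mult_right smear_dir_deriv) auto
    moreover have "(\<lambda>t. \<Sum>v\<in>V. c v * smear (K v) (g v) (A v (h + t *\<^sub>R std_dir j))) =
       (\<lambda>t. \<Sum>v\<in>V. c v * smear (K v) (g v) (A v h + t *\<^sub>R w v j))"
      using A by (intro ext sum.cong) auto
    ultimately show "dir_deriv (std_dir j) (\<lambda>h. \<Sum>v\<in>V. c v * smear (K v) (g v) (A v h)) h =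
        (\<Sum>v\<in>V. c v * smear (K v) (dir_deriv (w v j) (g v)) (A v h))"
      unfolding dir_deriv_def[of "std_dir j"] by (simp add: vector_derivative_at)
  qed
  have pow: "(dir_deriv (std_dir j) ^^ m) (\<lambda>h. \<Sum>v\<in>V. c v * smear (K v) (g v) (A v h)) =
      (\<lambda>h. \<Sum>v\<in>V. c v * smear (K v) ((dir_deriv (w v j) ^^ m) (g v)) (A v h))"
    if g: "\<And>v. v \<in> V \<Longrightarrow> smooth (g v)" "\<And>v. v \<in> V \<Longrightarrow> compact_support (g v)" for g j m
  proof (induction m)
    case (Suc m)
    have cs: "compact_support ((dir_deriv (w v j) ^^ m) (g v))" if "v \<in> V" for v
      using compact_support_foldr_deriv[where w="\<lambda>_::bool. w v j" and a="\<lambda>_. m" and l="[True]", OF g[OF that]] by simp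
    show ?case using one[of "\<lambda>v. (dir_deriv (w v j) ^^ m) (g v)" j] Suc cs g(1)
      by (simp add: smooth_dir_deriv_pow)
  qed simp
  have fold: "foldr (\<lambda>j. dir_deriv (std_dir j) ^^ a j) l (\<lambda>h. \<Sum>v\<in>V. c v * smear (K v) f (A v h)) =
      (\<lambda>h. \<Sum>v\<in>V. c v * smear (K v) (foldr (\<lambda>j. dir_deriv (w v j) ^^ a j) l f) (A v h))" for a l
  proof (induction l)
    case (Cons j l)
    then show ?case
      using pow[where g="\<lambda>v. foldr (\<lambda>j. dir_deriv (w v j) ^^ a j) l f" and j=j and m="a j"]
      by (simp add: smooth_foldr_deriv f compact_support_foldr_deriv)
  qed simp
  have "diff_op std_dir S (\<lambda>h. \<Sum>v\<in>V. c v * smear (K v) f (A v h)) h =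
     (\<Sum>a\<in>Poly_Mapping.keys S. Poly_Mapping.lookup S a *
        (\<Sum>v\<in>V. c v * smear (K v) (multi_deriv (w v) (Poly_Mapping.lookup a) f) (A v h)))"
    unfolding diff_op_def multi_deriv_def fold ..
  also have "\<dots> = (\<Sum>v\<in>V. c v * (\<Sum>a\<in>Poly_Mapping.keys S. Poly_Mapping.lookup S a *
        smear (K v) (multi_deriv (w v) (Poly_Mapping.lookup a) f) (A v h)))"
    unfolding sum_distrib_left by (subst sum.swap) (simp add: mult_ac)
  also have "\<dots> = (\<Sum>v\<in>V. c v * smear (K v) (diff_op (w v) S f) (A v h))"
  proof (intro sum.cong refl)
    fix v assume v: "v \<in> V"
    have "smear (K v) (diff_op (w v) S f) (A v h) = smear (K v) (\<lambda>x. \<Sum>a\<in>Poly_Mapping.keys S.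
        Poly_Mapping.lookup S a * multi_deriv (w v) (Poly_Mapping.lookup a) f x) (A v h)"
      by (simp add: diff_op_def[abs_def])
    also have "\<dots> = (\<Sum>a\<in>Poly_Mapping.keys S. Poly_Mapping.lookup S a *
        smear (K v) (multi_deriv (w v) (Poly_Mapping.lookup a) f) (A v h))"
      by (rule smear_linear_combination)
         (use K[OF v] f in \<open>auto simp: smooth_foldr_deriv multi_deriv_def compact_support_foldr_deriv\<close>)
    finally show "c v * (\<Sum>a\<in>Poly_Mapping.keys S. Poly_Mapping.lookup S a *
        smear (K v) (multi_deriv (w v) (Poly_Mapping.lookup a) f) (A v h)) =
        c v * smear (K v) (diff_op (w v) S f) (A v h)" by simp
  qed
  finally show ?thesis .
qed

lemma diff_op_prod_cong:
  fixes f :: "real^'n \<Rightarrow> complex"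
  assumes "finite S" "smooth f"
    and "\<And>j g. j \<in> S \<Longrightarrow> smooth g \<Longrightarrow> diff_op w (T j) g = diff_op w' (T' j) g"
  shows "diff_op w (\<Prod>j\<in>S. T j) f = diff_op w' (\<Prod>j\<in>S. T' j) f"
  using assms
proof (induction S rule: finite_induct)
  case empty
  then show ?case by (simp add: fun_eq_iff)
next
  case (insert i S)
  have "diff_op w (T i * (\<Prod>j\<in>S. T j)) f = diff_op w (T i) (diff_op w (\<Prod>j\<in>S. T j) f)"
    using insert.prems(1) by (simp add: diff_op_mult fun_eq_iff)
  also have "\<dots> = diff_op w' (T' i) (diff_op w' (\<Prod>j\<in>S. T' j) f)"
    using insert by (simp add: smooth_diff_op)
  also have "\<dots> = diff_op w' (T' i * (\<Prod>j\<in>S. T' j)) f"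
    using insert.prems(1) by (simp add: diff_op_mult fun_eq_iff)
  finally show ?case using insert.hyps by simp
qed

lemma dir_deriv_uminus:
  fixes g :: "real^'n \<Rightarrow> complex"
  assumes "smooth g"
  shows "dir_deriv (- w) g = (\<lambda>x. - dir_deriv w g x)"
  by (rule ext, subst (1 2) dir_deriv_expand_complex[OF assms]) (simp add: sum_negf)

lemma diff_op_in_var_uminus:
  fixes g :: "real^'n \<Rightarrow> complex"
  assumes g: "smooth g" and w: "w j = - w' j"
  shows "diff_op w (in_var j p) g = diff_op w' (in_var j (pcompose p [:0, -1:])) g"
proof
  fix x
  have pow: "(dir_deriv (- v) ^^ i) g = (\<lambda>x. (-1) ^ i * (dir_deriv v ^^ i) g x)" for v i
  proof (induction i)
    case (Suc i)
    have sm: "smooth ((dir_deriv v ^^ i) g)" by (rule smooth_dir_deriv_pow[OF g])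
    have "dir_deriv (- v) (\<lambda>x. (-1) ^ i * (dir_deriv v ^^ i) g x) = (\<lambda>x. - ((-1) ^ i * dir_deriv v ((dir_deriv v ^^ i) g) x))"
      using dir_deriv_uminus[OF smooth_cmult[OF sm, of "(-1) ^ i"], of v]
      by (simp add: dir_deriv_cmult_fun smooth_differentiable[OF sm])
    then show ?case unfolding funpow.simps o_def Suc by (simp add: fun_eq_iff)
  qed simp
  have "degree (pcompose p [:0, -1:]) \<le> degree p" by (rule degree_le) (simp add: coeff_pcompose_uminus coeff_eq_0)
  then have "diff_op w' (in_var j (pcompose p [:0, -1:])) g x =
     (\<Sum>i\<le>degree p. coeff (pcompose p [:0, -1:]) i * (dir_deriv (w' j) ^^ i) g x)"
    by (rule diff_op_in_var_bound)
  then show "diff_op w (in_var j p) g x = diff_op w' (in_var j (pcompose p [:0, -1:])) g x"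
    by (simp add: diff_op_in_var w pow coeff_pcompose_uminus mult_ac)
qed

lemma diff_op_in_var_zero_dir:
  assumes "w j = 0"
  shows "diff_op w (in_var j p) g x = coeff p 0 * g x"
proof -
  have "(dir_deriv 0 ^^ i) g x = (if i = 0 then g x else 0)" for i
    by (cases i) auto
  then have "diff_op w (in_var j p) g x = (\<Sum>i\<le>degree p. if i = 0 then coeff p 0 * g x else 0)"
    unfolding diff_op_in_var assms by (intro sum.cong) auto
  then show ?thesis by simp
qed

section \<open>The formula at a vertex\<close>

locale lattice_polytope = simple_presentation P u \<mu>
  for P :: "(real^'n::{finite,wellorder}) set" and u :: "'d::{finite,linorder} \<Rightarrow> real^'n::_" and \<mu> :: "'d \<Rightarrow> real" +
  assumes integral: "vertices P \<subseteq> int_lattice"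
begin

abbreviation "cone_dir \<xi> v \<equiv> alpha_sharp u (tight v) \<xi>"
abbreviation "cone_normal \<xi> v \<equiv> u_sharp u (tight v) \<xi>"
abbreviation "cone_root \<xi> v \<gamma> \<equiv> lam_sharp u (tight v) \<xi> \<gamma>"
abbreviation "groupv v \<equiv> Gamma_grp u (tight v)"

lemma sharp_dual:
  assumes v: "v \<in> vertices P" and ij: "i \<in> tight v" "j \<in> tight v"
  shows "cone_normal \<xi> v i \<bullet> cone_dir \<xi> v j = (if i = j then 1 else 0)"
  using edge_dir_dual[OF v ij(1), of j] by (auto simp: u_sharp_def alpha_sharp_def)

lemma sharp_expand:
  assumes v: "v \<in> vertices P"
  shows "x = (\<Sum>j\<in>tight v. (cone_normal \<xi> v j \<bullet> x) *\<^sub>R cone_dir \<xi> v j)"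
    "x = (\<Sum>j\<in>tight v. (cone_dir \<xi> v j \<bullet> x) *\<^sub>R cone_normal \<xi> v j)"
proof -
  have "(cone_normal \<xi> v j \<bullet> x) *\<^sub>R cone_dir \<xi> v j = (u j \<bullet> x) *\<^sub>R edge_dir v j"
    "(cone_dir \<xi> v j \<bullet> x) *\<^sub>R cone_normal \<xi> v j = (x \<bullet> edge_dir v j) *\<^sub>R u j" for j
    by (auto simp: u_sharp_def alpha_sharp_def inner_commute[of x])
  then show "x = (\<Sum>j\<in>tight v. (cone_normal \<xi> v j \<bullet> x) *\<^sub>R cone_dir \<xi> v j)"
    "x = (\<Sum>j\<in>tight v. (cone_dir \<xi> v j \<bullet> x) *\<^sub>R cone_normal \<xi> v j)"
    using edge_dir_expand[OF v, of x] dual_expand[OF v, of x] by simp_all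
qed

lemma dual_frame_vertex: "v \<in> vertices P \<Longrightarrow> dual_frame (cone_dir \<xi> v) (cone_normal \<xi> v) (tight v)"
  using sharp_dual sharp_expand card_tight_vertex by unfold_locales auto

lemma cone_root_of_unity:
  assumes "v \<in> vertices P" "\<gamma> \<in> groupv v" "j \<in> tight v"
  shows "\<exists>N>0. cone_root \<xi> v \<gamma> j ^ N = 1"
proof -
  obtain N where "N > 0" "lam_vertex u (tight v) \<gamma> j ^ N = 1" using lam_vertex_root_of_unity[OF assms] by blast
  then show ?thesis by (intro exI[of _ N]) (auto simp: lam_sharp_def power_inverse)
qed

lemma twisted_cone_vertex:
  assumes "v \<in> vertices P" "\<gamma> \<in> groupv v" "k \<ge> 1"
  shows "twisted_cone (cone_dir \<xi> v) (cone_normal \<xi> v) (cone_root \<xi> v \<gamma>) (tight v) k"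
  using assms sharp_dual cone_root_of_unity by unfold_locales auto

lemma mem_cone_sharp:
  assumes v: "v \<in> vertices P"
  shows "x \<in> cone_sharp u (tight v) \<xi> v \<longleftrightarrow> (\<forall>j\<in>tight v. cone_normal \<xi> v j \<bullet> (x - v) \<ge> 0)"
proof
  assume "x \<in> cone_sharp u (tight v) \<xi> v"
  then obtain t where t: "x = v + (\<Sum>j\<in>tight v. t j *\<^sub>R cone_dir \<xi> v j)" "\<forall>j\<in>tight v. 0 \<le> t j"
    by (auto simp: cone_sharp_def)
  have "cone_normal \<xi> v i \<bullet> (x - v) = t i" if i: "i \<in> tight v" for i
  proof -
    have "cone_normal \<xi> v i \<bullet> (x - v) = (\<Sum>j\<in>tight v. if j = i then t j else 0)"
      unfolding t(1) add_diff_cancel_left' inner_sum_right using i by (intro sum.cong) (auto simp: sharp_dual[OF v])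
    then show ?thesis using i by simp
  qed
  then show "\<forall>j\<in>tight v. cone_normal \<xi> v j \<bullet> (x - v) \<ge> 0" using t(2) by simp
next
  assume "\<forall>j\<in>tight v. cone_normal \<xi> v j \<bullet> (x - v) \<ge> 0"
  moreover have "x = v + (\<Sum>j\<in>tight v. (cone_normal \<xi> v j \<bullet> (x - v)) *\<^sub>R cone_dir \<xi> v j)"
    using sharp_expand(1)[OF v, of "x - v" \<xi>] by simp
  ultimately show "x \<in> cone_sharp u (tight v) \<xi> v" unfolding cone_sharp_def
    by (intro CollectI exI[of _ "\<lambda>j. cone_normal \<xi> v j \<bullet> (x - v)"] conjI)
qed

lemma cone_sharp_borel: "v \<in> vertices P \<Longrightarrow> cone_sharp u (tight v) \<xi> v \<in> sets borel"
proof -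
  assume v: "v \<in> vertices P"
  have "cone_sharp u (tight v) \<xi> v = (\<Inter>j\<in>tight v. {x. cone_normal \<xi> v j \<bullet> (x - v) \<ge> 0})"
    using mem_cone_sharp[OF v] by auto
  moreover have "closed {x. cone_normal \<xi> v j \<bullet> (x - v) \<ge> 0}" for j
    by (intro closed_Collect_le continuous_intros)
  ultimately show ?thesis by (auto intro!: borel_closed closed_INT)
qed

lemma cone_normal_slack:
  assumes v: "v \<in> vertices P" and j: "j \<in> tight v"
  shows "cone_normal \<xi> v j \<bullet> (x - v) = (if j \<in> flips \<xi> v then - slack j x else slack j x)"
  using slack_diff[of j x v] j by (auto simp: u_sharp_def flips_def flipped_iff tight_iff)

lemma cone_normal_slack_shift:
  assumes v: "v \<in> vertices P" and j: "j \<in> tight v"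
  shows "cone_normal \<xi> v j \<bullet> (x - vertex_shift v h) = (if j \<in> flips \<xi> v then - slack_shift h j x else slack_shift h j x)"
  using slack_shift_diff[of h j x "vertex_shift v h"] slack_shift_vertex[OF v j, of h] j
  by (auto simp: u_sharp_def flips_def flipped_iff)

lemma group_representatives:
  assumes v: "v \<in> vertices P"
  obtains G where "finite G" "G \<subseteq> int_lattice" "card G = card (groupv v)"
    "\<And>z. z \<in> int_lattice \<Longrightarrow> \<exists>!g. g \<in> G \<and> (\<forall>j\<in>tight v. cone_dir \<xi> v j \<bullet> (z - g) \<in> \<int>)"
proof -
  define r where "r \<gamma> = (SOME g. g \<in> int_lattice \<and> \<gamma> = coset (tight v) g)" for \<gamma>
  have r: "r \<gamma> \<in> int_lattice" "\<gamma> = coset (tight v) (r \<gamma>)" if "\<gamma> \<in> groupv v" for \<gamma>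
    using someI_ex[of "\<lambda>g. g \<in> int_lattice \<and> \<gamma> = coset (tight v) g"] that
    by (auto simp: r_def Gamma_grp_eq normal_lattice_vertex[OF v])
  have inj: "inj_on r (groupv v)" by (rule inj_onI) (metis r(2))
  have sharp: "(\<forall>j\<in>tight v. cone_dir \<xi> v j \<bullet> (z - g) \<in> \<int>) \<longleftrightarrow> coset (tight v) z = coset (tight v) g"
    if "z \<in> int_lattice" "g \<in> int_lattice" for z g
  proof -
    have "cone_dir \<xi> v j \<bullet> (z - g) \<in> \<int> \<longleftrightarrow> (z - g) \<bullet> edge_dir v j \<in> \<int>" for j
      by (auto simp: alpha_sharp_def inner_commute)
    then show ?thesis
      using coset_eq_iff[OF v order_refl, of z g] that
      by (auto simp: normal_lattice_vertex[OF v] facet_lattice_iff[OF v order_refl])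
  qed
  show thesis
  proof (rule that[of "r ` groupv v"])
    show "finite (r ` groupv v)" using finite_Gamma_vertex[OF v] by simp
    show "r ` groupv v \<subseteq> int_lattice" using r(1) by auto
    show "card (r ` groupv v) = card (groupv v)" by (rule card_image[OF inj])
    fix z :: "real^'n::_" assume z: "z \<in> int_lattice"
    let ?\<gamma> = "coset (tight v) z"
    have \<gamma>: "?\<gamma> \<in> groupv v" using z by (auto simp: Gamma_grp_eq normal_lattice_vertex[OF v])
    show "\<exists>!g. g \<in> r ` groupv v \<and> (\<forall>j\<in>tight v. cone_dir \<xi> v j \<bullet> (z - g) \<in> \<int>)"
    proof (rule ex1I[of _ "r ?\<gamma>"])
      show "r ?\<gamma> \<in> r ` groupv v \<and> (\<forall>j\<in>tight v. cone_dir \<xi> v j \<bullet> (z - r ?\<gamma>) \<in> \<int>)"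
        using \<gamma> r[OF \<gamma>] sharp[OF z, of "r ?\<gamma>"] by blast
      fix g assume g: "g \<in> r ` groupv v \<and> (\<forall>j\<in>tight v. cone_dir \<xi> v j \<bullet> (z - g) \<in> \<int>)"
      then obtain \<delta> where \<delta>: "\<delta> \<in> groupv v" "g = r \<delta>" by blast
      then have "?\<gamma> = coset (tight v) (r \<delta>)" using g sharp[OF z, of g] r(1) by blast
      then show "g = r ?\<gamma>" using r(2)[OF \<delta>(1)] \<delta>(2) by simp
    qed
  qed
qed

lemma card_groupv_pos: "v \<in> vertices P \<Longrightarrow> card (groupv v) > 0"
  using finite_Gamma_vertex[of v] int_lattice_zero
  by (auto simp: card_gt_0_iff Gamma_grp_eq normal_lattice_vertex)

lemma cone_normal_int: "cone_normal \<xi> v j \<in> int_lattice"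
  using u_int[of j] int_lattice_scale[of "-1" "u j"] by (auto simp: u_sharp_def)

definition periodic_factor :: "nat \<Rightarrow> real^'n::_ \<Rightarrow> real^'n::_ \<Rightarrow> (real^'n::_) set \<Rightarrow> 'd set \<Rightarrow> real^'n::_ \<Rightarrow> complex" where
  "periodic_factor k \<xi> v \<gamma> J x = (\<Prod>j\<in>tight v - J. Q_fun k (cone_root \<xi> v \<gamma> j) (cone_normal \<xi> v j \<bullet> (x - v)))"

lemma kernel_as_function:
  assumes v: "v \<in> vertices P" and J: "J \<subseteq> tight v"
  shows "orthant_kernel k (cone_root \<xi> v \<gamma>) (tight v) J (\<lambda>j. cone_normal \<xi> v j \<bullet> (x - v)) =
     of_real (indicat_real (cone_sharp u (tight v) \<xi> v) x) * periodic_factor k \<xi> v \<gamma> J x"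
proof -
  let ?t = "\<lambda>j. cone_normal \<xi> v j \<bullet> (x - v)"
  have "orthant_kernel k (cone_root \<xi> v \<gamma>) (tight v) J ?t =
     (\<Prod>j\<in>tight v. of_real (indicat_real {0..} (?t j))) *
     (\<Prod>j\<in>tight v. if j \<in> J then 1 else Q_fun k (cone_root \<xi> v \<gamma> j) (?t j))"
    by (simp add: orthant_kernel_def prod.distrib)
  also have "(\<Prod>j\<in>tight v. of_real (indicat_real {0..} (?t j))) = (of_real (indicat_real (cone_sharp u (tight v) \<xi> v) x) :: complex)"
  proof (cases "x \<in> cone_sharp u (tight v) \<xi> v")
    case True
    then show ?thesis using mem_cone_sharp[OF v] by (auto intro!: prod.neutral)
  next
    case False
    then obtain j where "j \<in> tight v" "?t j < 0" using mem_cone_sharp[OF v] by force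
    then have "(\<Prod>j\<in>tight v. of_real (indicat_real {0..} (?t j))) = (0::complex)" by (intro prod_zero bexI[of _ j]) auto
    then show ?thesis using False by simp
  qed
  also have "(\<Prod>j\<in>tight v. if j \<in> J then 1 else Q_fun k (cone_root \<xi> v \<gamma> j) (?t j)) = periodic_factor k \<xi> v \<gamma> J x"
    unfolding periodic_factor_def by (rule prod.mono_neutral_cong_right) auto
  finally show ?thesis .
qed

lemma periodic_factor_measurable:
  assumes v: "v \<in> vertices P" and \<gamma>: "\<gamma> \<in> groupv v" and k: "k \<ge> 1"
  shows "periodic_factor k \<xi> v \<gamma> J \<in> borel_measurable borel"
proof -
  interpret twisted_cone "cone_dir \<xi> v" "cone_normal \<xi> v" "cone_root \<xi> v \<gamma>" "tight v" v k
    by (rule twisted_cone_vertex[OF v \<gamma> k])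
  have "(\<lambda>x. Q_fun k (cone_root \<xi> v \<gamma> j) (cone_normal \<xi> v j \<bullet> (x - v))) \<in> borel_measurable borel" if "j \<in> tight v" for j
    by (rule measurable_compose[OF _ Q_fun_lam(1)[OF that]]) simp
  then show ?thesis unfolding periodic_factor_def[abs_def] by (intro borel_measurable_prod) auto
qed

lemma periodic_factor_bounded:
  assumes v: "v \<in> vertices P" and \<gamma>: "\<gamma> \<in> groupv v" and k: "k \<ge> 1"
  shows "\<exists>B. \<forall>x. norm (periodic_factor k \<xi> v \<gamma> J x) \<le> B"
proof -
  interpret twisted_cone "cone_dir \<xi> v" "cone_normal \<xi> v" "cone_root \<xi> v \<gamma>" "tight v" v k
    by (rule twisted_cone_vertex[OF v \<gamma> k])
  have "\<forall>j\<in>tight v. \<exists>B. \<forall>x. norm (Q_fun k (cone_root \<xi> v \<gamma> j) x) \<le> B" using Q_fun_lam(2) by blast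
  then obtain B where B: "\<And>j x. j \<in> tight v \<Longrightarrow> norm (Q_fun k (cone_root \<xi> v \<gamma> j) x) \<le> B j" by metis
  have "norm (periodic_factor k \<xi> v \<gamma> J x) \<le> (\<Prod>j\<in>tight v - J. B j)" for x
    unfolding periodic_factor_def by (rule order_trans[OF norm_prod_le prod_mono]) (use B in auto)
  then show ?thesis by blast
qed

definition cone_weight :: "real^'n::_ \<Rightarrow> real^'n::_ \<Rightarrow> real^'n::_ \<Rightarrow> real" where
  "cone_weight \<xi> v x = (\<Prod>j\<in>tight v. half_step (cone_normal \<xi> v j \<bullet> (x - v)))"

text \<open>Lattice points of the cone are the integer points of the lattice spanned by the edge vectors on
  which all characters of \<open>\<Gamma>\<^sub>v\<close> are trivial, so averaging the twisted orthant formula over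
  \<open>\<Gamma>\<^sub>v\<close> counts them.  The factor \<open>1/|\<Gamma>\<^sub>v|\<close> cancels against the volume of the lattice cell.\<close>

theorem euler_maclaurin_vertex:
  assumes v: "v \<in> vertices P" and k: "k \<ge> 1" and f: "smooth f" "compact_support f"
    and S: "finite S" "S \<subseteq> int_lattice" "\<And>x. x \<in> int_lattice \<Longrightarrow> x \<notin> S \<Longrightarrow> f x = 0"
  shows "(\<Sum>x\<in>S. of_real (cone_weight \<xi> v x) * f x) =
     (\<Sum>\<gamma>\<in>groupv v. \<Sum>J\<in>Pow (tight v). ((-1) ^ (k - 1)) ^ card (tight v - J) *
        (LINT x:cone_sharp u (tight v) \<xi> v|lborel. periodic_factor k \<xi> v \<gamma> J x *
           diff_op (cone_dir \<xi> v) (orthant_op k (cone_root \<xi> v \<gamma>) (tight v) J) f x))"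
proof -
  let ?I = "tight v" and ?a = "cone_dir \<xi> v" and ?b = "cone_normal \<xi> v"
  interpret dual_frame ?a ?b ?I by (rule dual_frame_vertex[OF v])
  obtain R where R: "\<And>x. norm x > R \<Longrightarrow> f x = 0" using f(2) by (auto simp: compact_support_def)
  define r where "r = (\<Sum>j\<in>?I. norm (?b j) * (\<bar>R\<bar> + norm v))"
  have van: "f x = 0" if j: "j \<in> ?I" "\<bar>?b j \<bullet> (x - v)\<bar> > r" for x j
  proof (rule R, rule ccontr)
    assume "\<not> R < norm x"
    then have "norm (x - v) \<le> \<bar>R\<bar> + norm v" using norm_triangle_ineq4[of x v] by linarith
    then have "norm (?b j) * norm (x - v) \<le> norm (?b j) * (\<bar>R\<bar> + norm v)" by (intro mult_left_mono) auto
    moreover have "\<bar>?b j \<bullet> (x - v)\<bar> \<le> norm (?b j) * norm (x - v)" by (rule Cauchy_Schwarz_ineq2)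
    moreover have "norm (?b j) * (\<bar>R\<bar> + norm v) \<le> r" unfolding r_def using j(1) by (intro member_le_sum) auto
    ultimately show False using j(2) by linarith
  qed
  obtain T :: nat where T: "r < real T" using reals_Archimedean2 by blast
  obtain G where G: "finite G" "G \<subseteq> int_lattice" "card G = card (groupv v)"
    "\<And>z. z \<in> int_lattice \<Longrightarrow> \<exists>!g. g \<in> G \<and> (\<forall>j\<in>?I. ?a j \<bullet> (z - g) \<in> \<int>)"
    by (rule group_representatives[OF v, of \<xi>], rule that; assumption)
  define \<Phi> where "\<Phi> m = v + (\<Sum>j\<in>?I. real (m j) *\<^sub>R ?a j)" for m
  let ?n = "of_nat (card (groupv v)) :: complex"
  have n0: "?n \<noteq> 0" using card_groupv_pos[OF v] by simp
  let ?term = "\<lambda>\<gamma> J. (LINT x:cone_sharp u ?I \<xi> v|lborel. periodic_factor k \<xi> v \<gamma> J x *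
           diff_op ?a (orthant_op k (cone_root \<xi> v \<gamma>) ?I J) f x)"
  let ?M = "PiE ?I (\<lambda>_. {..T})"
  have one: "(\<Sum>m\<in>?M. (\<Prod>j\<in>?I. ray_weight (m j) * cone_root \<xi> v \<gamma> j ^ m j) * f (\<Phi> m)) =
      ?n * (\<Sum>J\<in>Pow ?I. ((-1) ^ (k - 1)) ^ card (?I - J) * ?term \<gamma> J)" if \<gamma>: "\<gamma> \<in> groupv v" for \<gamma>
  proof -
    interpret twisted_cone ?a ?b "cone_root \<xi> v \<gamma>" ?I v k by (rule twisted_cone_vertex[OF v \<gamma> k])
    have int: "(\<integral>t. orthant_kernel k (cone_root \<xi> v \<gamma>) ?I J t * diff_op ?a (orthant_op k (cone_root \<xi> v \<gamma>) ?I J) f (v + (\<Sum>j\<in>?I. t j *\<^sub>R ?a j))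
           \<partial>PiM ?I (\<lambda>_. lborel)) = ?n * ?term \<gamma> J" if J: "J \<in> Pow ?I" for J
    proof -
      define D where "D = diff_op ?a (orthant_op k (cone_root \<xi> v \<gamma>) ?I J) f"
      define F where "F x = of_real (indicat_real (cone_sharp u ?I \<xi> v) x) * periodic_factor k \<xi> v \<gamma> J x * D x" for x
      have [measurable]: "D \<in> borel_measurable borel" unfolding D_def
        by (rule smooth_borel_measurable[OF smooth_diff_op[OF f(1)]])
      have [measurable]: "periodic_factor k \<xi> v \<gamma> J \<in> borel_measurable borel" by (rule periodic_factor_measurable[OF v \<gamma> k])
      have [measurable]: "cone_sharp u ?I \<xi> v \<in> sets borel" by (rule cone_sharp_borel[OF v])
      have F: "F \<in> borel_measurable borel" unfolding F_def[abs_def] by measurable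
      have "orthant_kernel k (cone_root \<xi> v \<gamma>) ?I J t * D (v + (\<Sum>j\<in>?I. t j *\<^sub>R ?a j)) = F (v + (\<Sum>j\<in>?I. t j *\<^sub>R ?a j))" for t
      proof -
        have "?b i \<bullet> (v + (\<Sum>j\<in>?I. t j *\<^sub>R ?a j) - v) = t i" if "i \<in> ?I" for i
          using ray_coordinate[OF order_refl that, of v t] that by simp
        then have "orthant_kernel k (cone_root \<xi> v \<gamma>) ?I J t =
           orthant_kernel k (cone_root \<xi> v \<gamma>) ?I J (\<lambda>i. ?b i \<bullet> (v + (\<Sum>j\<in>?I. t j *\<^sub>R ?a j) - v))"
          unfolding orthant_kernel_def by (intro prod.cong) auto
        then show ?thesis unfolding F_def using kernel_as_function[OF v, of J k \<xi> \<gamma> "v + (\<Sum>j\<in>?I. t j *\<^sub>R ?a j)"] J by simp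
      qed
      then have "(\<integral>t. orthant_kernel k (cone_root \<xi> v \<gamma>) ?I J t * D (v + (\<Sum>j\<in>?I. t j *\<^sub>R ?a j)) \<partial>PiM ?I (\<lambda>_. lborel)) =
         of_nat (card G) * (\<integral>x. F x \<partial>lborel)"
        using integral_edge_coordinates[OF cone_normal_int G(1,2,4) F, of v] by simp
      also have "(\<integral>x. F x \<partial>lborel) = ?term \<gamma> J"
        unfolding set_lebesgue_integral_def F_def D_def by (simp add: scaleR_conv_of_real mult.assoc)
      finally show ?thesis by (simp add: G(3) D_def)
    qed
    have "(\<Sum>m\<in>?M. (\<Prod>j\<in>?I. ray_weight (m j) * cone_root \<xi> v \<gamma> j ^ m j) * f (\<Phi> m)) =
     (\<Sum>J\<in>Pow ?I. ((-1) ^ (k - 1)) ^ card (?I - J) *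
        (\<integral>t. orthant_kernel k (cone_root \<xi> v \<gamma>) ?I J t * diff_op ?a (orthant_op k (cone_root \<xi> v \<gamma>) ?I J) f (v + (\<Sum>j\<in>?I. t j *\<^sub>R ?a j))
           \<partial>PiM ?I (\<lambda>_. lborel)))"
      unfolding \<Phi>_def by (rule euler_maclaurin_orthant[OF order_refl f van T]) auto
    also have "\<dots> = (\<Sum>J\<in>Pow ?I. ((-1) ^ (k - 1)) ^ card (?I - J) * (?n * ?term \<gamma> J))"
      by (intro sum.cong refl) (simp only: int)
    finally show ?thesis by (simp add: sum_distrib_left mult_ac)
  qed
  have chars: "(\<Sum>\<gamma>\<in>groupv v. \<Prod>j\<in>?I. cone_root \<xi> v \<gamma> j ^ m j) = (if \<Phi> m \<in> int_lattice then ?n else 0)" for m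
  proof -
    define m' where "m' j = (if flipped u ?I \<xi> j then - int (m j) else int (m j))" for j
    have "(\<Sum>\<gamma>\<in>groupv v. \<Prod>j\<in>?I. cone_root \<xi> v \<gamma> j ^ m j) = (\<Sum>\<gamma>\<in>groupv v. \<Prod>j\<in>?I. lam_vertex u ?I \<gamma> j powi m' j)"
      by (intro sum.cong prod.cong refl) (auto simp: lam_sharp_def m'_def power_int_minus power_inverse)
    moreover have "(\<Sum>j\<in>?I. of_int (m' j) *\<^sub>R edge_dir v j) = \<Phi> m - v"
      unfolding \<Phi>_def add_diff_cancel_left' by (intro sum.cong) (auto simp: m'_def alpha_sharp_def)
    moreover have "\<Phi> m - v \<in> int_lattice \<longleftrightarrow> \<Phi> m \<in> int_lattice"
      using int_lattice_add[of "\<Phi> m - v" v] int_lattice_diff[of "\<Phi> m" v] integral v by auto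
    ultimately show ?thesis using character_sum[OF v, of m'] by simp
  qed
  have "?n * (\<Sum>\<gamma>\<in>groupv v. \<Sum>J\<in>Pow ?I. ((-1) ^ (k - 1)) ^ card (?I - J) * ?term \<gamma> J) =
      (\<Sum>\<gamma>\<in>groupv v. \<Sum>m\<in>?M. (\<Prod>j\<in>?I. ray_weight (m j) * cone_root \<xi> v \<gamma> j ^ m j) * f (\<Phi> m))"
    by (simp add: sum_distrib_left one)
  also have "\<dots> = (\<Sum>m\<in>?M. \<Sum>\<gamma>\<in>groupv v. (\<Prod>j\<in>?I. ray_weight (m j) * cone_root \<xi> v \<gamma> j ^ m j) * f (\<Phi> m))"
    by (rule sum.swap)
  also have "\<dots> = (\<Sum>m\<in>?M. (\<Prod>j\<in>?I. ray_weight (m j)) * f (\<Phi> m) * (\<Sum>\<gamma>\<in>groupv v. \<Prod>j\<in>?I. cone_root \<xi> v \<gamma> j ^ m j))"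
    by (simp add: prod.distrib sum_distrib_left mult_ac)
  also have "\<dots> = ?n * (\<Sum>m\<in>?M. if \<Phi> m \<in> int_lattice then (\<Prod>j\<in>?I. ray_weight (m j)) * f (\<Phi> m) else 0)"
    unfolding chars sum_distrib_left by (intro sum.cong) auto
  also have "(\<Sum>m\<in>?M. if \<Phi> m \<in> int_lattice then (\<Prod>j\<in>?I. ray_weight (m j)) * f (\<Phi> m) else 0) =
      (\<Sum>m\<in>{m\<in>?M. \<Phi> m \<in> int_lattice}. (\<Prod>j\<in>?I. ray_weight (m j)) * f (\<Phi> m))"
    by (rule sum.inter_filter[symmetric]) (simp add: finite_PiE)
  also have "\<dots> = (\<Sum>x\<in>S. of_real (cone_weight \<xi> v x) * f x)"
  proof -
    let ?M' = "{m\<in>?M. \<Phi> m \<in> int_lattice}"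
    have coord: "?b i \<bullet> (\<Phi> m - v) = real (m i)" if i: "i \<in> ?I" for i m
    proof -
      have "?b i \<bullet> (\<Phi> m - v) = (\<Sum>j\<in>?I. if j = i then real (m j) else 0)"
        unfolding \<Phi>_def add_diff_cancel_left' inner_sum_right using i by (intro sum.cong) (auto simp: sharp_dual[OF v])
      then show ?thesis using i by simp
    qed
    have inj: "inj_on \<Phi> ?M'"
    proof (rule inj_onI)
      fix m m' assume m: "m \<in> ?M'" "m' \<in> ?M'" "\<Phi> m = \<Phi> m'"
      show "m = m'"
      proof (rule PiE_ext)
        show "m \<in> ?M" "m' \<in> ?M" using m by auto
        fix i assume "i \<in> ?I"
        then show "m i = m' i" using coord[of i m] coord[of i m'] m(3) by simp
      qed
    qed
    have w: "(\<Prod>j\<in>?I. ray_weight (m j)) = of_real (cone_weight \<xi> v (\<Phi> m))" for m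
      unfolding cone_weight_def of_real_prod
      by (intro prod.cong refl) (auto simp: coord ray_weight_def half_step_def)
    have "(\<Sum>m\<in>?M'. (\<Prod>j\<in>?I. ray_weight (m j)) * f (\<Phi> m)) = (\<Sum>x\<in>\<Phi> ` ?M'. of_real (cone_weight \<xi> v x) * f x)"
      by (simp add: sum.reindex[OF inj] w)
    also have "\<dots> = (\<Sum>x\<in>S. of_real (cone_weight \<xi> v x) * f x)"
    proof (rule sum.mono_neutral_cong)
      show "finite (\<Phi> ` ?M')" by (simp add: finite_PiE)
      show "finite S" by (rule S(1))
      show "of_real (cone_weight \<xi> v x) * f x = 0" if "x \<in> \<Phi> ` ?M' - S" for x
        using that S(3)[of x] by auto
      show "of_real (cone_weight \<xi> v x) * f x = 0" if x: "x \<in> S - \<Phi> ` ?M'" for x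
      proof (rule ccontr)
        assume nz: "of_real (cone_weight \<xi> v x) * f x \<noteq> 0"
        have xint: "x \<in> int_lattice" using x S(2) by blast
        have xv: "x - v \<in> int_lattice" using xint integral v by (auto intro: int_lattice_diff)
        have pos: "?b j \<bullet> (x - v) \<ge> 0" if j: "j \<in> ?I" for j
        proof (rule ccontr)
          assume "\<not> ?b j \<bullet> (x - v) \<ge> 0"
          then have "cone_weight \<xi> v x = 0" unfolding cone_weight_def
            using j by (intro prod_zero bexI[of _ j]) (auto simp: half_step_def)
          then show False using nz by simp
        qed
        have small: "?b j \<bullet> (x - v) \<le> r" if j: "j \<in> ?I" for j
          using van[OF j, of x] nz by (cases "\<bar>?b j \<bullet> (x - v)\<bar> > r") auto
        define m where "m = (\<lambda>j. if j \<in> ?I then nat \<lfloor>?b j \<bullet> (x - v)\<rfloor> else undefined)"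
        have mj: "real (m j) = ?b j \<bullet> (x - v)" if j: "j \<in> ?I" for j
        proof -
          have "?b j \<bullet> (x - v) \<in> \<int>" by (rule int_lattice_inner[OF cone_normal_int xv])
          then show ?thesis using pos[OF j] j by (auto simp: m_def elim!: Ints_cases)
        qed
        have "\<Phi> m = v + (\<Sum>j\<in>?I. (?b j \<bullet> (x - v)) *\<^sub>R ?a j)"
          unfolding \<Phi>_def by (simp add: mj)
        then have "\<Phi> m = x" using sharp_expand(1)[OF v, of "x - v" \<xi>] by simp
        moreover have "m \<in> ?M"
        proof (rule PiE_I)
          fix j assume j: "j \<in> ?I"
          have "real (m j) < real T" using small[OF j] T mj[OF j] by linarith
          then show "m j \<in> {..T}" by simp
        qed (simp add: m_def)
        ultimately have "x \<in> \<Phi> ` ?M'" using xint by auto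
        then show False using x by blast
      qed
    qed auto
    finally show ?thesis .
  qed
  finally show ?thesis using n0 by simp
qed

text \<open>The operators \<open>\<^bold>M\<^sub>\<gamma>\<^sub>,\<^sub>F\<close> act on the contribution of the vertex \<open>v\<close> as follows: they vanish
  unless the facets through \<open>F\<close> pass through \<open>v\<close>, because of a factor without constant term in a variable on which that contribution
  does not depend; otherwise they turn into the operator of the cone formula.\<close>

lemma M_op_at_vertex:
  assumes F: "F \<in> faces P" and \<gamma>: "\<gamma> \<in> Gamma_flat P u \<mu> F" and v: "v \<in> vertices P" and k: "k \<ge> 1"
    and f: "smooth f"
  shows "\<not> facet_idx u \<mu> F \<subseteq> tight v \<Longrightarrow> diff_op (\<lambda>j. - edge_dir v j) (M_op k P u \<mu> F \<gamma>) f = (\<lambda>x. 0)"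
    and "facet_idx u \<mu> F \<subseteq> tight v \<Longrightarrow> diff_op (\<lambda>j. - edge_dir v j) (M_op k P u \<mu> F \<gamma>) f =
       diff_op (cone_dir \<xi> v) (orthant_op k (cone_root \<xi> v (Gamma_map u (tight v) \<gamma>)) (tight v) (tight v)) f"
proof -
  let ?w = "\<lambda>j. - edge_dir v j" and ?T = "\<lambda>j. in_var j (M_poly k (lam_face P u \<mu> F \<gamma> j))"
  {
    assume "\<not> facet_idx u \<mu> F \<subseteq> tight v"
    then obtain j where j: "j \<in> facet_idx u \<mu> F" "j \<notin> tight v" by blast
    have w0: "?w j = 0" using edge_dir_outside[OF v j(2)] by simp
    have "M_op k P u \<mu> F \<gamma> = ?T j * (\<Prod>i\<in>UNIV - {j}. ?T i)"
      unfolding M_op_def by (rule prod.remove) auto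
    then show "diff_op ?w (M_op k P u \<mu> F \<gamma>) f = (\<lambda>x. 0)"
      using lam_face_flat_ne_1[OF F \<gamma> j(1)]
      by (auto simp: fun_eq_iff diff_op_mult[OF f] diff_op_in_var_zero_dir[where w="?w", OF w0] coeff_M_poly_0)
  next
    assume A: "facet_idx u \<mu> F \<subseteq> tight v"
    let ?g = "Gamma_map u (tight v) \<gamma>"
    let ?T' = "\<lambda>j. if j \<in> tight v then in_var j (main_poly k (cone_root \<xi> v ?g j)) else 1"
    have gG: "?g \<in> groupv v" using Gamma_flat_bij[OF v] F A \<gamma> by (auto simp: bij_betw_def)
    have "diff_op ?w (\<Prod>j\<in>UNIV. ?T j) f = diff_op (cone_dir \<xi> v) (\<Prod>j\<in>UNIV. ?T' j) f"
    proof (rule diff_op_prod_cong[OF finite_class.finite_UNIV f])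
      fix j and h :: "real^'n::_ \<Rightarrow> complex" assume h: "smooth h"
      show "diff_op ?w (?T j) h = diff_op (cone_dir \<xi> v) (?T' j) h"
      proof (cases "j \<in> tight v")
        case False
        have w0: "?w j = 0" using edge_dir_outside[OF v False] by simp
        have "j \<notin> facet_idx u \<mu> F" using A False by blast
        then have "lam_face P u \<mu> F \<gamma> j = 1" by (simp add: lam_face_def)
        moreover have "coeff (M_poly k 1) 0 = 1"
          using coeff_M_poly[of 1 1 k 0] k twist_series_nth_0[of 1] by (simp add: todd_series_def)
        ultimately show ?thesis using False by (simp add: fun_eq_iff diff_op_in_var_zero_dir[where w="?w", OF w0])
      next
        case True
        have lam: "lam_face P u \<mu> F \<gamma> j = lam_vertex u (tight v) ?g j" by (rule lam_face_eq_lam_vertex[OF F v A \<gamma> True])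
        obtain N where N: "lam_vertex u (tight v) ?g j ^ N = 1" "N > 0" using lam_vertex_root_of_unity[OF v gG True] by blast
        show ?thesis
        proof (cases "flipped u (tight v) \<xi> j")
          case flip: True
          have "main_poly k (cone_root \<xi> v ?g j) = M_poly k (lam_vertex u (tight v) ?g j)"
          proof (rule poly_eqI)
            fix i
            have "(- 1) ^ i * ((- 1) ^ i * c) = c" for c :: complex by (simp flip: mult.assoc power_mult_distrib)
            then show "coeff (main_poly k (cone_root \<xi> v ?g j)) i = coeff (M_poly k (lam_vertex u (tight v) ?g j)) i"
              using flip by (simp add: lam_sharp_def coeff_main_poly M_poly_inverse[OF N k] coeff_pcompose_uminus)
          qed
          moreover have "?w j = cone_dir \<xi> v j" using flip by (simp add: alpha_sharp_def)
          then have "diff_op ?w (in_var j p) h = diff_op (cone_dir \<xi> v) (in_var j p) h" for p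
            by (simp add: fun_eq_iff diff_op_in_var)
          ultimately show ?thesis using True lam by simp
        next
          case noflip: False
          have "?w j = - cone_dir \<xi> v j" using noflip by (simp add: alpha_sharp_def)
          then have "diff_op ?w (in_var j p) h = diff_op (cone_dir \<xi> v) (in_var j (pcompose p [:0, -1:])) h" for p
            by (intro diff_op_in_var_uminus[where w="?w"] h)
          then show ?thesis
            using True lam noflip by (simp add: lam_sharp_def main_poly_def)
        qed
      qed
    qed
    also have "(\<Prod>j\<in>UNIV. ?T' j) = orthant_op k (cone_root \<xi> v ?g) (tight v) (tight v)"
      unfolding orthant_op_def by (simp add: prod.If_cases)
    finally show "diff_op ?w (M_op k P u \<mu> F \<gamma>) f =
       diff_op (cone_dir \<xi> v) (orthant_op k (cone_root \<xi> v ?g) (tight v) (tight v)) f"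
      unfolding M_op_def .
  }
qed

definition cone_at_origin :: "real^'n::_ \<Rightarrow> real^'n::_ \<Rightarrow> (real^'n::_) set" where
  "cone_at_origin \<xi> v = {z. \<forall>j\<in>tight v. cone_normal \<xi> v j \<bullet> z \<ge> 0}"

lemma cone_at_origin_borel: "cone_at_origin \<xi> v \<in> sets borel"
proof -
  have "cone_at_origin \<xi> v = (\<Inter>j\<in>tight v. {z. cone_normal \<xi> v j \<bullet> z \<ge> 0})" by (auto simp: cone_at_origin_def)
  moreover have "closed {z. cone_normal \<xi> v j \<bullet> z \<ge> 0}" for j by (intro closed_Collect_le continuous_intros)
  ultimately show ?thesis by (auto intro!: borel_closed closed_INT)
qed

lemma smear_shift:
  assumes [measurable]: "K \<in> sets borel" "f \<in> borel_measurable borel"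
  shows "smear K f y = (\<integral>x. indicator K (x - y) *\<^sub>R f x \<partial>lborel)"
proof -
  have "(\<integral>x. indicator K (x - y) *\<^sub>R f x \<partial>lborel) =
      (\<integral>x. indicator K (x - y) *\<^sub>R f x \<partial>distr lborel borel ((+) y))"
    by (simp only: lborel_distr_plus)
  also have "\<dots> = (\<integral>x. indicator K (y + x - y) *\<^sub>R f (y + x) \<partial>lborel)"
    by (rule integral_distr) measurable
  finally show ?thesis by (simp add: smear_def)
qed

end

section \<open>The formula for compactly supported functions\<close>

lemma keys_prod_in_var:
  assumes "finite S" "b \<in> Poly_Mapping.keys (\<Prod>j\<in>S. in_var j (p j))"
  shows "if i \<in> S then coeff (p i) (Poly_Mapping.lookup b i) \<noteq> 0 else Poly_Mapping.lookup b i = 0"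
  using assms
proof (induction S arbitrary: b rule: finite_induct)
  case (insert j S)
  have "b \<in> Poly_Mapping.keys (in_var j (p j) * (\<Prod>j\<in>S. in_var j (p j)))" using insert by simp
  then obtain a c where ac: "b = a + c" "a \<in> Poly_Mapping.keys (in_var j (p j))"
      "c \<in> Poly_Mapping.keys (\<Prod>j\<in>S. in_var j (p j))"
    using keys_mult[of "in_var j (p j)" "\<Prod>j\<in>S. in_var j (p j)"] by blast
  have "Poly_Mapping.keys (in_var j (p j)) \<subseteq> (\<Union>m\<le>degree (p j). Poly_Mapping.keys (Poly_Mapping.single (Poly_Mapping.single j m) (coeff (p j) m)))"
    unfolding in_var_def by (rule keys_sum)
  then obtain m where "coeff (p j) m \<noteq> 0" "a = Poly_Mapping.single j m"
    using ac(2) by (auto split: if_splits)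
  then show ?case using insert.IH[OF ac(3)] insert.hyps
    by (auto simp: ac(1) lookup_add lookup_single when_def split: if_splits)
qed simp

text \<open>The periodic factors of the remainder need not be differentiable, but they are constant along the directions in
  which the operator in front of them differentiates.\<close>

lemma diff_op_invariant_factor:
  fixes g :: "real^'n \<Rightarrow> complex"
  assumes g: "smooth g" and S: "\<And>b j. b \<in> Poly_Mapping.keys T \<Longrightarrow> j \<notin> S \<Longrightarrow> Poly_Mapping.lookup b j = 0"
    and c: "\<And>j x t. j \<in> S \<Longrightarrow> c (x + t *\<^sub>R w j) = c x"
  shows "diff_op w T (\<lambda>x. c x * g x) x = c x * diff_op w T g x"
proof -
  have one: "dir_deriv (w j) (\<lambda>x. c x * h x) = (\<lambda>x. c x * dir_deriv (w j) h x)" if "j \<in> S" "smooth h" for h j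
  proof
    fix x
    have "((\<lambda>t. c x * h (x + t *\<^sub>R w j)) has_vector_derivative c x * dir_deriv (w j) h (x + 0 *\<^sub>R w j)) (at 0)"
      by (intro has_vector_derivative_mult_right dir_deriv_has_vector_derivative smooth_differentiable that)
    then show "dir_deriv (w j) (\<lambda>x. c x * h x) x = c x * dir_deriv (w j) h x"
      using c[OF that(1)] by (simp add: dir_deriv_def[of _ "\<lambda>x. c x * h x"] vector_derivative_at)
  qed
  have pow: "(dir_deriv (w j) ^^ m) (\<lambda>x. c x * h x) = (\<lambda>x. c x * (dir_deriv (w j) ^^ m) h x)"
    if "j \<in> S" "smooth h" for h j m
    by (induction m) (auto simp: one that smooth_dir_deriv_pow)
  have "foldr (\<lambda>j. dir_deriv (w j) ^^ a j) l (\<lambda>x. c x * g x) = (\<lambda>x. c x * foldr (\<lambda>j. dir_deriv (w j) ^^ a j) l g x)"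
    if "\<And>j. j \<notin> S \<Longrightarrow> a j = 0" for a l
  proof (induction l)
    case (Cons j l)
    show ?case
    proof (cases "j \<in> S")
      case True
      then show ?thesis by (simp add: Cons pow g smooth_foldr_deriv)
    qed (simp add: Cons that)
  qed simp
  then have "multi_deriv w (Poly_Mapping.lookup b) (\<lambda>x. c x * g x) x = c x * multi_deriv w (Poly_Mapping.lookup b) g x"
    if "b \<in> Poly_Mapping.keys T" for b
    using S[OF that] by (simp add: multi_deriv_def)
  then show ?thesis by (simp add: diff_op_def sum_distrib_left mult_ac)
qed

context lattice_polytope
begin

lemma half_step_uminus: "half_step (- s) = 1 - half_step s"
  by (auto simp: half_step_def)

lemma slack_shift_0: "slack_shift 0 i x = slack i x"
  by (simp add: slack_shift_def)

lemma weighted_sum_polar: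
  assumes pol: "polarizing P u \<mu> \<xi>" and S: "finite S" "S \<subseteq> int_lattice" "P \<inter> int_lattice \<subseteq> S"
  shows "weighted_sum P f = (\<Sum>v\<in>vertices P. (-1) ^ card (flips \<xi> v) * (\<Sum>x\<in>S. of_real (cone_weight \<xi> v x) * f x))"
proof -
  have w: "(if x \<in> P then face_weight P x else 0) = (\<Sum>v\<in>vertices P. (-1) ^ card (flips \<xi> v) * cone_weight \<xi> v x)" for x
  proof -
    have "(\<Prod>j\<in>tight v. if j \<in> flips \<xi> v then 1 - half_step (slack_shift 0 j x) else half_step (slack_shift 0 j x)) =
        cone_weight \<xi> v x" if "v \<in> vertices P" for v
      unfolding cone_weight_def by (intro prod.cong refl) (simp add: cone_normal_slack[OF that] half_step_uminus slack_shift_0)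
    then show ?thesis
      using weighted_polar_decomposition[OF pol stable_shift_0, of x] by (simp add: slack_shift_0 half_step_slack_prod)
  qed
  have "weighted_sum P f = (\<Sum>x\<in>S. of_real (if x \<in> P then face_weight P x else 0) * f x)"
    unfolding weighted_sum_def by (rule sum.mono_neutral_cong_left) (use S in auto)
  also have "\<dots> = (\<Sum>x\<in>S. \<Sum>v\<in>vertices P. (-1) ^ card (flips \<xi> v) * (of_real (cone_weight \<xi> v x) * f x))"
    unfolding w by (simp add: sum_distrib_right sum_distrib_left mult_ac)
  also have "\<dots> = (\<Sum>v\<in>vertices P. (-1) ^ card (flips \<xi> v) * (\<Sum>x\<in>S. of_real (cone_weight \<xi> v x) * f x))"
    by (subst sum.swap) (simp add: sum_distrib_left)
  finally show ?thesis .
qed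

text \<open>The weights and the indicator functions differ only on the facet hyperplanes, which are null sets.\<close>

lemma shifted_polytope_integral:
  assumes pol: "polarizing P u \<mu> \<xi>" and h: "stable_shift h" and f: "smooth f" "compact_support f"
  shows "(LINT x:shifted_polytope u \<mu> h|lborel. f x) =
     (\<Sum>v\<in>vertices P. (-1) ^ card (flips \<xi> v) * smear (cone_at_origin \<xi> v) f (vertex_shift v h))"
proof -
  let ?K = "\<lambda>v. {x. x - vertex_shift v h \<in> cone_at_origin \<xi> v}"
  have K [measurable]: "?K v \<in> sets borel" for v
    using measurable_sets[OF _ cone_at_origin_borel, of "\<lambda>x. x - vertex_shift v h" borel] by (simp add: vimage_def)
  have [measurable]: "f \<in> borel_measurable borel" by (rule smooth_borel_measurable[OF f(1)])
  have i: "integrable lborel (\<lambda>x. indicator (?K v) x *\<^sub>R f x)" for v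
    using test_function_integrable[OF f K, of v 0] by simp
  have meas: "shifted_polytope u \<mu> h \<in> sets borel"
    unfolding shifted_polytope_def by (intro borel_closed closed_INT ballI closed_Collect_le continuous_intros)
  have null: "AE x in lborel. \<forall>i. slack_shift h i x \<noteq> 0"
  proof -
    have "AE x in lborel. \<forall>i\<in>UNIV. slack_shift h i x \<noteq> 0"
    proof (intro AE_finite_allI finite_class.finite_UNIV)
      fix i
      have eq: "{x. \<not> slack_shift h i x \<noteq> 0} = {x. u i \<bullet> x = - \<mu> i - h $ i}"
        by (auto simp: slack_shift_def slack_def)
      have "negligible {x. u i \<bullet> x = - \<mu> i - h $ i}"
        using u_nonzero[of i] by (intro negligible_hyperplane) auto
      then have "{x. u i \<bullet> x = - \<mu> i - h $ i} \<in> null_sets lebesgue" by (simp add: negligible_iff_null_sets)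
      moreover have "closed {x. u i \<bullet> x = - \<mu> i - h $ i}" by (rule closed_hyperplane)
      ultimately have "{x. u i \<bullet> x = - \<mu> i - h $ i} \<in> null_sets lborel"
        by (auto simp: null_sets_def)
      then show "AE x in lborel. slack_shift h i x \<noteq> 0" by (rule AE_I') (use eq in simp)
    qed
    then show ?thesis by simp
  qed
  have pt: "indicator (shifted_polytope u \<mu> h) x *\<^sub>R f x =
      (\<Sum>v\<in>vertices P. (-1) ^ card (flips \<xi> v) * (indicator (?K v) x *\<^sub>R f x))"
    if nz: "\<forall>i. slack_shift h i x \<noteq> 0" for x
  proof -
    have "indicat_real (shifted_polytope u \<mu> h) x = (\<Prod>i\<in>UNIV. half_step (slack_shift h i x))"
    proof (cases "x \<in> shifted_polytope u \<mu> h")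
      case True
      then have "slack_shift h i x > 0" for i using nz mem_shifted_polytope[of x h] by (simp add: less_le)
      then show ?thesis using True by (simp add: half_step_def)
    next
      case False
      then obtain i where "slack_shift h i x < 0" using mem_shifted_polytope[of x h] by (auto simp: not_le)
      then have "(\<Prod>i\<in>UNIV. half_step (slack_shift h i x)) = 0"
        by (intro prod_zero bexI[of _ i]) (auto simp: half_step_def)
      then show ?thesis using False by simp
    qed
    also have "\<dots> = (\<Sum>v\<in>vertices P. (-1) ^ card (flips \<xi> v) * indicat_real (?K v) x)"
      unfolding weighted_polar_decomposition[OF pol h]
    proof (intro sum.cong arg_cong2[where f="(*)"] refl)
      fix v assume v: "v \<in> vertices P"
      let ?s = "\<lambda>j. cone_normal \<xi> v j \<bullet> (x - vertex_shift v h)"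
      have "(\<Prod>j\<in>tight v. if j \<in> flips \<xi> v then 1 - half_step (slack_shift h j x) else half_step (slack_shift h j x)) =
        (\<Prod>j\<in>tight v. half_step (?s j))"
        by (intro prod.cong refl) (simp add: cone_normal_slack_shift[OF v] half_step_uminus)
      also have "\<dots> = indicat_real (?K v) x"
      proof (cases "x \<in> ?K v")
        case True
        have "?s j \<ge> 0" "?s j \<noteq> 0" if j: "j \<in> tight v" for j
          using True j nz cone_normal_slack_shift[OF v j, of \<xi> x h] by (auto simp: cone_at_origin_def)
        then have "(\<Prod>j\<in>tight v. half_step (?s j)) = 1"
          by (intro prod.neutral) (auto simp: half_step_def less_le)
        then show ?thesis using True by simp
      next
        case False
        then obtain j where "j \<in> tight v" "?s j < 0" by (force simp: cone_at_origin_def)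
        then have "(\<Prod>j\<in>tight v. half_step (?s j)) = 0"
          by (intro prod_zero bexI[of _ j]) (auto simp: half_step_def)
        then show ?thesis using False by simp
      qed
      finally show "(\<Prod>j\<in>tight v. if j \<in> flips \<xi> v then 1 - half_step (slack_shift h j x) else half_step (slack_shift h j x)) =
         indicat_real (?K v) x" .
    qed
    finally have "complex_of_real (indicat_real (shifted_polytope u \<mu> h) x) =
        (\<Sum>v\<in>vertices P. (-1) ^ card (flips \<xi> v) * complex_of_real (indicat_real (?K v) x))" by simp
    then show ?thesis by (simp add: scaleR_conv_of_real sum_distrib_right mult.assoc)
  qed
  have "(LINT x:shifted_polytope u \<mu> h|lborel. f x) =
      (\<integral>x. (\<Sum>v\<in>vertices P. (-1) ^ card (flips \<xi> v) * (indicator (?K v) x *\<^sub>R f x)) \<partial>lborel)"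
    unfolding set_lebesgue_integral_def
  proof (rule integral_cong_AE)
    show "AE x in lborel. indicat_real (shifted_polytope u \<mu> h) x *\<^sub>R f x =
      (\<Sum>v\<in>vertices P. (-1) ^ card (flips \<xi> v) * (indicat_real (?K v) x *\<^sub>R f x))"
      using null by (rule eventually_mono) (rule pt)
  qed (use meas in measurable)
  also have "\<dots> = (\<Sum>v\<in>vertices P. \<integral>x. (-1) ^ card (flips \<xi> v) * (indicator (?K v) x *\<^sub>R f x) \<partial>lborel)"
    using i by (intro Bochner_Integration.integral_sum integrable_mult_right)
  also have "\<dots> = (\<Sum>v\<in>vertices P. (-1) ^ card (flips \<xi> v) * smear (cone_at_origin \<xi> v) f (vertex_shift v h))"
  proof (intro sum.cong refl)
    fix v
    have "smear (cone_at_origin \<xi> v) f (vertex_shift v h) = (\<integral>x. indicator (?K v) x *\<^sub>R f x \<partial>lborel)"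
      by (subst smear_shift[OF cone_at_origin_borel]) (auto simp: indicator_def)
    then show "(\<integral>x. (-1) ^ card (flips \<xi> v) * (indicator (?K v) x *\<^sub>R f x) \<partial>lborel) =
       (-1) ^ card (flips \<xi> v) * smear (cone_at_origin \<xi> v) f (vertex_shift v h)"
      by (simp only: integral_mult_right_zero)
  qed
  finally show ?thesis .
qed

lemma remainder_integrand_eq:
  assumes v: "v \<in> vertices P" and J: "J \<subseteq> tight v" and f: "smooth f"
  shows "remainder_integrand k u (tight v) \<xi> v \<gamma> J f x = periodic_factor k \<xi> v \<gamma> J x *
     diff_op (cone_dir \<xi> v) (orthant_op k (cone_root \<xi> v \<gamma>) (tight v) J) f x"
proof -
  let ?g = "diff_op (cone_dir \<xi> v) (\<Prod>j\<in>tight v - J. in_var j (monom 1 k)) f"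
  have c: "periodic_factor k \<xi> v \<gamma> J (x + t *\<^sub>R cone_dir \<xi> v j) = periodic_factor k \<xi> v \<gamma> J x" if j: "j \<in> J" for x t j
    unfolding periodic_factor_def
  proof (intro prod.cong refl)
    fix i assume "i \<in> tight v - J"
    then have "cone_normal \<xi> v i \<bullet> cone_dir \<xi> v j = 0" using j J sharp_dual[OF v, of i j \<xi>] by auto
    then have "cone_normal \<xi> v i \<bullet> (x + t *\<^sub>R cone_dir \<xi> v j - v) = cone_normal \<xi> v i \<bullet> (x - v)"
      by (simp add: inner_diff_right inner_add_right)
    then show "Q_fun k (cone_root \<xi> v \<gamma> i) (cone_normal \<xi> v i \<bullet> (x + t *\<^sub>R cone_dir \<xi> v j - v)) =
       Q_fun k (cone_root \<xi> v \<gamma> i) (cone_normal \<xi> v i \<bullet> (x - v))" by simp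
  qed
  have "remainder_integrand k u (tight v) \<xi> v \<gamma> J f x =
      diff_op (cone_dir \<xi> v) (\<Prod>j\<in>J. in_var j (main_poly k (cone_root \<xi> v \<gamma> j)))
        (\<lambda>x. periodic_factor k \<xi> v \<gamma> J x * ?g x) x"
    by (simp add: remainder_integrand_def main_poly_def periodic_factor_def[abs_def])
  also have "\<dots> = periodic_factor k \<xi> v \<gamma> J x *
      diff_op (cone_dir \<xi> v) (\<Prod>j\<in>J. in_var j (main_poly k (cone_root \<xi> v \<gamma> j))) ?g x"
  proof (rule diff_op_invariant_factor[where S=J])
    fix b j assume "b \<in> Poly_Mapping.keys (\<Prod>j\<in>J. in_var j (main_poly k (cone_root \<xi> v \<gamma> j)))" "j \<notin> J"
    then show "Poly_Mapping.lookup b j = 0" using keys_prod_in_var[of J b "\<lambda>j. main_poly k (cone_root \<xi> v \<gamma> j)" j] finite_subset[OF J] by auto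
  qed (use smooth_diff_op[OF f] c in auto)
  finally show ?thesis by (simp add: orthant_op_def diff_op_mult[OF f])
qed

text \<open>The signed sum over the vertices of the cone formulas.  The terms \<open>J = I\<^sub>v\<close> are integrals of derivatives of \<open>f\<close>
  over the cones; by differentiation in \<open>h\<close> and regrouping they are the main term.\<close>

theorem euler_maclaurin_test_function:
  assumes pol: "polarizing P u \<mu> \<xi>" and k: "k \<ge> 1" and f: "smooth f" "compact_support f"
  shows "weighted_sum P f =
      (\<Sum>F\<in>faces P. \<Sum>\<gamma>\<in>Gamma_flat P u \<mu> F.
         diff_op std_dir (M_op k P u \<mu> F \<gamma>) (\<lambda>h. LINT x:shifted_polytope u \<mu> h|lborel. f x) 0)
      + remainder k P u \<mu> \<xi> f"
proof -
  let ?V = "vertices P" and ?s = "\<lambda>v. (-1) ^ card (flips \<xi> v) :: complex"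
  let ?T = "\<lambda>v \<gamma> J. orthant_op k (cone_root \<xi> v \<gamma>) (tight v) J"
  define part where "part v \<gamma> J = (LINT x:cone_sharp u (tight v) \<xi> v|lborel. periodic_factor k \<xi> v \<gamma> J x *
           diff_op (cone_dir \<xi> v) (?T v \<gamma> J) f x)" for v \<gamma> J
  obtain R where R: "\<And>x. norm x > R \<Longrightarrow> f x = 0" using f(2) by (auto simp: compact_support_def)
  obtain R' where R': "\<And>x. x \<in> P \<Longrightarrow> norm x \<le> R'" using bounded_P by (auto simp: bounded_iff)
  define S where "S = int_lattice \<inter> cball (0::real^'n::_) (max R R')"
  have S: "finite S" "S \<subseteq> int_lattice" "P \<inter> int_lattice \<subseteq> S"
    and S0: "\<And>x. x \<in> int_lattice \<Longrightarrow> x \<notin> S \<Longrightarrow> f x = 0"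
    using finite_bounded_int_lattice[of "cball (0::real^'n::_) (max R R')"] R R'
    by (auto simp: S_def Int_commute le_max_iff_disj)
  have main: "(\<Sum>F\<in>faces P. \<Sum>\<gamma>\<in>Gamma_flat P u \<mu> F.
         diff_op std_dir (M_op k P u \<mu> F \<gamma>) (\<lambda>h. LINT x:shifted_polytope u \<mu> h|lborel. f x) 0) =
      (\<Sum>v\<in>?V. ?s v * (\<Sum>\<gamma>\<in>groupv v. part v \<gamma> (tight v)))"
  proof -
    obtain U where U: "open U" "0 \<in> U" "\<And>h. h \<in> U \<Longrightarrow> stable_shift h" using eventually_stable_shift by blast
    have A: "vertex_shift v (h + t *\<^sub>R std_dir j) = vertex_shift v h + t *\<^sub>R (- edge_dir v j)" for v h t j
    proof -
      have "(\<Sum>i\<in>UNIV. ((h + t *\<^sub>R std_dir j) $ i) *\<^sub>R edge_dir v i) =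
         (\<Sum>i\<in>UNIV. (h $ i) *\<^sub>R edge_dir v i + (if i = j then t *\<^sub>R edge_dir v j else 0))"
        by (intro sum.cong refl) (auto simp: std_dir_def axis_def scaleR_add_left)
      then show ?thesis by (simp add: vertex_shift_def sum.distrib)
    qed
    have "diff_op std_dir T (\<lambda>h. LINT x:shifted_polytope u \<mu> h|lborel. f x) 0 =
        (\<Sum>v\<in>?V. ?s v * smear (cone_at_origin \<xi> v) (diff_op (\<lambda>j. - edge_dir v j) T f) v)" for T
    proof -
      have "diff_op std_dir T (\<lambda>h. LINT x:shifted_polytope u \<mu> h|lborel. f x) 0 =
         diff_op std_dir T (\<lambda>h. \<Sum>v\<in>?V. ?s v * smear (cone_at_origin \<xi> v) f (vertex_shift v h)) 0"
        by (rule diff_op_local[OF U(1) _ U(2)]) (rule shifted_polytope_integral[OF pol U(3) f])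
      also have "\<dots> = (\<Sum>v\<in>?V. ?s v * smear (cone_at_origin \<xi> v) (diff_op (\<lambda>j. - edge_dir v j) T f) (vertex_shift v 0))"
        by (rule diff_op_smear_sum[where w="\<lambda>v j. - edge_dir v j"])
           (use finite_vertices cone_at_origin_borel f A in auto)
      finally show ?thesis by (simp add: vertex_shift_0)
    qed
    then have "(\<Sum>F\<in>faces P. \<Sum>\<gamma>\<in>Gamma_flat P u \<mu> F.
         diff_op std_dir (M_op k P u \<mu> F \<gamma>) (\<lambda>h. LINT x:shifted_polytope u \<mu> h|lborel. f x) 0) =
       (\<Sum>F\<in>faces P. \<Sum>\<gamma>\<in>Gamma_flat P u \<mu> F. \<Sum>v\<in>?V.
         ?s v * smear (cone_at_origin \<xi> v) (diff_op (\<lambda>j. - edge_dir v j) (M_op k P u \<mu> F \<gamma>) f) v)" by simp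
    also have "\<dots> = (\<Sum>v\<in>?V. ?s v * (\<Sum>F\<in>faces P. \<Sum>\<gamma>\<in>Gamma_flat P u \<mu> F.
         smear (cone_at_origin \<xi> v) (diff_op (\<lambda>j. - edge_dir v j) (M_op k P u \<mu> F \<gamma>) f) v))"
      unfolding sum_distrib_left by (subst sum.swap[of _ ?V]) (simp add: sum.swap[of _ ?V])
    also have "\<dots> = (\<Sum>v\<in>?V. ?s v * (\<Sum>\<gamma>\<in>groupv v. part v \<gamma> (tight v)))"
    proof (rule sum.cong[OF refl], rule arg_cong2[where f="(*)", OF refl])
      fix v assume v: "v \<in> ?V"
      show "(\<Sum>F\<in>faces P. \<Sum>\<gamma>\<in>Gamma_flat P u \<mu> F.
         smear (cone_at_origin \<xi> v) (diff_op (\<lambda>j. - edge_dir v j) (M_op k P u \<mu> F \<gamma>) f) v) =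
         (\<Sum>\<gamma>\<in>groupv v. part v \<gamma> (tight v))"
      proof (rule sum_over_flats[OF v])
        fix F \<gamma> assume F: "F \<in> faces P" "\<gamma> \<in> Gamma_flat P u \<mu> F"
        {
          assume "\<not> facet_idx u \<mu> F \<subseteq> tight v"
          then show "smear (cone_at_origin \<xi> v) (diff_op (\<lambda>j. - edge_dir v j) (M_op k P u \<mu> F \<gamma>) f) v = 0"
            by (simp add: M_op_at_vertex(1)[OF F v k f(1)] smear_def)
        next
          assume A: "facet_idx u \<mu> F \<subseteq> tight v"
          let ?D = "diff_op (cone_dir \<xi> v) (?T v (Gamma_map u (tight v) \<gamma>) (tight v)) f"
          have "smear (cone_at_origin \<xi> v) ?D v = (\<integral>x. indicator (cone_at_origin \<xi> v) (x - v) *\<^sub>R ?D x \<partial>lborel)"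
            by (rule smear_shift[OF cone_at_origin_borel smooth_borel_measurable[OF smooth_diff_op[OF f(1)]]])
          moreover have "indicat_real (cone_at_origin \<xi> v) (x - v) = indicator (cone_sharp u (tight v) \<xi> v) x" for x
            by (simp add: indicator_def mem_cone_sharp[OF v] cone_at_origin_def)
          ultimately show "smear (cone_at_origin \<xi> v) (diff_op (\<lambda>j. - edge_dir v j) (M_op k P u \<mu> F \<gamma>) f) v =
              part v (Gamma_map u (tight v) \<gamma>) (tight v)"
            unfolding M_op_at_vertex(2)[OF F v k f(1) A, of \<xi>]
            by (simp add: part_def set_lebesgue_integral_def periodic_factor_def)
        }
      qed
    qed
    finally show ?thesis .
  qed
  have rem: "remainder k P u \<mu> \<xi> f = (\<Sum>v\<in>?V. ?s v * (\<Sum>\<gamma>\<in>groupv v. \<Sum>J\<in>{J. J \<subset> tight v}.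
       ((-1) ^ (k - 1)) ^ card (tight v - J) * part v \<gamma> J))"
    unfolding remainder_def Let_def num_flips_eq
  proof (intro sum.cong arg_cong2[where f="(*)"] refl)
    fix v \<gamma> J assume v: "v \<in> ?V" and J: "J \<in> {J. J \<subset> tight v}"
    have "card (tight v - J) = CARD('n) - card J"
      using J card_tight_vertex[OF v] by (subst card_Diff_subset) (auto intro: finite_subset)
    then show "(-1) ^ ((k - 1) * (CARD('n) - card J)) = ((-1::complex) ^ (k - 1)) ^ card (tight v - J)"
      by (simp add: power_mult)
    show "(LINT x:cone_sharp u (tight v) \<xi> v|lborel. remainder_integrand k u (tight v) \<xi> v \<gamma> J f x) = part v \<gamma> J"
      using remainder_integrand_eq[OF v _ f(1), of J] J by (simp add: part_def psubset_imp_subset)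
  qed
  have "weighted_sum P f = (\<Sum>v\<in>?V. ?s v * (\<Sum>\<gamma>\<in>groupv v. \<Sum>J\<in>Pow (tight v).
      ((-1) ^ (k - 1)) ^ card (tight v - J) * part v \<gamma> J))"
    unfolding weighted_sum_polar[OF pol S] part_def
    by (intro sum.cong refl) (subst euler_maclaurin_vertex[OF _ k f S(1,2) S0], auto)
  also have "\<dots> = (\<Sum>v\<in>?V. ?s v * (\<Sum>\<gamma>\<in>groupv v. part v \<gamma> (tight v) + (\<Sum>J\<in>{J. J \<subset> tight v}.
      ((-1) ^ (k - 1)) ^ card (tight v - J) * part v \<gamma> J)))"
  proof (intro sum.cong arg_cong2[where f="(*)"] refl)
    fix v \<gamma>
    have "Pow (tight v) = insert (tight v) {J. J \<subset> tight v}" by auto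
    then show "(\<Sum>J\<in>Pow (tight v). ((-1) ^ (k - 1)) ^ card (tight v - J) * part v \<gamma> J) =
       part v \<gamma> (tight v) + (\<Sum>J\<in>{J. J \<subset> tight v}. ((-1) ^ (k - 1)) ^ card (tight v - J) * part v \<gamma> J)"
      by (subst \<open>Pow _ = _\<close>, subst sum.insert) auto
  qed
  finally show ?thesis unfolding main rem by (simp add: sum.distrib ring_distribs)
qed

end

section \<open>Cutoff functions\<close>

text \<open>Polynomials in \<open>1/t\<close> are admitted as factors of \<open>e^{-1/t}\<close> so that the class is closed under differentiation.\<close>

definition flat_exp :: "real poly \<Rightarrow> real \<Rightarrow> real" where
  "flat_exp p t = (if t > 0 then poly p (inverse t) * exp (- inverse t) else 0)"

lemma flat_exp_tendsto_0: "(flat_exp p \<longlongrightarrow> 0) (at 0)"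
proof -
  have "((\<lambda>s. \<Sum>i\<le>degree p. coeff p i * (s ^ i / exp s)) \<longlongrightarrow> (\<Sum>i\<le>degree p. coeff p i * 0)) at_top"
    by (intro tendsto_sum tendsto_mult tendsto_const tendsto_power_div_exp_0)
  moreover have "(\<lambda>s. \<Sum>i\<le>degree p. coeff p i * (s ^ i / exp s)) = (\<lambda>s. poly p s * exp (- s))"
    by (simp add: poly_altdef sum_distrib_left exp_minus divide_inverse mult_ac)
  ultimately have "((\<lambda>s. poly p s * exp (- s)) \<longlongrightarrow> 0) at_top" by simp
  from filterlim_compose[OF this filterlim_inverse_at_top_right]
  have "((\<lambda>t. poly p (inverse t) * exp (- inverse t)) \<longlongrightarrow> 0) (at_right 0)" .
  then have "(flat_exp p \<longlongrightarrow> 0) (at_right 0)"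
    by (rule Lim_transform_eventually) (auto simp: flat_exp_def eventually_at_right_field intro: exI[of _ 1])
  moreover have "(flat_exp p \<longlongrightarrow> 0) (at_left 0)"
    by (rule tendsto_eventually) (auto simp: flat_exp_def eventually_at_left_field intro: exI[of _ "-1"])
  ultimately show ?thesis by (simp add: filterlim_at_split)
qed

lemma flat_exp_deriv: "(flat_exp p has_real_derivative flat_exp ([:0, 0, 1:] * (p - pderiv p)) t) (at t)"
proof -
  consider "t > 0" | "t = 0" | "t < 0" by linarith
  then show ?thesis
  proof cases
    case 1
    have "((\<lambda>t. poly p (inverse t) * exp (- inverse t)) has_real_derivative flat_exp ([:0, 0, 1:] * (p - pderiv p)) t) (at t)"
      using 1 by (auto intro!: derivative_eq_intros DERIV_chain2[OF poly_DERIV]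
          simp: flat_exp_def algebra_simps power2_eq_square)
    then show ?thesis
      by (rule has_field_derivative_transform_within_open[of _ _ _ "{0<..}"]) (use 1 in \<open>auto simp: flat_exp_def\<close>)
  next
    case 2
    have "((\<lambda>y. (flat_exp p y - flat_exp p 0) / (y - 0)) \<longlongrightarrow> 0) (at 0)"
    proof (rule Lim_transform_eventually[OF flat_exp_tendsto_0[of "pCons 0 p"]])
      show "\<forall>\<^sub>F y in at 0. flat_exp (pCons 0 p) y = (flat_exp p y - flat_exp p 0) / (y - 0)"
        by (auto simp: flat_exp_def eventually_at_filter divide_inverse)
    qed
    then show ?thesis using 2 by (simp add: has_field_derivative_iff flat_exp_def[of _ 0])
  next
    case 3
    have "((\<lambda>_. 0) has_real_derivative flat_exp ([:0, 0, 1:] * (p - pderiv p)) t) (at t)"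
      using 3 by (simp add: flat_exp_def)
    then show ?thesis
      by (rule has_field_derivative_transform_within_open[of _ _ _ "{..<0}"]) (use 3 in \<open>auto simp: flat_exp_def\<close>)
  qed
qed

lemma smooth_flat_exp: "smooth (\<lambda>x::real^'n. complex_of_real (flat_exp p (c + s * x $ i)))"
proof -
  let ?X = "{\<lambda>x::real^'n. complex_of_real (a * flat_exp p (c + s * x $ i)) | a p. True}"
  have der: "((\<lambda>x::real^'n. complex_of_real (a * flat_exp p (c + s * x $ i))) has_derivative
     (\<lambda>h. complex_of_real (a * (s * h $ i * flat_exp ([:0, 0, 1:] * (p - pderiv p)) (c + s * x $ i))))) (at x)" for a p x
  proof -
    have "((\<lambda>x::real^'n. c + s * x $ i) has_derivative (\<lambda>h. s * h $ i)) (at x)"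
      by (auto intro!: derivative_eq_intros bounded_linear.has_derivative[OF bounded_linear_vec_nth])
    from DERIV_compose_FDERIV[OF flat_exp_deriv this, of p] show ?thesis
      by (intro has_derivative_of_real has_derivative_mult_right)
  qed
  show ?thesis
  proof (rule smooth_coinduct[of _ ?X])
    show "(\<lambda>x::real^'n. complex_of_real (flat_exp p (c + s * x $ i))) \<in> ?X"
      by (intro CollectI exI[of _ 1] exI[of _ p]) simp
    fix g assume "g \<in> ?X"
    then obtain a p where g: "g = (\<lambda>x::real^'n. complex_of_real (a * flat_exp p (c + s * x $ i)))" by blast
    show "g differentiable_on UNIV"
      unfolding g differentiable_on_def differentiable_def using der by (simp, blast)
    fix j
    have "dir_deriv (std_dir j) g = (\<lambda>x. complex_of_real ((a * s * (std_dir j :: real^'n) $ i) * flat_exp ([:0, 0, 1:] * (p - pderiv p)) (c + s * x $ i)))"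
      unfolding g by (rule ext, subst has_derivative_dir_deriv[OF der]) (simp add: mult_ac)
    then show "dir_deriv (std_dir j) g \<in> ?X" by blast
  qed
qed

text \<open>The functions \<open>a b\<^sup>-\<^sup>m\<close> with \<open>a\<close> smooth are closed under partial derivatives.\<close>

lemma smooth_inverse:
  fixes b :: "real^'n \<Rightarrow> complex"
  assumes b: "smooth b" and nz: "\<And>x. b x \<noteq> 0"
  shows "smooth (\<lambda>x. inverse (b x))"
proof -
  let ?X = "{\<lambda>x. a x * inverse (b x) ^ m | a m. smooth a}"
  have pow: "((\<lambda>x. inverse (b x) ^ m) differentiable at x)" for m x
    using nz smooth_differentiable[OF b] by (intro differentiable_power differentiable_inverse)
  have pw: "dir_deriv w (\<lambda>x. inverse (b x) ^ m) x = - of_nat m * dir_deriv w b x * inverse (b x) ^ Suc m" for w m x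
  proof -
    have "dir_deriv w (\<lambda>x. b x ^ m * inverse (b x) ^ m) x =
      dir_deriv w (\<lambda>x. b x ^ m) x * inverse (b x) ^ m + b x ^ m * dir_deriv w (\<lambda>x. inverse (b x) ^ m) x"
      by (intro dir_deriv_mult_fun pow differentiable_power smooth_differentiable b)
    moreover have "(\<lambda>x. b x ^ m * inverse (b x) ^ m) = (\<lambda>x. 1)"
      using nz by (simp flip: power_mult_distrib)
    moreover have "dir_deriv w (\<lambda>x. b x ^ m) x = of_nat m * b x ^ (m - 1) * dir_deriv w b x"
    proof -
      obtain D where D: "(b has_derivative D) (at x)" using smooth_differentiable[OF b] by (auto simp: differentiable_def)
      show ?thesis
        by (simp add: has_derivative_dir_deriv[OF has_derivative_power[OF D]] has_derivative_dir_deriv[OF D])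
    qed
    ultimately have e: "of_nat m * b x ^ (m - 1) * dir_deriv w b x * inverse (b x) ^ m + b x ^ m * dir_deriv w (\<lambda>x. inverse (b x) ^ m) x = 0"
      by simp
    show ?thesis
    proof (cases m)
      case (Suc l)
      have "b x ^ m * (dir_deriv w (\<lambda>x. inverse (b x) ^ m) x + of_nat m * dir_deriv w b x * inverse (b x) ^ Suc m) = 0"
        using e nz[of x] by (simp add: Suc field_simps)
      then show ?thesis using nz[of x] by (simp add: eq_neg_iff_add_eq_0)
    qed simp
  qed
  have "smooth (\<lambda>x. 1 * inverse (b x) ^ 1)"
  proof (rule smooth_coinduct[of _ ?X])
    show "(\<lambda>x. 1 * inverse (b x) ^ 1) \<in> ?X"
      by (intro CollectI exI[of _ "\<lambda>_. 1"] exI[of _ 1]) (simp add: smooth_const)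
    fix g assume "g \<in> ?X"
    then obtain a m where g: "g = (\<lambda>x. a x * inverse (b x) ^ m)" "smooth a" by blast
    show "g differentiable_on UNIV"
      unfolding g(1) differentiable_on_def using pow smooth_differentiable[OF g(2)] by (auto intro: differentiable_mult)
    fix j
    let ?a = "\<lambda>x. dir_deriv (std_dir j) a x * b x + (- of_nat m) * (a x * dir_deriv (std_dir j) b x)"
    have "dir_deriv (std_dir j) g = (\<lambda>x. ?a x * inverse (b x) ^ Suc m)"
    proof
      fix x
      have "dir_deriv (std_dir j) g x = dir_deriv (std_dir j) a x * inverse (b x) ^ m +
          a x * (- of_nat m * dir_deriv (std_dir j) b x * inverse (b x) ^ Suc m)"
        unfolding g(1) by (subst dir_deriv_mult_fun[OF smooth_differentiable[OF g(2)] pow]) (simp only: pw)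
      then show "dir_deriv (std_dir j) g x = ?a x * inverse (b x) ^ Suc m"
        using nz[of x] by (simp add: field_simps)
    qed
    moreover have "smooth ?a" by (intro smooth_add smooth_mult smooth_cmult smooth_partial g(2) b)
    ultimately show "dir_deriv (std_dir j) g \<in> ?X"
      unfolding mem_Collect_eq by (intro exI[of _ ?a] exI[of _ "Suc m"] conjI)
  qed
  then show ?thesis by simp
qed

text \<open>A product over the coordinates of smooth steps \<open>A / (A + B)\<close>, where \<open>A\<close> vanishes beyond 2 and \<open>B\<close> before 1; the
  two never vanish together.\<close>

lemma smooth_cutoff:
  obtains \<eta> :: "real^'n \<Rightarrow> complex" where "smooth \<eta>" "compact_support \<eta>" "\<And>x. norm x \<le> 1 \<Longrightarrow> \<eta> x = 1"
proof -
  define A B where "A s i x = complex_of_real (flat_exp 1 (2 + (- s) * x $ i))"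
    and "B s i x = complex_of_real (flat_exp 1 (- 1 + s * x $ i))" for s and i :: 'n and x :: "real^'n"
  define \<psi> where "\<psi> s i x = A s i x * inverse (A s i x + B s i x)" for s i x
  have pos: "A s i x + B s i x \<noteq> 0" for s i x
  proof -
    have "flat_exp 1 t > 0 \<longleftrightarrow> t > 0" "flat_exp 1 t \<ge> 0" for t by (auto simp: flat_exp_def)
    then have "flat_exp 1 (2 + (- s) * x $ i) + flat_exp 1 (- 1 + s * x $ i) > 0"
      by (cases "s * x $ i > 1") (auto intro: add_nonneg_pos add_pos_nonneg)
    then have "complex_of_real (flat_exp 1 (2 + (- s) * x $ i) + flat_exp 1 (- 1 + s * x $ i)) \<noteq> 0"
      by (simp only: of_real_eq_0_iff)
    then show ?thesis by (simp add: A_def B_def)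
  qed
  have sm: "smooth (\<psi> s i)" for s i
    unfolding \<psi>_def A_def B_def
    by (intro smooth_mult smooth_inverse smooth_add smooth_flat_exp pos[unfolded A_def B_def])
  have one: "\<psi> s i x = 1" if "s * x $ i \<le> 1" for s i x
    using pos[of s i x] that by (simp add: \<psi>_def B_def flat_exp_def)
  have zero: "\<psi> s i x = 0" if "s * x $ i \<ge> 2" for s i x
    using that by (simp add: \<psi>_def A_def flat_exp_def)
  have prod: "smooth (\<lambda>x. \<Prod>i\<in>S. f i x)" if "\<And>i. smooth (f i)" for S :: "'n set" and f :: "'n \<Rightarrow> real^'n \<Rightarrow> complex"
    by (induction S rule: infinite_finite_induct) (auto simp: smooth_const smooth_mult that)
  show thesis
  proof (rule that[of "\<lambda>x. \<Prod>i\<in>UNIV. \<psi> 1 i x * \<psi> (-1) i x"])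
    show "smooth (\<lambda>x. \<Prod>i\<in>UNIV. \<psi> 1 i x * \<psi> (-1) i x)" by (intro prod smooth_mult sm)
    show "(\<Prod>i\<in>UNIV. \<psi> 1 i x * \<psi> (-1) i x) = 1" if "norm x \<le> 1" for x
    proof (intro prod.neutral ballI)
      fix i
      have "\<bar>x $ i\<bar> \<le> 1" using component_le_norm_cart[of x i] that by linarith
      then show "\<psi> 1 i x * \<psi> (-1) i x = 1" using one[of 1 x i] one[of "-1" x i] by auto
    qed
    show "compact_support (\<lambda>x. \<Prod>i\<in>UNIV. \<psi> 1 i x * \<psi> (-1) i x)"
      unfolding compact_support_def
    proof (intro exI allI impI)
      fix x :: "real^'n" assume "norm x > 2 * real CARD('n)"
      have "\<exists>i. \<bar>x $ i\<bar> > 2"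
      proof (rule ccontr)
        assume "\<not> ?thesis"
        then have "(\<Sum>i\<in>UNIV. \<bar>x $ i\<bar>) \<le> (\<Sum>i\<in>(UNIV::'n set). 2)" by (intro sum_mono) (auto simp: not_less)
        then show False using norm_le_l1_cart[of x] \<open>norm x > _\<close> by simp
      qed
      then obtain i where "\<bar>x $ i\<bar> > 2" by blast
      then have "\<psi> 1 i x * \<psi> (-1) i x = 0" using zero[of 1 x i] zero[of "-1" x i] by (auto simp: abs_if split: if_splits)
      then show "(\<Prod>i\<in>UNIV. \<psi> 1 i x * \<psi> (-1) i x) = 0" by (intro prod_zero bexI[of _ i]) auto
    qed
  qed
qed

section \<open>Symbols and bounds for differential operators\<close>

abbreviation partials :: "'n list \<Rightarrow> (real^'n \<Rightarrow> complex) \<Rightarrow> real^'n \<Rightarrow> complex" where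
  "partials js \<equiv> foldr (\<lambda>i. dir_deriv (std_dir i)) js"

lemma smooth_partials: "smooth f \<Longrightarrow> smooth (partials js f)"
  by (induction js) (auto intro: smooth_partial)

lemma partials_add:
  assumes "smooth f" "smooth g"
  shows "partials js (\<lambda>x. f x + g x) = (\<lambda>x. partials js f x + partials js g x)"
proof (induction js)
  case (Cons i js)
  show ?case
    by (rule ext) (simp add: Cons dir_deriv_add_fun smooth_differentiable smooth_partials assms)
qed simp

lemma partials_eq_multi_deriv:
  fixes f :: "real^'n::{finite,linorder} \<Rightarrow> complex"
  assumes f: "smooth f"
  shows "partials js f = multi_deriv std_dir (count_list js) f"
proof (induction js)
  case Nil
  have "count_list [] = (\<lambda>_::'n. 0)" by (simp add: fun_eq_iff)
  then show ?case by simp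
next
  case (Cons i js)
  have "count_list (i # js) = (\<lambda>j. (if j = i then 1 else 0) + count_list js j)" by (auto simp: fun_eq_iff)
  then have "multi_deriv std_dir (count_list (i # js)) f =
      multi_deriv std_dir (\<lambda>j. if j = i then 1 else 0) (multi_deriv std_dir (count_list js) f)"
    by (simp only: multi_deriv_add[OF f])
  also have "\<dots> = dir_deriv (std_dir i) (multi_deriv std_dir (count_list js) f)"
    using multi_deriv_single[of std_dir i 1 "multi_deriv std_dir (count_list js) f"] by simp
  finally show ?case by (simp only: foldr.simps comp_apply Cons)
qed

lemma sum_count_list_UNIV: "(\<Sum>i\<in>(UNIV::'n::finite set). count_list js i) = length js"
proof (induction js)
  case (Cons j js)
  have "(\<Sum>i\<in>(UNIV::'n::finite set). count_list (j # js) i) = (\<Sum>i\<in>UNIV. count_list js i + (if i = j then 1 else 0))"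
    by (intro sum.cong) auto
  then show ?case using Cons by (simp add: sum.distrib)
qed simp

text \<open>Symbols with constants that are uniform in a parameter.  Lists of partial derivatives in any order replace
  multi-indices, because the product rule is an induction on such lists.\<close>

definition symbol_family :: "real \<Rightarrow> ('a \<Rightarrow> real^'n \<Rightarrow> complex) \<Rightarrow> bool" where
  "symbol_family N F \<longleftrightarrow> (\<forall>m. smooth (F m)) \<and>
     (\<forall>js. \<exists>C. \<forall>m x. norm (partials js (F m) x) \<le> C * (1 + norm x) powr (N - real (length js)))"

lemma symbol_family_const:
  fixes f :: "real^'n::{finite,linorder} \<Rightarrow> complex"
  assumes "symbol_of_order N f"
  shows "symbol_family N (\<lambda>_. f)"
proof -
  have f: "smooth f" using assms by (simp add: symbol_of_order_def)
  show ?thesis unfolding symbol_family_def partials_eq_multi_deriv[OF f]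
  proof (intro conjI allI f)
    fix js :: "'n list"
    have "real (\<Sum>i\<in>UNIV. count_list js i) = real (length js)" using sum_count_list_UNIV[of js] by simp
    moreover obtain C where "\<And>x. norm (multi_deriv std_dir (count_list js) f x)
       \<le> C * (1 + norm x) powr (N - real (\<Sum>i\<in>UNIV. count_list js i))"
      using assms unfolding symbol_of_order_def by blast
    ultimately show "\<exists>C. \<forall>m x. norm (multi_deriv std_dir (count_list js) f x) \<le> C * (1 + norm x) powr (N - real (length js))"
      by auto
  qed
qed

lemma symbol_family_partial:
  fixes F :: "'a \<Rightarrow> real^'n \<Rightarrow> complex"
  assumes "symbol_family N F"
  shows "symbol_family (N - 1) (\<lambda>m. dir_deriv (std_dir i) (F m))"
  unfolding symbol_family_def
proof (intro conjI allI)
  show "smooth (dir_deriv (std_dir i) (F m))" for m using assms by (auto simp: symbol_family_def intro: smooth_partial)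
  fix js :: "'n list"
  obtain C where C: "\<And>m x. norm (partials (js @ [i]) (F m) x) \<le> C * (1 + norm x) powr (N - real (length (js @ [i])))"
    using assms unfolding symbol_family_def by blast
  have "N - real (length (js @ [i])) = N - 1 - real (length js)" by simp
  then show "\<exists>C. \<forall>m x. norm (partials js (dir_deriv (std_dir i) (F m)) x) \<le> C * (1 + norm x) powr (N - 1 - real (length js))"
    using C by (intro exI[of _ C] allI) (simp only: foldr_append foldr.simps o_id comp_apply id_apply)
qed

text \<open>By the product rule \<open>\<partial>\<^sub>i (F G)\<close> is a sum of two products in which one factor has its order lowered by 1; the
  number of remaining derivatives decreases.\<close>

lemma symbol_family_mult:
  fixes F G :: "'a \<Rightarrow> real^'n \<Rightarrow> complex"
  assumes "symbol_family N F" "symbol_family M G"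
  shows "symbol_family (N + M) (\<lambda>m x. F m x * G m x)"
proof -
  have "\<exists>C. \<forall>m x. norm (partials js (\<lambda>x. F m x * G m x) x) \<le> C * (1 + norm x) powr (N + M - real (length js))" for js :: "'n list"
    using assms
  proof (induction js arbitrary: F G N M rule: rev_induct)
    case Nil
    obtain C where C: "\<And>m x. norm (partials [] (F m) x) \<le> C * (1 + norm x) powr (N - 0)"
      using Nil(1)[unfolded symbol_family_def, THEN conjunct2, rule_format, of "[]"] by auto
    obtain D where D: "\<And>m x. norm (partials [] (G m) x) \<le> D * (1 + norm x) powr (M - 0)"
      using Nil(2)[unfolded symbol_family_def, THEN conjunct2, rule_format, of "[]"] by auto
    have "norm (F m x * G m x) \<le> (C * D) * (1 + norm x) powr (N + M)" for m x
    proof -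
      have "norm (F m x) * norm (G m x) \<le> (C * (1 + norm x) powr N) * (D * (1 + norm x) powr M)"
        using C[of m x] D[of m x] by (intro mult_mono) (auto intro: order_trans[OF norm_ge_zero])
      then show ?thesis by (simp add: norm_mult powr_add mult_ac)
    qed
    then show ?case by (intro exI[of _ "C * D"]) simp
  next
    case (snoc i js)
    let ?F' = "\<lambda>m. dir_deriv (std_dir i) (F m)" and ?G' = "\<lambda>m. dir_deriv (std_dir i) (G m)"
    have sF: "smooth (F m)" and sG: "smooth (G m)" for m using snoc.prems by (auto simp: symbol_family_def)
    have e: "N - 1 + M - real (length js) = N + M - real (length (js @ [i]))"
      "N + (M - 1) - real (length js) = N + M - real (length (js @ [i]))" by auto
    obtain C where C: "\<And>m x. norm (partials js (\<lambda>x. ?F' m x * G m x) x) \<le> C * (1 + norm x) powr (N - 1 + M - real (length js))"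
      using snoc.IH[OF symbol_family_partial[OF snoc.prems(1)] snoc.prems(2)] by blast
    obtain D where D: "\<And>m x. norm (partials js (\<lambda>x. F m x * ?G' m x) x) \<le> D * (1 + norm x) powr (N + (M - 1) - real (length js))"
      using snoc.IH[OF snoc.prems(1) symbol_family_partial[OF snoc.prems(2)]] by blast
    have "norm (partials (js @ [i]) (\<lambda>x. F m x * G m x) x) \<le> (C + D) * (1 + norm x) powr (N + M - real (length (js @ [i])))" for m x
    proof -
      have "dir_deriv (std_dir i) (\<lambda>x. F m x * G m x) = (\<lambda>x. ?F' m x * G m x + F m x * ?G' m x)"
        by (rule ext, rule dir_deriv_mult_fun; rule smooth_differentiable; rule sF sG)
      then have "partials (js @ [i]) (\<lambda>x. F m x * G m x) = partials js (\<lambda>x. ?F' m x * G m x + F m x * ?G' m x)" by simp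
      also have "\<dots> = (\<lambda>x. partials js (\<lambda>x. ?F' m x * G m x) x + partials js (\<lambda>x. F m x * ?G' m x) x)"
        by (intro partials_add smooth_mult smooth_partial sF sG)
      finally have "norm (partials (js @ [i]) (\<lambda>x. F m x * G m x) x) \<le>
          norm (partials js (\<lambda>x. ?F' m x * G m x) x) + norm (partials js (\<lambda>x. F m x * ?G' m x) x)"
        by (simp add: norm_triangle_ineq)
      also have "\<dots> \<le> C * (1 + norm x) powr (N + M - real (length (js @ [i]))) + D * (1 + norm x) powr (N + M - real (length (js @ [i])))"
        using C[of m x] D[of m x] unfolding e by (rule add_mono)
      finally show ?thesis by (simp add: ring_distribs)
    qed
    then show ?case by blast
  qed
  then show ?thesis using assms unfolding symbol_family_def by (auto intro: smooth_mult)
qed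

lemma partials_dilation:
  fixes g :: "real^'n \<Rightarrow> complex"
  assumes g: "smooth g"
  shows "partials js (\<lambda>x. g (c *\<^sub>R x)) = (\<lambda>x. of_real c ^ length js * partials js g (c *\<^sub>R x))"
    and "smooth (\<lambda>x. g (c *\<^sub>R x))"
proof -
  have diff: "(\<lambda>x. h (c *\<^sub>R x)) differentiable (at x)" if h: "smooth h" for h :: "real^'n \<Rightarrow> complex" and x
    by (rule differentiable_compose[of h "\<lambda>x. c *\<^sub>R x" x UNIV]) (auto intro: smooth_differentiable[OF h])
  have one: "dir_deriv w (\<lambda>x. h (c *\<^sub>R x)) x = of_real c * dir_deriv w h (c *\<^sub>R x)" if h: "smooth h" for h :: "real^'n \<Rightarrow> complex" and x w
  proof -
    obtain D where D: "(h has_derivative D) (at (c *\<^sub>R x))" using smooth_differentiable[OF h] by (auto simp: differentiable_def)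
    have "((\<lambda>x. h (c *\<^sub>R x)) has_derivative (\<lambda>v. D (c *\<^sub>R v))) (at x)"
      by (rule has_derivative_compose[where f="\<lambda>x. c *\<^sub>R x", OF _ D]) (auto intro!: derivative_eq_intros)
    moreover have "D (c *\<^sub>R w) = of_real c * D w"
      using linear_scale[OF bounded_linear.linear[OF has_derivative_bounded_linear[OF D]], of c w]
      by (simp only: scaleR_conv_of_real[where 'a=complex])
    ultimately show ?thesis by (simp only: has_derivative_dir_deriv[OF D] has_derivative_dir_deriv)
  qed
  have p: "partials js (\<lambda>x. g (c *\<^sub>R x)) = (\<lambda>x. of_real c ^ length js * partials js g (c *\<^sub>R x))" for js :: "'n list"
  proof (induction js)
    case (Cons i js)
    have "dir_deriv (std_dir i) (\<lambda>x. of_real c ^ length js * partials js g (c *\<^sub>R x)) x =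
       of_real c ^ length js * dir_deriv (std_dir i) (\<lambda>x. partials js g (c *\<^sub>R x)) x" for x
      by (rule dir_deriv_cmult_fun[OF diff[OF smooth_partials[OF g]]])
    then show ?case by (simp add: Cons fun_eq_iff one smooth_partials[OF g])
  qed simp
  show "partials js (\<lambda>x. g (c *\<^sub>R x)) = (\<lambda>x. of_real c ^ length js * partials js g (c *\<^sub>R x))" by (rule p)
  show "smooth (\<lambda>x. g (c *\<^sub>R x))"
    unfolding smooth_def p differentiable_on_def
    by (auto intro!: differentiable_mult diff smooth_partials[OF g])
qed

text \<open>Each derivative gains a factor \<open>1/(m+1)\<close>, and on the support \<open>1 + |x|\<close> is at most a constant times \<open>m + 1\<close>.\<close>

lemma symbol_family_cutoff:
  fixes \<eta> :: "real^'n \<Rightarrow> complex"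
  assumes \<eta>: "smooth \<eta>" "compact_support \<eta>"
  shows "symbol_family 0 (\<lambda>m x. \<eta> (inverse (real (Suc m)) *\<^sub>R x))"
  unfolding symbol_family_def
proof (intro conjI allI)
  show "smooth (\<lambda>x. \<eta> (inverse (real (Suc m)) *\<^sub>R x))" for m by (rule partials_dilation(2)[OF \<eta>(1)])
  fix js :: "'n list"
  have "compact_support (partials js \<eta>)"
    using compact_support_foldr_deriv[OF \<eta>, where w=std_dir and a="\<lambda>_. 1" and l=js] by simp
  then obtain R where R: "\<And>x. norm x > R \<Longrightarrow> partials js \<eta> x = 0" by (auto simp: compact_support_def)
  obtain B where B: "\<And>x. norm (partials js \<eta> x) \<le> B"
    using compact_support_bounded[OF smooth_partials[OF \<eta>(1)] \<open>compact_support (partials js \<eta>)\<close>] by blast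
  have B0: "B \<ge> 0" using order_trans[OF norm_ge_zero B] .
  have "norm (partials js (\<lambda>x. \<eta> (inverse (real (Suc m)) *\<^sub>R x)) x) \<le> B * (1 + \<bar>R\<bar>) ^ length js * (1 + norm x) powr (0 - real (length js))" for m x
  proof (cases "norm (inverse (real (Suc m)) *\<^sub>R x) > R")
    case True
    then show ?thesis using R[OF True] B0 by (simp only: partials_dilation(1)[OF \<eta>(1)]) simp
  next
    case False
    have n: "inverse (real (Suc m)) * norm x \<le> \<bar>R\<bar>" using False by simp
    have "1 + norm x \<le> (1 + \<bar>R\<bar>) * real (Suc m)"
    proof -
      have "norm x \<le> \<bar>R\<bar> * real (Suc m)" using n by (simp add: field_simps)
      then show ?thesis by (simp add: algebra_simps)
    qed
    then have "inverse (real (Suc m)) \<le> (1 + \<bar>R\<bar>) / (1 + norm x)" by (simp add: field_simps add_pos_nonneg)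
    then have "inverse (real (Suc m)) ^ length js \<le> ((1 + \<bar>R\<bar>) / (1 + norm x)) ^ length js" by (intro power_mono) auto
    also have "\<dots> = (1 + \<bar>R\<bar>) ^ length js * (1 + norm x) powr (0 - real (length js))"
      by (simp add: powr_minus powr_realpow add_pos_nonneg divide_inverse power_mult_distrib power_inverse)
    finally have a: "inverse (real (Suc m)) ^ length js \<le> (1 + \<bar>R\<bar>) ^ length js * (1 + norm x) powr (0 - real (length js))" .
    have "norm (partials js (\<lambda>x. \<eta> (inverse (real (Suc m)) *\<^sub>R x)) x) =
        inverse (real (Suc m)) ^ length js * norm (partials js \<eta> (inverse (real (Suc m)) *\<^sub>R x))"
      by (simp only: partials_dilation(1)[OF \<eta>(1)] norm_mult norm_power norm_of_real) simp
    also have "\<dots> \<le> ((1 + \<bar>R\<bar>) ^ length js * (1 + norm x) powr (0 - real (length js))) * B"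
      by (rule mult_mono[OF a B]) auto
    finally show ?thesis by (simp only: mult_ac)
  qed
  then show "\<exists>C. \<forall>m x. norm (partials js (\<lambda>x. \<eta> (inverse (real (Suc m)) *\<^sub>R x)) x) \<le> C * (1 + norm x) powr (0 - real (length js))"
    by blast
qed

text \<open>The function is at most \<open>2^{-m(n+1)}\<close> where \<open>2\<^sup>m \<le> 1 + |x| < 2\<^sup>m\<^sup>+\<^sup>1\<close>, and this shell lies in a cube of volume
  \<open>4\<^sup>n 2\<^sup>m\<^sup>n\<close>; the products form a convergent geometric series.\<close>

lemma integrable_decay:
  "integrable lborel (\<lambda>x::real^'n. (1 + norm x) powr (- (real CARD('n) + 1)))"
proof (rule integrableI_bounded)
  let ?n = "CARD('n)"
  show "(\<lambda>x::real^'n. (1 + norm x) powr (- (real ?n + 1))) \<in> borel_measurable lborel" by measurable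
  define c :: "nat \<Rightarrow> real" where "c m = inverse (2 ^ m) ^ (?n + 1)" for m
  define Q :: "nat \<Rightarrow> (real^'n) set" where "Q m = cbox (\<chi> i. - (2 ^ (m + 1))) (\<chi> i. 2 ^ (m + 1))" for m
  have dom: "ennreal (norm ((1 + norm x) powr (- (real ?n + 1)))) \<le> suminf (\<lambda>m. ennreal (c m) * indicator (Q m) x)" for x :: "real^'n"
  proof -
    define m where "m = nat \<lfloor>log 2 (1 + norm x)\<rfloor>"
    have m0: "log 2 (1 + norm x) \<ge> 0" by (subst zero_le_log_cancel_iff) (auto simp: add_pos_nonneg)
    have "real m \<le> log 2 (1 + norm x)" "log 2 (1 + norm x) < real (m + 1)"
      using m0 unfolding m_def by linarith+
    moreover have p: "(2::real) powr real j = 2 ^ j" for j by (simp add: powr_realpow)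
    ultimately have m: "2 ^ m \<le> 1 + norm x" "1 + norm x < 2 ^ (m + 1)"
      using le_log_iff[of 2 "1 + norm x" "real m"] log_less_iff[of 2 "1 + norm x" "real (m + 1)"]
      unfolding p by (auto simp: add_pos_nonneg)
    have "(1 + norm x) powr (- (real ?n + 1)) = inverse (1 + norm x) ^ (?n + 1)"
    proof -
      have e: "- (real ?n + 1) = - real (?n + 1)" by simp
      show ?thesis
        unfolding e powr_minus power_inverse by (subst powr_realpow) (auto simp: add_pos_nonneg)
    qed
    also have "\<dots> \<le> c m" unfolding c_def using m(1) by (intro power_mono le_imp_inverse_le) auto
    finally have "norm ((1 + norm x) powr (- (real ?n + 1))) \<le> c m" by simp
    moreover have "x \<in> Q m"
    proof -
      have "\<bar>x $ i\<bar> \<le> 2 ^ (m + 1)" for i using component_le_norm_cart[of x i] m(2) by linarith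
      then show ?thesis by (auto simp: Q_def mem_box_cart abs_le_iff minus_le_iff)
    qed
    ultimately have "ennreal (norm ((1 + norm x) powr (- (real ?n + 1)))) \<le> ennreal (c m) * indicator (Q m) x"
      by (simp add: ennreal_leI)
    also have "\<dots> = (\<Sum>i\<in>{m}. ennreal (c i) * indicator (Q i) x)" by (simp only: sum.insert sum.empty finite.emptyI empty_iff simp_thms add_0_right)
    also have "\<dots> \<le> suminf (\<lambda>m. ennreal (c m) * indicator (Q m) x)" by (rule sum_le_suminf) auto
    finally show ?thesis .
  qed
  have vol: "emeasure lborel (Q m :: (real^'n) set) = ennreal ((2 ^ (m + 2)) ^ ?n)" for m
  proof -
    have "measure lborel (Q m :: (real^'n) set) = (\<Prod>i\<in>(UNIV :: 'n set). 2 ^ (m + 1) - (- (2 ^ (m + 1))))"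
      unfolding Q_def by (subst content_cbox_cart) (auto simp: interval_ne_empty_cart)
    then have "measure lborel (Q m :: (real^'n) set) = (2 ^ (m + 2)) ^ ?n" by simp
    moreover have "emeasure lborel (Q m :: (real^'n) set) = ennreal (measure lborel (Q m :: (real^'n) set))"
      unfolding Q_def by (intro emeasure_eq_ennreal_measure) (simp add: emeasure_lborel_cbox_eq)
    ultimately show ?thesis by (simp only:)
  qed
  have "(\<integral>\<^sup>+ x. ennreal (norm ((1 + norm (x::real^'n)) powr (- (real ?n + 1)))) \<partial>lborel) \<le>
      (\<integral>\<^sup>+ x. suminf (\<lambda>m. ennreal (c m) * indicator (Q m :: (real^'n) set) x) \<partial>lborel)"
    by (rule nn_integral_mono) (rule dom)
  also have "\<dots> = suminf (\<lambda>m. \<integral>\<^sup>+ x. ennreal (c m) * indicator (Q m :: (real^'n) set) x \<partial>lborel)"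
    by (rule nn_integral_suminf) (simp add: Q_def)
  also have "\<dots> = suminf (\<lambda>m. ennreal (4 ^ ?n * (1/2) ^ m))"
  proof (intro suminf_cong)
    fix m
    have "(\<integral>\<^sup>+ x. ennreal (c m) * indicator (Q m :: (real^'n) set) x \<partial>lborel) = ennreal (c m) * ennreal ((2 ^ (m + 2)) ^ ?n)"
    proof -
      have Q: "Q m \<in> sets lborel" by (simp add: Q_def)
      show ?thesis by (simp only: nn_integral_cmult_indicator[OF Q] vol)
    qed
    also have "\<dots> = ennreal (c m * (2 ^ (m + 2)) ^ ?n)" by (rule ennreal_mult'[symmetric]) (simp add: c_def)
    also have "c m * (2 ^ (m + 2)) ^ ?n = 4 ^ ?n * (1/2) ^ m"
      by (simp add: c_def power_mult_distrib power_inverse field_simps)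
    finally show "(\<integral>\<^sup>+ x. ennreal (c m) * indicator (Q m :: (real^'n) set) x \<partial>lborel) = ennreal (4 ^ ?n * (1/2) ^ m)" .
  qed
  also have "\<dots> < \<infinity>"
    unfolding less_top[symmetric] infinity_ennreal_def
    by (rule ennreal_suminf_neq_top) (auto intro!: summable_mult summable_geometric)
  finally show "(\<integral>\<^sup>+ x. ennreal (norm ((1 + norm (x::real^'n)) powr (- (real ?n + 1)))) \<partial>lborel) < \<infinity>" .
qed

lemma foldr_dir_deriv_bound:
  fixes g :: "real^'n \<Rightarrow> complex"
  assumes "smooth g" "\<And>js. length js = length ws \<Longrightarrow> norm (partials js g x) \<le> B"
  shows "norm (foldr dir_deriv ws g x) \<le> (\<Prod>w\<leftarrow>ws. \<Sum>i\<in>UNIV. \<bar>w $ i\<bar>) * B"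
  using assms
proof (induction ws arbitrary: g)
  case Nil
  then show ?case using Nil(2)[of "[]"] by simp
next
  case (Cons w ws)
  have comm: "smooth (foldr dir_deriv ws h) \<and> dir_deriv v (foldr dir_deriv ws h) = foldr dir_deriv ws (dir_deriv v h)"
    if "smooth h" for ws v and h :: "real^'n \<Rightarrow> complex"
    by (induction ws) (auto simp: that smooth_dir_deriv dir_deriv_commute[of _ v])
  have "foldr dir_deriv (w # ws) g x = (\<Sum>i\<in>UNIV. of_real (w $ i) * dir_deriv (std_dir i) (foldr dir_deriv ws g) x)"
    by (simp only: foldr.simps comp_apply dir_deriv_expand_complex[OF conjunct1[OF comm[OF Cons.prems(1)]], of w])
  also have "\<dots> = (\<Sum>i\<in>UNIV. of_real (w $ i) * foldr dir_deriv ws (dir_deriv (std_dir i) g) x)"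
    using comm[OF Cons.prems(1), of ws] by simp
  finally have "norm (foldr dir_deriv (w # ws) g x) \<le> (\<Sum>i\<in>UNIV. norm (of_real (w $ i) * foldr dir_deriv ws (dir_deriv (std_dir i) g) x))"
    by (simp only: norm_sum)
  also have "\<dots> \<le> (\<Sum>i\<in>UNIV. \<bar>w $ i\<bar> * ((\<Prod>w\<leftarrow>ws. \<Sum>i\<in>UNIV. \<bar>w $ i\<bar>) * B))"
  proof (intro sum_mono)
    fix i
    have "norm (foldr dir_deriv ws (dir_deriv (std_dir i) g) x) \<le> (\<Prod>w\<leftarrow>ws. \<Sum>i\<in>UNIV. \<bar>w $ i\<bar>) * B"
    proof (rule Cons.IH[OF smooth_partial[OF Cons.prems(1)]])
      fix js :: "'n list" assume "length js = length ws"
      then show "norm (partials js (dir_deriv (std_dir i) g) x) \<le> B" using Cons.prems(2)[of "js @ [i]"] by simp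
    qed
    then show "norm (of_real (w $ i) * foldr dir_deriv ws (dir_deriv (std_dir i) g) x) \<le> \<bar>w $ i\<bar> * ((\<Prod>w\<leftarrow>ws. \<Sum>i\<in>UNIV. \<bar>w $ i\<bar>) * B)"
      by (simp add: norm_mult mult_left_mono)
  qed
  finally show ?case by (simp add: sum_distrib_right mult.assoc)
qed

lemma foldr_dir_deriv_pow_eq:
  fixes g :: "'b::real_normed_vector \<Rightarrow> 'c::real_normed_vector"
  shows "foldr (\<lambda>j. dir_deriv (w j) ^^ a j) l g = foldr dir_deriv (concat (map (\<lambda>j. replicate (a j) (w j)) l)) g"
proof -
  have "foldr dir_deriv (replicate m v) h = (dir_deriv v ^^ m) h" for m v and h :: "'b \<Rightarrow> 'c"
    by (induction m) auto
  then show ?thesis by (induction l) auto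
qed

lemma multi_deriv_eq_partials:
  fixes a :: "'n::{finite,linorder} \<Rightarrow> nat"
  shows "\<exists>js. length js = (\<Sum>i\<in>UNIV. a i) \<and> (\<forall>g :: real^'n::_ \<Rightarrow> complex. multi_deriv std_dir a g = partials js g)"
proof -
  let ?js = "\<lambda>l. concat (map (\<lambda>j. replicate (a j) j) l)"
  have "length (?js (sorted_list_of_set UNIV)) = sum_list (map a (sorted_list_of_set UNIV))"
    by (simp add: length_concat o_def)
  then have "length (?js (sorted_list_of_set UNIV)) = (\<Sum>i\<in>UNIV. a i)"
    by (simp add: sum_list_distinct_conv_sum_set)
  moreover have "partials (replicate m i) h = (dir_deriv (std_dir i) ^^ m) h" for m i and h :: "real^'n::_ \<Rightarrow> complex"
    by (induction m) auto
  then have "foldr (\<lambda>j. dir_deriv (std_dir j) ^^ a j) l g = partials (?js l) g" for l and g :: "real^'n::_ \<Rightarrow> complex"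
    by (induction l) auto
  ultimately show ?thesis unfolding multi_deriv_def by blast
qed

abbreviation exponents :: "nat \<Rightarrow> nat \<Rightarrow> ('n::finite \<Rightarrow> nat) set" where
  "exponents lo hi \<equiv> {a. lo \<le> (\<Sum>i\<in>UNIV. a i) \<and> (\<Sum>i\<in>UNIV. a i) \<le> hi}"

lemma finite_exponents: "finite (exponents lo hi :: ('n::finite \<Rightarrow> nat) set)"
proof (rule finite_subset)
  show "(exponents lo hi :: ('n \<Rightarrow> nat) set) \<subseteq> PiE UNIV (\<lambda>_. {..hi})"
  proof
    fix a :: "'n \<Rightarrow> nat" assume a: "a \<in> exponents lo hi"
    have "a i \<le> hi" for i
    proof -
      have "a i \<le> (\<Sum>i\<in>UNIV. a i)" by (rule member_le_sum) auto
      then show ?thesis using a by simp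
    qed
    then show "a \<in> PiE UNIV (\<lambda>_. {..hi})" by (simp add: PiE_UNIV_domain)
  qed
qed (simp add: finite_PiE)

text \<open>Expand the directional derivatives in the coordinate directions.  The bound serves both to dominate the
  integrands in the passage to symbols and to estimate the remainder.\<close>

lemma diff_op_bound:
  fixes w :: "'d::{finite,linorder} \<Rightarrow> real^'n::{finite,linorder}"
  assumes "\<And>b. b \<in> Poly_Mapping.keys T \<Longrightarrow> lo \<le> (\<Sum>j\<in>UNIV. Poly_Mapping.lookup b j) \<and> (\<Sum>j\<in>UNIV. Poly_Mapping.lookup b j) \<le> hi"
  shows "\<exists>C\<ge>0. \<forall>g x. smooth g \<longrightarrow> norm (diff_op w T g x) \<le> C * (\<Sum>a\<in>exponents lo hi. norm (multi_deriv std_dir a g x))"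
proof -
  define ws where "ws b = concat (map (\<lambda>j. replicate (Poly_Mapping.lookup b j) (w j)) (sorted_list_of_set UNIV))" for b
  define C where "C = (\<Sum>b\<in>Poly_Mapping.keys T. norm (Poly_Mapping.lookup T b) * (\<Prod>w\<leftarrow>ws b. \<Sum>i\<in>UNIV. \<bar>w $ i\<bar>))"
  have len: "length (ws b) = (\<Sum>j\<in>UNIV. Poly_Mapping.lookup b j)" for b
  proof -
    have "length (ws b) = sum_list (map (Poly_Mapping.lookup b) (sorted_list_of_set UNIV))"
      by (simp add: ws_def length_concat o_def)
    then show ?thesis by (simp add: sum_list_distinct_conv_sum_set)
  qed
  have "norm (diff_op w T g x) \<le> C * (\<Sum>a\<in>exponents lo hi. norm (multi_deriv std_dir a g x))" (is "_ \<le> C * ?B") if g: "smooth g" for g x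
  proof -
    have "norm (diff_op w T g x) \<le> (\<Sum>b\<in>Poly_Mapping.keys T. norm (Poly_Mapping.lookup T b * multi_deriv w (Poly_Mapping.lookup b) g x))"
      unfolding diff_op_def by (rule norm_sum)
    also have "\<dots> \<le> (\<Sum>b\<in>Poly_Mapping.keys T. norm (Poly_Mapping.lookup T b) * ((\<Prod>w\<leftarrow>ws b. \<Sum>i\<in>UNIV. \<bar>w $ i\<bar>) * ?B))"
    proof (intro sum_mono)
      fix b assume b: "b \<in> Poly_Mapping.keys T"
      have "norm (foldr dir_deriv (ws b) g x) \<le> (\<Prod>w\<leftarrow>ws b. \<Sum>i\<in>UNIV. \<bar>w $ i\<bar>) * ?B"
      proof (rule foldr_dir_deriv_bound[OF g])
        fix js :: "'n list" assume js: "length js = length (ws b)"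
        have "count_list js \<in> exponents lo hi" using assms[OF b] js by (simp add: sum_count_list_UNIV len)
        then show "norm (partials js g x) \<le> ?B" unfolding partials_eq_multi_deriv[OF g]
          by (intro member_le_sum finite_exponents) auto
      qed
      then show "norm (Poly_Mapping.lookup T b * multi_deriv w (Poly_Mapping.lookup b) g x) \<le>
          norm (Poly_Mapping.lookup T b) * ((\<Prod>w\<leftarrow>ws b. \<Sum>i\<in>UNIV. \<bar>w $ i\<bar>) * ?B)"
        by (simp add: norm_mult mult_left_mono multi_deriv_def foldr_dir_deriv_pow_eq ws_def)
    qed
    finally show ?thesis by (simp add: C_def sum_distrib_right mult.assoc)
  qed
  moreover have "C \<ge> 0" unfolding C_def by (intro sum_nonneg mult_nonneg_nonneg prod_list_nonneg) (auto intro: sum_nonneg)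
  ultimately show ?thesis by blast
qed

lemma symbol_family_decay:
  fixes F :: "'a \<Rightarrow> real^'n::{finite,linorder} \<Rightarrow> complex"
  assumes F: "symbol_family N F" and k: "real lo \<ge> N + M"
  shows "\<exists>C. \<forall>m x. (\<Sum>a\<in>exponents lo hi. norm (multi_deriv std_dir a (F m) x)) \<le> C * (1 + norm x) powr (- M)"
proof -
  have "\<forall>a\<in>exponents lo hi. \<exists>C. \<forall>m x. norm (multi_deriv std_dir a (F m) x) \<le> C * (1 + norm x) powr (- M)"
  proof
    fix a :: "'n \<Rightarrow> nat" assume a: "a \<in> exponents lo hi"
    obtain js where js: "length js = (\<Sum>i\<in>UNIV. a i)" "\<And>g :: real^'n::_ \<Rightarrow> complex. multi_deriv std_dir a g = partials js g"
      using multi_deriv_eq_partials by blast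
    obtain C where C: "\<And>m x. norm (partials js (F m) x) \<le> C * (1 + norm x) powr (N - real (length js))"
      using F unfolding symbol_family_def by blast
    have "norm (multi_deriv std_dir a (F m) x) \<le> \<bar>C\<bar> * (1 + norm x) powr (- M)" for m x
    proof -
      have "C * (1 + norm x) powr (N - real (length js)) \<le> \<bar>C\<bar> * (1 + norm x) powr (- M)"
      proof (intro mult_mono powr_mono)
        have "lo \<le> length js" using a js(1) by simp
        then have "real lo \<le> real (length js)" by (simp only: of_nat_le_iff)
        then show "N - real (length js) \<le> - M" using k by linarith
      qed auto
      then show ?thesis using C[of m x] by (simp add: js(2))
    qed
    then show "\<exists>C. \<forall>m x. norm (multi_deriv std_dir a (F m) x) \<le> C * (1 + norm x) powr (- M)" by blast
  qed
  from bchoice[OF this] obtain C where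
    "\<forall>a\<in>exponents lo hi. \<forall>m x. norm (multi_deriv std_dir a (F m) x) \<le> C a * (1 + norm x) powr (- M)" ..
  then have C: "norm (multi_deriv std_dir a (F m) x) \<le> C a * (1 + norm x) powr (- M)" if "a \<in> exponents lo hi" for a m x
    using that by blast
  have "(\<Sum>a\<in>exponents lo hi. norm (multi_deriv std_dir a (F m) x)) \<le> (\<Sum>a\<in>exponents lo hi. C a) * (1 + norm x) powr (- M)" for m x
    unfolding sum_distrib_right by (rule sum_mono) (rule C)
  then show ?thesis by blast
qed

section \<open>The remainder and the formula for symbols\<close>

text \<open>If \<open>J \<noteq> K\<close>, at least one direction carries a \<open>k\<close>-th derivative, and none carries more.\<close>

lemma orthant_op_order:
  fixes lam :: "'d::{finite,linorder} \<Rightarrow> complex"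
  assumes J: "J \<subset> K" and K: "finite K" and k: "k \<ge> 1" and b: "b \<in> Poly_Mapping.keys (orthant_op k lam K J)"
  shows "k \<le> (\<Sum>j\<in>UNIV. Poly_Mapping.lookup b j)" "(\<Sum>j\<in>UNIV. Poly_Mapping.lookup b j) \<le> card K * k"
proof -
  let ?A = "\<Prod>j\<in>J. in_var j (main_poly k (lam j))" and ?B = "\<Prod>j\<in>K - J. in_var j (monom 1 k)"
  have fin: "finite J" "finite (K - J)" using J K by (auto intro: finite_subset)
  obtain a c where ac: "b = a + c" "a \<in> Poly_Mapping.keys ?A" "c \<in> Poly_Mapping.keys ?B"
    using b keys_mult[of ?A ?B] unfolding orthant_op_def by blast
  have l: "(i \<in> J \<longrightarrow> Poly_Mapping.lookup b i \<le> k) \<and> (i \<in> K - J \<longrightarrow> Poly_Mapping.lookup b i = k) \<and>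
      (i \<notin> K \<longrightarrow> Poly_Mapping.lookup b i = 0)" for i
  proof -
    have "coeff (main_poly k (lam i)) m \<noteq> 0 \<Longrightarrow> m \<le> k" for m
      using degree_main_poly[OF k] le_degree order_trans by blast
    then show ?thesis
      using keys_prod_in_var[OF fin(1) ac(2), of i] keys_prod_in_var[OF fin(2) ac(3), of i] J
      by (auto simp: ac(1) lookup_add split: if_splits)
  qed
  obtain i where i: "i \<in> K - J" using J by blast
  have "k = Poly_Mapping.lookup b i" using l[of i] i by simp
  also have "\<dots> \<le> (\<Sum>j\<in>UNIV. Poly_Mapping.lookup b j)" by (rule member_le_sum) auto
  finally show "k \<le> (\<Sum>j\<in>UNIV. Poly_Mapping.lookup b j)" .
  have "(\<Sum>j\<in>UNIV. Poly_Mapping.lookup b j) = (\<Sum>j\<in>K. Poly_Mapping.lookup b j)"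
    using l by (intro sum.mono_neutral_right) auto
  also have "\<dots> \<le> (\<Sum>j\<in>K. k)"
    by (rule sum_mono) (use l in \<open>metis Diff_iff order_refl\<close>)
  finally show "(\<Sum>j\<in>UNIV. Poly_Mapping.lookup b j) \<le> card K * k" by simp
qed

context lattice_polytope
begin

lemma remainder_integrand_bound:
  assumes v: "v \<in> vertices P" and \<gamma>: "\<gamma> \<in> groupv v" and J: "J \<subset> tight v" and k: "k \<ge> 1"
  shows "\<exists>C\<ge>0. \<forall>f x. smooth f \<longrightarrow> norm (remainder_integrand k u (tight v) \<xi> v \<gamma> J f x) \<le>
     C * (\<Sum>a\<in>exponents k (CARD('n) * k). norm (multi_deriv std_dir a f x))"
proof -
  let ?T = "orthant_op k (cone_root \<xi> v \<gamma>) (tight v) J"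
  have "\<exists>C\<ge>0. \<forall>g x. smooth g \<longrightarrow> norm (diff_op (cone_dir \<xi> v) ?T g x) \<le>
      C * (\<Sum>a\<in>exponents k (CARD('n) * k). norm (multi_deriv std_dir a g x))"
    using orthant_op_order[OF J finite k] card_tight_vertex[OF v] by (intro diff_op_bound) auto
  then obtain C where C: "C \<ge> 0" "\<And>g x. smooth g \<Longrightarrow> norm (diff_op (cone_dir \<xi> v) ?T g x) \<le>
      C * (\<Sum>a\<in>exponents k (CARD('n) * k). norm (multi_deriv std_dir a g x))" by blast
  obtain B where B: "\<And>x. norm (periodic_factor k \<xi> v \<gamma> J x) \<le> B" using periodic_factor_bounded[OF v \<gamma> k] by blast
  have B0: "B \<ge> 0" using order_trans[OF norm_ge_zero B] .
  show ?thesis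
  proof (intro exI[of _ "B * C"] conjI allI impI)
    show "0 \<le> B * C" using B0 C(1) by simp
    fix f :: "real^'n::_ \<Rightarrow> complex" and x assume f: "smooth f"
    show "norm (remainder_integrand k u (tight v) \<xi> v \<gamma> J f x) \<le>
       B * C * (\<Sum>a\<in>exponents k (CARD('n) * k). norm (multi_deriv std_dir a f x))"
      unfolding remainder_integrand_eq[OF v psubset_imp_subset[OF J] f] norm_mult mult.assoc
      using B[of x] C(2)[OF f, of x] B0 by (intro mult_mono) auto
  qed
qed

lemma remainder_integrand_measurable:
  assumes "v \<in> vertices P" "\<gamma> \<in> groupv v" "J \<subseteq> tight v" "k \<ge> 1" "smooth f"
  shows "remainder_integrand k u (tight v) \<xi> v \<gamma> J f \<in> borel_measurable borel"
proof -
  have "remainder_integrand k u (tight v) \<xi> v \<gamma> J f = (\<lambda>x. periodic_factor k \<xi> v \<gamma> J x *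
     diff_op (cone_dir \<xi> v) (orthant_op k (cone_root \<xi> v \<gamma>) (tight v) J) f x)"
    using assms by (intro ext remainder_integrand_eq)
  then show ?thesis
    using borel_measurable_times[OF periodic_factor_measurable[OF assms(1,2,4)] smooth_borel_measurable[OF smooth_diff_op[OF assms(5)]]]
    by simp
qed

text \<open>Dominated convergence: derivatives of order at least \<open>k\<close> of symbols of order \<open>N\<close> are \<open>O((1+|x|)^{-n-1})\<close>,
  uniformly in the family.\<close>

lemma remainder_continuous:
  assumes k: "k \<ge> 1" and F: "symbol_family N F" "real k \<ge> N + real CARD('n) + 1" and f: "smooth f"
    and loc: "\<And>x. \<forall>\<^sub>F m in sequentially. \<exists>U. open U \<and> x \<in> U \<and> (\<forall>y\<in>U. F m y = f y)"
  shows "(\<lambda>m. remainder k P u \<mu> \<xi> (F m)) \<longlonglongrightarrow> remainder k P u \<mu> \<xi> f"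
proof -
  have sF: "smooth (F m)" for m using F(1) by (simp add: symbol_family_def)
  obtain D where D: "\<And>m x. (\<Sum>a\<in>exponents k (CARD('n) * k). norm (multi_deriv std_dir a (F m) x)) \<le>
      D * (1 + norm x) powr (- (real CARD('n) + 1))"
    using symbol_family_decay[OF F(1), of "real CARD('n) + 1" k "CARD('n) * k"] F(2) by (auto simp: add.assoc)
  have "(\<lambda>m. LINT x:cone_sharp u (tight v) \<xi> v|lborel. remainder_integrand k u (tight v) \<xi> v \<gamma> J (F m) x)
     \<longlonglongrightarrow> (LINT x:cone_sharp u (tight v) \<xi> v|lborel. remainder_integrand k u (tight v) \<xi> v \<gamma> J f x)"
    if v: "v \<in> vertices P" and \<gamma>: "\<gamma> \<in> groupv v" and J: "J \<subset> tight v" for v \<gamma> J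
  proof -
    let ?c = "cone_sharp u (tight v) \<xi> v" and ?R = "remainder_integrand k u (tight v) \<xi> v \<gamma> J"
    have J': "J \<subseteq> tight v" using J by blast
    obtain C where C: "C \<ge> 0" "\<And>g x. smooth g \<Longrightarrow> norm (?R g x) \<le>
        C * (\<Sum>a\<in>exponents k (CARD('n) * k). norm (multi_deriv std_dir a g x))"
      using remainder_integrand_bound[OF v \<gamma> J k, of \<xi>] by blast
    have [measurable]: "?R g \<in> borel_measurable borel" if "smooth g" for g
      using remainder_integrand_measurable[OF v \<gamma> J' k that] .
    have [measurable]: "?c \<in> sets borel" by (rule cone_sharp_borel[OF v])
    show ?thesis unfolding set_lebesgue_integral_def
    proof (rule integral_dominated_convergence[where w="\<lambda>x. C * D * (1 + norm x) powr (- (real CARD('n) + 1))"])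
      show "(\<lambda>x. indicat_real ?c x *\<^sub>R ?R f x) \<in> borel_measurable lborel" using f by measurable
      show "(\<lambda>x. indicat_real ?c x *\<^sub>R ?R (F m) x) \<in> borel_measurable lborel" for m using sF by measurable
      show "integrable lborel (\<lambda>x::real^'n::_. C * D * (1 + norm x) powr (- (real CARD('n) + 1)))"
        by (intro integrable_mult_right integrable_decay)
      show "AE x in lborel. (\<lambda>m. indicat_real ?c x *\<^sub>R ?R (F m) x) \<longlonglongrightarrow> indicat_real ?c x *\<^sub>R ?R f x"
      proof (intro AE_I2 tendsto_scaleR tendsto_const tendsto_eventually eventually_mono[OF loc])
        fix x m assume "\<exists>U. open U \<and> x \<in> U \<and> (\<forall>y\<in>U. F m y = f y)"
        then obtain U where U: "open U" "x \<in> U" "\<And>y. y \<in> U \<Longrightarrow> F m y = f y" by blast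
        have "diff_op (cone_dir \<xi> v) T (F m) x = diff_op (cone_dir \<xi> v) T f x" for T
          by (rule diff_op_local[OF U(1) U(3) U(2)])
        then show "?R (F m) x = ?R f x"
          unfolding remainder_integrand_eq[OF v J' f] remainder_integrand_eq[OF v J' sF] by simp
      qed
      show "AE x in lborel. norm (indicat_real ?c x *\<^sub>R ?R (F m) x) \<le> C * D * (1 + norm x) powr (- (real CARD('n) + 1))" for m
      proof (rule AE_I2)
        fix x
        have "norm (indicat_real ?c x *\<^sub>R ?R (F m) x) \<le> norm (?R (F m) x)" by (simp add: indicator_def)
        also have "\<dots> \<le> C * (\<Sum>a\<in>exponents k (CARD('n) * k). norm (multi_deriv std_dir a (F m) x))" by (rule C(2)[OF sF])
        also have "\<dots> \<le> C * (D * (1 + norm x) powr (- (real CARD('n) + 1)))" by (rule mult_left_mono[OF D C(1)])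
        finally show "norm (indicat_real ?c x *\<^sub>R ?R (F m) x) \<le> C * D * (1 + norm x) powr (- (real CARD('n) + 1))" by (simp only: mult.assoc)
      qed
    qed
  qed
  then show ?thesis unfolding remainder_def Let_def by (intro tendsto_sum tendsto_mult tendsto_const) auto
qed

text \<open>An interior point \<open>p\<close> has slack at least \<open>\<epsilon>\<close> in every inequality.  A contraction with centre \<open>p\<close> by a factor
  depending only on \<open>\<epsilon>\<close> therefore maps every \<open>\<Delta>(h)\<close> with \<open>|h\<^sub>i| \<le> 1\<close> into the bounded set \<open>\<Delta>\<close>.\<close>

lemma shifted_polytopes_bounded:
  "\<exists>R. \<forall>h x. (\<forall>i. \<bar>h $ i\<bar> \<le> 1) \<longrightarrow> x \<in> shifted_polytope u \<mu> h \<longrightarrow> norm x \<le> R"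
proof -
  obtain p e where p: "e > 0" "ball p e \<subseteq> P" using interior_P_nonempty by (auto simp: mem_interior)
  define d where "d i = e / 2 * norm (u i)" for i
  have slack_p: "slack i p \<ge> d i" "d i > 0" for i
  proof -
    show "d i > 0" using p(1) u_nonzero[of i] by (simp add: d_def)
    define y where "y = p - (e / (2 * norm (u i))) *\<^sub>R u i"
    have "dist p y < e" using p(1) u_nonzero[of i] by (simp add: y_def dist_norm)
    then have "slack i y \<ge> 0" using p(2) mem_P_iff by auto
    moreover have "slack i y - slack i p = - d i"
      using slack_diff[of i y p] u_nonzero[of i]
      by (simp add: y_def d_def power2_norm_eq_inner[symmetric] power2_eq_square field_simps)
    ultimately show "slack i p \<ge> d i" by linarith
  qed
  define \<epsilon> where "\<epsilon> = Min (range d)"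
  have \<epsilon>: "\<epsilon> > 0" using slack_p(2) by (simp add: \<epsilon>_def)
  have "\<epsilon> \<le> d i" for i unfolding \<epsilon>_def by (rule Min_le) auto
  then have \<epsilon>_le: "slack i p \<ge> \<epsilon>" for i using slack_p(1) order_trans by blast
  define t where "t = \<epsilon> / (1 + \<epsilon>)"
  have t: "0 < t" "t < 1" "(1 - t) * \<epsilon> = t" using \<epsilon> by (auto simp: t_def field_simps)
  obtain B where B: "\<And>x. x \<in> P \<Longrightarrow> norm x \<le> B" using bounded_P by (auto simp: bounded_iff)
  have "norm x \<le> norm p + (B + norm p) / t" if h: "\<forall>i. \<bar>h $ i\<bar> \<le> 1" and x: "x \<in> shifted_polytope u \<mu> h" for h x
  proof -
    have "p + t *\<^sub>R (x - p) \<in> P" unfolding mem_P_iff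
    proof
      fix i
      have "slack i (p + t *\<^sub>R (x - p)) = slack i p + t * (slack i x - slack i p)"
        using slack_diff[of i "p + t *\<^sub>R (x - p)" p] slack_diff[of i x p] by simp
      also have "\<dots> = (1 - t) * slack i p + t * slack i x" by (simp add: algebra_simps)
      also have "\<dots> \<ge> (1 - t) * \<epsilon> + t * (-1)"
      proof (intro add_mono mult_left_mono)
        have "slack i x + h $ i \<ge> 0" using x by (auto simp: mem_shifted_polytope slack_shift_def)
        then show "- 1 \<le> slack i x" using h[rule_format, of i] by linarith
      qed (use \<epsilon>_le t in auto)
      finally show "slack i (p + t *\<^sub>R (x - p)) \<ge> 0" using t(3) by simp
    qed
    then have "norm (t *\<^sub>R (x - p)) \<le> B + norm p"
      using B[of "p + t *\<^sub>R (x - p)"] norm_triangle_ineq4[of "p + t *\<^sub>R (x - p)" p] by simp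
    then have "t * norm (x - p) \<le> B + norm p" using t(1) by (simp only: norm_scaleR abs_of_pos)
    then have "norm (x - p) \<le> (B + norm p) / t" using t(1) by (simp add: field_simps)
    then show ?thesis using norm_triangle_ineq[of p "x - p"] by simp
  qed
  then show ?thesis by blast
qed

text \<open>For large \<open>m\<close> the truncated function agrees with \<open>f\<close> on all \<open>\<Delta>(h)\<close> with \<open>h\<close> near 0, so in the formula for it only
  the remainder still depends on \<open>m\<close>.\<close>

theorem euler_maclaurin_symbol:
  assumes pol: "polarizing P u \<mu> \<xi>" and k: "k \<ge> 1" "real k \<ge> N + real CARD('n) + 1" and f: "symbol_of_order N f"
  shows "weighted_sum P f =
      (\<Sum>F\<in>faces P. \<Sum>\<gamma>\<in>Gamma_flat P u \<mu> F.
         diff_op std_dir (M_op k P u \<mu> F \<gamma>) (\<lambda>h. LINT x:shifted_polytope u \<mu> h|lborel. f x) 0)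
      + remainder k P u \<mu> \<xi> f" (is "_ = ?main f + _")
proof -
  obtain \<eta> :: "real^'n::_ \<Rightarrow> complex" where \<eta>: "smooth \<eta>" "compact_support \<eta>" "\<And>x. norm x \<le> 1 \<Longrightarrow> \<eta> x = 1"
    using smooth_cutoff by blast
  define F where "F m x = f x * \<eta> (inverse (real (Suc m)) *\<^sub>R x)" for m x
  have f': "smooth f" using f by (simp add: symbol_of_order_def)
  have fam: "symbol_family N F"
    using symbol_family_mult[OF symbol_family_const[OF f] symbol_family_cutoff[OF \<eta>(1,2)]] by (simp add: F_def[abs_def])
  have sF: "smooth (F m)" for m using fam by (simp add: symbol_family_def)
  have eq: "F m x = f x" if "norm x \<le> real (Suc m)" for m x
    using that \<eta>(3)[of "inverse (real (Suc m)) *\<^sub>R x"] by (simp add: F_def field_simps)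
  have cF: "compact_support (F m)" for m
  proof -
    obtain R where R: "\<And>x. norm x > R \<Longrightarrow> \<eta> x = 0" using \<eta>(2) by (auto simp: compact_support_def)
    have "F m x = 0" if "norm x > R * real (Suc m)" for x
      using that R[of "inverse (real (Suc m)) *\<^sub>R x"] by (simp add: F_def field_simps)
    then show ?thesis unfolding compact_support_def by blast
  qed
  have "(\<lambda>m. remainder k P u \<mu> \<xi> (F m)) \<longlonglongrightarrow> remainder k P u \<mu> \<xi> f"
  proof (rule remainder_continuous[OF k(1) fam k(2) f'])
    fix x :: "real^'n::_"
    obtain m0 :: nat where m0: "norm x < real m0" using reals_Archimedean2 by blast
    show "\<forall>\<^sub>F m in sequentially. \<exists>U. open U \<and> x \<in> U \<and> (\<forall>y\<in>U. F m y = f y)"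
    proof (rule eventually_sequentiallyI[of m0])
      fix m assume "m0 \<le> m"
      then show "\<exists>U. open U \<and> x \<in> U \<and> (\<forall>y\<in>U. F m y = f y)"
        using m0 eq[of _ m] by (intro exI[of _ "ball 0 (real (Suc m))"]) auto
    qed
  qed
  moreover have "\<forall>\<^sub>F m in sequentially. remainder k P u \<mu> \<xi> (F m) = weighted_sum P f - ?main f"
  proof -
    obtain R where R: "\<And>h x. \<forall>i. \<bar>h $ i\<bar> \<le> 1 \<Longrightarrow> x \<in> shifted_polytope u \<mu> h \<Longrightarrow> norm x \<le> R"
      using shifted_polytopes_bounded by blast
    obtain m0 :: nat where m0: "R < real m0" using reals_Archimedean2 by blast
    show ?thesis
    proof (rule eventually_sequentiallyI[of m0])
      fix m assume m: "m0 \<le> m"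
      have same: "F m x = f x" if "x \<in> shifted_polytope u \<mu> h" "\<forall>i. \<bar>h $ i\<bar> \<le> 1" for x h
        using R[OF that(2,1)] m0 m by (intro eq) linarith
      have "x \<in> shifted_polytope u \<mu> 0" if "x \<in> P" for x
        using that mem_P_iff by (simp add: mem_shifted_polytope slack_shift_0)
      then have w: "weighted_sum P (F m) = weighted_sum P f"
        unfolding weighted_sum_def by (intro sum.cong refl) (use same[of _ 0] in auto)
      have "diff_op std_dir T (\<lambda>h. LINT x:shifted_polytope u \<mu> h|lborel. F m x) 0 =
         diff_op std_dir T (\<lambda>h. LINT x:shifted_polytope u \<mu> h|lborel. f x) 0" for T
      proof (rule diff_op_local[of "ball 0 1"])
        fix h :: "real^'d::_" assume "h \<in> ball 0 1"
        then have "\<forall>i. \<bar>h $ i\<bar> \<le> 1" using component_le_norm_cart[of h] by (auto intro: order_trans[OF _ less_imp_le])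
        then show "(LINT x:shifted_polytope u \<mu> h|lborel. F m x) = (LINT x:shifted_polytope u \<mu> h|lborel. f x)"
          unfolding set_lebesgue_integral_def using same[of _ h]
          by (intro Bochner_Integration.integral_cong) (auto simp: indicator_def)
      qed auto
      then have "?main (F m) = ?main f" by simp
      then show "remainder k P u \<mu> \<xi> (F m) = weighted_sum P f - ?main f"
        using euler_maclaurin_test_function[OF pol k(1) sF cF, of m] w by simp
    qed
  qed
  ultimately have "(\<lambda>m. weighted_sum P f - ?main f) \<longlonglongrightarrow> remainder k P u \<mu> \<xi> f"
    by (rule Lim_transform_eventually)
  then have "weighted_sum P f - ?main f = remainder k P u \<mu> \<xi> f" by (rule LIMSEQ_unique[OF tendsto_const])
  then show ?thesis by (simp add: algebra_simps)
qed

lemma remainder_bound: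
  assumes k: "k \<ge> 1"
  shows "\<exists>K\<ge>0. \<forall>f. smooth f \<longrightarrow> (\<forall>a\<in>exponents k (CARD('n) * k). integrable lborel (\<lambda>x. norm (multi_deriv std_dir a f x))) \<longrightarrow>
     norm (remainder k P u \<mu> \<xi> f) \<le> K * (\<Sum>a\<in>exponents k (CARD('n) * k). LINT x|lborel. norm (multi_deriv std_dir a f x))"
proof -
  let ?E = "exponents k (CARD('n) * k) :: ('n \<Rightarrow> nat) set"
  define C where "C v \<gamma> J = (SOME C. C \<ge> 0 \<and> (\<forall>f x. smooth f \<longrightarrow> norm (remainder_integrand k u (tight v) \<xi> v \<gamma> J f x) \<le>
     C * (\<Sum>a\<in>?E. norm (multi_deriv std_dir a f x))))" for v \<gamma> J
  have C: "C v \<gamma> J \<ge> 0" "\<And>f x. smooth f \<Longrightarrow> norm (remainder_integrand k u (tight v) \<xi> v \<gamma> J f x) \<le>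
     C v \<gamma> J * (\<Sum>a\<in>?E. norm (multi_deriv std_dir a f x))"
    if "v \<in> vertices P" "\<gamma> \<in> groupv v" "J \<subset> tight v" for v \<gamma> J
    using someI_ex[OF remainder_integrand_bound[OF that k, of \<xi>]] unfolding C_def by blast+
  show ?thesis
  proof (intro exI[of _ "\<Sum>v\<in>vertices P. \<Sum>\<gamma>\<in>groupv v. \<Sum>J\<in>{J. J \<subset> tight v}. C v \<gamma> J"] conjI allI impI)
    show "0 \<le> (\<Sum>v\<in>vertices P. \<Sum>\<gamma>\<in>groupv v. \<Sum>J\<in>{J. J \<subset> tight v}. C v \<gamma> J)"
      by (intro sum_nonneg) (auto intro: C(1))
    fix f :: "real^'n::_ \<Rightarrow> complex"
    assume f: "smooth f" and int: "\<forall>a\<in>?E. integrable lborel (\<lambda>x. norm (multi_deriv std_dir a f x))"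
    let ?S = "\<Sum>a\<in>?E. LINT x|lborel. norm (multi_deriv std_dir a f x)"
    have one: "norm (LINT x:cone_sharp u (tight v) \<xi> v|lborel. remainder_integrand k u (tight v) \<xi> v \<gamma> J f x) \<le> C v \<gamma> J * ?S"
      if v: "v \<in> vertices P" and \<gamma>: "\<gamma> \<in> groupv v" and J: "J \<subset> tight v" for v \<gamma> J
    proof -
      let ?g = "\<lambda>x. indicat_real (cone_sharp u (tight v) \<xi> v) x *\<^sub>R remainder_integrand k u (tight v) \<xi> v \<gamma> J f x"
      let ?w = "\<lambda>x. C v \<gamma> J * (\<Sum>a\<in>?E. norm (multi_deriv std_dir a f x))"
      have w: "integrable lborel ?w"
        using int by (intro integrable_mult_right Bochner_Integration.integrable_sum) auto
      have b: "norm (?g x) \<le> ?w x" for x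
        using C(2)[OF v \<gamma> J f, of x] C(1)[OF v \<gamma> J] by (auto simp: indicator_def intro!: mult_nonneg_nonneg sum_nonneg)
      have [measurable]: "remainder_integrand k u (tight v) \<xi> v \<gamma> J f \<in> borel_measurable borel"
        using J by (intro remainder_integrand_measurable[OF v \<gamma> _ k f]) auto
      have [measurable]: "cone_sharp u (tight v) \<xi> v \<in> sets borel" by (rule cone_sharp_borel[OF v])
      have g: "integrable lborel ?g"
      proof (rule Bochner_Integration.integrable_bound[OF w])
        show "AE x in lborel. norm (?g x) \<le> norm (?w x)" using order_trans[OF b abs_ge_self] by (intro AE_I2) (simp only: real_norm_def)
      qed measurable
      have "norm (integral\<^sup>L lborel ?g) \<le> integral\<^sup>L lborel ?w"
        by (rule Bochner_Integration.integral_norm_bound_integral[OF g w]) (rule b)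
      also have "integral\<^sup>L lborel ?w = C v \<gamma> J * ?S"
        using int by (subst integral_mult_right_zero, subst Bochner_Integration.integral_sum) auto
      finally show ?thesis by (simp only: set_lebesgue_integral_def)
    qed
    have "norm (remainder k P u \<mu> \<xi> f) \<le> (\<Sum>v\<in>vertices P. \<Sum>\<gamma>\<in>groupv v. \<Sum>J\<in>{J. J \<subset> tight v}. C v \<gamma> J * ?S)"
      unfolding remainder_def Let_def
      by (intro order_trans[OF norm_sum] sum_mono, subst norm_mult,
          simp only: norm_power norm_minus_cancel norm_one power_one mult_1,
          intro order_trans[OF norm_sum] sum_mono, subst norm_mult,
          simp only: norm_power norm_minus_cancel norm_one power_one mult_1)
         (auto intro: one)
    then show "norm (remainder k P u \<mu> \<xi> f) \<le> (\<Sum>v\<in>vertices P. \<Sum>\<gamma>\<in>groupv v. \<Sum>J\<in>{J. J \<subset> tight v}. C v \<gamma> J) * ?S"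
      by (simp add: sum_distrib_right)
  qed
qed

lemma remainder_cong_flipped:
  assumes "\<And>v. v \<in> vertices P \<Longrightarrow> flipped u (tight v) \<xi> = flipped u (tight v) \<zeta>"
  shows "remainder k P u \<mu> \<xi> f = remainder k P u \<mu> \<zeta> f"
proof -
  have "alpha_sharp u (tight v) \<xi> = alpha_sharp u (tight v) \<zeta>" "u_sharp u (tight v) \<xi> = u_sharp u (tight v) \<zeta>"
    "lam_sharp u (tight v) \<xi> \<gamma> = lam_sharp u (tight v) \<zeta> \<gamma>" "num_flips u (tight v) \<xi> = num_flips u (tight v) \<zeta>"
    if "v \<in> vertices P" for v \<gamma>
    using assms[OF that] by (auto simp: fun_eq_iff alpha_sharp_def u_sharp_def lam_sharp_def num_flips_def)
  then show ?thesis
    by (auto simp: remainder_def Let_def remainder_integrand_def cone_sharp_def set_lebesgue_integral_def intro!: sum.cong)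
qed

text \<open>The remainder depends on \<open>\<xi>\<close> only through the sets of flipped edges at the vertices.  There are finitely many such
  configurations, and the sum of their constants serves for all \<open>\<xi>\<close>.\<close>

theorem remainder_estimate:
  assumes k: "k \<ge> 1"
  shows "\<exists>K::real. \<forall>(N::real) (f :: real^'n::_ \<Rightarrow> complex) \<xi>.
          symbol_of_order N f \<and> real k \<ge> N + real CARD('n::_) + 1 \<longrightarrow>
          norm (remainder k P u \<mu> \<xi> f) \<le>
            K * (SUP a \<in> exponents k (CARD('n) * k). LINT x|lborel. norm (multi_deriv std_dir a f x))"
proof -
  let ?E = "exponents k (CARD('n) * k) :: ('n \<Rightarrow> nat) set"
  let ?I = "\<lambda>f a. LINT x|lborel. norm (multi_deriv std_dir a f x)"
  define cfg where "cfg \<xi> = (\<lambda>v. if v \<in> vertices P then {j. flipped u (tight v) \<xi> j} else {})" for \<xi>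
  define K where "K c = (SOME K. K \<ge> 0 \<and> (\<forall>f \<xi>. cfg \<xi> = c \<longrightarrow> smooth f \<longrightarrow>
     (\<forall>a\<in>?E. integrable lborel (\<lambda>x. norm (multi_deriv std_dir a f x))) \<longrightarrow>
     norm (remainder k P u \<mu> \<xi> f) \<le> K * (\<Sum>a\<in>?E. ?I f a)))" for c
  have K: "K (cfg \<xi>) \<ge> 0" "\<And>f. smooth f \<Longrightarrow> \<forall>a\<in>?E. integrable lborel (\<lambda>x. norm (multi_deriv std_dir a f x)) \<Longrightarrow>
     norm (remainder k P u \<mu> \<xi> f) \<le> K (cfg \<xi>) * (\<Sum>a\<in>?E. ?I f a)" for \<xi>
  proof -
    have cong: "remainder k P u \<mu> \<zeta> f = remainder k P u \<mu> \<xi> f" if "cfg \<zeta> = cfg \<xi>" for \<zeta> f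
    proof (rule remainder_cong_flipped)
      fix v assume v: "v \<in> vertices P"
      have "cfg \<zeta> v = cfg \<xi> v" using that by simp
      then show "flipped u (tight v) \<zeta> = flipped u (tight v) \<xi>" using v by (auto simp: cfg_def fun_eq_iff)
    qed
    obtain K0 where K0: "K0 \<ge> 0" "\<And>f. smooth f \<Longrightarrow> \<forall>a\<in>?E. integrable lborel (\<lambda>x. norm (multi_deriv std_dir a f x)) \<Longrightarrow>
       norm (remainder k P u \<mu> \<xi> f) \<le> K0 * (\<Sum>a\<in>?E. ?I f a)"
      using remainder_bound[OF k, of \<xi>] by blast
    have "\<exists>K. K \<ge> 0 \<and> (\<forall>f \<zeta>. cfg \<zeta> = cfg \<xi> \<longrightarrow> smooth f \<longrightarrow>
     (\<forall>a\<in>?E. integrable lborel (\<lambda>x. norm (multi_deriv std_dir a f x))) \<longrightarrow>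
     norm (remainder k P u \<mu> \<zeta> f) \<le> K * (\<Sum>a\<in>?E. ?I f a))"
    proof (intro exI[of _ K0] conjI allI impI K0(1))
      fix f :: "real^'n::_ \<Rightarrow> complex" and \<zeta> assume "cfg \<zeta> = cfg \<xi>" "smooth f" "\<forall>a\<in>?E. integrable lborel (\<lambda>x. norm (multi_deriv std_dir a f x))"
      then show "norm (remainder k P u \<mu> \<zeta> f) \<le> K0 * (\<Sum>a\<in>?E. ?I f a)"
        using cong[of \<zeta> f] K0(2)[of f] by (simp only:)
    qed
    from someI_ex[OF this] show "K (cfg \<xi>) \<ge> 0" "\<And>f. smooth f \<Longrightarrow> \<forall>a\<in>?E. integrable lborel (\<lambda>x. norm (multi_deriv std_dir a f x)) \<Longrightarrow>
       norm (remainder k P u \<mu> \<xi> f) \<le> K (cfg \<xi>) * (\<Sum>a\<in>?E. ?I f a)"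
      unfolding K_def by blast+
  qed
  have fin: "finite (range cfg)"
  proof (rule finite_subset)
    show "range cfg \<subseteq> {c. \<forall>v. (v \<in> vertices P \<longrightarrow> c v \<in> UNIV) \<and> (v \<notin> vertices P \<longrightarrow> c v = {})}" by (auto simp: cfg_def)
  qed (intro finite_set_of_finite_funs finite_vertices, simp)
  show ?thesis
  proof (intro exI[of _ "(\<Sum>c\<in>range cfg. K c) * real (card ?E)"] allI impI)
    fix N and f :: "real^'n::_ \<Rightarrow> complex" and \<xi>
    assume "symbol_of_order N f \<and> real k \<ge> N + real CARD('n) + 1"
    then have f: "symbol_of_order N f" "smooth f" and kN: "real k \<ge> N + (real CARD('n) + 1)" by (auto simp: symbol_of_order_def)
    obtain D where D: "\<And>x. (\<Sum>a\<in>?E. norm (multi_deriv std_dir a f x)) \<le> D * (1 + norm x) powr (- (real CARD('n) + 1))"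
      using symbol_family_decay[where F="\<lambda>_::unit. f", OF symbol_family_const[OF f(1)] kN, of "CARD('n) * k"] by auto
    have int: "\<forall>a\<in>?E. integrable lborel (\<lambda>x. norm (multi_deriv std_dir a f x))"
    proof
      fix a assume a: "a \<in> ?E"
      show "integrable lborel (\<lambda>x. norm (multi_deriv std_dir a f x))"
      proof (rule Bochner_Integration.integrable_bound[OF integrable_mult_right[OF integrable_decay, of D]])
        show "(\<lambda>x. norm (multi_deriv std_dir a f x)) \<in> borel_measurable lborel"
          using smooth_borel_measurable[OF smooth_multi_deriv[OF f(2), of std_dir a]] by simp
        show "AE x in lborel. norm (norm (multi_deriv std_dir a f x)) \<le> norm (D * (1 + norm x) powr (- (real CARD('n) + 1)))"
        proof (rule AE_I2)
          fix x
          have "norm (multi_deriv std_dir a f x) \<le> (\<Sum>a\<in>?E. norm (multi_deriv std_dir a f x))"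
            by (rule member_le_sum[OF a]) (auto simp: finite_exponents)
          also have "\<dots> \<le> \<bar>D * (1 + norm x) powr (- (real CARD('n) + 1))\<bar>" using D[of x] by linarith
          finally show "norm (norm (multi_deriv std_dir a f x)) \<le> norm (D * (1 + norm x) powr (- (real CARD('n) + 1)))" by simp
        qed
      qed
    qed
    have "(\<Sum>a\<in>?E. ?I f a) \<le> (\<Sum>a\<in>?E. SUP a\<in>?E. ?I f a)"
      by (intro sum_mono cSUP_upper bdd_above_finite finite_imageI finite_exponents)
    then have s: "(\<Sum>a\<in>?E. ?I f a) \<le> real (card ?E) * (SUP a\<in>?E. ?I f a)" by simp
    have "norm (remainder k P u \<mu> \<xi> f) \<le> K (cfg \<xi>) * (\<Sum>a\<in>?E. ?I f a)" by (rule K(2)[OF f(2) int])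
    also have "\<dots> \<le> (\<Sum>c\<in>range cfg. K c) * (\<Sum>a\<in>?E. ?I f a)"
      by (intro mult_right_mono member_le_sum fin sum_nonneg) (auto intro: K(1))
    also have "\<dots> \<le> (\<Sum>c\<in>range cfg. K c) * (real (card ?E) * (SUP a\<in>?E. ?I f a))"
      by (intro mult_left_mono s sum_nonneg) (auto intro: K(1))
    finally show "norm (remainder k P u \<mu> \<xi> f) \<le> (\<Sum>c\<in>range cfg. K c) * real (card ?E) * (SUP a\<in>?E. ?I f a)"
      by (simp only: mult.assoc)
  qed
qed

end

theorem theorem3:
  fixes P :: "(real^'n::{finite,wellorder}) set"
    and u :: "'d::{finite,linorder} \<Rightarrow> real^'n::_"
    and \<mu> :: "'d \<Rightarrow> real"
    and k :: nat
  assumes "simple_polytope P"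
    and "integral_polytope P"
    and "facet_presentation P u \<mu>"
    and "k \<ge> 1"
  shows
    "(\<forall>(N::real) (f :: real^'n::_ \<Rightarrow> complex) \<xi>.
        symbol_of_order N f \<and> real k \<ge> N + real CARD('n::_) + 1 \<and> polarizing P u \<mu> \<xi> \<longrightarrow>
        weighted_sum P f =
          (\<Sum>F\<in>faces P. \<Sum>\<gamma>\<in>Gamma_flat P u \<mu> F.
             diff_op std_dir (M_op k P u \<mu> F \<gamma>)
               (\<lambda>h. LINT x:shifted_polytope u \<mu> h|lborel. f x) 0)
          + remainder k P u \<mu> \<xi> f)
     \<and> (\<forall>F\<in>faces P. \<forall>\<gamma>\<in>Gamma_face u \<mu> F. \<forall>a\<in>Poly_Mapping.keys (M_op k P u \<mu> F \<gamma>).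
          \<forall>j. Poly_Mapping.lookup a j \<le> k)
     \<and> (\<exists>K::real. \<forall>(N::real) (f :: real^'n::_ \<Rightarrow> complex) \<xi>.
          symbol_of_order N f \<and> real k \<ge> N + real CARD('n::_) + 1 \<and> polarizing P u \<mu> \<xi> \<longrightarrow>
          norm (remainder k P u \<mu> \<xi> f) \<le>
            K * (SUP a \<in> {a :: 'n \<Rightarrow> nat. k \<le> (\<Sum>i\<in>UNIV. a i) \<and> (\<Sum>i\<in>UNIV. a i) \<le> CARD('n) * k}.
                   LINT x|lborel. norm (multi_deriv std_dir a f x)))"
proof -
  interpret lattice_polytope P u \<mu>
    using assms by unfold_locales (auto simp: integral_polytope_def)
  have "Poly_Mapping.lookup a j \<le> k" if "a \<in> Poly_Mapping.keys (M_op k P u \<mu> F \<gamma>)" for F \<gamma> a j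
    using keys_prod_in_var[OF finite_class.finite_UNIV that[unfolded M_op_def], of j] le_degree
      degree_M_poly[OF assms(4)] order_trans by (auto, blast)
  moreover obtain K where "\<forall>(N::real) (f :: real^'n::_ \<Rightarrow> complex) \<xi>.
          symbol_of_order N f \<and> real k \<ge> N + real CARD('n::_) + 1 \<longrightarrow>
          norm (remainder k P u \<mu> \<xi> f) \<le>
            K * (SUP a \<in> exponents k (CARD('n) * k). LINT x|lborel. norm (multi_deriv std_dir a f x))"
    using remainder_estimate[OF assms(4)] by blast
  ultimately show ?thesis
    using euler_maclaurin_symbol[OF _ assms(4)] by (intro conjI exI[of _ K]) blast+
qed

end
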